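(* Let $f$ be a meromorphic function that is not a Möbius transformation. Assume that for some $C\geq 1$, $c>0$ and $r_0>0$ we have $$\log M(Cr,f)\geq\left(1-\frac{c}{\log r}\right)T(r,f),\quad \forall\ r>r_0.$$ Then there exist constants $D>1$, $d>1$ and $R_0>0$, which depend on $C$, $c$ and $r_0$, such that for a Fatou component $U$ of $f$ the following holds. If for some positive integer $m$ and some $r\geq R_0$ we have $$A(D^{-d}r,D^dr)\subseteq f^m(U),$$ then $U$ is an escaping wandering domain, $h(z):=\overline{h}(z)=\underline{h}(z)$ exists on $U$ (that is, $\overline{h}$ and $\underline{h}$ coincide on $U$), and $h(z)$ is a non-constant positive harmonic function on $U$. Therefore, for any point $z_0\in U$ and any neighborhood $V$ of $z_0$ in $U$, we have for some constant $0<\alpha<1$ and all sufficiently large $n$ $$f^n(V)\supset A(|f^n(z_0)|^{1-\alpha},|f^n(z_0)|^{1+\alpha}).$$ Moreover, there exist two points $a$ and $b$ in $V$ and $\tau>1$ such that, for all sufficiently large $n$, $$|f^n(a)|^\tau\leq |f^n(b)|$$ and $$A_n=A(r_n,R_n)\subseteq f^n(V)$$ with $R_n\geq r_n^\tau\to\infty$ $(n\to\infty)$ and $A_{n+1}\subseteq f(A_n)$.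
   Context: Meromorphic functions are meromorphic in the complex plane $\mathbb{C}$. For a meromorphic function $f$, $f^n$ denotes the $n$th iterate. The Fatou set $F(f)$ is the set of points $z\in\hat{\mathbb{C}}$ such that $\{f^n\}_{n\in\mathbb{N}}$ is well-defined and forms a normal family in some neighborhood of $z$. A Fatou component is a connected component $U$ of $F(f)$; $U_n$ denotes the component of $F(f)$ with $f^n(U)\subseteq U_n$. $U$ is escaping if $f^n|_U\to\infty$ as $n\to\infty$. $U$ is a wandering domain if $U_m\neq U_n$ for any pair of positive integers $m\neq n$. For $0<r<R$, $A(r,R)=\{z:\ r<|z|<R\}$. $M(r,f)=\max\{|f(z)|:\ |z|=r\}$, with $M(r,f)=+\infty$ if $f$ has a pole on $\{|z|=r\}$. $T(r,f)=m(r,f)+N(r,f)$ is the Nevanlinna characteristic, where $m(r,f)=\frac{1}{2\pi}\int_0^{2\pi}\log^+|f(re^{i\theta})|\,d\theta$ with $\log^+x=\log\max\{1,x\}$, $N(r,f)=\int_0^r\frac{n(t,f)-n(0,f)}{t}\,dt+n(0,f)\log r$, and $n(t,f)$ is the number of poles of $f$ in $\{|z|<t\}$ counted with multiplicity ($n(0,f)$ being the multiplicity of the pole at $0$, if any). For an escaping Fatou component $U$ and a base point $z_*\in U$, define for $z\in U$ $$h_n(z)=\frac{\log|f^n(z)|}{\log|f^n(z_* )|},\quad \overline{h}(z)=\limsup_{n\to\infty}h_n(z),\quad \underline{h}(z)=\liminf_{n\to\infty}h_n(z).$$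
   Formalization: Polynomials of degree at least 2 are excluded (their basin of infinity contains all large annuli but is not wandering), and R_0 may depend on f as well as on C, c, r_0 (a choice from C, c, r_0 alone is impossible); D and d depend only on C, c, r_0. *)

theory Defs
  imports "HOL-Complex_Analysis.Complex_Analysis"
begin

section \<open>The Riemann sphere\<close>

text \<open>The point at infinity is \<open>None\<close>; a finite point \<open>z\<close> is \<open>Some z\<close>.\<close>

type_synonym csphere = "complex option"

definition riemann_sphere :: "csphere topology" where
  "riemann_sphere = Alexandroff_compactification euclidean"

fun chordal :: "csphere \<Rightarrow> csphere \<Rightarrow> real" where
  "chordal (Some z) (Some w) =
     2 * cmod (z - w) / (sqrt (1 + (cmod z)\<^sup>2) * sqrt (1 + (cmod w)\<^sup>2))"
| "chordal (Some z) None = 2 / sqrt (1 + (cmod z)\<^sup>2)"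
| "chordal None (Some w) = 2 / sqrt (1 + (cmod w)\<^sup>2)"
| "chordal None None = 0"

fun sphere_norm :: "csphere \<Rightarrow> ereal" where
  "sphere_norm (Some z) = ereal (cmod z)"
| "sphere_norm None = \<infinity>"

definition annulus :: "real \<Rightarrow> real \<Rightarrow> csphere set" where
  "annulus r R = Some ` {z. r < cmod z \<and> cmod z < R}"

text \<open>The logarithm on \<open>[0, \<infinity>]\<close>, with \<open>log 0 = -\<infinity>\<close> and \<open>log \<infinity> = \<infinity>\<close>.\<close>

definition elog :: "ereal \<Rightarrow> ereal" where
  "elog x = (if x = \<infinity> then \<infinity> else if x \<le> 0 then -\<infinity> else ereal (ln (real_of_ereal x)))"

section \<open>Maximum modulus and Nevanlinna characteristic\<close>

text \<open>
  Functions meromorphic in the plane are represented by \<open>f :: complex \<Rightarrow> complex\<close> with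
  \<open>f nicely_meromorphic_on UNIV\<close>: there are no removable singularities, and the value of \<open>f\<close>
  at a pole is \<open>0\<close> by convention.
\<close>

definition max_modulus :: "real \<Rightarrow> (complex \<Rightarrow> complex) \<Rightarrow> ereal" where
  "max_modulus r f =
     (if \<exists>z. cmod z = r \<and> is_pole f z then \<infinity> else (SUP z\<in>{z. cmod z = r}. ereal (cmod (f z))))"

definition pole_mult :: "(complex \<Rightarrow> complex) \<Rightarrow> complex \<Rightarrow> nat" where
  "pole_mult f z = (if is_pole f z then nat (- zorder f z) else 0)"

definition pole_count :: "real \<Rightarrow> (complex \<Rightarrow> complex) \<Rightarrow> nat" where
  "pole_count t f = (\<Sum>z | cmod z < t \<and> is_pole f z. pole_mult f z)"

definition nevanlinna_m :: "real \<Rightarrow> (complex \<Rightarrow> complex) \<Rightarrow> real" where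
  "nevanlinna_m r f =
     1 / (2 * pi) * integral {0..2 * pi} (\<lambda>\<theta>. ln (max 1 (cmod (f (of_real r * cis \<theta>)))))"

definition nevanlinna_N :: "real \<Rightarrow> (complex \<Rightarrow> complex) \<Rightarrow> real" where
  "nevanlinna_N r f =
     integral {0..r} (\<lambda>t. (real (pole_count t f) - real (pole_mult f 0)) / t)
     + real (pole_mult f 0) * ln r"

definition nevanlinna_T :: "real \<Rightarrow> (complex \<Rightarrow> complex) \<Rightarrow> real" where
  "nevanlinna_T r f = nevanlinna_m r f + nevanlinna_N r f"

definition moebius_transformation :: "(complex \<Rightarrow> complex) \<Rightarrow> bool" where
  "moebius_transformation f \<longleftrightarrow> (\<exists>a b c d. a * d - b * c \<noteq> 0 \<and> (\<forall>z. f z = (a * z + b) / (c * z + d)))"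

section \<open>Iteration on the sphere and the Fatou set\<close>

definition meromorphic_value :: "(complex \<Rightarrow> complex) \<Rightarrow> complex \<Rightarrow> csphere" where
  "meromorphic_value f z = (if is_pole f z then None else Some (f z))"

text \<open>
  For rational \<open>f\<close> the value at infinity is the limit there. Otherwise infinity is an essential
  singularity or a limit of poles, there is no limit, and \<open>f\<close> is undefined at infinity.
\<close>

definition defined_at_infinity :: "(complex \<Rightarrow> complex) \<Rightarrow> bool" where
  "defined_at_infinity f \<longleftrightarrow> (\<exists>l. limitin riemann_sphere (meromorphic_value f) l at_infinity)"

definition sphere_map :: "(complex \<Rightarrow> complex) \<Rightarrow> csphere \<Rightarrow> csphere" where
  "sphere_map f w =
     (case w of
        Some z \<Rightarrow> meromorphic_value f z
      | None \<Rightarrow> (THE l. limitin riemann_sphere (meromorphic_value f) l at_infinity))"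

abbreviation iterate :: "(complex \<Rightarrow> complex) \<Rightarrow> nat \<Rightarrow> csphere \<Rightarrow> csphere" where
  "iterate f n \<equiv> sphere_map f ^^ n"

text \<open>
  \<open>sphere_map\<close> is total, so \<open>iterate f n w\<close> is meaningful only if the orbit of \<open>w\<close> does not reach
  infinity before time \<open>n\<close>, or \<open>f\<close> is defined at infinity.
\<close>

definition iterate_defined :: "(complex \<Rightarrow> complex) \<Rightarrow> nat \<Rightarrow> csphere \<Rightarrow> bool" where
  "iterate_defined f n w \<longleftrightarrow> (\<forall>k<n. iterate f k w = None \<longrightarrow> defined_at_infinity f)"

definition locally_uniformly_convergent ::
    "csphere set \<Rightarrow> (nat \<Rightarrow> csphere \<Rightarrow> csphere) \<Rightarrow> (csphere \<Rightarrow> csphere) \<Rightarrow> bool" where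
  "locally_uniformly_convergent V F g \<longleftrightarrow>
     (\<forall>K. compactin riemann_sphere K \<and> K \<subseteq> V \<longrightarrow>
       (\<forall>e>0. \<forall>\<^sub>F n in sequentially. \<forall>w\<in>K. chordal (F n w) (g w) < e))"

definition normal_family :: "csphere set \<Rightarrow> (csphere \<Rightarrow> csphere) set \<Rightarrow> bool" where
  "normal_family V \<F> \<longleftrightarrow>
     (\<forall>F :: nat \<Rightarrow> csphere \<Rightarrow> csphere. range F \<subseteq> \<F> \<longrightarrow>
       (\<exists>k g. strict_mono k \<and> locally_uniformly_convergent V (F \<circ> k) g))"

definition fatou_set :: "(complex \<Rightarrow> complex) \<Rightarrow> csphere set" where
  "fatou_set f =
     {w. \<exists>V. openin riemann_sphere V \<and> w \<in> V \<and> (\<forall>n. \<forall>v\<in>V. iterate_defined f n v) \<and>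
             normal_family V (range (iterate f))}"

definition fatou_components :: "(complex \<Rightarrow> complex) \<Rightarrow> csphere set set" where
  "fatou_components f = connected_components_of (subtopology riemann_sphere (fatou_set f))"

definition component_at :: "(complex \<Rightarrow> complex) \<Rightarrow> csphere set \<Rightarrow> nat \<Rightarrow> csphere set" where
  "component_at f U n = (THE W. W \<in> fatou_components f \<and> iterate f n ` U \<subseteq> W)"

definition wandering :: "(complex \<Rightarrow> complex) \<Rightarrow> csphere set \<Rightarrow> bool" where
  "wandering f U \<longleftrightarrow> (\<forall>m>0. \<forall>n>0. m \<noteq> n \<longrightarrow> component_at f U m \<noteq> component_at f U n)"

definition escaping :: "(complex \<Rightarrow> complex) \<Rightarrow> csphere set \<Rightarrow> bool" where
  "escaping f U \<longleftrightarrow> locally_uniformly_convergent U (iterate f) (\<lambda>_. None)"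

section \<open>The functions $h_n$ and harmonicity\<close>

definition h_seq :: "(complex \<Rightarrow> complex) \<Rightarrow> csphere \<Rightarrow> nat \<Rightarrow> csphere \<Rightarrow> ereal" where
  "h_seq f zs n z = elog (sphere_norm (iterate f n z)) / elog (sphere_norm (iterate f n zs))"

definition h_upper :: "(complex \<Rightarrow> complex) \<Rightarrow> csphere \<Rightarrow> csphere \<Rightarrow> ereal" where
  "h_upper f zs z = limsup (\<lambda>n. h_seq f zs n z)"

definition h_lower :: "(complex \<Rightarrow> complex) \<Rightarrow> csphere \<Rightarrow> csphere \<Rightarrow> ereal" where
  "h_lower f zs z = liminf (\<lambda>n. h_seq f zs n z)"

text \<open>Twice continuously differentiable with vanishing Laplacian.\<close>

definition harmonic_on :: "(complex \<Rightarrow> real) \<Rightarrow> complex set \<Rightarrow> bool" where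
  "harmonic_on u S \<longleftrightarrow> open S \<and>
     (\<exists>ux uy uxx uxy uyx uyy :: complex \<Rightarrow> real.
        (\<forall>z\<in>S. (u has_derivative (\<lambda>v. ux z * Re v + uy z * Im v)) (at z) \<and>
               (ux has_derivative (\<lambda>v. uxx z * Re v + uxy z * Im v)) (at z) \<and>
               (uy has_derivative (\<lambda>v. uyx z * Re v + uyy z * Im v)) (at z) \<and>
               uxx z + uyy z = 0) \<and>
        continuous_on S uxx \<and> continuous_on S uxy \<and> continuous_on S uyx \<and> continuous_on S uyy)"

end

theory Submission
  imports Defs 
begin

text \<open>Suppose \<open>f\<close> is pole-free and omits a value on a wide annulus \<open>e\<^sup>x < \<bar>z\<bar> < e\<^sup>y\<close>. There \<open>ln \<bar>f - a\<bar>\<close> is, in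
  logarithmic coordinates, the real part of a holomorphic function \<open>F\<close>; its circular maximum is convex, its
  circular mean is affine by Jensen's formula, and the growth hypothesis keeps the two close to each other.
  Hence \<open>f\<close> maps the annulus onto an annulus of almost the same relative logarithmic width
  and much larger radius, with an error that is summable along the orbit. Iterating, \<open>f^n(U)\<close> contains annuli
  \<open>A(r, r^(1 + \<rho>))\<close> with \<open>\<rho>\<close> independent of \<open>n\<close>, and \<open>ln r\<close> grows faster than any geometric sequence. By
  Harnack's inequality \<open>ln \<bar>f^n\<bar>\<close> is comparable to itself at two points of a component, which excludes
  non-wandering behaviour. The fixed relative width prevents limits of the normalised \<open>ln \<bar>f^n\<bar>\<close> from being
  constant, so the image of every disc contains such annuli. On these the ratio of \<open>ln \<bar>f^n\<bar>\<close> at two points is almost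
  monotone in \<open>n\<close>, which gives convergence of \<open>h_n\<close>.\<close>

section \<open>Harnack inequality and covering properties of the exponential\<close>

text \<open>A branch of log (f - a) exists over an annulus only if f has neither poles nor a-points
  there. The number a is any point outside the Fatou set: f maps this set into itself, so a is
  omitted on all annuli of the chain. That such a point exists needs an argument of its own when f
  is entire, because one must exclude that all points of the plane are normal. Widths are measured
  on the scale log |z| and written as q^4. The covering step works at distance about q^3 from the
  inner circle: far enough for N to bound the number of enclosed poles, and close enough, compared
  with q^4, for the relative loss to be O(1/q). The width grows at least 16-fold in each step, so q
  doubles and the losses form a geometric series. The width needed to start a chain depends on C and
  c only. The radius from which it may start depends also on f, through the constant in Jensen's
  formula and the number a. Limits are always taken with points of one compact subset of U whose
  images fill the annuli; otherwise the points could drift to the boundary of U.\<close>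

lemma harnack_unit_disc:
  assumes "cmod (w - 1) \<le> r * cmod (w + 1)" "0 \<le> r" "r < 1"
  shows "(1 - r) / (1 + r) \<le> Re w" "Re w \<le> (1 + r) / (1 - r)"
proof -
  have "(cmod (w - 1))\<^sup>2 \<le> (r * cmod (w + 1))\<^sup>2"
    using assms by (intro power_mono) auto
  then have *: "(Re w - 1)\<^sup>2 + (Im w)\<^sup>2 \<le> r\<^sup>2 * ((Re w + 1)\<^sup>2 + (Im w)\<^sup>2)"
    by (simp add: cmod_power2 power_mult_distrib)
  \<comment> \<open>The hypothesis describes a disc symmetric about the real axis. Since r < 1 the
    imaginary part may be dropped, which leaves its real diameter.\<close>
  have "r\<^sup>2 * (Im w)\<^sup>2 \<le> 1 * (Im w)\<^sup>2"
    using assms by (intro mult_right_mono) (auto simp: power_le_one)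
  with * have "(Re w - 1)\<^sup>2 \<le> (r * (Re w + 1))\<^sup>2"
    unfolding power_mult_distrib by (simp add: distrib_left)
  then have **: "\<bar>Re w - 1\<bar> \<le> r * \<bar>Re w + 1\<bar>"
    using assms by (metis abs_le_square_iff abs_mult abs_of_nonneg)
  have "Re w > 0 - 1"
  proof (rule ccontr)
    assume "\<not> ?thesis"
    then have "\<bar>Re w - 1\<bar> = 1 - Re w" "\<bar>Re w + 1\<bar> = - Re w - 1" by auto
    with ** have "1 - Re w \<le> r * (- Re w - 1)" by simp
    moreover have "r * (- Re w - 1) \<le> 1 * (- Re w - 1)"
      using assms \<open>\<not> Re w > 0 - 1\<close> by (intro mult_right_mono) auto
    ultimately show False by simp
  qed
  with ** have "\<bar>Re w - 1\<bar> \<le> r * (Re w + 1)" by simp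
  then show "(1 - r) / (1 + r) \<le> Re w" "Re w \<le> (1 + r) / (1 - r)"
    using assms by (auto simp: divide_simps algebra_simps)
qed

text \<open>The Schwarz lemma for G followed by the Cayley map (v - a) / (v + cnj a), a = G z0,
  which takes the right half-plane to the unit disc and a to 0. Harnack's inequality and a bound on
  the full modulus of G both come from this one estimate.\<close>

lemma positive_real_schwarz:
  assumes G: "G holomorphic_on ball z0 R" and pos: "\<And>z. z \<in> ball z0 R \<Longrightarrow> Re (G z) > 0"
    and z: "z \<in> ball z0 R"
  shows "cmod (G z - G z0) \<le> dist z0 z / R * cmod (G z + cnj (G z0))"
proof -
  have R: "R > 0" using z by (auto intro: le_less_trans[OF zero_le_dist])
  define a where "a = G z0"
  have a: "Re a > 0" using pos R by (simp add: a_def)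
  define h where "h = (\<lambda>\<zeta>. (G (z0 + of_real R * \<zeta>) - a) / (G (z0 + of_real R * \<zeta>) + cnj a))"
  have mem: "z0 + of_real R * \<zeta> \<in> ball z0 R" if "norm \<zeta> < 1" for \<zeta>
    using that R by (simp add: dist_norm norm_mult)
  have nz: "G (z0 + of_real R * \<zeta>) + cnj a \<noteq> 0" if "norm \<zeta> < 1" for \<zeta>
  proof -
    have "Re (G (z0 + of_real R * \<zeta>) + cnj a) > 0" using pos[OF mem[OF that]] a by simp
    then show ?thesis by (metis less_irrefl zero_complex.sel(1))
  qed
  have holh: "h holomorphic_on ball 0 1"
    unfolding h_def
  proof (intro holomorphic_intros)
    have "(\<lambda>\<zeta>. z0 + of_real R * \<zeta>) ` ball 0 1 \<subseteq> ball z0 R" using mem by auto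
    then have "G \<circ> (\<lambda>\<zeta>. z0 + of_real R * \<zeta>) holomorphic_on ball 0 1"
      by (intro holomorphic_on_compose_gen[OF _ G]) (auto intro!: holomorphic_intros)
    then show "(\<lambda>\<zeta>. G (z0 + of_real R * \<zeta>)) holomorphic_on ball 0 1" by (simp add: o_def)
    then show "(\<lambda>\<zeta>. G (z0 + of_real R * \<zeta>)) holomorphic_on ball 0 1" .
  qed (use nz in auto)
  have h1: "norm (h \<zeta>) < 1" if "norm \<zeta> < 1" for \<zeta>
  proof -
    let ?w = "G (z0 + of_real R * \<zeta>)"
    have w: "Re ?w > 0" using pos[OF mem[OF that]] .
    have "(Re ?w - Re a)\<^sup>2 < (Re ?w + Re a)\<^sup>2"
      using mult_pos_pos[OF w a] by (simp add: power2_eq_square algebra_simps)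
    then have "(cmod (?w - a))\<^sup>2 < (cmod (?w + cnj a))\<^sup>2"
      by (simp add: cmod_power2)
    then have "cmod (?w - a) < cmod (?w + cnj a)" by (simp add: power2_less_imp_less)
    then show ?thesis using nz[OF that] by (simp add: h_def norm_divide divide_simps)
  qed
  define \<zeta> where "\<zeta> = (z - z0) / of_real R"
  have \<zeta>1: "norm \<zeta> < 1" using z R by (simp add: \<zeta>_def norm_divide dist_norm norm_minus_commute)
  have n\<zeta>: "norm \<zeta> = dist z0 z / R" using R by (simp add: \<zeta>_def norm_divide dist_norm norm_minus_commute)
  have zz: "z0 + of_real R * \<zeta> = z" using R by (simp add: \<zeta>_def)
  have "norm (h \<zeta>) \<le> norm \<zeta>"
    by (rule Schwarz_Lemma(1)[OF holh _ h1 \<zeta>1]) (auto simp: h_def a_def)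
  then have "cmod (G z - a) \<le> norm \<zeta> * cmod (G z + cnj a)"
    using nz[OF \<zeta>1] by (simp add: h_def norm_divide divide_simps zz)
  then show ?thesis by (simp add: n\<zeta> a_def)
qed

lemma harnack_ball_pos:
  assumes G: "G holomorphic_on ball z0 R" and pos: "\<And>z. z \<in> ball z0 R \<Longrightarrow> Re (G z) > 0"
    and z: "z \<in> ball z0 R"
  shows "(R - dist z0 z) / (R + dist z0 z) * Re (G z0) \<le> Re (G z)"
    "Re (G z) \<le> (R + dist z0 z) / (R - dist z0 z) * Re (G z0)"
proof -
  have R: "R > 0" using z by (auto intro: le_less_trans[OF zero_le_dist])
  define a where "a = G z0"
  have a: "Re a > 0" using pos R by (simp add: a_def)
  define s where "s = dist z0 z / R"
  have s1: "0 \<le> s" "s < 1" using z R by (auto simp: s_def)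
  have hz: "cmod (G z - a) \<le> s * cmod (G z + cnj a)"
    using positive_real_schwarz[OF G pos z] by (simp add: s_def a_def)
  \<comment> \<open>An affine automorphism of the half-plane moves a = G z0 to 1, where
    \<open>harnack_unit_disc\<close> applies.\<close>
  define w where "w = (G z - \<i> * Im a) / Re a"
  have "w - 1 = (G z - a) / Re a" "w + 1 = (G z + cnj a) / Re a"
    using a unfolding w_def by (auto simp: complex_eq_iff field_simps Re_divide_of_real Im_divide_of_real)
  then have "cmod (w - 1) \<le> s * cmod (w + 1)"
    using hz a by (simp add: norm_divide divide_right_mono)
  note H = harnack_unit_disc[OF this s1]
  have Rew: "Re w = Re (G z) / Re a" using a by (simp add: w_def Re_divide_of_real)
  have e1: "(1 - s) / (1 + s) = (R - dist z0 z) / (R + dist z0 z)"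
    "(1 + s) / (1 - s) = (R + dist z0 z) / (R - dist z0 z)"
    using R z by (auto simp: s_def divide_simps)
  show "(R - dist z0 z) / (R + dist z0 z) * Re (G z0) \<le> Re (G z)"
    "Re (G z) \<le> (R + dist z0 z) / (R - dist z0 z) * Re (G z0)"
    using H a unfolding e1 Rew a_def[symmetric] by (simp_all only: pos_le_divide_eq pos_divide_le_eq)
qed

text \<open>Harnack's inequality controls the real part only. Montel's theorem needs the modulus,
  and for that the imaginary part has to be normalised at the centre.\<close>

lemma positive_real_norm_le:
  assumes G: "G holomorphic_on ball z0 R" and pos: "\<And>z. z \<in> ball z0 R \<Longrightarrow> Re (G z) > 0"
    and z: "z \<in> ball z0 R" and im: "Im (G z0) = 0"
  shows "cmod (G z) \<le> (R + dist z0 z) / (R - dist z0 z) * Re (G z0)"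
proof -
  have R: "R > 0" using z by (auto intro: le_less_trans[OF zero_le_dist])
  define a where "a = Re (G z0)"
  have a: "a > 0" using pos R by (simp add: a_def)
  have Ga: "G z0 = of_real a" using im by (simp add: a_def complex_eq_iff)
  have "R * cmod (G z - of_real a) \<le> dist z0 z * cmod (G z + of_real a)"
    using positive_real_schwarz[OF G pos z] R by (simp add: Ga pos_le_divide_eq mult.commute)
  also have "\<dots> \<le> dist z0 z * (cmod (G z) + a)"
    using norm_triangle_ineq[of "G z" "of_real a"] a by (intro mult_left_mono) auto
  finally have "R * (cmod (G z) - a) \<le> dist z0 z * (cmod (G z) + a)"
    using norm_triangle_ineq2[of "G z" "of_real a"] a R by (smt (verit) mult_left_mono norm_of_real)
  then have "cmod (G z) * (R - dist z0 z) \<le> (R + dist z0 z) * a" by (simp add: algebra_simps)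
  then show ?thesis using z unfolding a_def[symmetric] by (simp add: pos_le_divide_eq)
qed

lemma harnack_ball:
  assumes G: "G holomorphic_on ball z0 R" and pos: "\<And>z. z \<in> ball z0 R \<Longrightarrow> Re (G z) \<ge> 0"
    and z: "z \<in> ball z0 R"
  shows "(R - dist z0 z) / (R + dist z0 z) * Re (G z0) \<le> Re (G z)"
    "Re (G z) \<le> (R + dist z0 z) / (R - dist z0 z) * Re (G z0)"
proof -
  let ?c = "(R - dist z0 z) / (R + dist z0 z)" and ?d = "(R + dist z0 z) / (R - dist z0 z)"
  \<comment> \<open>A nonnegative real part is made positive by adding e; afterwards e tends to
    0.\<close>
  have H: "?c * (Re (G z0) + e) \<le> Re (G z) + e \<and> Re (G z) + e \<le> ?d * (Re (G z0) + e)" if "e > 0" for e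
  proof -
    have "(\<lambda>z. G z + of_real e) holomorphic_on ball z0 R" using G by (intro holomorphic_intros)
    from harnack_ball_pos[OF this _ z] show ?thesis using that pos by (simp add: add_nonneg_pos)
  qed
  have "((\<lambda>e. ?c * (Re (G z0) + e)) \<longlongrightarrow> ?c * (Re (G z0) + 0)) (at_right 0)"
    "((\<lambda>e. Re (G z) + e) \<longlongrightarrow> Re (G z) + 0) (at_right 0)"
    "((\<lambda>e. ?d * (Re (G z0) + e)) \<longlongrightarrow> ?d * (Re (G z0) + 0)) (at_right 0)"
    by (intro tendsto_intros)+
  note L = this
  have ev: "\<forall>\<^sub>F e in at_right (0::real). 0 < e" by (simp add: eventually_at_right_less)
  have "\<forall>\<^sub>F e in at_right 0. ?c * (Re (G z0) + e) \<le> Re (G z) + e"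
    using ev by eventually_elim (use H in blast)
  from tendsto_le[OF trivial_limit_at_right_real L(2) L(1) this]
  show "?c * Re (G z0) \<le> Re (G z)" by simp
  have "\<forall>\<^sub>F e in at_right 0. Re (G z) + e \<le> ?d * (Re (G z0) + e)"
    using ev by eventually_elim (use H in blast)
  from tendsto_le[OF trivial_limit_at_right_real L(3) L(2) this]
  show "Re (G z) \<le> ?d * Re (G z0)" by simp
qed

text \<open>If \<open>exp \<circ> F\<close> omitted a value \<open>w\<close> with \<open>\<bar>w\<bar> = exp (Re (F z))\<close>, then \<open>F\<close> would omit two points of
  \<open>Ln w + 2 \<pi> \<i> \<int>\<close> close to \<open>F z\<close>, and Schottky's theorem would bound \<open>F'(z)\<close>.\<close>

lemma exp_covers_circle:
  obtains \<Lambda> :: real where "\<Lambda> > 0"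
    "\<And>F z l w. \<lbrakk>F holomorphic_on ball z l; l > 0; cmod (deriv F z) * l \<ge> \<Lambda>;
        cmod w = exp (Re (F z))\<rbrakk> \<Longrightarrow> w \<in> (\<lambda>\<zeta>. exp (F \<zeta>)) ` ball z l"
proof -
  \<comment> \<open>Schottky's bound, at points of modulus at most 1/2, for functions on the unit
    disc that omit 0 and 1 and have modulus at most 1 at the centre.\<close>
  define K where "K = exp (pi * exp (pi * (2 + 2 * 1 + 12 * (1/2) / (1 - 1/2))))"
  define \<Lambda> where "\<Lambda> = 4 * (2 * pi * K) + 1"
  have Kpos: "K > 0" by (simp add: K_def)
  have "\<Lambda> > 0" using Kpos by (simp add: \<Lambda>_def add_pos_pos)
  moreover have "w \<in> (\<lambda>\<zeta>. exp (F \<zeta>)) ` ball z l"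
    if F: "F holomorphic_on ball z l" and l: "l > 0" and der: "cmod (deriv F z) * l \<ge> \<Lambda>"
      and w: "cmod w = exp (Re (F z))" for F z l w
  proof (rule ccontr)
    assume omit: "w \<notin> (\<lambda>\<zeta>. exp (F \<zeta>)) ` ball z l"
    have w0: "w \<noteq> 0" using w by force
    \<comment> \<open>The logarithm a of w is chosen with Im a \<le> Im (F z) \<le> Im a + 2 \<pi>.
      Since Re a = Re (F z), the normalised function G takes a value in [0, 1] at z, and the omitted
      values a and a + 2 \<pi> \<i> of F become the values 0 and 1 omitted by G.\<close>
    define m where "m = \<lfloor>(Im (F z) - Im (Ln w)) / (2 * pi)\<rfloor>"
    define a where "a = Ln w + of_real (2 * pi * of_int m) * \<i>"
    have expa: "exp (a + of_int k * (2 * pi * \<i>)) = w" for k :: int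
    proof -
      have "a + of_int k * (2 * pi * \<i>) = Ln w + (2 * of_int (m + k) * pi) * \<i>"
        by (simp add: a_def algebra_simps)
      moreover have "exp ((2 * of_int (m + k) * pi) * \<i>) = 1"
        by (rule exp_integer_2pi) (rule Ints_of_int)
      ultimately show ?thesis using exp_Ln[OF w0] by (simp only: exp_add mult_1_right)
    qed
    have Rea: "Re a = Re (F z)" using w w0 by (simp add: a_def)
    have "of_int m \<le> (Im (F z) - Im (Ln w)) / (2 * pi)" "(Im (F z) - Im (Ln w)) / (2 * pi) < of_int m + 1"
      unfolding m_def by linarith+
    then have Ima: "0 \<le> Im (F z) - Im a" "Im (F z) - Im a \<le> 2 * pi"
      by (simp_all add: a_def field_simps)
    define G where "G = (\<lambda>\<zeta>. (F \<zeta> - a) / (2 * pi * \<i>))"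
    have Gz: "cmod (G z) \<le> 1"
    proof -
      have "F z - a = \<i> * of_real (Im (F z) - Im a)" using Rea by (simp add: complex_eq_iff)
      then have "cmod (F z - a) = \<bar>Im (F z) - Im a\<bar>" by (metis norm_mult norm_ii norm_of_real mult_1)
      then show ?thesis using Ima by (simp add: G_def norm_divide norm_mult)
    qed
    have Gn: "G \<zeta> \<noteq> 0 \<and> G \<zeta> \<noteq> 1" if "\<zeta> \<in> ball z l" for \<zeta>
    proof -
      have "F \<zeta> \<noteq> a + of_int 0 * (2 * pi * \<i>)" "F \<zeta> \<noteq> a + of_int 1 * (2 * pi * \<i>)"
        using omit that expa by (metis image_eqI)+
      then show ?thesis by (auto simp: G_def field_simps)
    qed
    have bd: "cmod (G \<zeta>) \<le> K" if "\<zeta> \<in> cball z (l / 4)" for \<zeta>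
    proof -
      define g where "g = (\<lambda>\<xi>. G (z + of_real (l/2) * \<xi>))"
      have mem: "z + of_real (l/2) * \<xi> \<in> ball z l" if "\<xi> \<in> cball 0 1" for \<xi>
        using that l by (auto simp: dist_norm norm_mult intro: le_less_trans[of _ "l/2 * 1"])
      have "G \<circ> (\<lambda>\<xi>. z + of_real (l/2) * \<xi>) holomorphic_on cball 0 1"
        by (rule holomorphic_on_compose_gen[of _ _ _ "ball z l"])
          (use F mem in \<open>auto intro!: holomorphic_intros simp: G_def\<close>)
      then have hg: "g holomorphic_on cball 0 1" by (simp add: g_def o_def)
      have "cmod (g ((\<zeta> - z) / of_real (l/2))) \<le> K"
        unfolding K_def
      proof (rule Schottky[OF hg])
        show "cmod (g 0) \<le> 1" using Gz by (simp add: g_def)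
        show "\<not> (g \<xi> = 0 \<or> g \<xi> = 1)" if "\<xi> \<in> cball 0 1" for \<xi>
          using Gn[OF mem[OF that]] by (simp add: g_def)
        show "cmod ((\<zeta> - z) / of_real (l/2)) \<le> 1/2"
          using that l unfolding norm_divide by (simp add: dist_norm norm_minus_commute)
      qed auto
      moreover have "z + of_real (l/2) * ((\<zeta> - z) / of_real (l/2)) = \<zeta>" using l by (simp add: field_simps)
      ultimately show ?thesis unfolding g_def by metis
    qed
    have hG: "G holomorphic_on ball z l" unfolding G_def by (intro holomorphic_intros F) auto
    have "norm ((deriv ^^ 1) G z) \<le> fact 1 * K / (l/4) ^ 1"
    proof (rule Cauchy_inequality)
      show "G holomorphic_on ball z (l/4)" using hG by (rule holomorphic_on_subset) (use l in auto)
      show "continuous_on (cball z (l/4)) G"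
        using hG by (rule holomorphic_on_imp_continuous_on[OF holomorphic_on_subset]) (use l in auto)
    qed (use l bd in \<open>auto simp: dist_norm norm_minus_commute\<close>)
    then have dG: "norm (deriv G z) * l \<le> 4 * K" using l by (simp add: field_simps)
    have "F field_differentiable at z"
      using F l holomorphic_on_imp_differentiable_at by (metis centre_in_ball open_ball)
    then have "deriv G z = deriv F z / (2 * pi * \<i>)"
      unfolding G_def by (intro DERIV_imp_deriv) (auto intro!: derivative_eq_intros DERIV_deriv_iff_field_differentiable[THEN iffD2])
    then have "norm (deriv G z) = norm (deriv F z) / (2 * pi)" by (simp add: norm_divide norm_mult)
    then have "cmod (deriv F z) * l = 2 * pi * (norm (deriv G z) * l)" by simp
    also have "\<dots> \<le> 2 * pi * (4 * K)" using dG by (intro mult_left_mono) auto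
    finally have "cmod (deriv F z) * l \<le> 4 * (2 * pi * K)" by simp
    then show False using der by (simp add: \<Lambda>_def)
  qed
  ultimately show ?thesis using that by blast
qed

section \<open>Circular maxima and means in logarithmic coordinates\<close>

text \<open>If F is a branch of log g (exp \<zeta>), this is log M(e^t, g), and
  \<open>circle_mean\<close> is the mean of log |g| on |z| = e^t. In the variable t = log r
  Hadamard's theorem becomes ordinary convexity and Jensen's formula produces affine
  functions.\<close>

definition circle_max :: "(complex \<Rightarrow> complex) \<Rightarrow> real \<Rightarrow> real" where
  "circle_max F t = (SUP \<theta>\<in>{0..2 * pi}. Re (F (Complex t \<theta>)))"

definition circle_mean :: "(complex \<Rightarrow> complex) \<Rightarrow> real \<Rightarrow> real" where
  "circle_mean F t = integral {0..2 * pi} (\<lambda>\<theta>. Re (F (Complex t \<theta>))) / (2 * pi)"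

text \<open>A zero-free holomorphic function \<open>g\<close> on the annulus \<open>e\<^sup>x < \<bar>z\<bar> < e\<^sup>y\<close> is encoded by a branch
  \<open>F\<close> of \<open>log (g (exp \<zeta>))\<close> on the strip \<open>x < Re \<zeta> < y\<close>; only its real part is periodic.\<close>

locale log_strip =
  fixes F :: "complex \<Rightarrow> complex" and x y :: real
  assumes holo: "F holomorphic_on {\<zeta>. x < Re \<zeta> \<and> Re \<zeta> < y}"
    and periodic: "\<And>t \<theta>. x < t \<Longrightarrow> t < y \<Longrightarrow> Re (F (Complex t (\<theta> + 2 * pi))) = Re (F (Complex t \<theta>))"
begin

lemma open_strip: "open {\<zeta>. x < Re \<zeta> \<and> Re \<zeta> < y}"
proof -
  have "{\<zeta>. x < Re \<zeta> \<and> Re \<zeta> < y} = {\<zeta>. x < Re \<zeta>} \<inter> {\<zeta>. Re \<zeta> < y}" by auto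
  then show ?thesis by (simp add: open_Int open_halfspace_Re_gt open_halfspace_Re_lt)
qed

lemma ball_subset_strip:
  assumes "x \<le> Re z - l" "Re z + l \<le> y"
  shows "ball z l \<subseteq> {\<zeta>. x < Re \<zeta> \<and> Re \<zeta> < y}"
proof
  fix \<zeta> assume "\<zeta> \<in> ball z l"
  then have "\<bar>Re (z - \<zeta>)\<bar> < l" by (metis abs_Re_le_cmod dist_norm le_less_trans mem_ball)
  then show "\<zeta> \<in> {\<zeta>. x < Re \<zeta> \<and> Re \<zeta> < y}" using assms by auto
qed

lemma periodic_nat:
  assumes "x < t" "t < y" shows "Re (F (Complex t (\<theta> + 2 * pi * real n))) = Re (F (Complex t \<theta>))"
proof (induction n)
  case (Suc n)
  have "Re (F (Complex t (\<theta> + 2 * pi * real (Suc n)))) = Re (F (Complex t ((\<theta> + 2 * pi * real n) + 2 * pi)))"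
    by (simp add: algebra_simps)
  then show ?case using periodic[OF assms] Suc by simp
qed simp

lemma periodic_int:
  assumes "x < t" "t < y" shows "Re (F (Complex t (\<theta> + 2 * pi * of_int k))) = Re (F (Complex t \<theta>))"
proof (cases "k \<ge> 0")
  case True
  then show ?thesis using periodic_nat[OF assms, of \<theta> "nat k"] by simp
next
  case False
  then show ?thesis using periodic_nat[OF assms, of "\<theta> + 2 * pi * of_int k" "nat (-k)"] by simp
qed

text \<open>Only Re F is periodic, so a point has to be replaced by a translate before Harnack's
  inequality is used; the distance along a circle is then at most \<pi>. One angle serves all radii
  at once.\<close>

lemma angle_near:
  assumes "x < t" "t < y"
  obtains \<theta>' where "\<bar>\<theta>' - \<theta>0\<bar> \<le> pi" "\<And>t. x < t \<Longrightarrow> t < y \<Longrightarrow> Re (F (Complex t \<theta>')) = Re (F (Complex t \<theta>))"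
proof -
  define k where "k = \<lfloor>(\<theta>0 + pi - \<theta>) / (2 * pi)\<rfloor>"
  have "of_int k \<le> (\<theta>0 + pi - \<theta>) / (2 * pi)" "(\<theta>0 + pi - \<theta>) / (2 * pi) < of_int k + 1"
    unfolding k_def by linarith+
  then have "\<bar>\<theta> + 2 * pi * of_int k - \<theta>0\<bar> \<le> pi"
    by (simp add: field_simps abs_le_iff)
  then show ?thesis using that[of "\<theta> + 2 * pi * of_int k"] periodic_int by blast
qed

lemma continuous_circle:
  assumes "x < t" "t < y" shows "continuous_on A (\<lambda>\<theta>. Re (F (Complex t \<theta>)))"
proof -
  have "continuous_on A (\<lambda>\<theta>. F (Complex t \<theta>))"
    by (rule continuous_on_compose2[OF holomorphic_on_imp_continuous_on[OF holo]])
      (use assms in \<open>auto simp: Complex_eq intro!: continuous_intros\<close>)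
  then show ?thesis by (intro continuous_intros)
qed

lemma circle_max_attained:
  assumes "x < t" "t < y" obtains \<theta> where "Re (F (Complex t \<theta>)) = circle_max F t"
proof -
  have "compact ((\<lambda>\<theta>. Re (F (Complex t \<theta>))) ` {0..2 * pi})"
    by (intro compact_continuous_image continuous_circle assms compact_Icc)
  moreover have "(\<lambda>\<theta>. Re (F (Complex t \<theta>))) ` {0..2 * pi} \<noteq> {}" by simp
  ultimately have "circle_max F t \<in> (\<lambda>\<theta>. Re (F (Complex t \<theta>))) ` {0..2 * pi}"
    unfolding circle_max_def
    by (intro closed_contains_Sup) (auto simp: compact_imp_bounded compact_imp_closed bounded_imp_bdd_above)
  then show ?thesis using that by force
qed

lemma le_circle_max:
  assumes "x < t" "t < y" shows "Re (F (Complex t \<theta>)) \<le> circle_max F t"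
proof -
  obtain \<theta>' where \<theta>': "\<bar>\<theta>' - pi\<bar> \<le> pi" "Re (F (Complex t \<theta>')) = Re (F (Complex t \<theta>))"
    using angle_near[OF assms, of pi \<theta>] assms by metis
  have "compact ((\<lambda>\<theta>. Re (F (Complex t \<theta>))) ` {0..2 * pi})"
    by (intro compact_continuous_image continuous_circle assms compact_Icc)
  then have "Re (F (Complex t \<theta>')) \<le> circle_max F t"
    unfolding circle_max_def using \<theta>'
    by (intro cSUP_upper) (auto simp: compact_imp_bounded bounded_imp_bdd_above)
  then show ?thesis using \<theta>' by simp
qed

text \<open>Hadamard's three circles theorem. Subtracting k \<zeta>, with k the secant slope, gives
  the same maximum M on both bounding lines, and the maximum principle shows that M is not exceeded
  in between.\<close>

lemma circle_max_line:
  assumes t: "x < t1" "t1 < t" "t < t2" "t2 < y"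
  shows "circle_max F t \<le> circle_max F t1 + (circle_max F t2 - circle_max F t1) / (t2 - t1) * (t - t1)"
proof -
  define k where "k = (circle_max F t2 - circle_max F t1) / (t2 - t1)"
  define M where "M = circle_max F t1 - k * t1"
  have M2: "M = circle_max F t2 - k * t2" using t by (simp add: M_def k_def field_simps)
  define G where "G = (\<lambda>\<zeta>. F \<zeta> - of_real k * \<zeta>)"
  have ReG: "Re (G (Complex s \<theta>)) = Re (F (Complex s \<theta>)) - k * s" for s \<theta> by (simp add: G_def)
  have holG: "G holomorphic_on {\<zeta>. x < Re \<zeta> \<and> Re \<zeta> < y}"
    unfolding G_def by (intro holomorphic_intros holo)
  have contG: "continuous_on {\<zeta>. x < Re \<zeta> \<and> Re \<zeta> < y} (\<lambda>\<zeta>. Re (G \<zeta>))"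
    by (intro continuous_intros holomorphic_on_imp_continuous_on holG)
  define B where "B = cbox (Complex t1 0) (Complex t2 (2 * pi))"
  have memB: "\<zeta> \<in> B \<longleftrightarrow> t1 \<le> Re \<zeta> \<and> Re \<zeta> \<le> t2 \<and> 0 \<le> Im \<zeta> \<and> Im \<zeta> \<le> 2 * pi" for \<zeta>
    unfolding B_def in_cbox_complex_iff by auto
  have "\<exists>p\<in>B. \<forall>q\<in>B. Re (G q) \<le> Re (G p)"
  proof (rule continuous_attains_sup)
    show "compact B" by (simp add: B_def)
    show "B \<noteq> {}" using t memB[of "Complex t1 0"] by auto
    show "continuous_on B (\<lambda>\<zeta>. Re (G \<zeta>))"
      by (rule continuous_on_subset[OF contG]) (use memB t in auto)
  qed
  then obtain p where pB: "p \<in> B" and pmax: "\<And>q. q \<in> B \<Longrightarrow> Re (G q) \<le> Re (G p)" by blast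
  have pmax': "Re (G (Complex s \<theta>)) \<le> Re (G p)" if s: "t1 \<le> s" "s \<le> t2" for s \<theta>
  proof -
    have sxy: "x < s" "s < y" using s t by auto
    obtain \<theta>' where \<theta>': "\<bar>\<theta>' - pi\<bar> \<le> pi" "Re (F (Complex s \<theta>')) = Re (F (Complex s \<theta>))"
      using angle_near[OF sxy, of pi \<theta>] sxy by metis
    have "Complex s \<theta>' \<in> B" using \<theta>' s by (auto simp: memB)
    from pmax[OF this] show ?thesis using \<theta>' by (simp add: ReG)
  qed
  have edge1: "Re (G (Complex t1 \<theta>)) \<le> M" for \<theta>
    unfolding ReG M_def using le_circle_max[of t1 \<theta>] t by auto
  have edge2: "Re (G (Complex t2 \<theta>)) \<le> M" for \<theta>
    unfolding ReG M2 using le_circle_max[of t2 \<theta>] t by auto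
  have "Re (G p) \<le> M"
  proof (cases "t1 < Re p \<and> Re p < t2")
    case False
    then have "p = Complex t1 (Im p) \<or> p = Complex t2 (Im p)" using pB by (auto simp: memB complex_eq_iff)
    then show ?thesis using edge1 edge2 by metis
  next
    case True
    \<comment> \<open>The maximum over the rectangle B may lie on one of its horizontal sides. By
      periodicity it is a maximum over the whole open strip S, in which p is an interior point, so
      exp G is constant on S.\<close>
    define S where "S = {\<zeta>. t1 < Re \<zeta> \<and> Re \<zeta> < t2}"
    have S: "open S" "connected S"
    proof -
      have "S = {\<zeta>. t1 < Re \<zeta>} \<inter> {\<zeta>. Re \<zeta> < t2}" by (auto simp: S_def)
      then show "open S" "connected S"
        by (auto intro!: open_Int open_halfspace_Re_gt open_halfspace_Re_lt convex_connected convex_Int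
            convex_halfspace_Re_gt convex_halfspace_Re_lt)
    qed
    have "(\<lambda>\<zeta>. exp (G \<zeta>)) constant_on S"
    proof (rule maximum_modulus_principle[where U = S and \<xi> = p])
      show "(\<lambda>\<zeta>. exp (G \<zeta>)) holomorphic_on S"
        by (intro holomorphic_intros holomorphic_on_subset[OF holG]) (use t in \<open>auto simp: S_def\<close>)
      show "p \<in> S" using True by (simp add: S_def)
      show "norm (exp (G z)) \<le> norm (exp (G p))" if "z \<in> S" for z
        using pmax'[of "Re z" "Im z"] that by (simp add: S_def)
    qed (use S in auto)
    then obtain c where c: "\<And>\<zeta>. \<zeta> \<in> S \<Longrightarrow> exp (G \<zeta>) = c" unfolding constant_on_def by blast
    have eq: "Re (G \<zeta>) = Re (G p)" if "\<zeta> \<in> S" for \<zeta>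
    proof -
      have "norm (exp (G \<zeta>)) = norm (exp (G p))" using c[OF that] c[of p] True by (simp add: S_def)
      then show ?thesis by simp
    qed
    \<comment> \<open>The constant value of Re G on the open strip passes to the line Re \<zeta> =
      t1 by continuity, and there it is at most M.\<close>
    define m where "m = (t1 + t2) / 2"
    have m: "t1 < m" "m < t2" using t by (auto simp: m_def)
    have "continuous_on {t1..m} (\<lambda>s. Re (G (Complex s 0)))"
      by (rule continuous_on_compose2[OF contG])
        (use t m in \<open>auto simp: Complex_eq intro!: continuous_intros\<close>)
    then have "((\<lambda>s. Re (G (Complex s 0))) \<longlongrightarrow> Re (G (Complex t1 0))) (at_right t1)"
      using m by (metis continuous_on at_within_Icc_at_right atLeastAtMost_iff order_refl less_imp_le)
    moreover have "\<forall>\<^sub>F s in at_right t1. Re (G p) \<le> Re (G (Complex s 0))"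
      unfolding eventually_at_right_field using t
      by (intro exI[of _ t2]) (auto intro!: eq[THEN sym, THEN eq_refl] simp: S_def)
    ultimately have "Re (G p) \<le> Re (G (Complex t1 0))"
      using tendsto_lowerbound trivial_limit_at_right_real by blast
    then show ?thesis using edge1[of 0] by linarith
  qed
  moreover obtain \<theta> where "Re (F (Complex t \<theta>)) = circle_max F t"
    using circle_max_attained[of t] t by auto
  ultimately have "circle_max F t - k * t \<le> M"
    using pmax'[of t \<theta>] t by (simp add: ReG)
  then have "circle_max F t \<le> circle_max F t1 + k * (t - t1)" by (simp add: M_def algebra_simps)
  then show ?thesis unfolding k_def .
qed

text \<open>Along the ray through a maximum point, Re F stays below \<open>circle_max F\<close>,
  hence below the secant of this convex function, and it meets the secant at t. So its radial
  derivative, and with it |F'|, is at least the secant quotient.\<close>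

lemma circle_max_deriv:
  assumes s: "x < s" "s < y" and t: "x < t" "t < y" and "s \<noteq> t"
    and \<theta>: "Re (F (Complex t \<theta>)) = circle_max F t"
  shows "circle_max F t - circle_max F s \<le> cmod (deriv F (Complex t \<theta>)) * \<bar>t - s\<bar>"
proof -
  define d where "d = deriv F (Complex t \<theta>)"
  define k where "k = (circle_max F t - circle_max F s) / \<bar>t - s\<bar>"
  have st: "\<bar>t - s\<bar> > 0" using \<open>s \<noteq> t\<close> by simp
  have below: "Re (F (Complex r \<theta>)) \<le> circle_max F t - k * \<bar>t - r\<bar>"
    if r: "(s < r \<and> r < t) \<or> (t < r \<and> r < s)" for r
  proof -
    have "Re (F (Complex r \<theta>)) \<le> circle_max F r" using r s t by (intro le_circle_max) auto
    also have "\<dots> \<le> circle_max F t - k * \<bar>t - r\<bar>"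
    proof (cases "s < t")
      case True
      then have "circle_max F r \<le> circle_max F s + k * (r - s)"
        using circle_max_line[of s r t] r s t True by (auto simp: k_def)
      moreover have "k * (t - s) = circle_max F t - circle_max F s" using True by (simp add: k_def)
      moreover have "\<bar>t - r\<bar> = t - r" using True r by auto
      ultimately show ?thesis by (simp add: algebra_simps)
    next
      case False
      have "(circle_max F s - circle_max F t) / (s - t) = - k"
        using False \<open>s \<noteq> t\<close> by (simp add: k_def divide_simps)
      then have "circle_max F r \<le> circle_max F t + (- k) * (r - t)"
        using circle_max_line[of t r s] r s t False by auto
      moreover have "\<bar>t - r\<bar> = r - t" using False r by auto
      ultimately show ?thesis by (simp add: algebra_simps)
    qed
    finally show ?thesis .
  qed
  have "(F has_field_derivative d) (at (Complex t \<theta>))"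
    unfolding d_def by (rule holomorphic_derivI[OF holo open_strip]) (use t in auto)
  then have "(F has_derivative (\<lambda>h. d * h)) (at (Complex t \<theta>))" by (simp add: has_field_derivative_def)
  moreover have "((\<lambda>r. Complex r \<theta>) has_derivative (\<lambda>h. of_real h)) (at t)"
    unfolding Complex_eq by (auto intro!: derivative_eq_intros)
  ultimately have "((\<lambda>r. F (Complex r \<theta>)) has_derivative (\<lambda>h. d * of_real h)) (at t)"
    using diff_chain_at by (fastforce simp: o_def)
  then have "((\<lambda>r. Re (F (Complex r \<theta>))) has_derivative (\<lambda>h. Re (d * of_real h))) (at t)"
    by (rule has_derivative_Re)
  then have D: "((\<lambda>r. Re (F (Complex r \<theta>))) has_real_derivative (Re d)) (at t)"
    unfolding has_field_derivative_def by (rule has_derivative_eq_rhs) (simp add: fun_eq_iff)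
  have "k \<le> \<bar>Re d\<bar>"
  proof (cases "s < t")
    case True
    have "((\<lambda>r. (Re (F (Complex r \<theta>)) - Re (F (Complex t \<theta>))) / (r - t)) \<longlongrightarrow> Re d) (at_left t)"
      using D unfolding has_field_derivative_iff by (rule tendsto_within_subset) auto
    moreover have "\<forall>\<^sub>F r in at_left t. k \<le> (Re (F (Complex r \<theta>)) - Re (F (Complex t \<theta>))) / (r - t)"
      unfolding eventually_at_left_field
    proof (intro exI[of _ s] conjI True allI impI)
      fix r assume "s < r" "r < t"
      then show "k \<le> (Re (F (Complex r \<theta>)) - Re (F (Complex t \<theta>))) / (r - t)"
        using below[of r] \<theta> by (simp add: neg_le_divide_eq algebra_simps)
    qed
    ultimately have "k \<le> Re d" using tendsto_lowerbound trivial_limit_at_left_real by blast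
    then show ?thesis by linarith
  next
    case False
    have "((\<lambda>r. (Re (F (Complex r \<theta>)) - Re (F (Complex t \<theta>))) / (r - t)) \<longlongrightarrow> Re d) (at_right t)"
      using D unfolding has_field_derivative_iff by (rule tendsto_within_subset) auto
    moreover have "\<forall>\<^sub>F r in at_right t. (Re (F (Complex r \<theta>)) - Re (F (Complex t \<theta>))) / (r - t) \<le> - k"
      unfolding eventually_at_right_field
    proof (intro exI[of _ s] conjI allI impI)
      show "t < s" using False \<open>s \<noteq> t\<close> by simp
      fix r assume "t < r" "r < s"
      then show "(Re (F (Complex r \<theta>)) - Re (F (Complex t \<theta>))) / (r - t) \<le> - k"
        using below[of r] \<theta> by (simp add: pos_divide_le_eq algebra_simps)
    qed
    ultimately have "Re d \<le> - k" using tendsto_upperbound trivial_limit_at_right_real by blast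
    then show ?thesis by linarith
  qed
  also have "\<dots> \<le> cmod d" by (rule abs_Re_le_cmod)
  finally show ?thesis using st by (simp add: k_def d_def divide_simps)
qed

lemma circle_mean_le:
  assumes t: "x < t" "t < y" and "\<And>\<theta>. Re (F (Complex t \<theta>)) \<le> B"
  shows "circle_mean F t \<le> B"
proof -
  have "integral {0..2 * pi} (\<lambda>\<theta>. Re (F (Complex t \<theta>))) \<le> integral {0..2 * pi} (\<lambda>\<theta>. B)"
    by (intro integral_le integrable_continuous_real continuous_circle t) (use assms in auto)
  then show ?thesis by (simp add: circle_mean_def field_simps)
qed

lemma circle_mean_ge:
  assumes t: "x < t" "t < y" and "\<And>\<theta>. Re (F (Complex t \<theta>)) \<ge> B"
  shows "circle_mean F t \<ge> B"
proof -
  have "integral {0..2 * pi} (\<lambda>\<theta>. B) \<le> integral {0..2 * pi} (\<lambda>\<theta>. Re (F (Complex t \<theta>)))"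
    by (intro integral_le integrable_continuous_real continuous_circle t) (use assms in auto)
  then show ?thesis by (simp add: circle_mean_def field_simps)
qed

text \<open>Harnack's inequality for \<open>circle_max F t\<close> + E - Re F, which is nonnegative
  on the disc of radius 2 \<pi> about a maximum point and equals E at its centre. Every point of the
  circle has a translate within \<pi>, where the factor is (2 \<pi> + \<pi>) / (2 \<pi> - \<pi>) =
  3; what remains is 3 E - E = 2 E.\<close>

lemma circle_mean_ge_max:
  assumes t: "x \<le> t - 2 * pi" "t + 2 * pi \<le> y"
    and B: "\<And>s. \<bar>s - t\<bar> < 2 * pi \<Longrightarrow> circle_max F s \<le> circle_max F t + E"
  shows "circle_mean F t \<ge> circle_max F t - 2 * E"
proof -
  have pi0: "pi > 0" by simp
  have xt: "x < t" "t < y" using t pi_gt_zero by linarith+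
  obtain \<theta>0 where \<theta>0: "Re (F (Complex t \<theta>0)) = circle_max F t" using circle_max_attained[OF xt] by blast
  define G where "G = (\<lambda>\<zeta>. of_real (circle_max F t + E) - F \<zeta>)"
  let ?b = "ball (Complex t \<theta>0) (2 * pi)"
  have sub: "?b \<subseteq> {\<zeta>. x < Re \<zeta> \<and> Re \<zeta> < y}" by (rule ball_subset_strip) (use t in auto)
  have hG: "G holomorphic_on ?b"
    unfolding G_def by (intro holomorphic_intros holomorphic_on_subset[OF holo] sub)
  have pos: "Re (G z) \<ge> 0" if "z \<in> ?b" for z
  proof -
    have "\<bar>Re (Complex t \<theta>0 - z)\<bar> < 2 * pi"
      using that by (metis abs_Re_le_cmod dist_norm le_less_trans mem_ball)
    then have "circle_max F (Re z) \<le> circle_max F t + E" by (intro B) auto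
    moreover have "Re (F (Complex (Re z) (Im z))) \<le> circle_max F (Re z)"
      using sub that by (intro le_circle_max) auto
    ultimately show ?thesis by (simp add: G_def)
  qed
  have E: "E \<ge> 0" using B[of t] by simp
  show ?thesis
  proof (rule circle_mean_ge[OF xt])
    fix \<theta>
    obtain \<theta>' where \<theta>': "\<bar>\<theta>' - \<theta>0\<bar> \<le> pi" "Re (F (Complex t \<theta>')) = Re (F (Complex t \<theta>))"
      using angle_near[OF xt, of \<theta>0 \<theta>] xt by metis
    define d where "d = dist (Complex t \<theta>0) (Complex t \<theta>')"
    have d: "d = \<bar>\<theta>' - \<theta>0\<bar>" by (simp add: d_def dist_norm cmod_def)
    have d2: "d < 2 * pi" using \<theta>' pi0 unfolding d by linarith
    have "Re (G (Complex t \<theta>')) \<le> (2 * pi + d) / (2 * pi - d) * Re (G (Complex t \<theta>0))"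
      unfolding d_def by (rule harnack_ball(2)[OF hG pos]) (use d2 in \<open>auto simp: d_def\<close>)
    also have "Re (G (Complex t \<theta>0)) = E" using \<theta>0 by (simp add: G_def)
    also have "(2 * pi + d) / (2 * pi - d) * E \<le> 3 * E"
      using \<theta>' d d2 by (intro mult_right_mono E) (auto simp: divide_simps)
    finally show "circle_max F t - 2 * E \<le> Re (F (Complex t \<theta>))"
      using \<theta>' by (simp add: G_def)
  qed
qed

text \<open>The secant quotient forces |F'| \<ge> \<Lambda> at a maximum point, and the covering
  property of exp F applies to the disc of radius 1 about it.\<close>

lemma covers_circle:
  assumes \<Lambda>: "\<And>F z l w. \<lbrakk>F holomorphic_on ball z l; l > 0; cmod (deriv F z) * l \<ge> \<Lambda>;
        cmod w = exp (Re (F z))\<rbrakk> \<Longrightarrow> w \<in> (\<lambda>\<zeta>. exp (F \<zeta>)) ` ball z l"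
    and t: "x + 1 \<le> t" "t + 1 \<le> y" and s: "x < s" "s < y" "s \<noteq> t"
    and le: "\<Lambda> * \<bar>t - s\<bar> \<le> circle_max F t - circle_max F s"
    and w: "cmod w = exp (circle_max F t)"
  shows "w \<in> (\<lambda>\<zeta>. exp (F \<zeta>)) ` {\<zeta>. x < Re \<zeta> \<and> Re \<zeta> < y}"
proof -
  have xt: "x < t" "t < y" using t by auto
  obtain \<theta> where \<theta>: "Re (F (Complex t \<theta>)) = circle_max F t" using circle_max_attained[OF xt] by blast
  have sub: "ball (Complex t \<theta>) 1 \<subseteq> {\<zeta>. x < Re \<zeta> \<and> Re \<zeta> < y}"
    by (rule ball_subset_strip) (use t in auto)
  have "\<Lambda> * \<bar>t - s\<bar> \<le> cmod (deriv F (Complex t \<theta>)) * \<bar>t - s\<bar>"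
    using circle_max_deriv[OF s(1,2) xt s(3) \<theta>] le by linarith
  then have "\<Lambda> \<le> cmod (deriv F (Complex t \<theta>)) * 1" using s by simp
  from \<Lambda>[OF holomorphic_on_subset[OF holo sub] _ this, of w] w \<theta> sub show ?thesis by auto
qed

end

section \<open>Jensen formula and Nevanlinna functions\<close>

lemma mean_value_circle:
  fixes h :: "complex \<Rightarrow> complex"
  assumes h: "h holomorphic_on ball 0 R" and \<rho>: "0 < \<rho>" "\<rho> < R"
  shows "((\<lambda>\<theta>. h (of_real \<rho> * cis \<theta>)) has_integral (2 * pi * h 0)) {0..2 * pi}"
proof -
  have "((\<lambda>u. h u / (u - 0)) has_contour_integral (2 * of_real pi * \<i> * h 0)) (circlepath 0 \<rho>)"
    by (rule Cauchy_integral_circlepath_simple[OF holomorphic_on_subset[OF h]]) (use \<rho> in auto)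
  then have "((\<lambda>x. h (circlepath 0 \<rho> x) / circlepath 0 \<rho> x * vector_derivative (circlepath 0 \<rho>) (at x within {0..1}))
      has_integral (2 * of_real pi * \<i> * h 0)) {0..1}"
    by (simp add: has_contour_integral_def)
  then have "((\<lambda>x. (2 * of_real pi * \<i>) * h (of_real \<rho> * cis (2 * pi * x)))
      has_integral (2 * of_real pi * \<i> * h 0)) {0..1}"
  proof (rule has_integral_eq[rotated])
    fix x :: real assume "x \<in> {0..1}"
    then have "vector_derivative (circlepath 0 \<rho>) (at x within {0..1}) = 2 * of_real pi * \<i> * circlepath 0 \<rho> x"
      by (subst vector_derivative_circlepath01) (auto simp: circlepath algebra_simps)
    moreover have "circlepath 0 \<rho> x = of_real \<rho> * cis (2 * pi * x)"
      by (simp add: circlepath cis_conv_exp algebra_simps)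
    moreover have "of_real \<rho> * cis (2 * pi * x) \<noteq> 0" using \<rho> by simp
    ultimately show "h (circlepath 0 \<rho> x) / circlepath 0 \<rho> x * vector_derivative (circlepath 0 \<rho>) (at x within {0..1})
      = (2 * of_real pi * \<i>) * h (of_real \<rho> * cis (2 * pi * x))"
      by (simp del: mult_eq_0_iff)
  qed
  from has_integral_mult_right[OF this, of "1 / (2 * of_real pi * \<i>)"]
  have "((\<lambda>x. h (of_real \<rho> * cis (2 * pi * x))) has_integral h 0) (cbox 0 1)" by simp
  from has_integral_affinity[OF this, of "1 / (2 * pi)" 0]
  have "((\<lambda>x. h (of_real \<rho> * cis x)) has_integral (2 * pi) *\<^sub>R h 0) ((\<lambda>x. 2 * pi * x) ` {0..1})"
    by simp
  moreover have "(\<lambda>x. 2 * pi * x) ` {0..1::real} = {0..2 * pi}"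
    using image_mult_atLeastAtMost[of "2 * pi" 0 1] by simp
  ultimately show ?thesis by (simp add: scaleR_conv_of_real)
qed

lemma circle_mean_exp:
  assumes h: "h holomorphic_on ball 0 R" and t: "exp t < R"
  shows "((\<lambda>\<theta>. Re (h (exp (Complex t \<theta>)))) has_integral (2 * pi * Re (h 0))) {0..2 * pi}"
proof -
  have "((\<lambda>\<theta>. h (of_real (exp t) * cis \<theta>)) has_integral (2 * pi * h 0)) {0..2 * pi}"
    by (rule mean_value_circle[OF h]) (use t in auto)
  then have "((\<lambda>\<theta>. Re (h (of_real (exp t) * cis \<theta>))) has_integral Re (2 * pi * h 0)) {0..2 * pi}"
    by (rule has_integral_Re)
  moreover have "of_real (exp t) * cis \<theta> = exp (Complex t \<theta>)" for \<theta>
    by (simp add: exp_eq_polar)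
  ultimately show ?thesis by simp
qed

text \<open>The function 1 - w/z is not holomorphic inside the circle |z| = e^t. On the circle,
  however, its conjugate is 1 - cnj w z / e^(2t), which is holomorphic and zero-free inside because
  |w| < e^t, so the mean is log 1 = 0.\<close>

lemma circle_mean_log_factor:
  assumes t: "cmod w < exp t"
  shows "((\<lambda>\<theta>. Re (Ln (1 - w * exp (- Complex t \<theta>)))) has_integral 0) {0..2 * pi}"
proof -
  define h where "h = (\<lambda>v. Ln (1 - cnj w * of_real (exp (- 2 * t)) * v))"
  \<comment> \<open>The radius is e^(2t) / max |w| (e^t / 2). It exceeds e^t, the factor stays
    zero-free up to it, and the second entry of the maximum keeps it finite for w = 0.\<close>
  have bound: "cmod (cnj w * of_real (exp (- 2 * t)) * v) < 1" if "v \<in> ball 0 (exp (t + (t - ln (max (cmod w) (exp t / 2)))))" for v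
  proof (cases "w = 0")
    case False
    let ?m = "max (cmod w) (exp t / 2)"
    have m: "?m > 0" by (simp add: less_max_iff_disj)
    have "exp (t + (t - ln ?m)) = exp (2 * t) / ?m"
      unfolding mult_2 exp_add exp_diff exp_ln[OF m] by simp
    then have "cmod v < exp (2 * t) / ?m" using that by simp
    then have "cmod w * exp (- 2 * t) * cmod v < cmod w * exp (- 2 * t) * (exp (2 * t) / ?m)"
      using False by (intro mult_strict_left_mono) auto
    also have "\<dots> = cmod w / ?m" by (simp add: exp_minus field_simps)
    also have "\<dots> \<le> 1" using m by (simp add: divide_le_eq)
    finally show ?thesis by (simp add: norm_mult)
  qed simp
  have Re1: "Re (1 - v) > 0" if "cmod v < 1" for v :: complex
    using complex_Re_le_cmod[of v] that by simp
  have "h holomorphic_on ball 0 (exp (t + (t - ln (max (cmod w) (exp t / 2)))))"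
    unfolding h_def
    using Re1[OF bound] by (intro holomorphic_intros) (force simp: complex_nonpos_Reals_iff)+
  then have "((\<lambda>\<theta>. Re (h (exp (Complex t \<theta>)))) has_integral (2 * pi * Re (h 0))) {0..2 * pi}"
  proof (rule circle_mean_exp)
    have "max (cmod w) (exp t / 2) < exp t" "max (cmod w) (exp t / 2) > 0"
      using t by (auto simp: max_def)
    then have "ln (max (cmod w) (exp t / 2)) < t" by (metis exp_less_cancel_iff exp_ln)
    then show "exp t < exp (t + (t - ln (max (cmod w) (exp t / 2))))" by simp
  qed
  moreover have "Re (h (exp (Complex t \<theta>))) = Re (Ln (1 - w * exp (- Complex t \<theta>)))" for \<theta>
  proof -
    have e: "of_real (exp (- 2 * t)) * exp (Complex t \<theta>) = cnj (exp (- Complex t \<theta>))"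
      unfolding exp_cnj by (simp add: exp_of_real[symmetric] exp_add[symmetric] Complex_eq algebra_simps del: exp_of_real)
    have eq: "1 - cnj w * of_real (exp (- 2 * t)) * exp (Complex t \<theta>) = cnj (1 - w * exp (- Complex t \<theta>))"
      using e by (simp add: mult.assoc)
    have "cmod (w * exp (- Complex t \<theta>)) < 1"
      using t by (simp add: norm_mult norm_divide exp_minus field_simps)
    then have "1 - w * exp (- Complex t \<theta>) \<noteq> 0" by auto
    then show ?thesis unfolding h_def eq by (subst (1 2) Re_Ln) (simp_all only: complex_cnj_zero_iff complex_mod_cnj not_False_eq_True)
  qed
  ultimately show ?thesis by (simp add: h_def)
qed

text \<open>Multiplication by the powers of z - w with opposite orders cancels the zeros and poles
  in Z, and \<open>remove_sings\<close> fills in the missing values. The last conclusion gives the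
  value of G at a point of Z, which Jensen's formula needs at 0.\<close>

lemma divisor_factorization:
  fixes g :: "complex \<Rightarrow> complex"
  assumes mero: "g meromorphic_on UNIV" and freq: "\<And>z. \<exists>\<^sub>F w in at z. g w \<noteq> 0"
    and fin: "finite Z" and B: "open B"
    and ana: "\<And>z. z \<in> B - Z \<Longrightarrow> g analytic_on {z}"
  obtains G where "G holomorphic_on B" "\<And>z. z \<in> B \<Longrightarrow> z \<in> Z \<or> g z \<noteq> 0 \<Longrightarrow> G z \<noteq> 0"
    "\<And>z. z \<in> B - Z \<Longrightarrow> g z = G z * (\<Prod>w\<in>Z. (z - w) powi (zorder g w))"
    "\<And>z. z \<in> B \<inter> Z \<Longrightarrow> G z = zor_poly g z z * (\<Prod>w\<in>Z - {z}. (z - w) powi (- zorder g w))"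
proof -
  define P where "P = (\<lambda>A z. \<Prod>w\<in>A. (z - w) powi (- zorder g w))"
  define G0 where "G0 = (\<lambda>z. g z * P Z z)"
  define G where "G = remove_sings G0"
  have Pana: "P A analytic_on {z}" "P A z \<noteq> 0" if "z \<notin> A" "finite A" for A z
    using that unfolding P_def by (auto intro!: analytic_intros simp: power_int_eq_0_iff)
  have iso: "isolated_singularity_at g z" "not_essential g z" for z
    using mero meromorphic_at_iff meromorphic_on_subset by blast+
  have G0mero: "G0 meromorphic_on UNIV" unfolding G0_def P_def by (intro meromorphic_intros mero)
  have lim: "G0 \<midarrow>z\<rightarrow> zor_poly g z z * P (Z - {z}) z" if z: "z \<in> Z" for z
  proof -
    obtain r where r: "r > 0" "zor_poly g z holomorphic_on cball z r"
      and eq: "\<And>w. w \<in> cball z r - {z} \<Longrightarrow> g w = zor_poly g z w * (w - z) powi (zorder g z)"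
      using zorder_exist[OF iso[of z] freq[of z]] by blast
    have "isCont (zor_poly g z) z"
      using r holomorphic_on_imp_continuous_on[OF holomorphic_on_subset[OF r(2) ball_subset_cball]]
      by (simp add: continuous_on_eq_continuous_at)
    moreover have "isCont (P (Z - {z})) z"
      by (rule analytic_at_imp_isCont) (rule Pana, use fin in auto)
    ultimately have "(\<lambda>w. zor_poly g z w * P (Z - {z}) w) \<midarrow>z\<rightarrow> zor_poly g z z * P (Z - {z}) z"
      by (intro tendsto_mult isContD)
    moreover have "\<forall>\<^sub>F w in at z. w \<in> cball z r - {z}"
      using r by (auto simp: eventually_at intro!: exI[of _ r] simp: dist_commute less_imp_le)
    then have "\<forall>\<^sub>F w in at z. zor_poly g z w * P (Z - {z}) w = G0 w"
    proof eventually_elim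
      case (elim w)
      have "P Z w = (w - z) powi (- zorder g z) * P (Z - {z}) w"
        unfolding P_def by (rule prod.remove[OF fin z])
      then show ?case using elim eq[OF elim] by (simp add: G0_def power_int_minus)
    qed
    ultimately show ?thesis by (rule Lim_transform_eventually)
  qed
  have GZ: "G analytic_on {z}" "G z = zor_poly g z z * P (Z - {z}) z" "G z \<noteq> 0" if z: "z \<in> Z" for z
  proof -
    have i0: "isolated_singularity_at G0 z" using G0mero meromorphic_at_iff meromorphic_on_subset by blast
    show "G analytic_on {z}" unfolding G_def by (rule remove_sings_analytic_at[OF i0 lim[OF z]])
    show *: "G z = zor_poly g z z * P (Z - {z}) z" unfolding G_def by (rule remove_sings_eqI[OF lim[OF z]])
    show "G z \<noteq> 0" unfolding * using Pana(2)[of z "Z - {z}"] fin zorder_exist[OF iso[of z] freq[of z]] by auto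
  qed
  have GB: "G analytic_on {z}" "G z = G0 z" "g z \<noteq> 0 \<Longrightarrow> G z \<noteq> 0" if z: "z \<in> B - Z" for z
  proof -
    have a: "G0 analytic_on {z}"
      unfolding G0_def using ana[OF z] Pana(1)[of z Z] z fin by (intro analytic_intros) auto
    then show "G analytic_on {z}" unfolding G_def by (rule remove_sings_analytic_on)
    show *: "G z = G0 z" unfolding G_def using a by (rule remove_sings_at_analytic)
    show "g z \<noteq> 0 \<Longrightarrow> G z \<noteq> 0" unfolding * using Pana(2)[of z Z] z fin by (simp add: G0_def)
  qed
  show ?thesis
  proof
    have "G analytic_on B" unfolding analytic_on_analytic_at[of G B] using GZ(1) GB(1) by (metis DiffI)
    then show "G holomorphic_on B" by (rule analytic_imp_holomorphic)
    show "G z \<noteq> 0" if "z \<in> B" "z \<in> Z \<or> g z \<noteq> 0" for z using that GZ(3) GB(3) by (metis DiffI)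
    show "g z = G z * (\<Prod>w\<in>Z. (z - w) powi (zorder g w))" if "z \<in> B - Z" for z
    proof -
      have "P Z z * (\<Prod>w\<in>Z. (z - w) powi (zorder g w)) = 1"
        unfolding P_def prod.distrib[symmetric] using that
        by (intro prod.neutral) (auto simp: power_int_minus power_int_eq_0_iff intro!: left_inverse)
      then show ?thesis using GB(2)[OF that] by (simp add: G0_def mult.assoc)
    qed
    show "G z = zor_poly g z z * (\<Prod>w\<in>Z - {z}. (z - w) powi (- zorder g w))" if "z \<in> B \<inter> Z" for z
      using GZ(2)[of z] that by (simp add: P_def)
  qed
qed

locale meromorphic_plane =
  fixes f :: "complex \<Rightarrow> complex"
  assumes nice: "f nicely_meromorphic_on UNIV" and nonconst: "\<not> f constant_on UNIV"
begin

lemma mero: "f meromorphic_on A"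
  using nice meromorphic_on_subset by (auto simp: nicely_meromorphic_on_def)

lemma analytic_at_nonpole: "\<not> is_pole f z \<Longrightarrow> f analytic_on {z}"
  using nicely_meromorphic_on_imp_analytic_at[OF nice] by blast

lemma iso: "isolated_singularity_at f z" "not_essential f z"
  using mero meromorphic_at_iff by blast+

lemma frequently_ne: "\<exists>\<^sub>F w in at z. f w \<noteq> a"
proof (rule ccontr)
  assume "\<not> ?thesis"
  then have "\<forall>\<^sub>F w in at z. f w = a" by (simp add: not_frequently)
  then have "\<exists>\<^sub>F w in at z. f w = a" by (intro eventually_frequently at_neq_bot)
  from frequently_eq_meromorphic_imp_constant[OF this nice] show False
    using nonconst by (auto simp: constant_on_def)
qed

lemma eventually_ne: "\<forall>\<^sub>F w in at z. f w \<noteq> a"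
proof (rule ccontr)
  assume "\<not> ?thesis"
  then have "\<exists>\<^sub>F w in at z. f w = a" by (simp add: frequently_def)
  from frequently_eq_meromorphic_imp_constant[OF this nice] show False
    using nonconst by (auto simp: constant_on_def)
qed

lemma not_islimpt_special: "\<not> z islimpt {w. is_pole f w \<or> f w = a}"
proof -
  have "\<forall>\<^sub>F w in at z. f analytic_on {w}"
    using iso(1)[of z] isolated_singularity_at_altdef by blast
  then have "\<forall>\<^sub>F w in at z. \<not> (is_pole f w \<or> f w = a)"
    using eventually_ne[of a z] by eventually_elim (use analytic_at_imp_no_pole in blast)
  then show ?thesis by (simp add: islimpt_conv_frequently_at frequently_def)
qed

lemma finite_special: "finite {w. cmod w \<le> r \<and> (is_pole f w \<or> f w = a)}"
proof -
  have "finite (cball 0 r \<inter> {w. is_pole f w \<or> f w = a})"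
    by (rule finite_not_islimpt_in_compact) (use not_islimpt_special in auto)
  then show ?thesis by (rule rev_finite_subset) auto
qed

lemma finite_poles: "finite {w. cmod w \<le> r \<and> is_pole f w}"
  by (rule finite_subset[OF _ finite_special[of r 0]]) auto

lemma finite_poles_less: "finite {w. cmod w < r \<and> is_pole f w}"
  by (rule finite_subset[OF _ finite_special[of r 0]]) auto

lemma zorder_diff_pole:
  assumes "is_pole f z" shows "zorder (\<lambda>w. f w - a) z = - int (pole_mult f z)"
proof -
  have neg: "zorder f z < 0" using assms iso(1) isolated_pole_imp_neg_zorder by blast
  have "zorder (\<lambda>w. f w - a) z = zorder f z"
  proof (cases "a = 0")
    case False
    have "zorder (\<lambda>_. a) z = 0" using False by (intro zorder_eq_0I) auto
    then show ?thesis
      using False neg frequently_ne[of 0 z] by (intro zorder_diff1) (auto intro!: meromorphic_intros mero)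
  qed simp
  then show ?thesis using assms neg by (simp add: pole_mult_def)
qed

lemma pole_mult_pos: "is_pole f z \<Longrightarrow> pole_mult f z \<ge> 1"
  using iso(1) isolated_pole_imp_neg_zorder[of f z] by (simp add: pole_mult_def)

lemma zorder_diff_nonpole:
  assumes "\<not> is_pole f z" shows "zorder (\<lambda>w. f w - a) z \<ge> 0"
  using analytic_at_nonpole[OF assms] frequently_ne[of a z]
  by (intro zorder_ge_0) (auto intro!: analytic_intros)

lemma counting_integral:
  fixes s r :: real
  assumes p: "0 < s" "s \<le> r"
  shows "((\<lambda>t. if s < t then 1 / t else 0) has_integral (ln (r / s))) {0..r}"
proof -
  have "((\<lambda>t. if s < t then 1 / t else 0) has_integral 0) {0..s}"
    by (rule has_integral_is_0) auto
  moreover have "((\<lambda>t. 1 / t) has_integral (ln r - ln s)) {s..r}"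
    using p by (intro fundamental_theorem_of_calculus)
      (auto intro!: derivative_eq_intros simp flip: has_real_derivative_iff_has_vector_derivative)
  then have "((\<lambda>t. if s < t then 1 / t else 0) has_integral (ln r - ln s)) {s..r}"
    by (rule has_integral_spike_finite[of "{s}", rotated 2]) auto
  ultimately have "((\<lambda>t. if s < t then 1 / t else 0) has_integral (0 + (ln r - ln s))) {0..r}"
    by (rule has_integral_combine[rotated 2]) (use p in auto)
  then show ?thesis using p by (simp add: ln_div)
qed

lemma nevanlinna_N_eq:
  assumes r: "r > 0"
  shows "nevanlinna_N r f = (\<Sum>p | cmod p < r \<and> p \<noteq> 0 \<and> is_pole f p. real (pole_mult f p) * ln (r / cmod p))
     + real (pole_mult f 0) * ln r"
proof -
  define P where "P = {p. cmod p < r \<and> p \<noteq> 0 \<and> is_pole f p}"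
  have finP: "finite P" unfolding P_def by (rule finite_subset[OF _ finite_poles_less[of r]]) auto
  have "((\<lambda>t. \<Sum>p\<in>P. real (pole_mult f p) * (if cmod p < t then 1 / t else 0)) has_integral
      (\<Sum>p\<in>P. real (pole_mult f p) * ln (r / cmod p))) {0..r}"
    using finP by (intro has_integral_sum has_integral_mult_right counting_integral) (auto simp: P_def)
  moreover have "(\<Sum>p\<in>P. real (pole_mult f p) * (if cmod p < t then 1 / t else 0))
      = (real (pole_count t f) - real (pole_mult f 0)) / t" if t: "t \<in> {0..r}" for t
  \<comment> \<open>At t = 0 both sides vanish, since division by 0 yields 0.\<close>
  proof (cases "t = 0")
    case False
    then have t0: "t > 0" using t by simp
    have eq: "{p. cmod p < t \<and> is_pole f p} - {0} = {p\<in>P. cmod p < t}" using t by (auto simp: P_def)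
    have "pole_count t f = (\<Sum>p\<in>{p\<in>P. cmod p < t}. pole_mult f p) + pole_mult f 0"
    proof (cases "is_pole f 0")
      case True
      then have "0 \<in> {p. cmod p < t \<and> is_pole f p}" using t0 by simp
      then show ?thesis unfolding pole_count_def eq[symmetric]
        using finite_poles_less by (subst sum.remove[of _ 0]) (auto simp: add.commute)
    next
      case False
      then have "{p. cmod p < t \<and> is_pole f p} = {p. cmod p < t \<and> is_pole f p} - {0}" by auto
      then show ?thesis unfolding pole_count_def eq[symmetric] using False by (simp add: pole_mult_def)
    qed
    then have "(real (pole_count t f) - real (pole_mult f 0)) / t = (\<Sum>p\<in>{p\<in>P. cmod p < t}. real (pole_mult f p) * (1 / t))"
      by (simp add: sum_divide_distrib)
    also have "\<dots> = (\<Sum>p\<in>P. real (pole_mult f p) * (if cmod p < t then 1 / t else 0))"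
      using finP by (intro sum.mono_neutral_cong_left) auto
    finally show ?thesis by simp
  qed simp
  ultimately have "((\<lambda>t. (real (pole_count t f) - real (pole_mult f 0)) / t) has_integral
      (\<Sum>p\<in>P. real (pole_mult f p) * ln (r / cmod p))) {0..r}"
    by (rule has_integral_eq[rotated])
  then show ?thesis unfolding nevanlinna_N_def P_def by (simp add: integral_unique)
qed

text \<open>A pole p with 0 < |p| \<le> e^x contributes log (e^t / |p|) \<ge> t - x for each
  multiplicity, a pole at 0 contributes t. In this way a bound on N at one radius bounds the number
  of poles inside a smaller one.\<close>

lemma nevanlinna_N_ge:
  assumes "0 \<le> x" "x < t"
  shows "nevanlinna_N (exp t) f \<ge> (\<Sum>p | cmod p \<le> exp x \<and> is_pole f p. real (pole_mult f p)) * (t - x)"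
proof -
  define P where "P = {p. cmod p < exp t \<and> p \<noteq> 0 \<and> is_pole f p}"
  define Q where "Q = {p. cmod p \<le> exp x \<and> p \<noteq> 0 \<and> is_pole f p}"
  have fin: "finite P" unfolding P_def by (rule finite_subset[OF _ finite_poles[of "exp t"]]) auto
  have finQ: "finite Q" unfolding Q_def by (rule finite_subset[OF _ finite_poles[of "exp x"]]) auto
  have QP: "Q \<subseteq> P" using assms by (auto simp: Q_def P_def intro: le_less_trans)
  have 1: "(\<Sum>p | cmod p \<le> exp x \<and> is_pole f p. real (pole_mult f p)) = (\<Sum>p\<in>Q. real (pole_mult f p)) + real (pole_mult f 0)"
  proof (cases "is_pole f 0")
    case True
    then have "{p. cmod p \<le> exp x \<and> is_pole f p} = insert 0 Q" by (auto simp: Q_def)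
    then show ?thesis using finQ by (simp add: Q_def)
  next
    case False
    then have "{p. cmod p \<le> exp x \<and> is_pole f p} = Q" by (auto simp: Q_def)
    then show ?thesis using False by (simp add: pole_mult_def)
  qed
  have "(\<Sum>p\<in>Q. real (pole_mult f p) * (t - x)) \<le> (\<Sum>p\<in>Q. real (pole_mult f p) * ln (exp t / cmod p))"
  proof (intro sum_mono mult_left_mono)
    fix p assume "p \<in> Q"
    then have "0 < cmod p" "cmod p \<le> exp x" by (auto simp: Q_def)
    then have "ln (cmod p) \<le> ln (exp x)" by (subst ln_le_cancel_iff) auto
    moreover have "ln (exp t / cmod p) = ln (exp t) - ln (cmod p)"
      using \<open>0 < cmod p\<close> by (simp add: ln_div)
    ultimately show "t - x \<le> ln (exp t / cmod p)" by simp
  qed auto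
  also have "\<dots> \<le> (\<Sum>p\<in>P. real (pole_mult f p) * ln (exp t / cmod p))"
  proof (rule sum_mono2[OF fin QP])
    fix p assume "p \<in> P - Q"
    then have "0 < cmod p" "cmod p \<le> exp t" by (auto simp: P_def)
    then have "1 \<le> exp t / cmod p" by simp
    then show "0 \<le> real (pole_mult f p) * ln (exp t / cmod p)" by simp
  qed
  finally have "(\<Sum>p\<in>Q. real (pole_mult f p)) * (t - x) \<le> (\<Sum>p\<in>P. real (pole_mult f p) * ln (exp t / cmod p))"
    by (simp add: sum_distrib_right)
  moreover have "real (pole_mult f 0) * (t - x) \<le> real (pole_mult f 0) * t"
    using assms by (intro mult_left_mono) auto
  ultimately show ?thesis using nevanlinna_N_eq[of "exp t"] unfolding 1 P_def[symmetric]
    by (simp add: distrib_right)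
qed

lemma continuous_log_plus:
  assumes "r \<ge> 0" "\<And>z. cmod z = r \<Longrightarrow> \<not> is_pole f z"
  shows "continuous_on A (\<lambda>\<theta>. ln (max 1 (cmod (f (of_real r * cis \<theta>)))))"
proof -
  have "continuous_on A (\<lambda>\<theta>. f (of_real r * cis \<theta>))"
  proof (rule continuous_at_imp_continuous_on, rule ballI)
    fix \<theta> :: real
    have "isCont f (of_real r * cis \<theta>)"
      using assms by (intro analytic_at_imp_isCont analytic_at_nonpole) (auto simp: norm_mult)
    then show "isCont (\<lambda>\<theta>. f (of_real r * cis \<theta>)) \<theta>"
      by (rule isCont_o2[rotated, where g = f]) (simp add: cis_conv_exp)
  qed
  then show ?thesis by (intro continuous_intros) (auto simp: max_def)
qed

lemma nevanlinna_m_ge: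
  assumes "r \<ge> 0" "\<And>z. cmod z = r \<Longrightarrow> \<not> is_pole f z" "\<And>z. cmod z = r \<Longrightarrow> B \<le> ln (max 1 (cmod (f z)))"
  shows "B \<le> nevanlinna_m r f"
proof -
  have "integral {0..2 * pi} (\<lambda>\<theta>. B) \<le> integral {0..2 * pi} (\<lambda>\<theta>. ln (max 1 (cmod (f (of_real r * cis \<theta>)))))"
    using assms by (intro integral_le integrable_continuous_real continuous_on_const continuous_log_plus)
      (auto simp: norm_mult)
  then have "2 * pi * B / (2 * pi) \<le> integral {0..2 * pi} (\<lambda>\<theta>. ln (max 1 (cmod (f (of_real r * cis \<theta>))))) / (2 * pi)"
    by (intro divide_right_mono) auto
  then show ?thesis unfolding nevanlinna_m_def by simp
qed

lemma nevanlinna_N_le_T: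
  assumes "r \<ge> 0" "\<And>z. cmod z = r \<Longrightarrow> \<not> is_pole f z"
  shows "nevanlinna_N r f \<le> nevanlinna_T r f"
  using nevanlinna_m_ge[OF assms, of 0] by (simp add: nevanlinna_T_def)

definition jensen_data :: "complex \<Rightarrow> real \<Rightarrow> real \<Rightarrow> real \<Rightarrow> (complex \<Rightarrow> complex) \<Rightarrow> real \<Rightarrow> real \<Rightarrow> bool" where
  "jensen_data a K x y F A n \<longleftrightarrow>
     log_strip F x y \<and> (\<forall>\<zeta>. x < Re \<zeta> \<and> Re \<zeta> < y \<longrightarrow> exp (F \<zeta>) = f (exp \<zeta>) - a) \<and> 0 \<le> n \<and>
     (\<forall>t. x < t \<and> t < y \<longrightarrow> circle_mean F t \<le> (A + n) * t + K \<and>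
        (\<forall>s. x < s \<and> s < y \<longrightarrow> circle_mean F t = circle_mean F s + A * (t - s)) \<and>
        n * (t - x) \<le> nevanlinna_N (exp t) f \<and>
        circle_mean F t + nevanlinna_N (exp t) f - K \<le> nevanlinna_T (exp t) f)"

text \<open>Jensen's formula for \<open>f - a\<close> on the circles \<open>\<bar>z\<bar> = e\<^sup>t\<close> of an annulus without poles and
  \<open>a\<close>-points: \<open>A\<close> is the number of \<open>a\<close>-points minus the number of poles enclosed, \<open>n\<close> the number
  of poles enclosed.\<close>

lemma jensen_strip:
  obtains K where "K \<ge> 0"
    "\<And>x y. \<lbrakk>0 \<le> x; x < y; \<And>z. exp x < cmod z \<Longrightarrow> cmod z < exp y \<Longrightarrow> \<not> is_pole f z \<and> f z \<noteq> a\<rbrakk> \<Longrightarrow>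
      \<exists>F A n. jensen_data a K x y F A n"
proof -
  define g where "g = (\<lambda>z. f z - a)"
  define ord where "ord = zorder g"
  define c0 where "c0 = zor_poly g 0 0"
  have gmero: "g meromorphic_on UNIV" unfolding g_def by (intro meromorphic_intros mero)
  have gfreq: "\<exists>\<^sub>F w in at z. g w \<noteq> 0" for z using frequently_ne[of a z] by (simp add: g_def)
  have c0: "c0 \<noteq> 0"
    unfolding c0_def using zorder_exist[of g 0] gfreq gmero meromorphic_at_iff meromorphic_on_subset by blast
  define W where "W = {w. cmod w \<le> 1 \<and> (is_pole f w \<or> f w = a)}"
  have finW: "finite W" unfolding W_def by (rule finite_special)
  \<comment> \<open>K does not depend on the annulus. It collects the leading coefficient of g at 0,
    the zeros and poles in the closed unit disc, where log |w| may have the wrong sign, and the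
    additive loss in log |f - a| \<le> log^+ |f| + log (1 + |a|).\<close>
  define K where "K = \<bar>ln (cmod c0)\<bar> + (\<Sum>w\<in>W. \<bar>real_of_int (ord w) * ln (cmod w)\<bar>) + ln (1 + cmod a)"
  have K1: "ln (1 + cmod a) \<le> K" "ln (1 + cmod a) \<ge> 0" by (auto simp: K_def sum_nonneg)
  have K0: "K \<ge> 0" using K1 by linarith
  have ord_pole: "ord w = - int (pole_mult f w)" if "is_pole f w" for w
    unfolding ord_def g_def by (rule zorder_diff_pole[OF that])
  have ord_nonpole: "ord w \<ge> 0" if "\<not> is_pole f w" for w
    unfolding ord_def g_def by (rule zorder_diff_nonpole[OF that])
  show ?thesis
  proof (rule that[OF K0])
    fix x y :: real
    assume x: "0 \<le> x" "x < y"
      and reg: "\<And>z. exp x < cmod z \<Longrightarrow> cmod z < exp y \<Longrightarrow> \<not> is_pole f z \<and> f z \<noteq> a"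
    \<comment> \<open>The point 0 is put into Z even if it is neither a pole nor an a-point. Its
      order is then 0, and the last clause of \<open>divisor_factorization\<close> gives G 0 in all
      cases.\<close>
    define Z where "Z = insert 0 {w. cmod w \<le> exp x \<and> (is_pole f w \<or> f w = a)}"
    have finZ: "finite Z" unfolding Z_def using finite_special[of "exp x" a] by simp
    have Zx: "cmod w \<le> exp x" if "w \<in> Z" for w using that by (auto simp: Z_def)
    have reg': "\<not> is_pole f z \<and> f z \<noteq> a" if z: "z \<in> ball 0 (exp y) - Z" for z
    proof (cases "exp x < cmod z")
      case True then show ?thesis using reg z by auto
    next
      case False then show ?thesis using z by (auto simp: Z_def)
    qed
    obtain G where G: "G holomorphic_on ball 0 (exp y)" "\<And>z. z \<in> ball 0 (exp y) \<Longrightarrow> z \<in> Z \<or> g z \<noteq> 0 \<Longrightarrow> G z \<noteq> 0"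
      "\<And>z. z \<in> ball 0 (exp y) - Z \<Longrightarrow> g z = G z * (\<Prod>w\<in>Z. (z - w) powi (ord w))"
      "\<And>z. z \<in> ball 0 (exp y) \<inter> Z \<Longrightarrow> G z = zor_poly g z z * (\<Prod>w\<in>Z - {z}. (z - w) powi (- ord w))"
      unfolding ord_def
    proof (rule divisor_factorization[OF gmero gfreq finZ, of "ball 0 (exp y)"])
      show "g analytic_on {z}" if "z \<in> ball 0 (exp y) - Z" for z
        using analytic_at_nonpole reg'[OF that] unfolding g_def by (auto intro!: analytic_intros)
    qed auto
    have Gnz: "G z \<noteq> 0" if "z \<in> ball 0 (exp y)" for z
      using G(2)[OF that] reg'[of z] that by (auto simp: g_def)
    obtain H where H: "H holomorphic_on ball 0 (exp y)" "\<And>z. z \<in> ball 0 (exp y) \<Longrightarrow> exp (H z) = G z"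
      by (rule holomorphic_logarithm_exists[OF convex_ball open_ball G(1) Gnz, of 0]) auto
    define A where "A = (\<Sum>w\<in>Z. real_of_int (ord w))"
    define n where "n = (\<Sum>p | cmod p \<le> exp x \<and> is_pole f p. real (pole_mult f p))"
    \<comment> \<open>With z = exp \<zeta> this is a logarithm of z^A G(z) times the product of the
      (1 - w/z)^(ord w). Since |w| < |z|, the last logarithms may be principal values, and their
      circular means vanish.\<close>
    define F where "F = (\<lambda>\<zeta>. of_real A * \<zeta> + H (exp \<zeta>) + (\<Sum>w\<in>Z. of_int (ord w) * Ln (1 - w * exp (- \<zeta>))))"
    have n0: "n \<ge> 0" unfolding n_def by (intro sum_nonneg) auto
    have small: "cmod (w * exp (- \<zeta>)) < 1" if "w \<in> Z" "x < Re \<zeta>" for w \<zeta>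
    proof -
      have "cmod w < exp (Re \<zeta>)" using Zx[OF that(1)] that(2) by (smt (verit) exp_less_mono)
      then show ?thesis by (simp add: norm_mult norm_divide exp_minus field_simps)
    qed
    have Re1: "Re (1 - v) > 0" if "cmod v < 1" for v :: complex
      using complex_Re_le_cmod[of v] that by simp
    have inball: "exp \<zeta> \<in> ball 0 (exp y)" if "Re \<zeta> < y" for \<zeta> using that by simp
    have expF: "exp (F \<zeta>) = f (exp \<zeta>) - a" if \<zeta>: "x < Re \<zeta>" "Re \<zeta> < y" for \<zeta>
    proof -
      have nz: "1 - w * exp (- \<zeta>) \<noteq> 0" if "w \<in> Z" for w using small[OF that \<zeta>(1)] by auto
      have "exp \<zeta> \<notin> Z" using Zx[of "exp \<zeta>"] \<zeta> by auto
      then have "f (exp \<zeta>) - a = G (exp \<zeta>) * (\<Prod>w\<in>Z. (exp \<zeta> - w) powi (ord w))"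
        using G(3)[of "exp \<zeta>"] inball[OF \<zeta>(2)] by (simp add: g_def)
      also have "(\<Prod>w\<in>Z. (exp \<zeta> - w) powi (ord w)) = (\<Prod>w\<in>Z. exp (of_int (ord w) * \<zeta> + of_int (ord w) * Ln (1 - w * exp (- \<zeta>))))"
      proof (rule prod.cong[OF refl])
        fix w assume w: "w \<in> Z"
        have "exp \<zeta> - w = exp (\<zeta> + Ln (1 - w * exp (- \<zeta>)))"
          using nz[OF w] by (simp add: exp_add right_diff_distrib exp_minus)
        then show "(exp \<zeta> - w) powi (ord w) = exp (of_int (ord w) * \<zeta> + of_int (ord w) * Ln (1 - w * exp (- \<zeta>)))"
          by (simp only: exp_power_int distrib_left)
      qed
      also have "\<dots> = exp (of_real A * \<zeta> + (\<Sum>w\<in>Z. of_int (ord w) * Ln (1 - w * exp (- \<zeta>))))"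
        using finZ by (simp add: exp_sum[symmetric] sum.distrib A_def sum_distrib_right)
      also have "G (exp \<zeta>) = exp (H (exp \<zeta>))" using H(2) inball[OF \<zeta>(2)] by simp
      finally show ?thesis unfolding F_def exp_add by (simp add: mult_ac)
    qed
    have hF: "F holomorphic_on {\<zeta>. x < Re \<zeta> \<and> Re \<zeta> < y}"
    proof -
      have "(\<lambda>\<zeta>. H (exp \<zeta>)) holomorphic_on {\<zeta>. x < Re \<zeta> \<and> Re \<zeta> < y}"
        using holomorphic_on_compose_gen[OF holomorphic_on_exp H(1), of "{\<zeta>. x < Re \<zeta> \<and> Re \<zeta> < y}"]
        by (force simp: o_def)
      then show ?thesis unfolding F_def
        using Re1[OF small] by (intro holomorphic_intros) (auto simp: complex_nonpos_Reals_iff, force)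
    qed
    have expper: "exp (Complex t (\<theta> + 2 * pi)) = exp (Complex t \<theta>)" for t \<theta>
      by (simp add: exp_eq_polar flip: cis_mult)
    have expper': "exp (- Complex t (\<theta> + 2 * pi)) = exp (- Complex t \<theta>)" for t \<theta>
      by (simp only: exp_minus expper)
    have strip: "log_strip F x y"
      by standard (use hF in \<open>auto simp: F_def expper expper'\<close>)
    have mean: "circle_mean F t = A * t + Re (H 0)" if t: "x < t" "t < y" for t
    proof -
      have "((\<lambda>\<theta>. A * t) has_integral (A * t * (2 * pi))) {0..2 * pi}"
        using has_integral_const_real[of "A * t" 0 "2 * pi"] by (simp add: mult.commute)
      moreover have "((\<lambda>\<theta>. Re (H (exp (Complex t \<theta>)))) has_integral (2 * pi * Re (H 0))) {0..2 * pi}"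
        by (rule circle_mean_exp[OF H(1)]) (use t in auto)
      moreover have "((\<lambda>\<theta>. \<Sum>w\<in>Z. real_of_int (ord w) * Re (Ln (1 - w * exp (- Complex t \<theta>)))) has_integral (\<Sum>w\<in>Z. real_of_int (ord w) * 0)) {0..2 * pi}"
      proof (intro has_integral_sum finZ has_integral_mult_right circle_mean_log_factor)
        fix w assume "w \<in> Z" then show "cmod w < exp t" using Zx[of w] t by (smt (verit) exp_less_mono)
      qed
      ultimately have "((\<lambda>\<theta>. A * t + Re (H (exp (Complex t \<theta>))) + (\<Sum>w\<in>Z. real_of_int (ord w) * Re (Ln (1 - w * exp (- Complex t \<theta>)))))
          has_integral (A * t * (2 * pi) + 2 * pi * Re (H 0) + (\<Sum>w\<in>Z. real_of_int (ord w) * 0))) {0..2 * pi}"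
        by (intro has_integral_add)
      then have "((\<lambda>\<theta>. Re (F (Complex t \<theta>))) has_integral (A * t * (2 * pi) + 2 * pi * Re (H 0))) {0..2 * pi}"
        by (simp add: F_def)
      then show ?thesis unfolding circle_mean_def by (simp add: integral_unique field_simps)
    qed
    \<comment> \<open>Re (H 0) = log |G 0|. The nonzero poles contribute at most n x, the a-points
      outside the unit disc at most 0, and all other terms have been put into K.\<close>
    have H0: "Re (H 0) \<le> n * x + (K - ln (1 + cmod a))"
    proof -
      have "exp (Re (H 0)) = cmod (G 0)" using H(2)[of 0] by (metis norm_exp_eq_Re centre_in_ball exp_gt_zero)
      also have "G 0 = c0 * (\<Prod>w\<in>Z - {0}. (- w) powi (- ord w))"
        using G(4)[of 0] by (simp add: Z_def c0_def)
      finally have "exp (Re (H 0)) = cmod c0 * (\<Prod>w\<in>Z - {0}. cmod w powi (- ord w))"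
        by (simp add: norm_mult norm_power_int flip: prod_norm)
      also have "\<dots> = cmod c0 * (\<Prod>w\<in>Z - {0}. exp (- real_of_int (ord w) * ln (cmod w)))"
      proof (intro arg_cong2[where f = "(*)"] refl prod.cong)
        fix w assume "w \<in> Z - {0}"
        then have "cmod w powi (- ord w) = exp (ln (cmod w)) powi (- ord w)" by simp
        also have "\<dots> = exp (of_int (- ord w) * ln (cmod w))" by (rule exp_power_int)
        finally show "cmod w powi (- ord w) = exp (- real_of_int (ord w) * ln (cmod w))" by simp
      qed
      also have "\<dots> = exp (ln (cmod c0) + (\<Sum>w\<in>Z - {0}. - real_of_int (ord w) * ln (cmod w)))"
        using c0 finZ by (simp add: exp_add exp_sum)
      finally have "Re (H 0) = ln (cmod c0) + (\<Sum>w\<in>Z - {0}. - real_of_int (ord w) * ln (cmod w))"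
        by (simp only: exp_inj_iff)
      also have "(\<Sum>w\<in>Z - {0}. - real_of_int (ord w) * ln (cmod w))
        \<le> (\<Sum>w\<in>Z - {0}. (if is_pole f w then real (pole_mult f w) * x else 0) + (if w \<in> W then \<bar>real_of_int (ord w) * ln (cmod w)\<bar> else 0))"
      proof (rule sum_mono)
        fix w assume w: "w \<in> Z - {0}"
        then have w0: "cmod w > 0" by simp
        show "- real_of_int (ord w) * ln (cmod w)
          \<le> (if is_pole f w then real (pole_mult f w) * x else 0) + (if w \<in> W then \<bar>real_of_int (ord w) * ln (cmod w)\<bar> else 0)"
        proof (cases "is_pole f w")
          case True
          have "ln (cmod w) \<le> ln (exp x)" using Zx[of w] w w0 by (subst ln_le_cancel_iff) auto
          then have "real (pole_mult f w) * ln (cmod w) \<le> real (pole_mult f w) * x" by (intro mult_left_mono) auto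
          then show ?thesis using True ord_pole[OF True] by auto
        next
          case False
          show ?thesis
          proof (cases "cmod w \<le> 1")
            case True
            then have "w \<in> W" using w False by (auto simp: W_def Z_def)
            then show ?thesis using False by auto
          next
            case False2: False
            then have "0 \<le> real_of_int (ord w) * ln (cmod w)" using ord_nonpole[OF False] by simp
            then show ?thesis using False by auto
          qed
        qed
      qed
      also have "\<dots> = (\<Sum>w\<in>Z - {0}. if is_pole f w then real (pole_mult f w) * x else 0) + (\<Sum>w\<in>Z - {0}. if w \<in> W then \<bar>real_of_int (ord w) * ln (cmod w)\<bar> else 0)"
        by (rule sum.distrib)
      also have "(\<Sum>w\<in>Z - {0}. if is_pole f w then real (pole_mult f w) * x else 0) \<le> n * x"
      proof -
        have "(\<Sum>w\<in>Z - {0}. if is_pole f w then real (pole_mult f w) * x else 0) = (\<Sum>w\<in>{w\<in>Z - {0}. is_pole f w}. real (pole_mult f w) * x)"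
          using finZ by (intro sum.mono_neutral_cong_right) auto
        also have "\<dots> \<le> (\<Sum>p | cmod p \<le> exp x \<and> is_pole f p. real (pole_mult f p) * x)"
          using x finite_poles Zx by (intro sum_mono2) auto
        finally show ?thesis by (simp add: n_def sum_distrib_right)
      qed
      also have "(\<Sum>w\<in>Z - {0}. if w \<in> W then \<bar>real_of_int (ord w) * ln (cmod w)\<bar> else 0) \<le> (\<Sum>w\<in>W. \<bar>real_of_int (ord w) * ln (cmod w)\<bar>)"
      proof -
        have "(\<Sum>w\<in>Z - {0}. if w \<in> W then \<bar>real_of_int (ord w) * ln (cmod w)\<bar> else 0) = (\<Sum>w\<in>{w\<in>Z - {0}. w \<in> W}. \<bar>real_of_int (ord w) * ln (cmod w)\<bar>)"
          using finZ by (intro sum.mono_neutral_cong_right) auto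
        also have "\<dots> \<le> (\<Sum>w\<in>W. \<bar>real_of_int (ord w) * ln (cmod w)\<bar>)"
          using finW by (intro sum_mono2) auto
        finally show ?thesis .
      qed
      finally show ?thesis unfolding K_def by linarith
    qed
    have "circle_mean F t \<le> (A + n) * t + K \<and>
        (\<forall>s. x < s \<and> s < y \<longrightarrow> circle_mean F t = circle_mean F s + A * (t - s)) \<and>
        n * (t - x) \<le> nevanlinna_N (exp t) f \<and>
        circle_mean F t + nevanlinna_N (exp t) f - K \<le> nevanlinna_T (exp t) f" if t: "x < t" "t < y" for t
    proof (intro conjI allI impI)
      have "n * x \<le> n * t" using n0 t by (intro mult_left_mono) auto
      then show "circle_mean F t \<le> (A + n) * t + K"
        using mean[OF t] H0 K1 unfolding distrib_right by linarith
      show "circle_mean F t = circle_mean F s + A * (t - s)" if "x < s \<and> s < y" for s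
        using mean[OF t] mean[of s] that by (simp add: algebra_simps)
      show "n * (t - x) \<le> nevanlinna_N (exp t) f"
        unfolding n_def by (rule nevanlinna_N_ge) (use x t in auto)
      \<comment> \<open>Averaging this pointwise bound over the circle compares the mean of log |f -
        a| with m(e^t, f).\<close>
      have Fle: "Re (F (Complex t \<theta>)) - ln (1 + cmod a) \<le> ln (max 1 (cmod (f (of_real (exp t) * cis \<theta>))))" for \<theta>
      proof -
        let ?v = "f (of_real (exp t) * cis \<theta>)"
        have "exp (Re (F (Complex t \<theta>))) = cmod (?v - a)"
          using expF[of "Complex t \<theta>"] t by (metis complex.sel(1) exp_eq_polar complex.sel(2) norm_exp_eq_Re)
        also have "\<dots> \<le> cmod ?v + cmod a" by (rule norm_triangle_ineq4)
        also have "\<dots> \<le> max 1 (cmod ?v) * (1 + cmod a)"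
        proof -
          have "1 * cmod a \<le> max 1 (cmod ?v) * cmod a" by (intro mult_right_mono) auto
          moreover have "cmod ?v \<le> max 1 (cmod ?v)" by simp
          ultimately show ?thesis by (simp only: distrib_left mult_1_right)
        qed
        finally have "exp (Re (F (Complex t \<theta>))) \<le> max 1 (cmod ?v) * (1 + cmod a)" .
        then have "Re (F (Complex t \<theta>)) \<le> ln (max 1 (cmod ?v) * (1 + cmod a))"
          by (subst ln_ge_iff) (auto intro!: mult_pos_pos simp: add_pos_nonneg less_max_iff_disj)
        also have "\<dots> = ln (max 1 (cmod ?v)) + ln (1 + cmod a)"
          by (rule ln_mult_pos) (auto simp: add_pos_nonneg less_max_iff_disj)
        finally show ?thesis by simp
      qed
      have c1: "continuous_on {0..2 * pi} (\<lambda>\<theta>. Re (F (Complex t \<theta>)))"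
        by (rule log_strip.continuous_circle[OF strip t])
      have c2: "continuous_on {0..2 * pi} (\<lambda>\<theta>. ln (max 1 (cmod (f (of_real (exp t) * cis \<theta>)))))"
        using reg t by (intro continuous_log_plus) auto
      have "integral {0..2 * pi} (\<lambda>\<theta>. Re (F (Complex t \<theta>)) - ln (1 + cmod a))
        \<le> integral {0..2 * pi} (\<lambda>\<theta>. ln (max 1 (cmod (f (of_real (exp t) * cis \<theta>)))))"
        by (intro integral_le integrable_continuous_real continuous_on_diff c1 c2 continuous_on_const Fle)
      also have "integral {0..2 * pi} (\<lambda>\<theta>. Re (F (Complex t \<theta>)) - ln (1 + cmod a))
         = integral {0..2 * pi} (\<lambda>\<theta>. Re (F (Complex t \<theta>))) - 2 * pi * ln (1 + cmod a)"
        using integrable_continuous_real[OF c1] by (subst integral_diff) auto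
      finally have "circle_mean F t - ln (1 + cmod a) \<le> nevanlinna_m (exp t) f"
        unfolding circle_mean_def nevanlinna_m_def
        by (drule_tac divide_right_mono[where c = "2 * pi"]) (simp_all add: diff_divide_distrib)
      then show "circle_mean F t + nevanlinna_N (exp t) f - K \<le> nevanlinna_T (exp t) f"
        using K1 unfolding nevanlinna_T_def by linarith
    qed
    then have "jensen_data a K x y F A n" unfolding jensen_data_def using strip expF n0 by blast
    then show "\<exists>F A n. jensen_data a K x y F A n" by blast
  qed
qed

end

section \<open>The covering step\<close>

definition covering_const :: "real \<Rightarrow> bool" where
  "covering_const \<Lambda> \<longleftrightarrow> \<Lambda> > 0 \<and> (\<forall>F z l w. F holomorphic_on ball z l \<longrightarrow> l > 0 \<longrightarrow> cmod (deriv F z) * l \<ge> \<Lambda> \<longrightarrow>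
        cmod w = exp (Re (F z)) \<longrightarrow> w \<in> (\<lambda>\<zeta>. exp (F \<zeta>)) ` ball z l)"

lemma covering_const_exists: "\<exists>\<Lambda>. covering_const \<Lambda>"
  unfolding covering_const_def using exp_covers_circle by metis

context log_strip
begin

lemma circle_max_convex: "convex_on {x<..<y} (circle_max F)"
proof (rule convex_onI)
  fix u t1 t2 :: real assume u: "0 < u" "u < 1" and t: "t1 \<in> {x<..<y}" "t2 \<in> {x<..<y}"
  have key: "circle_max F ((1 - u) * t1 + u * t2) \<le> (1 - u) * circle_max F t1 + u * circle_max F t2"
    if "t1 < t2" "x < t1" "t2 < y" "0 < u" "u < 1" for t1 t2 u
  proof -
    have e: "(1 - u) * t1 + u * t2 - t1 = u * (t2 - t1)" by (simp add: algebra_simps)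
    have "u * (t2 - t1) > 0" "(1 - u) * (t2 - t1) > 0" using that by auto
    then have "t1 < (1 - u) * t1 + u * t2" "(1 - u) * t1 + u * t2 < t2" by (auto simp: algebra_simps)
    from circle_max_line[OF that(2) this that(3)]
    have "circle_max F ((1 - u) * t1 + u * t2) \<le> circle_max F t1 + (circle_max F t2 - circle_max F t1) / (t2 - t1) * (u * (t2 - t1))"
      unfolding e .
    also have "\<dots> = (1 - u) * circle_max F t1 + u * circle_max F t2" using that by (simp add: field_simps)
    finally show ?thesis .
  qed
  consider "t1 < t2" | "t1 = t2" | "t2 < t1" by linarith
  then show "circle_max F ((1 - u) *\<^sub>R t1 + u *\<^sub>R t2) \<le> (1 - u) * circle_max F t1 + u * circle_max F t2"
  proof cases
    case 1 then show ?thesis using key[of t1 t2 u] t u by simp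
  next
    case 2 then show ?thesis by (simp add: algebra_simps)
  next
    case 3 then show ?thesis using key[of t2 t1 "1 - u"] t u by (simp add: add.commute)
  qed
qed simp

lemma circle_max_continuous: "continuous_on {x<..<y} (circle_max F)"
  using convex_on_continuous[OF _ circle_max_convex] by simp

text \<open>Secant quotients of a convex function, taken outward from s, grow with the distance from
  s.\<close>

lemma circle_max_extrapolate:
  assumes "x < s" "s < y" "x < t" "t < y" "x < r" "r < y"
    and "(s < t \<and> t \<le> r) \<or> (r \<le> t \<and> t < s)"
  shows "(circle_max F t - circle_max F s) / \<bar>t - s\<bar> * \<bar>r - s\<bar> \<le> circle_max F r - circle_max F s"
proof (cases "r = t")
  case False
  show ?thesis
  proof (cases "s < t")
    case True
    then have r: "t < r" using assms False by auto
    have "circle_max F t \<le> circle_max F s + (circle_max F r - circle_max F s) / (r - s) * (t - s)"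
      using True r assms by (intro circle_max_line) auto
    then have "circle_max F t - circle_max F s \<le> (circle_max F r - circle_max F s) * ((t - s) / (r - s))" by simp
    then have "(circle_max F t - circle_max F s) * (r - s) \<le> (circle_max F r - circle_max F s) * (t - s)"
      using True r by (simp add: pos_le_divide_eq mult.commute)
    then show ?thesis using True r by (simp add: pos_divide_le_eq)
  next
    case False
    then have r: "r < t" "t < s" using assms \<open>r \<noteq> t\<close> by auto
    have "circle_max F t \<le> circle_max F r + (circle_max F s - circle_max F r) / (s - r) * (t - r)"
      using r assms by (intro circle_max_line) auto
    also have "\<dots> = circle_max F s + (circle_max F r - circle_max F s) * ((s - t) / (s - r))"
      using r by (simp add: field_simps)
    finally have "circle_max F t - circle_max F s \<le> (circle_max F r - circle_max F s) * ((s - t) / (s - r))" by simp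
    then have "(circle_max F t - circle_max F s) * (s - r) \<le> (circle_max F r - circle_max F s) * (s - t)"
      using r by (simp add: pos_le_divide_eq mult.commute)
    then show ?thesis using r by (simp add: pos_divide_le_eq)
  qed
qed (use assms in auto)

text \<open>By continuity, every level between the two end values is the value of
  \<open>circle_max F\<close> at some t between u and v, and \<open>covers_circle\<close> applies at
  this t with the same base point s.\<close>

lemma covers_annulus:
  assumes \<Lambda>: "covering_const \<Lambda>" and s: "x < s" "s < y"
    and I: "x + 1 \<le> u" "u \<le> v" "v \<le> y - 1" "s < u \<or> v < s"
    and slope: "\<And>t. u \<le> t \<Longrightarrow> t \<le> v \<Longrightarrow> \<Lambda> * \<bar>t - s\<bar> \<le> circle_max F t - circle_max F s"
    and w: "w \<noteq> 0" "min (circle_max F u) (circle_max F v) \<le> ln (cmod w)" "ln (cmod w) \<le> max (circle_max F u) (circle_max F v)"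
  shows "w \<in> (\<lambda>\<zeta>. exp (F \<zeta>)) ` {\<zeta>. x < Re \<zeta> \<and> Re \<zeta> < y}"
proof -
  have cont: "continuous_on {u..v} (circle_max F)"
    by (rule continuous_on_subset[OF circle_max_continuous]) (use I in auto)
  obtain t where t: "u \<le> t" "t \<le> v" "circle_max F t = ln (cmod w)"
  proof (cases "circle_max F u \<le> circle_max F v")
    case True
    then show ?thesis using IVT'[of "circle_max F" u "ln (cmod w)" v] w I cont that by auto
  next
    case False
    then show ?thesis using IVT2'[of "circle_max F" v "ln (cmod w)" u] w I cont that by auto
  qed
  show ?thesis
  proof (rule covers_circle[where \<Lambda> = \<Lambda> and t = t and s = s])
    show "cmod w = exp (circle_max F t)" using t w by simp
    show "\<Lambda> * \<bar>t - s\<bar> \<le> circle_max F t - circle_max F s" using slope t by blast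
  qed (use \<Lambda> t s I in \<open>auto simp: covering_const_def\<close>)
qed

text \<open>Let \<open>L = q\<^sup>4\<close> be the width of the strip. Either \<open>circle_max F\<close> has a large slope near \<open>t1\<close>, and
  then convexity alone gives a wide image, or \<open>circle_max F\<close> is nearly constant there; in this case
  Harnack's inequality bounds the oscillation of \<open>Re F\<close>, the growth hypothesis \<open>H\<close> bounds \<open>N\<close> and hence the
  number \<open>n\<close> of poles, and Jensen's formula bounds the slope \<open>A\<close> of the circular means from below.\<close>

lemma step_strip:
  fixes A n K c \<gamma> \<Lambda> Q q t1 :: real and N :: "real \<Rightarrow> real"
  defines "s \<equiv> 2 * pi + \<gamma> + 1"
  defines "\<kappa>1 \<equiv> 40 * pi + 20 * \<gamma> + 3 + 2 * c"
  defines "\<kappa>2 \<equiv> 40 * pi + 1 + \<kappa>1"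
  assumes \<Lambda>: "covering_const \<Lambda>"
    and c: "c > 0" and \<gamma>: "\<gamma> \<ge> 0" and K: "K \<ge> 0" and n: "n \<ge> 0"
    and Q: "Q \<ge> K" "Q \<ge> 4 * \<Lambda>" "Q \<ge> 1"
    and q: "q \<ge> 1 + \<gamma> + 2 * c + 400 * s + 2 * \<kappa>2"
    and L: "y = x + q ^ 4" "q ^ 4 \<le> x"
    and t1: "x + q ^ 3 \<le> t1" "t1 \<le> x + q ^ 3 + \<gamma>"
    and J1: "circle_mean F t1 \<le> (A + n) * t1 + K"
    and J2: "\<And>t. x < t \<Longrightarrow> t < y \<Longrightarrow> circle_mean F t = circle_mean F t1 + A * (t - t1)"
    and J3: "n * (t1 - x) \<le> N t1"
    and H: "(1 - c / t1) * (circle_mean F t1 + N t1 - K) \<le> max (circle_max F (t1 + \<gamma>)) 0 + K"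
    and G: "circle_max F t1 \<ge> Q * t1"
  obtains x1 y1 where "x1 \<ge> Q * x" "y1 - x1 \<ge> (1 - (\<kappa>2 + 4 + 40 * pi + 1600 * s) / q) * (q ^ 4 / x) * x1"
    "\<And>w. w \<noteq> 0 \<Longrightarrow> x1 \<le> ln (cmod w) \<Longrightarrow> ln (cmod w) \<le> y1 \<Longrightarrow> w \<in> (\<lambda>\<zeta>. exp (F \<zeta>)) ` {\<zeta>. x < Re \<zeta> \<and> Re \<zeta> < y}"
proof -
  let ?\<phi> = "circle_max F"
  define \<phi>1 where "\<phi>1 = ?\<phi> t1"
  \<comment> \<open>The slope of the chord from the origin to (t1, \<phi>1). In the first case
    below, the maximum grows beyond t1 with slope nearly \<beta>, and this reproduces the relative
    width (y - x) / x.\<close>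
  define \<beta> where "\<beta> = \<phi>1 / t1"
  \<comment> \<open>Slopes beyond \<sigma> count as large. The factor 10 q makes the value at t at
    most \<sigma>' x / (2 q) in the second case, while the way to the edge adds \<sigma>' q^3 / 2;
    the quotient is q^4 / x, without any loss.\<close>
  define \<sigma> where "\<sigma> = 10 * q * \<beta>"
  \<comment> \<open>The window has to absorb the Harnack error 4 \<pi> \<sigma>: with 80 q s one has
    \<beta> S / 4 \<ge> 4 \<pi> \<sigma>. It stays below q^2 / 5 because q \<ge> 400 s.\<close>
  define S where "S = 80 * q * s"
  have pi3: "pi > 3" by (rule pi_gt3)
  have s7: "s \<ge> 7" "2 * pi \<le> s" "\<gamma> \<le> s" using pi3 \<gamma> by (auto simp: s_def)
  have \<kappa>: "\<kappa>1 > 0" "\<kappa>2 > 0" using pi3 \<gamma> c by (auto simp: \<kappa>1_def \<kappa>2_def)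
  have q1: "q \<ge> 1" "q \<ge> \<gamma> + 1" "q \<ge> 2 * c" "q \<ge> 400 * s" "q \<ge> 2 * \<kappa>2" "q \<ge> 2800"
    using q c \<gamma> \<kappa> s7 by linarith+
  have q0: "q > 0" using q1 by simp
  have qq: "q \<le> q\<^sup>2" "q\<^sup>2 \<le> q ^ 3" "q ^ 3 \<le> q ^ 4" "1 \<le> q\<^sup>2"
    using q1 power_increasing[of 1 2 q] power_increasing[of 2 3 q] power_increasing[of 3 4 q] by (auto simp: one_le_power)
  have q43: "q ^ 4 \<ge> 2800 * q ^ 3" "q ^ 3 \<ge> 2800 * q\<^sup>2" "q\<^sup>2 \<ge> 2800 * q"
    using q1 by (auto simp: power4_eq_xxxx power3_eq_cube power2_eq_square intro!: mult_right_mono)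
  have Sq: "S \<le> q\<^sup>2 / 5"
  proof -
    have "400 * s * q \<le> q * q" using q1 by (intro mult_right_mono) auto
    then show ?thesis by (simp add: S_def power2_eq_square mult_ac)
  qed
  have S0: "S > 0" "S \<ge> \<gamma>" "S \<ge> 2 * pi"
  proof -
    have "S \<ge> 1 * s" unfolding S_def using q1 s7 by (intro mult_right_mono) auto
    then show "S > 0" "S \<ge> \<gamma>" "S \<ge> 2 * pi" using s7 by linarith+
  qed
  have x0: "x > 0" "x \<ge> q ^ 4" using L q0 zero_less_power[of q 4] by linarith+
  have t10: "t1 > 0" "t1 \<ge> x" "t1 \<ge> q ^ 4" "t1 \<ge> 2 * c" "t1 \<le> 2 * x" using t1 x0 q1 qq q43 by linarith+
  have \<phi>1: "\<phi>1 \<ge> Q * t1" using G by (simp add: \<phi>1_def)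
  then have \<beta>: "\<beta> \<ge> Q" using t10 by (simp add: \<beta>_def pos_le_divide_eq)
  have \<phi>\<beta>: "\<phi>1 = \<beta> * t1" using t10 by (simp add: \<beta>_def)
  have \<beta>0: "\<beta> > 0" "\<beta> \<ge> K" "\<beta> \<ge> 4 * \<Lambda>" using \<beta> Q by auto
  have \<Lambda>0: "\<Lambda> > 0" using \<Lambda> by (simp add: covering_const_def)
  have \<phi>1Q: "\<phi>1 \<ge> Q * x"
  proof -
    have "Q * x \<le> Q * t1" using Q t10 by (intro mult_left_mono) auto
    then show ?thesis using \<phi>1 by linarith
  qed
  have \<sigma>0: "\<sigma> > 0" "\<sigma> \<ge> \<beta>" "\<sigma> \<ge> \<Lambda>"
  proof -
    have "1 * \<beta> \<le> 10 * q * \<beta>" using q1 \<beta>0 by (intro mult_right_mono) auto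
    then have "\<beta> \<le> \<sigma>" unfolding \<sigma>_def mult_1 .
    then show "\<sigma> > 0" "\<sigma> \<ge> \<beta>" "\<sigma> \<ge> \<Lambda>" using \<beta>0 \<Lambda>0 by linarith+
  qed
  have range: "x + 1 \<le> t1 - S" "t1 + S \<le> y - 1" "x < t1" "t1 < y"
    using L t1 Sq S0 q1 qq q43 by linarith+
  have Kge: "\<kappa>2 + 4 + 40 * pi + 1600 * s \<ge> 0" using \<kappa> s7 pi3 by simp
  show ?thesis
  proof (cases "\<forall>t. \<bar>t - t1\<bar> \<le> S \<longrightarrow> ?\<phi> t \<le> \<phi>1 + \<sigma> * \<bar>t - t1\<bar>")
    case True
    let ?I = "circle_mean F t1"
    have I1: "?I \<ge> \<phi>1 - 4 * pi * \<sigma>"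
    proof -
      have "?I \<ge> ?\<phi> t1 - 2 * (\<sigma> * (2 * pi))"
      proof (rule circle_mean_ge_max)
        show "x \<le> t1 - 2 * pi" "t1 + 2 * pi \<le> y" using range S0 by linarith+
        fix t assume t: "\<bar>t - t1\<bar> < 2 * pi"
        then have "?\<phi> t \<le> \<phi>1 + \<sigma> * \<bar>t - t1\<bar>" using True S0 by auto
        also have "\<dots> \<le> \<phi>1 + \<sigma> * (2 * pi)" using t \<sigma>0 by (intro add_left_mono mult_left_mono) auto
        finally show "?\<phi> t \<le> ?\<phi> t1 + \<sigma> * (2 * pi)" by (simp add: \<phi>1_def)
      qed
      then show ?thesis by (simp add: \<phi>1_def mult_ac)
    qed
    define R where "R = \<phi>1 + \<sigma> * \<gamma> + K"
    have \<phi>1pos: "\<phi>1 > 0" using \<phi>\<beta> \<beta>0 t10 by simp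
    have "?\<phi> (t1 + \<gamma>) \<le> \<phi>1 + \<sigma> * \<gamma>" using True[rule_format, of "t1 + \<gamma>"] S0 \<gamma> by simp
    moreover have "0 \<le> \<phi>1 + \<sigma> * \<gamma>" using \<gamma> \<sigma>0 \<phi>1pos mult_nonneg_nonneg[of \<sigma> \<gamma>] by linarith
    ultimately have "max (?\<phi> (t1 + \<gamma>)) 0 \<le> \<phi>1 + \<sigma> * \<gamma>" by simp
    then have HR: "(1 - c / t1) * (?I + N t1 - K) \<le> R" using H unfolding R_def by linarith
    have R0: "R \<ge> 0" using \<phi>1pos \<sigma>0 \<gamma> K by (simp add: R_def)
    define \<epsilon> where "\<epsilon> = c / t1"
    have \<epsilon>: "0 < \<epsilon>" "\<epsilon> \<le> 1 / 2" "c = \<epsilon> * t1" using c t10 by (auto simp: field_simps \<epsilon>_def)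
    \<comment> \<open>For \<epsilon> \<le> 1/2 the factor 1 - \<epsilon> is inverted at the price of
      1 + 2 \<epsilon>.\<close>
    have NR: "?I + N t1 - K \<le> (1 + 2 * \<epsilon>) * R"
    proof -
      have pos: "1 - \<epsilon> > 0" using \<epsilon> by linarith
      have "\<epsilon> * \<epsilon> \<le> \<epsilon> * (1 / 2)" using \<epsilon> by (intro mult_left_mono) auto
      then have "1 \<le> (1 - \<epsilon>) * (1 + 2 * \<epsilon>)" by (simp add: algebra_simps)
      from mult_right_mono[OF this R0]
      have "(1 - \<epsilon>) * (?I + N t1 - K) \<le> (1 - \<epsilon>) * ((1 + 2 * \<epsilon>) * R)"
        using HR by (simp add: mult.assoc \<epsilon>_def)
      then show ?thesis by (simp only: mult_le_cancel_left_pos[OF pos])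
    qed
    \<comment> \<open>The mean and the upper bound R differ by O(\<sigma>), so N has to fit into
      this gap. The term 2 \<epsilon> R adds only O(c \<beta>) to it, since \<epsilon> = c / t1 and
      \<phi>1 = \<beta> t1. This is where the form 1 - c / log r of the growth hypothesis
      enters.\<close>
    have "N t1 \<le> \<beta> * q * \<kappa>1"
    proof -
      have "2 * \<epsilon> * R = 2 * c * \<beta> + 2 * \<epsilon> * (\<sigma> * \<gamma> + K)" by (simp add: R_def \<phi>\<beta> \<epsilon>(3) algebra_simps)
      also have "\<dots> \<le> 2 * c * \<beta> + 1 * (\<sigma> * \<gamma> + K)"
        using \<epsilon> \<sigma>0 \<gamma> K by (intro add_left_mono mult_right_mono) auto
      finally have "N t1 \<le> 4 * pi * \<sigma> + 2 * \<sigma> * \<gamma> + 3 * K + 2 * c * \<beta>"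
        using NR I1 unfolding R_def by (simp add: distrib_right)
      also have "3 * K \<le> 3 * \<beta> * q" 
      proof -
        have "3 * \<beta> * 1 \<le> 3 * \<beta> * q" using q1 \<beta>0 by (intro mult_left_mono) auto
        then show ?thesis using \<beta>0 by linarith
      qed
      also have "2 * c * \<beta> \<le> 2 * c * \<beta> * q" using q1 \<beta>0 c by simp
      finally show ?thesis by (simp add: \<sigma>_def \<kappa>1_def algebra_simps)
    qed
    \<comment> \<open>The distance q^3 from the inner edge turns the bound O(\<beta> q) for N into n
      = O(\<beta> / q^2).\<close>
    moreover have "n * q ^ 3 \<le> n * (t1 - x)" using n t1 by (intro mult_left_mono) auto
    ultimately have "n * q ^ 3 \<le> \<beta> * q * \<kappa>1" using J3 by linarith
    then have n2: "n \<le> \<beta> * \<kappa>1 / q\<^sup>2"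
      using q0 by (simp add: pos_le_divide_eq power3_eq_cube power2_eq_square mult_ac)
    have A1: "A \<ge> \<beta> * (1 - \<kappa>2 / q\<^sup>2)"
    proof -
      have "A * t1 \<ge> \<phi>1 - 4 * pi * \<sigma> - K - n * t1" using I1 J1 by (simp add: algebra_simps)
      then have "A \<ge> (\<phi>1 - 4 * pi * \<sigma> - K - n * t1) / t1" using t10 by (simp add: pos_divide_le_eq)
      also have "(\<phi>1 - 4 * pi * \<sigma> - K - n * t1) / t1 = \<beta> - (4 * pi * \<sigma> + K) / t1 - n"
        using t10 by (simp add: \<beta>_def field_simps)
      finally have A0: "A \<ge> \<beta> - (4 * pi * \<sigma> + K) / t1 - n" .
      have "4 * pi * \<sigma> + K \<le> \<beta> * q * (40 * pi + 1)"
      proof -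
        have "\<beta> * 1 \<le> \<beta> * q" using q1 \<beta>0 by (intro mult_left_mono) auto
        moreover have "4 * pi * \<sigma> = \<beta> * q * (40 * pi)" by (simp add: \<sigma>_def)
        ultimately show ?thesis using \<beta>0 unfolding distrib_left mult_1_right by linarith
      qed
      also have "\<beta> * q * (40 * pi + 1) \<le> \<beta> * (40 * pi + 1) / q\<^sup>2 * t1"
      proof -
        have "\<beta> * (40 * pi + 1) / q\<^sup>2 * (q * q\<^sup>2) \<le> \<beta> * (40 * pi + 1) / q\<^sup>2 * t1"
        proof (intro mult_left_mono)
          have "q * q\<^sup>2 = q ^ 3" by (simp add: power3_eq_cube power2_eq_square)
          then show "q * q\<^sup>2 \<le> t1" using t10 qq by linarith
        qed (use \<beta>0 pi3 in auto)
        then show ?thesis using q0 by (simp add: mult_ac)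
      qed
      finally have "(4 * pi * \<sigma> + K) / t1 \<le> \<beta> * (40 * pi + 1) / q\<^sup>2" using t10 by (simp add: pos_divide_le_eq)
      then have "A \<ge> \<beta> - \<beta> * (40 * pi + 1) / q\<^sup>2 - \<beta> * \<kappa>1 / q\<^sup>2" using A0 n2 by linarith
      then show ?thesis by (simp add: \<kappa>2_def algebra_simps add_divide_distrib)
    qed
    have \<kappa>2q: "\<kappa>2 / q\<^sup>2 \<le> 1 / 2" "\<kappa>2 / q\<^sup>2 \<le> \<kappa>2 / q" "0 \<le> \<kappa>2 / q"
      using q1 qq \<kappa> q0 by (auto simp: divide_simps intro!: mult_left_mono)
    have A2: "A \<ge> \<beta> / 2" using A1 mult_left_mono[OF \<kappa>2q(1), of \<beta>] \<beta>0
      unfolding right_diff_distrib mult_1_right by linarith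
    \<comment> \<open>The maximum dominates the mean, which is affine with slope A.\<close>
    have lower: "?\<phi> t \<ge> \<phi>1 - 4 * pi * \<sigma> + A * (t - t1)" if "x < t" "t < y" for t
      using circle_mean_le[OF that le_circle_max[OF that]] J2[OF that] I1 by linarith
    define t2 where "t2 = t1 + S"
    define y' where "y' = y - 1"
    have t2: "t2 \<le> y'" "x < t2" "t2 < y" "y' < y" "x < y'" using range S0 by (auto simp: t2_def y'_def)
    have slope: "\<Lambda> * \<bar>t - t1\<bar> \<le> ?\<phi> t - ?\<phi> t1" if "t2 \<le> t" "t \<le> y'" for t
    proof -
      have "(A - \<Lambda>) * (t - t1) \<ge> (\<beta> / 4) * S"
        using A2 \<beta>0 \<Lambda>0 that S0 by (intro mult_mono) (auto simp: t2_def)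
      moreover have "(\<beta> / 4) * S \<ge> 4 * pi * \<sigma>"
      proof -
        have "\<beta> * q * (20 * (2 * pi)) \<le> \<beta> * q * (20 * s)" using s7 \<beta>0 q0 by (intro mult_left_mono) auto
        then show ?thesis by (simp add: S_def \<sigma>_def algebra_simps)
      qed
      moreover have "?\<phi> t \<ge> \<phi>1 - 4 * pi * \<sigma> + A * (t - t1)" using that t2 by (intro lower) auto
      ultimately have "\<Lambda> * (t - t1) \<le> ?\<phi> t - ?\<phi> t1" by (simp add: \<phi>1_def left_diff_distrib)
      then show ?thesis using that S0 by (simp add: t2_def)
    qed
    have p2: "?\<phi> t2 \<ge> \<phi>1"
    proof -
      have "0 \<le> \<Lambda> * \<bar>t2 - t1\<bar>" using \<Lambda>0 by simp
      then show ?thesis using slope[of t2] t2 by (simp add: \<phi>1_def)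
    qed
    have \<sigma>S: "\<sigma> * S \<le> \<beta> * (q ^ 3 * (800 * s / q))"
      using q0 by (simp add: \<sigma>_def S_def power3_eq_cube)
    have \<sigma>S2: "\<sigma> * S \<le> \<beta> * (q ^ 4 * (800 * s / q))"
    proof -
      have "\<beta> * (q ^ 3 * (800 * s / q)) \<le> \<beta> * (q ^ 4 * (800 * s / q))"
        using qq \<beta>0 s7 q0 by (intro mult_left_mono mult_right_mono) auto
      then show ?thesis using \<sigma>S by linarith
    qed
    have up2: "?\<phi> t2 \<le> \<beta> * x * (1 + (2 + 800 * s) / q)"
    proof -
      have "?\<phi> t2 \<le> \<phi>1 + \<sigma> * \<bar>t2 - t1\<bar>"
        using True[rule_format, of t2] S0 by (simp add: t2_def)
      then have "?\<phi> t2 \<le> \<beta> * t1 + \<beta> * (q ^ 4 * (800 * s / q))" using \<sigma>S2 S0 by (simp add: t2_def \<phi>\<beta>)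
      also have "\<beta> * (q ^ 4 * (800 * s / q)) \<le> \<beta> * (x * (800 * s / q))"
        using x0 \<beta>0 s7 q0 by (intro mult_left_mono mult_right_mono) auto
      also have "\<beta> * t1 \<le> \<beta> * (x + x * (2 / q))"
      proof (rule mult_left_mono)
        have "q ^ 4 * (2 / q) \<le> x * (2 / q)" using x0 q0 by (intro mult_right_mono) auto
        then have "2 * q ^ 3 \<le> x * (2 / q)" using q0 by (simp add: power4_eq_xxxx power3_eq_cube)
        then show "t1 \<le> x + x * (2 / q)" using t1 q1 qq by linarith
      qed (use \<beta>0 in auto)
      finally show ?thesis by (simp add: algebra_simps add_divide_distrib)
    qed
    have low2: "?\<phi> y' - ?\<phi> t2 \<ge> \<beta> * q ^ 4 * (1 - (\<kappa>2 + 2 + 40 * pi + 800 * s) / q)"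
    proof -
      have "?\<phi> t2 \<le> \<phi>1 + \<sigma> * \<bar>t2 - t1\<bar>"
        using True[rule_format, of t2] S0 by (simp add: t2_def)
      then have a: "?\<phi> t2 \<le> \<phi>1 + \<beta> * (q ^ 4 * (800 * s / q))" using \<sigma>S2 S0 by (simp add: t2_def)
      have b: "4 * pi * \<sigma> \<le> \<beta> * (q ^ 4 * (40 * pi / q))"
      proof -
        have "q * q \<le> q ^ 4" using qq by (simp add: power2_eq_square)
        then have "\<beta> * (q * q * (40 * pi / q)) \<le> \<beta> * (q ^ 4 * (40 * pi / q))"
          using \<beta>0 q0 by (intro mult_left_mono mult_right_mono) auto
        then show ?thesis using q0 by (simp add: \<sigma>_def mult_ac)
      qed
      have d: "A * (y' - t1) \<ge> \<beta> * (q ^ 4 * (1 - \<kappa>2 / q - 2 / q))"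
      proof -
        have "y' - t1 \<ge> q ^ 4 - 2 * q ^ 3" using t1 q1 qq L unfolding y'_def by linarith
        also have "q ^ 4 - 2 * q ^ 3 = q ^ 4 * (1 - 2 / q)" using q0 by (simp add: field_simps power4_eq_xxxx power3_eq_cube)
        finally have e: "y' - t1 \<ge> q ^ 4 * (1 - 2 / q)" .
        have f: "0 \<le> 1 - 2 / q" using q1 by simp
        have "A \<ge> \<beta> * (1 - \<kappa>2 / q)"
          using A1 mult_left_mono[OF \<kappa>2q(2), of \<beta>] \<beta>0 by (simp add: algebra_simps)
        then have "A * (y' - t1) \<ge> \<beta> * (1 - \<kappa>2 / q) * (q ^ 4 * (1 - 2 / q))"
          using e f q1 \<beta>0 A2 q0 by (intro mult_mono) auto
        moreover have prod1: "(1 - a) * (1 - b) \<ge> 1 - a - b" if "0 \<le> a" "0 \<le> b" for a b :: real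
          using mult_nonneg_nonneg[OF that] by (simp add: algebra_simps)
        have "(1 - \<kappa>2 / q) * (1 - 2 / q) \<ge> 1 - \<kappa>2 / q - 2 / q" using \<kappa>2q q0 by (intro prod1) auto
        then have "\<beta> * q ^ 4 * ((1 - \<kappa>2 / q) * (1 - 2 / q)) \<ge> \<beta> * q ^ 4 * (1 - \<kappa>2 / q - 2 / q)"
          using \<beta>0 q0 by (intro mult_left_mono) auto
        ultimately show ?thesis by (simp only: mult_ac)
      qed
      have "?\<phi> y' \<ge> \<phi>1 - 4 * pi * \<sigma> + A * (y' - t1)" by (rule lower) (use t2 in auto)
      then have "?\<phi> y' - ?\<phi> t2 \<ge> \<beta> * (q ^ 4 * (1 - \<kappa>2 / q - 2 / q)) - \<beta> * (q ^ 4 * (40 * pi / q)) - \<beta> * (q ^ 4 * (800 * s / q))"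
        using a b d by linarith
      also have "\<beta> * (q ^ 4 * (1 - \<kappa>2 / q - 2 / q)) - \<beta> * (q ^ 4 * (40 * pi / q)) - \<beta> * (q ^ 4 * (800 * s / q))
         = \<beta> * q ^ 4 * (1 - (\<kappa>2 + 2 + 40 * pi + 800 * s) / q)"
        by (simp add: algebra_simps add_divide_distrib)
      finally show ?thesis .
    qed
    show ?thesis
    proof (rule that[of "?\<phi> t2" "?\<phi> y'"])
      show "?\<phi> t2 \<ge> Q * x" using p2 \<phi>1Q by linarith
      define u where "u = (\<kappa>2 + 2 + 40 * pi + 800 * s) / q"
      define v where "v = (2 + 800 * s) / q"
      have uv: "u \<ge> 0" "v \<ge> 0" "(\<kappa>2 + 4 + 40 * pi + 1600 * s) / q = u + v"
        using \<kappa> s7 pi3 q0 by (auto simp: u_def v_def add_divide_distrib)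
      show "(1 - (\<kappa>2 + 4 + 40 * pi + 1600 * s) / q) * (q ^ 4 / x) * ?\<phi> t2 \<le> ?\<phi> y' - ?\<phi> t2"
      proof (cases "1 - (u + v) \<ge> 0")
        case True
        have "(1 - (u + v)) * (q ^ 4 / x) * ?\<phi> t2 \<le> (1 - (u + v)) * (q ^ 4 / x) * (\<beta> * x * (1 + v))"
          using up2 True x0 by (intro mult_left_mono) (auto simp: v_def)
        also have "\<dots> = \<beta> * q ^ 4 * ((1 - (u + v)) * (1 + v))" using x0 by simp
        also have "\<dots> \<le> \<beta> * q ^ 4 * (1 - u)"
          using uv \<beta>0 q0 by (intro mult_left_mono) (auto simp: algebra_simps)
        also have "\<dots> \<le> ?\<phi> y' - ?\<phi> t2" using low2 by (simp add: u_def)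
        finally show ?thesis unfolding uv(3) .
      next
        \<comment> \<open>If the total loss exceeds 1, the left side is nonpositive and it is enough
          that the image interval is not reversed.\<close>
        case False
        have "0 \<le> (q ^ 4 / x) * ?\<phi> t2" using x0 q0 p2 \<phi>1pos by (intro mult_nonneg_nonneg) auto
        then have "(1 - (u + v)) * ((q ^ 4 / x) * ?\<phi> t2) \<le> 0" using False by (intro mult_nonpos_nonneg) auto
        moreover have "?\<phi> t2 \<le> ?\<phi> y'"
        proof -
          have "(?\<phi> t2 - ?\<phi> t1) / \<bar>t2 - t1\<bar> * \<bar>y' - t1\<bar> \<le> ?\<phi> y' - ?\<phi> t1"
            by (rule circle_max_extrapolate) (use t2 range S0 in \<open>auto simp: t2_def\<close>)
          moreover have "(?\<phi> t2 - ?\<phi> t1) * 1 \<le> (?\<phi> t2 - ?\<phi> t1) * (\<bar>y' - t1\<bar> / \<bar>t2 - t1\<bar>)"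
            using p2 t2 S0 by (intro mult_left_mono) (auto simp: \<phi>1_def t2_def)
          ultimately show ?thesis by simp
        qed
        ultimately show ?thesis unfolding uv(3) by (simp only: mult.assoc)
      qed
      show "w \<in> (\<lambda>\<zeta>. exp (F \<zeta>)) ` {\<zeta>. x < Re \<zeta> \<and> Re \<zeta> < y}"
        if "w \<noteq> 0" "?\<phi> t2 \<le> ln (cmod w)" "ln (cmod w) \<le> ?\<phi> y'" for w
        by (rule covers_annulus[OF \<Lambda> range(3,4) _ t2(1) _ _ slope \<open>w \<noteq> 0\<close>])
          (use that range S0 in \<open>auto simp: t2_def y'_def\<close>)
    qed
  next
    case False
    \<comment> \<open>At t the maximum has risen with slope \<sigma>' > \<sigma>. By convexity this
      slope persists up to the edge e on the same side of t1, which lies at least q^3 / 2 beyond t;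
      on the left side this uses t1 \<ge> x + q^3.\<close>
    then obtain t where t: "\<bar>t - t1\<bar> \<le> S" "?\<phi> t > \<phi>1 + \<sigma> * \<bar>t - t1\<bar>" by (auto simp: not_le)
    have tt: "t \<noteq> t1" using t by (auto simp: \<phi>1_def)
    define \<sigma>' where "\<sigma>' = (?\<phi> t - ?\<phi> t1) / \<bar>t - t1\<bar>"
    have \<sigma>': "\<sigma>' > \<sigma>" using t tt by (simp add: \<sigma>'_def \<phi>1_def pos_less_divide_eq)
    have \<phi>t: "?\<phi> t = \<phi>1 + \<sigma>' * \<bar>t - t1\<bar>" using tt by (simp add: \<sigma>'_def \<phi>1_def)
    have txy: "x < t" "t < y" "x + 1 \<le> t" "t \<le> y - 1" using t range by auto
    define e where "e = (if t1 < t then y - 1 else x + 1)"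
    have exy: "x < e" "e < y" using range S0 by (auto simp: e_def)
    have slope: "\<sigma>' * \<bar>r - t1\<bar> \<le> ?\<phi> r - ?\<phi> t1" if "(t1 < t \<and> t \<le> r \<and> r < y) \<or> (t < t1 \<and> r \<le> t \<and> x < r)" for r
      unfolding \<sigma>'_def by (rule circle_max_extrapolate) (use that txy range in auto)
    have "\<sigma>' * \<bar>e - t1\<bar> \<le> ?\<phi> e - ?\<phi> t1" by (rule slope) (use tt txy exy in \<open>auto simp: e_def\<close>)
    moreover have "\<bar>e - t1\<bar> - \<bar>t - t1\<bar> \<ge> q ^ 3 / 2"
    proof (cases "t1 < t")
      case True
      then have "\<bar>t - t1\<bar> = t - t1" "\<bar>e - t1\<bar> = y - 1 - t1" using txy by (auto simp: e_def)
      then show ?thesis using t(1) t1 L q1 qq q43 Sq by linarith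
    next
      case False
      then have "\<bar>t - t1\<bar> = t1 - t" "\<bar>e - t1\<bar> = t1 - (x + 1)" using txy by (auto simp: e_def)
      then show ?thesis using t(1) t1 L q1 qq q43 Sq by linarith
    qed
    then have "\<sigma>' * (q ^ 3 / 2) \<le> \<sigma>' * (\<bar>e - t1\<bar> - \<bar>t - t1\<bar>)" using \<sigma>' \<sigma>0 by (intro mult_left_mono) auto
    ultimately have width: "?\<phi> e - ?\<phi> t \<ge> \<sigma>' * (q ^ 3 / 2)" using \<phi>t by (simp add: algebra_simps \<phi>1_def)
    have ub: "?\<phi> t \<le> \<sigma>' * (x / (2 * q))"
    proof -
      have "\<phi>1 = \<sigma> * (t1 / (10 * q))" using q0 by (simp add: \<sigma>_def \<phi>\<beta>)
      also have "\<dots> \<le> \<sigma>' * (2 * x / (10 * q))" using \<sigma>' \<sigma>0 t10 q0 by (intro mult_mono divide_right_mono) auto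
      finally have "?\<phi> t \<le> \<sigma>' * (2 * x / (10 * q)) + \<sigma>' * S"
        using \<phi>t mult_left_mono[OF t(1), of \<sigma>'] \<sigma>' \<sigma>0 by linarith
      also have "S \<le> x / (5 * q)"
      proof -
        have "S * (5 * q) \<le> q\<^sup>2 / 5 * (5 * q)" using Sq q0 by (intro mult_right_mono) auto
        also have "\<dots> = q ^ 3" by (simp add: power2_eq_square power3_eq_cube)
        also have "\<dots> \<le> x" using qq x0 by linarith
        finally show ?thesis using q0 by (simp add: pos_le_divide_eq)
      qed
      finally have "?\<phi> t \<le> \<sigma>' * (2 * x / (10 * q)) + \<sigma>' * (x / (5 * q))" using \<sigma>' \<sigma>0 by simp
      also have "\<dots> \<le> \<sigma>' * (x / (2 * q))" using \<sigma>' \<sigma>0 x0 q0 by (simp add: field_simps)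
      finally show ?thesis .
    qed
    have \<phi>tpos: "?\<phi> t \<ge> \<phi>1" using \<phi>t \<sigma>' \<sigma>0 by simp
    have \<phi>1pos: "\<phi>1 > 0" using \<phi>\<beta> \<beta>0 t10 by simp
    show ?thesis
    proof (rule that[of "?\<phi> t" "?\<phi> e"])
      show "?\<phi> t \<ge> Q * x" using \<phi>tpos \<phi>1Q by linarith
      have "(1 - (\<kappa>2 + 4 + 40 * pi + 1600 * s) / q) * ((q ^ 4 / x) * ?\<phi> t) \<le> 1 * ((q ^ 4 / x) * ?\<phi> t)"
        using Kge q0 x0 \<phi>tpos \<phi>1pos by (intro mult_right_mono mult_nonneg_nonneg) auto
      also have "\<dots> \<le> (q ^ 4 / x) * (\<sigma>' * (x / (2 * q)))" unfolding mult_1 using ub x0 by (intro mult_left_mono) auto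
      also have "\<dots> = \<sigma>' * (q ^ 3 / 2)" using x0 q0 by (simp add: power4_eq_xxxx power3_eq_cube)
      finally show "(1 - (\<kappa>2 + 4 + 40 * pi + 1600 * s) / q) * (q ^ 4 / x) * ?\<phi> t \<le> ?\<phi> e - ?\<phi> t"
        using width by (simp only: mult.assoc)
      have le: "?\<phi> t \<le> ?\<phi> e" 
      proof -
        have "0 \<le> \<sigma>' * (q ^ 3 / 2)" using \<sigma>' \<sigma>0 q0 by (intro mult_nonneg_nonneg) auto
        then show ?thesis using width by linarith
      qed
      show "w \<in> (\<lambda>\<zeta>. exp (F \<zeta>)) ` {\<zeta>. x < Re \<zeta> \<and> Re \<zeta> < y}"
        if w: "w \<noteq> 0" "?\<phi> t \<le> ln (cmod w)" "ln (cmod w) \<le> ?\<phi> e" for w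
      proof (rule covers_annulus[OF \<Lambda> range(3,4), where u = "min t e" and v = "max t e"])
        show "\<Lambda> * \<bar>r - t1\<bar> \<le> ?\<phi> r - ?\<phi> t1" if r: "min t e \<le> r" "r \<le> max t e" for r
        proof -
          have "\<Lambda> * \<bar>r - t1\<bar> \<le> \<sigma>' * \<bar>r - t1\<bar>" using \<sigma>' \<sigma>0 by (intro mult_right_mono) auto
          also have "\<dots> \<le> ?\<phi> r - ?\<phi> t1"
            by (rule slope) (use r tt txy exy in \<open>auto simp: e_def min_def max_def split: if_splits\<close>)
          finally show ?thesis .
        qed
      qed (use w le tt txy range S0 in \<open>auto simp: e_def min_def max_def split: if_splits\<close>)
    qed
  qed
qed

end

section \<open>Growth of rational functions and transcendence of f\<close>

lemma entire_poly_growth_imp_poly: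
  fixes G :: "complex \<Rightarrow> complex"
  assumes G: "G holomorphic_on UNIV"
    and B: "\<And>r0. \<exists>r\<ge>r0. r > 0 \<and> (\<forall>z. cmod z = r \<longrightarrow> cmod (G z) \<le> r ^ m)"
  obtains p where "G = poly p"
proof -
  \<comment> \<open>Cauchy's inequality on arbitrarily large circles is enough; no bound between
    these circles is required.\<close>
  have zero: "(deriv ^^ k) G 0 = 0" if k: "k > m" for k
  proof (rule ccontr)
    assume nz: "(deriv ^^ k) G 0 \<noteq> 0"
    define e where "e = cmod ((deriv ^^ k) G 0) / fact k"
    have e: "e > 0" using nz by (simp add: e_def)
    obtain r where r: "r \<ge> max 1 (1 / e + 1)" "r > 0" "\<And>z. cmod z = r \<Longrightarrow> cmod (G z) \<le> r ^ m" using B by blast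
    have "cmod ((deriv ^^ k) G 0) \<le> fact k * (r ^ m) / r ^ k"
      by (rule Cauchy_inequality) (use r in \<open>auto intro: holomorphic_on_subset[OF G] holomorphic_on_imp_continuous_on\<close>)
    then have "e \<le> r ^ m / r ^ k" by (simp add: e_def field_simps)
    also have "r ^ k = r ^ m * r ^ (k - m)" using k by (simp flip: power_add)
    also have "r ^ m / (r ^ m * r ^ (k - m)) = 1 / r ^ (k - m)" using r by simp
    also have "\<dots> \<le> 1 / r ^ 1" using r k by (intro divide_left_mono power_increasing) auto
    finally have "e * r \<le> 1" using r by (simp add: pos_le_divide_eq)
    moreover have "e * r \<ge> e * (1 / e + 1)" using r e by (intro mult_left_mono) auto
    ultimately show False using e by (simp add: distrib_left)
  qed
  have "G z = poly (\<Sum>k\<le>m. monom ((deriv ^^ k) G 0 / fact k) k) z" for z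
  proof -
    have "((\<lambda>n. (deriv ^^ n) G 0 / fact n * (z - 0) ^ n) sums G z)"
      by (rule holomorphic_power_series[of _ _ "cmod z + 1"]) (auto intro: holomorphic_on_subset[OF G])
    moreover have "((\<lambda>n. (deriv ^^ n) G 0 / fact n * (z - 0) ^ n) sums (\<Sum>k\<le>m. (deriv ^^ k) G 0 / fact k * (z - 0) ^ k))"
      by (rule sums_finite) (use zero in auto)
    ultimately have "G z = (\<Sum>k\<le>m. (deriv ^^ k) G 0 / fact k * (z - 0) ^ k)" by (rule sums_unique2)
    then show ?thesis by (simp add: poly_sum poly_monom)
  qed
  then show ?thesis using that by blast
qed

lemma elog_max_modulus_le:
  assumes "r \<ge> 0" "B > 0" "\<And>z. cmod z = r \<Longrightarrow> \<not> is_pole f z \<and> cmod (f z) \<le> B"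
  shows "elog (max_modulus r f) \<le> ereal (ln B)"
proof -
  define S where "S = (SUP z\<in>{z. cmod z = r}. ereal (cmod (f z)))"
  have S: "S \<le> ereal B" unfolding S_def using assms by (intro SUP_least) auto
  have "max_modulus r f = S" using assms by (auto simp: max_modulus_def S_def)
  moreover have "elog S \<le> ereal (ln B)"
    using S assms(2) by (cases S) (auto simp: elog_def)
  ultimately show ?thesis by simp
qed

text \<open>If t \<ge> 2 x and n poles lie in the disc of radius e^x, then
  \<open>nevanlinna_N_ge\<close> gives n t / 2 \<le> N \<le> Q t. So no disc contains more than 2 Q
  poles.\<close>

lemma (in meromorphic_plane) finite_poles_if_N_small:
  assumes "\<And>t0. \<exists>t\<ge>t0. nevanlinna_N (exp t) f \<le> Q * t"
  shows "finite {p. is_pole f p}"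
proof -
  have card: "card {p. cmod p \<le> exp x \<and> is_pole f p} \<le> nat \<lceil>2 * Q\<rceil>" if x: "x > 0" for x
  proof -
    obtain t where t: "t \<ge> 2 * x" "nevanlinna_N (exp t) f \<le> Q * t" using assms by blast
    have "real (card {p. cmod p \<le> exp x \<and> is_pole f p}) \<le> (\<Sum>p | cmod p \<le> exp x \<and> is_pole f p. real (pole_mult f p))"
      using sum_mono[of "{p. cmod p \<le> exp x \<and> is_pole f p}" "\<lambda>_. 1" "\<lambda>p. real (pole_mult f p)"] pole_mult_pos by fastforce
    then have "real (card {p. cmod p \<le> exp x \<and> is_pole f p}) * (t - x) \<le> (\<Sum>p | cmod p \<le> exp x \<and> is_pole f p. real (pole_mult f p)) * (t - x)"
      using t x by (intro mult_right_mono) auto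
    also have "\<dots> \<le> Q * t" using nevanlinna_N_ge[of x t] t x by linarith
    finally have 1: "real (card {p. cmod p \<le> exp x \<and> is_pole f p}) * (t - x) \<le> Q * t" .
    have "real (card {p. cmod p \<le> exp x \<and> is_pole f p}) * (t / 2) \<le> real (card {p. cmod p \<le> exp x \<and> is_pole f p}) * (t - x)"
      using t by (intro mult_left_mono) auto
    with 1 have "real (card {p. cmod p \<le> exp x \<and> is_pole f p}) * t \<le> (2 * Q) * t" by simp
    then have "real (card {p. cmod p \<le> exp x \<and> is_pole f p}) \<le> 2 * Q" using t x by simp
    then show ?thesis by linarith
  qed
  show ?thesis
  proof (rule ccontr)
    assume "infinite {p. is_pole f p}"
    then obtain A where A: "A \<subseteq> {p. is_pole f p}" "finite A" "card A = Suc (nat \<lceil>2 * Q\<rceil>)"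
      using infinite_arbitrarily_large by blast
    define x where "x = (\<Sum>p\<in>A. cmod p) + 1"
    have x: "x > 0" by (simp add: x_def sum_nonneg add_nonneg_pos)
    have "A \<subseteq> {p. cmod p \<le> exp x \<and> is_pole f p}"
    proof
      fix p assume p: "p \<in> A"
      have "cmod p \<le> x" using member_le_sum[OF p, of cmod] A by (simp add: x_def)
      also have "\<dots> \<le> exp x" using exp_ge_add_one_self[of x] by linarith
      finally show "p \<in> {p. cmod p \<le> exp x \<and> is_pole f p}" using A p by auto
    qed
    then have "card A \<le> card {p. cmod p \<le> exp x \<and> is_pole f p}" by (intro card_mono finite_poles)
    then show False using card[OF x] A by linarith
  qed
qed

text \<open>The poles are finite in number, and after multiplication by the corresponding linear
  factors f becomes entire and of polynomial growth on arbitrarily large circles.\<close>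

lemma (in meromorphic_plane) rational_if_slow_growth:
  assumes Q: "\<And>t0. \<exists>t\<ge>t0. nevanlinna_N (exp t) f \<le> Q * t \<and>
      (\<forall>z. cmod z = exp t \<longrightarrow> \<not> is_pole f z \<and> cmod (f z) \<le> exp (Q * t))"
  obtains p where "finite {w. is_pole f w}" "p \<noteq> 0"
    "\<And>z. \<not> is_pole f z \<Longrightarrow> f z * (\<Prod>w | is_pole f w. (z - w) ^ pole_mult f w) = poly p z"
proof -
  define P where "P = {w. is_pole f w}"
  have fin: "finite P" unfolding P_def by (rule finite_poles_if_N_small[of Q]) (use Q in blast)
  have z0: "zorder f w = - int (pole_mult f w)" if "is_pole f w" for w
    using zorder_diff_pole[OF that, of 0] by simp
  obtain G where G: "G holomorphic_on UNIV" "\<And>z. z \<in> P \<or> f z \<noteq> 0 \<Longrightarrow> G z \<noteq> 0"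
    "\<And>z. z \<notin> P \<Longrightarrow> f z = G z * (\<Prod>w\<in>P. (z - w) powi (zorder f w))"
  proof (rule divisor_factorization[OF mero _ fin, of UNIV])
    show "\<exists>\<^sub>F w in at z. f w \<noteq> 0" for z by (rule frequently_ne)
    show "f analytic_on {z}" if "z \<in> UNIV - P" for z using that analytic_at_nonpole by (auto simp: P_def)
  qed auto
  define R where "R = (\<lambda>z. \<Prod>w\<in>P. (z - w) ^ pole_mult f w)"
  have fR: "f z * R z = G z" if "z \<notin> P" for z
  proof -
    have "(\<Prod>w\<in>P. (z - w) powi (zorder f w)) * R z = (\<Prod>w\<in>P. (z - w) powi (zorder f w) * (z - w) ^ pole_mult f w)"
      by (simp add: R_def prod.distrib)
    also have "\<dots> = 1"
      using that z0 by (intro prod.neutral) (auto simp: P_def power_int_minus intro!: left_inverse)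
    finally show ?thesis using G(3)[OF that] by (simp add: mult.assoc)
  qed
  define M where "M = (\<Sum>w\<in>P. pole_mult f w)"
  define \<rho> where "\<rho> = 1 + (\<Sum>w\<in>P. cmod w)"
  have \<rho>: "\<rho> \<ge> 1" "cmod w \<le> \<rho>" if "w \<in> P" for w
    using member_le_sum[OF that, of cmod] fin by (auto simp: \<rho>_def sum_nonneg)
  obtain p where p: "G = poly p"
  proof (rule entire_poly_growth_imp_poly[OF G(1), where m = "nat \<lceil>Q\<rceil> + 2 * M"])
    fix r0 :: real
    obtain t where t: "t \<ge> max (ln (max \<rho> (max 2 r0))) 0"
      "\<And>z. cmod z = exp t \<Longrightarrow> \<not> is_pole f z \<and> cmod (f z) \<le> exp (Q * t)" using Q by blast
    define r where "r = exp t"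
    have "0 < max \<rho> (max 2 r0)" by simp
    then have "max \<rho> (max 2 r0) \<le> exp t" using t(1) by (metis exp_le_cancel_iff exp_ln max.bounded_iff)
    then have r: "r \<ge> \<rho>" "r \<ge> 2" "r \<ge> r0" by (auto simp: r_def)
    have t0: "t \<ge> 0" using t(1) by linarith
    have "cmod (G z) \<le> r ^ (nat \<lceil>Q\<rceil> + 2 * M)" if z: "cmod z = r" for z
    proof -
      have "z \<notin> P" using t(2)[of z] z by (simp add: r_def P_def)
      then have "cmod (G z) = cmod (f z) * cmod (R z)" using fR[of z] by (metis norm_mult)
      also have "cmod (R z) = (\<Prod>w\<in>P. cmod (z - w) ^ pole_mult f w)"
        by (simp add: R_def norm_power flip: prod_norm)
      finally have "cmod (G z) = cmod (f z) * (\<Prod>w\<in>P. cmod (z - w) ^ pole_mult f w)" .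
      also have "\<dots> \<le> r ^ nat \<lceil>Q\<rceil> * (\<Prod>w\<in>P. (r\<^sup>2) ^ pole_mult f w)"
      proof (intro mult_mono prod_mono conjI power_mono)
        have "cmod (f z) \<le> exp (Q * t)" using t(2)[of z] z by (simp add: r_def)
        also have "\<dots> \<le> exp (real (nat \<lceil>Q\<rceil>) * t)" using t0 real_nat_ceiling_ge[of Q] by (simp add: mult_right_mono)
        also have "\<dots> = r ^ nat \<lceil>Q\<rceil>" by (simp add: r_def exp_of_nat_mult)
        finally show "cmod (f z) \<le> r ^ nat \<lceil>Q\<rceil>" .
        show "cmod (z - w) \<le> r\<^sup>2" if "w \<in> P" for w
        proof -
          have "cmod (z - w) \<le> r + r" using norm_triangle_ineq4[of z w] z \<rho>(2)[OF that] r by linarith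
          also have "\<dots> \<le> r * r" using mult_right_mono[of 2 r r] r by simp
          finally show ?thesis by (simp add: power2_eq_square)
        qed
      qed (use r in \<open>auto intro!: prod_nonneg\<close>)
      also have "(\<Prod>w\<in>P. (r\<^sup>2) ^ pole_mult f w) = r ^ (2 * M)"
        by (simp add: M_def power_sum power_mult)
      finally show ?thesis by (simp add: power_add)
    qed
    then show "\<exists>r\<ge>r0. 0 < r \<and> (\<forall>z. cmod z = r \<longrightarrow> cmod (G z) \<le> r ^ (nat \<lceil>Q\<rceil> + 2 * M))"
      using r by (intro exI[of _ r]) auto
  qed
  have "p \<noteq> 0"
  proof
    assume "p = 0"
    then have "f z = 0" if "z \<notin> P" for z using G(3)[OF that] p by simp
    moreover have "f z = 0" if "z \<in> P" for z
      using that is_pole_zero_at_nicely_mero[OF nice] by (simp add: P_def)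
    ultimately have "f z = 0" for z by blast
    then show False using nonconst by (auto simp: constant_on_def)
  qed
  moreover have "f z * (\<Prod>w | is_pole f w. (z - w) ^ pole_mult f w) = poly p z" if "\<not> is_pole f z" for z
    using fR[of z] that p by (simp add: R_def P_def)
  ultimately show ?thesis using that fin by (simp add: P_def)
qed

lemma poly_growth_bounds:
  fixes p :: "complex poly"
  assumes "p \<noteq> 0"
  obtains R a b where "R > 0" "a > 0" "b > 0"
    "\<And>z. cmod z \<ge> R \<Longrightarrow> a * cmod z ^ degree p \<le> cmod (poly p z) \<and> cmod (poly p z) \<le> b * cmod z ^ degree p"
proof -
  define l where "l = cmod (lead_coeff p)"
  have l: "l > 0" using assms by (simp add: l_def)
  have "((\<lambda>z. cmod (poly p z / z ^ degree p)) \<longlongrightarrow> l) at_infinity"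
    unfolding l_def by (intro tendsto_norm poly_divide_tendsto_aux)
  then have "\<forall>\<^sub>F z in at_infinity. dist (cmod (poly p z / z ^ degree p)) l < l / 2"
    using l by (intro tendstoD) auto
  then obtain R where R: "\<And>z. cmod z \<ge> R \<Longrightarrow> dist (cmod (poly p z / z ^ degree p)) l < l / 2"
    by (auto simp: eventually_at_infinity)
  have "(l / 2) * cmod z ^ degree p \<le> cmod (poly p z) \<and> cmod (poly p z) \<le> (2 * l) * cmod z ^ degree p"
    if z: "cmod z \<ge> max R 1" for z
  proof -
    have "\<bar>cmod (poly p z) / cmod z ^ degree p - l\<bar> < l / 2"
      using R[of z] z by (simp add: dist_real_def norm_divide norm_power)
    then have "l / 2 \<le> cmod (poly p z) / cmod z ^ degree p" "cmod (poly p z) / cmod z ^ degree p \<le> 2 * l"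
      by linarith+
    moreover have "cmod z ^ degree p > 0" using z by (intro zero_less_power) auto
    ultimately show ?thesis by (simp add: field_simps)
  qed
  then show ?thesis using l by (intro that[of "max R 1" "l / 2" "2 * l"]) auto
qed

text \<open>Polynomials are excluded: with suitable constants those of degree at least 2 satisfy the
  growth inequality, but their basin of infinity contains wide annuli and is not wandering. The
  radius 1 is left out because log r vanishes there.\<close>

locale growth_function = meromorphic_plane +
  fixes C c r\<^sub>0 :: real
  assumes C: "C \<ge> 1" and c: "c > 0" and r0: "r\<^sub>0 > 0"
    and growth: "\<And>r. r > r\<^sub>0 \<Longrightarrow> r \<noteq> 1 \<Longrightarrow> ereal ((1 - c / ln r) * nevanlinna_T r f) \<le> elog (max_modulus (C * r) f)"
    and not_poly: "\<And>p. f \<noteq> poly p"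
begin

lemma growth_le:
  assumes "t > 0" "exp t > r\<^sub>0" "B > 0"
    and "\<And>z. cmod z = exp (t + ln C) \<Longrightarrow> \<not> is_pole f z \<and> cmod (f z) \<le> B"
  shows "(1 - c / t) * nevanlinna_T (exp t) f \<le> ln B"
proof -
  have e: "exp (t + ln C) = C * exp t" using C by (simp add: exp_add)
  have "ereal ((1 - c / ln (exp t)) * nevanlinna_T (exp t) f) \<le> elog (max_modulus (C * exp t) f)"
    using assms by (intro growth) auto
  also have "\<dots> \<le> ereal (ln B)"
    using assms C by (intro elog_max_modulus_le) (auto simp: e)
  finally show ?thesis by simp
qed

text \<open>If this fails for some Q, then f is rational with a pole, and |f(z)| is comparable to
  |z|^k near infinity. Then m(r, f) \<ge> k log r - O(1) and the pole yields N(r, f) \<ge> log r -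
  O(1), while log M(C r, f) \<le> k log r + O(1). This contradicts the growth hypothesis for either
  sign of k.\<close>

lemma transcendental:
  obtains t0 where "\<And>t. t \<ge> t0 \<Longrightarrow> (\<And>z. cmod z = exp t \<Longrightarrow> \<not> is_pole f z) \<Longrightarrow>
     nevanlinna_N (exp t) f \<le> Q * t \<Longrightarrow> \<exists>z. cmod z = exp t \<and> cmod (f z) > exp (Q * t)"
proof (rule ccontr)
  assume "\<not> thesis"
  then have slow: "\<exists>t\<ge>t0. nevanlinna_N (exp t) f \<le> Q * t \<and>
      (\<forall>z. cmod z = exp t \<longrightarrow> \<not> is_pole f z \<and> cmod (f z) \<le> exp (Q * t))" for t0
    using that not_less by metis
  define P where "P = {w. is_pole f w}"
  define R where "R = (\<lambda>z. \<Prod>w\<in>P. (z - w) ^ pole_mult f w)"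
  obtain p where fin: "finite P" and p: "p \<noteq> 0" and fR: "\<And>z. z \<notin> P \<Longrightarrow> f z * R z = poly p z"
    using rational_if_slow_growth[OF slow] unfolding P_def R_def by (metis mem_Collect_eq)
  define r where "r = (\<Prod>w\<in>P. [:- w, 1:] ^ pole_mult f w)"
  have R: "R z = poly r z" for z by (simp add: R_def r_def poly_prod algebra_simps)
  have r0: "r \<noteq> 0" using fin by (simp add: r_def)
  show False
  proof (cases "P = {}")
    case True
    then have "f = poly p" using fR by (auto simp: R_def fun_eq_iff)
    then show False using not_poly by blast
  next
    case False
    then obtain w where w: "is_pole f w" by (auto simp: P_def)
    obtain R1 a1 b1 where 1: "R1 > 0" "a1 > 0" "b1 > 0"
      "\<And>z. cmod z \<ge> R1 \<Longrightarrow> a1 * cmod z ^ degree p \<le> cmod (poly p z) \<and> cmod (poly p z) \<le> b1 * cmod z ^ degree p"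
      using poly_growth_bounds[OF p] by blast
    obtain R2 a2 b2 where 2: "R2 > 0" "a2 > 0" "b2 > 0"
      "\<And>z. cmod z \<ge> R2 \<Longrightarrow> a2 * cmod z ^ degree r \<le> cmod (poly r z) \<and> cmod (poly r z) \<le> b2 * cmod z ^ degree r"
      using poly_growth_bounds[OF r0] by blast
    define k where "k = real (degree p) - real (degree r)"
    define X where "X = max (max (ln R1) (ln R2)) (max (ln (1 + (\<Sum>w\<in>P. cmod w))) 1)"
    have bounds: "\<not> is_pole f z \<and> (a1 / b2) * exp (k * t) \<le> cmod (f z) \<and> cmod (f z) \<le> (b1 / a2) * exp (k * t)"
      if z: "cmod z = exp t" "t \<ge> X" for z t
    proof -
      have "exp (ln R1) \<le> exp t" "exp (ln R2) \<le> exp t" "exp (ln (1 + (\<Sum>w\<in>P. cmod w))) \<le> exp t"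
        using z(2) by (auto simp: X_def)
      moreover have "1 + (\<Sum>w\<in>P. cmod w) > 0" by (simp add: add_pos_nonneg sum_nonneg)
      ultimately have zR: "cmod z \<ge> R1" "cmod z \<ge> R2" "cmod z \<ge> 1 + (\<Sum>w\<in>P. cmod w)" using z 1 2 by auto
      have zP: "z \<notin> P" using member_le_sum[of z P cmod] fin zR by auto
      have pos: "cmod z ^ degree p > 0" "cmod z ^ degree r > 0" using z by auto
      have Rz: "cmod (R z) > 0"
      proof -
        have "0 < a2 * cmod z ^ degree r" using 2 pos by simp
        then show ?thesis using 2(4)[OF zR(2)] R by auto
      qed
      have fz: "cmod (f z) = cmod (poly p z) / cmod (R z)" using fR[OF zP] Rz by (metis nonzero_mult_div_cancel_right norm_mult less_irrefl)
      have e: "exp (k * t) = cmod z ^ degree p / cmod z ^ degree r"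
        by (simp add: z(1) k_def left_diff_distrib exp_diff exp_of_nat_mult)
      have "a1 * cmod z ^ degree p / (b2 * cmod z ^ degree r) \<le> cmod (poly p z) / cmod (R z)"
        using 1(4)[OF zR(1)] 2(4)[OF zR(2)] Rz 1 2 pos R by (intro frac_le) auto
      moreover have "cmod (poly p z) / cmod (R z) \<le> b1 * cmod z ^ degree p / (a2 * cmod z ^ degree r)"
        using 1(4)[OF zR(1)] 2(4)[OF zR(2)] Rz 1 2 pos R by (intro frac_le) auto
      ultimately show ?thesis unfolding fz e using zP by (simp add: P_def)
    qed
    define Kn where "Kn = \<bar>ln (cmod w)\<bar>"
    have Nlow: "t - Kn \<le> nevanlinna_N (exp t) f" if t: "t > Kn" for t
    proof -
      have "1 * (t - Kn) \<le> (\<Sum>p | cmod p \<le> exp Kn \<and> is_pole f p. real (pole_mult f p)) * (t - Kn)"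
      proof (rule mult_right_mono)
        have "cmod w \<le> exp Kn"
        proof (cases "w = 0")
          case False
          then have "cmod w = exp (ln (cmod w))" by simp
          also have "\<dots> \<le> exp Kn" by (simp add: Kn_def)
          finally show ?thesis .
        qed simp
        then have "real (pole_mult f w) \<le> (\<Sum>p | cmod p \<le> exp Kn \<and> is_pole f p. real (pole_mult f p))"
          using w finite_poles by (intro member_le_sum[where f = "\<lambda>p. real (pole_mult f p)"]) auto
        then show "1 \<le> (\<Sum>p | cmod p \<le> exp Kn \<and> is_pole f p. real (pole_mult f p))"
          using pole_mult_pos[OF w] by linarith
      qed (use t in auto)
      also have "\<dots> \<le> nevanlinna_N (exp t) f" by (rule nevanlinna_N_ge) (use t in \<open>auto simp: Kn_def\<close>)
      finally show ?thesis by simp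
    qed
    define K where "K = \<bar>ln (a1 / b2)\<bar> + Kn"
    define t where "t = max (max X (ln r\<^sub>0 + 1)) (max (Kn + 1) (c + c * (\<bar>k + 1\<bar> + K) + K + \<bar>k * ln C\<bar> + \<bar>ln (b1 / a2)\<bar> + 1))"
    have K0: "K \<ge> 0" by (simp add: K_def Kn_def)
    have t: "t \<ge> X" "t \<ge> ln r\<^sub>0 + 1" "t \<ge> Kn + 1" "t \<ge> c + c * (\<bar>k + 1\<bar> + K) + K + \<bar>k * ln C\<bar> + \<bar>ln (b1 / a2)\<bar> + 1" "t \<ge> 1"
      by (simp_all only: t_def X_def le_max_iff_disj order_refl simp_thms)
    have lnC: "ln C \<ge> 0" using C by simp
    have "nevanlinna_m (exp t) f \<ge> ln (a1 / b2) + k * t"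
    proof (rule nevanlinna_m_ge)
      fix z assume z: "cmod z = exp t"
      show "\<not> is_pole f z" using bounds[OF z t(1)] by blast
      have "0 < (a1 / b2) * exp (k * t)" using 1 2 by simp
      moreover have "(a1 / b2) * exp (k * t) \<le> max 1 (cmod (f z))" using bounds[OF z t(1)] by linarith
      ultimately have "ln ((a1 / b2) * exp (k * t)) \<le> ln (max 1 (cmod (f z)))" by (subst ln_le_cancel_iff) auto
      moreover have "ln ((a1 / b2) * exp (k * t)) = ln (a1 / b2) + k * t" using 1 2 by (subst ln_mult_pos) auto
      ultimately show "ln (a1 / b2) + k * t \<le> ln (max 1 (cmod (f z)))" by simp
    qed auto
    then have T: "nevanlinna_T (exp t) f \<ge> (k + 1) * t - K"
      using Nlow[of t] t unfolding nevanlinna_T_def K_def by (simp add: algebra_simps)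
    have "0 \<le> c * (\<bar>k + 1\<bar> + K)" using c K0 by simp
    then have "c \<le> t" using t(4) K0 by linarith
    then have ct: "c / t \<le> 1" using t by (simp add: divide_le_eq)
    have rt: "exp t > r\<^sub>0"
    proof -
      have "exp (ln r\<^sub>0) < exp t" using t(2) by simp
      then show ?thesis using r0 growth_function.r0[OF growth_function_axioms] by simp
    qed
    have "(1 - c / t) * nevanlinna_T (exp t) f \<le> ln ((b1 / a2) * exp (k * (t + ln C)))"
    proof (rule growth_le[OF _ rt])
      show "\<not> is_pole f z \<and> cmod (f z) \<le> b1 / a2 * exp (k * (t + ln C))" if "cmod z = exp (t + ln C)" for z
        using bounds[OF that] t lnC by auto
    qed (use t 1 2 in auto)
    also have "ln ((b1 / a2) * exp (k * (t + ln C))) = ln (b1 / a2) + k * (t + ln C)" using 1 2 by (subst ln_mult_pos) auto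
    finally have "(1 - c / t) * ((k + 1) * t - K) \<le> ln (b1 / a2) + k * (t + ln C)"
      using mult_left_mono[OF T, of "1 - c / t"] ct by linarith
    moreover have "(1 - c / t) * ((k + 1) * t - K) = (k + 1) * t - K - c * (k + 1) + (c / t) * K"
      using t by (simp add: field_simps)
    moreover have "(c / t) * K \<ge> 0" using c t K0 by simp
    moreover have "c * (k + 1) \<le> c * (\<bar>k + 1\<bar> + K)" using c K0 by (intro mult_left_mono) auto
    ultimately have "t \<le> K + c * (\<bar>k + 1\<bar> + K) + \<bar>k * ln C\<bar> + \<bar>ln (b1 / a2)\<bar>"
      by (simp add: algebra_simps)
    then show False using t(4) c by linarith
  qed
qed

end

section \<open>The covering step for f, with constants depending on C and c only\<close>

definition step_radius :: "real \<Rightarrow> real" where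
  "step_radius C = 2 * pi + ln C + 1"

text \<open>\<open>step_radius\<close> and \<open>step_pole_const\<close> are the numbers s and
  \<kappa>2 of \<open>step_strip\<close> for \<gamma> = ln C.\<close>

definition step_pole_const :: "real \<Rightarrow> real \<Rightarrow> real" where
  "step_pole_const C c = 40 * pi + 1 + (40 * pi + 20 * ln C + 3 + 2 * c)"

text \<open>The loss of \<open>step_strip\<close> increased by 4. Passing from the values of f - a
  to those of f shortens the image by 1 at each end of the logarithmic scale, and the extra 4 / q
  covers this.\<close>

definition step_loss :: "real \<Rightarrow> real \<Rightarrow> real" where
  "step_loss C c = step_pole_const C c + 8 + 40 * pi + 1600 * step_radius C"

definition step_min :: "real \<Rightarrow> real \<Rightarrow> real" where
  "step_min C c = 1 + ln C + 2 * c + 400 * step_radius C + 2 * step_pole_const C c"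

lemma ln_norm_diff:
  fixes w a :: complex
  assumes "cmod w \<ge> 2 * cmod a" "w \<noteq> 0"
  shows "w - a \<noteq> 0" "\<bar>ln (cmod (w - a)) - ln (cmod w)\<bar> \<le> 1"
proof -
  have w: "cmod w > 0" using assms by simp
  have lo: "cmod (w - a) \<ge> cmod w / 2" using norm_triangle_ineq2[of w a] assms by linarith
  have hi: "cmod (w - a) \<le> 2 * cmod w" using norm_triangle_ineq4[of w a] assms w by linarith
  show ne: "w - a \<noteq> 0" using lo w by auto
  have ln2: "ln (2::real) \<le> 1" using ln_le_minus_one[of 2] by simp
  have "ln (cmod w / 2) \<le> ln (cmod (w - a))" using lo w by (subst ln_le_cancel_iff) auto
  moreover have "ln (cmod (w - a)) \<le> ln (2 * cmod w)" using hi w ne by (subst ln_le_cancel_iff) auto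
  moreover have "ln (cmod w / 2) = ln (cmod w) - ln 2" "ln (2 * cmod w) = ln 2 + ln (cmod w)"
    using w by (simp_all add: ln_div ln_mult_pos)
  ultimately show "\<bar>ln (cmod (w - a)) - ln (cmod w)\<bar> \<le> 1" using ln2 by linarith
qed

context growth_function
begin

lemma lnC: "ln C \<ge> 0" using C by simp

lemma norm_f_le_circle_max:
  assumes "log_strip F x y" "x < t" "t < y"
    and F: "\<And>\<zeta>. x < Re \<zeta> \<and> Re \<zeta> < y \<Longrightarrow> exp (F \<zeta>) = f (exp \<zeta>) - a"
    and z: "cmod z = exp t"
  shows "cmod (f z) \<le> exp (max (circle_max F t) 0) * (1 + cmod a)"
proof -
  interpret log_strip F x y by fact
  obtain \<zeta> where \<zeta>: "exp \<zeta> = z" using z by (metis exp_Ln exp_not_eq_zero norm_eq_zero)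
  then have Re: "Re \<zeta> = t" using z by auto
  have "cmod (f z - a) = exp (Re (F \<zeta>))" using F[of \<zeta>] assms(2,3) Re \<zeta> by (metis norm_exp_eq_Re)
  also have "\<dots> \<le> exp (max (circle_max F t) 0)"
    using le_circle_max[OF assms(2,3), of "Im \<zeta>"] Re[symmetric] by (simp add: le_max_iff_disj)
  finally have 1: "cmod (f z - a) \<le> exp (max (circle_max F t) 0)" .
  have "cmod (f z) \<le> cmod (f z - a) + cmod a" using norm_triangle_ineq[of "f z - a" a] by simp
  also have "\<dots> \<le> exp (max (circle_max F t) 0) + exp (max (circle_max F t) 0) * cmod a"
    using 1 by (intro add_mono) (auto simp: mult_le_cancel_right1)
  finally show ?thesis by (simp add: distrib_left)
qed

lemma growth_strip:
  assumes strip: "log_strip F x y" and t: "x < t" "t + ln C < y"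
    and F: "\<And>\<zeta>. x < Re \<zeta> \<and> Re \<zeta> < y \<Longrightarrow> exp (F \<zeta>) = f (exp \<zeta>) - a"
    and reg: "\<And>z. exp x < cmod z \<Longrightarrow> cmod z < exp y \<Longrightarrow> \<not> is_pole f z \<and> f z \<noteq> a"
    and "t > 0" "exp t > r\<^sub>0"
  shows "(1 - c / t) * nevanlinna_T (exp t) f \<le> max (circle_max F (t + ln C)) 0 + ln (1 + cmod a)"
proof -
  have "(1 - c / t) * nevanlinna_T (exp t) f \<le> ln (exp (max (circle_max F (t + ln C)) 0) * (1 + cmod a))"
  proof (rule growth_le)
    fix z assume z: "cmod z = exp (t + ln C)"
    show "\<not> is_pole f z \<and> cmod (f z) \<le> exp (max (circle_max F (t + ln C)) 0) * (1 + cmod a)"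
      using norm_f_le_circle_max[OF strip _ _ F z] reg[of z] z t lnC by auto
  next
    show "0 < exp (max (circle_max F (t + ln C)) 0) * (1 + cmod a)"
      by (intro mult_pos_pos add_pos_nonneg) auto
  qed (use assms in auto)
  also have "\<dots> = max (circle_max F (t + ln C)) 0 + ln (1 + cmod a)"
    by (subst ln_mult_pos) (auto intro: add_pos_nonneg)
  finally show ?thesis .
qed

text \<open>If the maximum on |z| = e^t is small, then N(e^t, f) is large by
  \<open>transcendental\<close>, and the growth hypothesis makes the maximum on |z| = C e^t large.
  Because of this alternative, t1 in \<open>step_annulus\<close> may have to be shifted by ln
  C.\<close>

lemma circle_max_large:
  obtains t0 where "\<And>F x y t. \<lbrakk>t \<ge> t0; log_strip F x y; x < t; t + ln C < y;
     \<And>\<zeta>. x < Re \<zeta> \<and> Re \<zeta> < y \<Longrightarrow> exp (F \<zeta>) = f (exp \<zeta>) - a;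
     \<And>z. exp x < cmod z \<Longrightarrow> cmod z < exp y \<Longrightarrow> \<not> is_pole f z \<and> f z \<noteq> a\<rbrakk> \<Longrightarrow>
     circle_max F t \<ge> Q * t \<or> circle_max F (t + ln C) \<ge> Q * (t + ln C)"
proof -
  define Q1 where "Q1 = max Q 1"
  \<comment> \<open>The factor 4 pays for 1 - c / t \<ge> 1/2 and for t + ln C \<le> 2 t; the
    summand 2 pays for log (1 + |a|) \<le> t.\<close>
  obtain t0 where t0: "\<And>t. t \<ge> t0 \<Longrightarrow> (\<And>z. cmod z = exp t \<Longrightarrow> \<not> is_pole f z) \<Longrightarrow>
     nevanlinna_N (exp t) f \<le> (4 * Q1 + 2) * t \<Longrightarrow> \<exists>z. cmod z = exp t \<and> cmod (f z) > exp ((4 * Q1 + 2) * t)"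
    using transcendental[of "4 * Q1 + 2"] by blast
  define la where "la = ln (1 + cmod a)"
  have la: "la \<ge> 0" "exp la = 1 + cmod a" by (auto simp: la_def add_pos_nonneg)
  define M where "M = max t0 (\<bar>ln r\<^sub>0\<bar> + 2 * c + la + ln C + 1)"
  show ?thesis
  proof (rule that[of M])
    fix F x y t
    assume t: "t \<ge> M" and strip: "log_strip F x y" and xy: "x < t" "t + ln C < y"
      and F: "\<And>\<zeta>. x < Re \<zeta> \<and> Re \<zeta> < y \<Longrightarrow> exp (F \<zeta>) = f (exp \<zeta>) - a"
      and reg: "\<And>z. exp x < cmod z \<Longrightarrow> cmod z < exp y \<Longrightarrow> \<not> is_pole f z \<and> f z \<noteq> a"
    have Q1: "Q1 \<ge> Q" "Q1 \<ge> 1" by (auto simp: Q1_def)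
    have tt: "t \<ge> t0" "t \<ge> \<bar>ln r\<^sub>0\<bar> + 2 * c + la + ln C + 1" using t by (auto simp: M_def)
    have t1: "t \<ge> 1" "t \<ge> 2 * c" "t \<ge> la" "t \<ge> ln C" "t > ln r\<^sub>0" using tt(2) la lnC c by linarith+
    have "exp (ln r\<^sub>0) < exp t" using t1(5) by simp
    then have rt: "exp t > r\<^sub>0" using r0 by simp
    have np: "\<not> is_pole f z" if "cmod z = exp t" for z using reg[of z] xy lnC that by auto
    have Qt: "Q * t \<le> Q1 * t" "Q * (t + ln C) \<le> Q1 * (2 * t)"
    proof -
      show "Q * t \<le> Q1 * t" using Q1 t1 by (intro mult_right_mono) auto
      have "Q * (t + ln C) \<le> Q1 * (t + ln C)" using Q1 t1 lnC by (intro mult_right_mono) auto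
      also have "\<dots> \<le> Q1 * (2 * t)" using Q1 t1 by (intro mult_left_mono) auto
      finally show "Q * (t + ln C) \<le> Q1 * (2 * t)" .
    qed
    have Qpos: "Q1 * t \<ge> 1 * 1" using Q1 t1 by (intro mult_mono) auto
    show "circle_max F t \<ge> Q * t \<or> circle_max F (t + ln C) \<ge> Q * (t + ln C)"
    proof (cases "nevanlinna_N (exp t) f \<le> (4 * Q1 + 2) * t")
      case True
      then obtain z where z: "cmod z = exp t" "cmod (f z) > exp ((4 * Q1 + 2) * t)" using t0[OF tt(1) np] by blast
      have "exp ((4 * Q1 + 2) * t) < exp (max (circle_max F t) 0 + la)"
        using norm_f_le_circle_max[OF strip xy(1) _ F z(1)] z(2) xy lnC by (simp add: exp_add la(2))
      then have "(4 * Q1 + 2) * t < max (circle_max F t) 0 + la" by simp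
      moreover have "(4 * Q1 + 2) * t = 4 * (Q1 * t) + 2 * t" by (simp add: algebra_simps)
      ultimately show ?thesis using Qt(1) Qpos t1 by linarith
    next
      case False
      then have T: "nevanlinna_T (exp t) f \<ge> (4 * Q1 + 2) * t"
        using nevanlinna_N_le_T[of "exp t"] np by force
      have "c / t \<le> 1 / 2" using t1 c by (simp add: field_simps)
      then have "(1 / 2) * ((4 * Q1 + 2) * t) \<le> (1 - c / t) * nevanlinna_T (exp t) f"
        using T Q1 t1 by (intro mult_mono) auto
      also have "\<dots> \<le> max (circle_max F (t + ln C)) 0 + la"
        unfolding la_def by (rule growth_strip[OF strip xy F reg]) (use t1 rt in auto)
      finally have "2 * (Q1 * t) + t \<le> max (circle_max F (t + ln C)) 0 + la" by (simp add: algebra_simps)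
      then show ?thesis using Qt(2) Qpos t1 by linarith
    qed
  qed
qed

lemma step_annulus:
  obtains t0 where
    "\<And>x q. \<lbrakk>x \<ge> t0; q \<ge> step_min C c; q ^ 4 \<le> x;
        \<And>z. exp x < cmod z \<Longrightarrow> cmod z < exp (x + q ^ 4) \<Longrightarrow> \<not> is_pole f z \<and> f z \<noteq> a\<rbrakk> \<Longrightarrow>
      \<exists>x1 y1. x1 \<ge> Q * x \<and> y1 - x1 \<ge> (1 - step_loss C c / q) * (q ^ 4 / x) * x1 \<and>
        (\<forall>w. w \<noteq> 0 \<and> x1 \<le> ln (cmod w) \<and> ln (cmod w) \<le> y1 \<longrightarrow> w \<in> f ` {z. exp x < cmod z \<and> cmod z < exp (x + q ^ 4)})"
proof -
  obtain \<Lambda> where \<Lambda>: "covering_const \<Lambda>" using covering_const_exists by blast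
  obtain K where K: "K \<ge> 0"
    "\<And>x y. \<lbrakk>0 \<le> x; x < y; \<And>z. exp x < cmod z \<Longrightarrow> cmod z < exp y \<Longrightarrow> \<not> is_pole f z \<and> f z \<noteq> a\<rbrakk> \<Longrightarrow>
      \<exists>F A n. jensen_data a K x y F A n"
    using jensen_strip[of a] by blast
  define K' where "K' = K + ln (1 + cmod a)"
  have K': "K' \<ge> 0" "K' \<ge> K" using K(1) by (auto simp: K'_def)
  define Q1 where "Q1 = max (max Q K') (max (4 * \<Lambda>) 1)"
  have Q1: "Q1 \<ge> Q" "Q1 \<ge> K'" "Q1 \<ge> 4 * \<Lambda>" "Q1 \<ge> 1" by (auto simp: Q1_def)
  obtain t0 where t0: "\<And>F x y t. \<lbrakk>t \<ge> t0; log_strip F x y; x < t; t + ln C < y;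
     \<And>\<zeta>. x < Re \<zeta> \<and> Re \<zeta> < y \<Longrightarrow> exp (F \<zeta>) = f (exp \<zeta>) - a;
     \<And>z. exp x < cmod z \<Longrightarrow> cmod z < exp y \<Longrightarrow> \<not> is_pole f z \<and> f z \<noteq> a\<rbrakk> \<Longrightarrow>
     circle_max F t \<ge> Q1 * t \<or> circle_max F (t + ln C) \<ge> Q1 * (t + ln C)"
    using circle_max_large[of a Q1] by blast
  define M where "M = max t0 (\<bar>ln r\<^sub>0\<bar> + 2 * c + 1 + 2 * cmod a)"
  show ?thesis
  proof (rule that[of M])
    fix x q
    assume x: "x \<ge> M" and q: "q \<ge> step_min C c" "q ^ 4 \<le> x"
      and reg: "\<And>z. exp x < cmod z \<Longrightarrow> cmod z < exp (x + q ^ 4) \<Longrightarrow> \<not> is_pole f z \<and> f z \<noteq> a"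
    have xM: "x \<ge> t0" "x \<ge> \<bar>ln r\<^sub>0\<bar> + 2 * c + 1 + 2 * cmod a" using x by (auto simp: M_def)
    have x1: "x \<ge> 1" "x > ln r\<^sub>0" "x \<ge> 2 * c" "x \<ge> 2 * cmod a" using xM(2) c norm_ge_zero[of a] by linarith+
    have sp: "step_radius C > 7" "step_pole_const C c > 0" using pi_gt3 lnC c by (auto simp: step_radius_def step_pole_const_def)
    have q1: "q \<ge> 1 + ln C" "q \<ge> 2800" using q(1) sp lnC c by (auto simp: step_min_def)
    define y where "y = x + q ^ 4"
    have "q ^ 3 * 2800 \<le> q ^ 3 * q" using q1 by (intro mult_left_mono) auto
    then have q43: "2800 * q ^ 3 \<le> q ^ 4" by (simp add: power4_eq_xxxx power3_eq_cube mult_ac)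
    have q3: "q \<le> q ^ 3" "q ^ 3 > 0" using power_increasing[of 1 3 q] q1 by auto
    define \<tau> where "\<tau> = x + q ^ 3"
    have \<tau>: "x < \<tau>" "\<tau> + ln C < y" "\<tau> + ln C + ln C < y" using q43 q3 q1 lnC unfolding \<tau>_def y_def by linarith+
    have reg': "\<And>z. exp x < cmod z \<Longrightarrow> cmod z < exp y \<Longrightarrow> \<not> is_pole f z \<and> f z \<noteq> a" using reg by (simp add: y_def)
    obtain F A n where JD: "jensen_data a K x y F A n"
      using K(2)[of x y] x1 \<tau> lnC reg' by (smt (verit))
    then have strip: "log_strip F x y" and F: "\<And>\<zeta>. x < Re \<zeta> \<and> Re \<zeta> < y \<Longrightarrow> exp (F \<zeta>) = f (exp \<zeta>) - a"
      and n: "0 \<le> n" and J: "\<And>t. x < t \<and> t < y \<Longrightarrow> circle_mean F t \<le> (A + n) * t + K \<and>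
          (\<forall>s. x < s \<and> s < y \<longrightarrow> circle_mean F t = circle_mean F s + A * (t - s)) \<and>
          n * (t - x) \<le> nevanlinna_N (exp t) f \<and>
          circle_mean F t + nevanlinna_N (exp t) f - K \<le> nevanlinna_T (exp t) f"
      unfolding jensen_data_def by blast+
    have "circle_max F \<tau> \<ge> Q1 * \<tau> \<or> circle_max F (\<tau> + ln C) \<ge> Q1 * (\<tau> + ln C)"
      by (rule t0[OF _ strip \<tau>(1,2) F reg']) (use xM \<tau> in auto)
    then obtain t1 where t1: "t1 = \<tau> \<or> t1 = \<tau> + ln C" "circle_max F t1 \<ge> Q1 * t1" by blast
    have t1x: "x < t1" "t1 < y" "t1 + ln C < y" "t1 \<ge> x" using t1(1) \<tau> lnC by auto
    have "exp (ln r\<^sub>0) < exp t1" using t1x x1(2) by simp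
    then have rt: "exp t1 > r\<^sub>0" using r0 by simp
    have ct: "0 \<le> 1 - c / t1" using t1x x1 c by (simp add: divide_le_eq)
    have J1: "circle_mean F t1 \<le> (A + n) * t1 + K" and J3: "n * (t1 - x) \<le> nevanlinna_N (exp t1) f"
      and J4: "circle_mean F t1 + nevanlinna_N (exp t1) f - K \<le> nevanlinna_T (exp t1) f"
      using J[of t1] t1x(1,2) by blast+
    have J2: "circle_mean F t = circle_mean F t1 + A * (t - t1)" if "x < t" "t < y" for t
      using J[of t] t1x(1,2) that by blast
    have H: "(1 - c / t1) * (circle_mean F t1 + nevanlinna_N (exp t1) f - K') \<le> max (circle_max F (t1 + ln C)) 0 + K'"
    proof -
      have "(1 - c / t1) * (circle_mean F t1 + nevanlinna_N (exp t1) f - K') \<le> (1 - c / t1) * nevanlinna_T (exp t1) f"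
        using J4 K'(2) ct by (intro mult_left_mono) linarith+
      also have "\<dots> \<le> max (circle_max F (t1 + ln C)) 0 + ln (1 + cmod a)"
        by (rule growth_strip[OF strip t1x(1,3) F reg']) (use t1x x1 rt in auto)
      finally show ?thesis using K(1) by (simp add: K'_def)
    qed
    have qs: "q \<ge> 1 + ln C + 2 * c + 400 * (2 * pi + ln C + 1) + 2 * (40 * pi + 1 + (40 * pi + 20 * ln C + 3 + 2 * c))"
      using q(1) by (simp only: step_min_def step_radius_def step_pole_const_def)
    have J1': "circle_mean F t1 \<le> (A + n) * t1 + K'" using J1 K'(2) by linarith
    have t1': "x + q ^ 3 \<le> t1" "t1 \<le> x + q ^ 3 + ln C" using t1(1) lnC by (auto simp: \<tau>_def)
    obtain x1' y1' where s: "x1' \<ge> Q1 * x"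
      "y1' - x1' \<ge> (1 - (step_pole_const C c + 4 + 40 * pi + 1600 * step_radius C) / q) * (q ^ 4 / x) * x1'"
      and cov: "\<And>w. w \<noteq> 0 \<Longrightarrow> x1' \<le> ln (cmod w) \<Longrightarrow> ln (cmod w) \<le> y1' \<Longrightarrow> w \<in> (\<lambda>\<zeta>. exp (F \<zeta>)) ` {\<zeta>. x < Re \<zeta> \<and> Re \<zeta> < y}"
      using log_strip.step_strip[where N = "\<lambda>t. nevanlinna_N (exp t) f", OF strip \<Lambda> c lnC K'(1) n Q1(2,3,4) qs y_def q(2) t1'(1,2) J1' J2 J3 H t1(2)]
      unfolding step_pole_const_def step_radius_def by blast
    define X where "X = x1' + 1"
    have x1'x: "x1' \<ge> x" "x1' \<ge> Q * x"
      using s(1) Q1 x1 mult_right_mono[of 1 Q1 x] mult_right_mono[of Q Q1 x] by linarith+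
    have "X \<ge> Q * x" using x1'x by (simp add: X_def)
    moreover have "(y1' - 1) - X \<ge> (1 - step_loss C c / q) * (q ^ 4 / x) * X"
    proof -
      define r where "r = q ^ 4 / x"
      define k where "k = (step_pole_const C c + 4 + 40 * pi + 1600 * step_radius C) / q"
      have r: "0 \<le> r" "r \<le> 1" using q x1 q43 q3 by (auto simp: r_def divide_le_eq)
      have k0: "k \<ge> 0" using sp q1 pi_gt3 by (auto simp: k_def)
      have q4: "4 / q \<ge> 0" using q1 by simp
      have loss: "step_loss C c / q = k + 4 / q" using q1 by (simp add: step_loss_def k_def field_simps)
      have "r * x1' \<ge> r * x" using r x1'x by (intro mult_left_mono) auto
      then have "4 / q * (r * x1') \<ge> 4 / q * q ^ 4" using x1 q1 by (intro mult_left_mono) (auto simp: r_def)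
      moreover have "4 / q * q ^ 4 = 4 * q ^ 3" using q1 by (simp add: power4_eq_xxxx power3_eq_cube)
      moreover have "(1 - (k + 4 / q)) * r \<le> 1 * 1" using r k0 q4 by (intro mult_mono) linarith+
      moreover have "(1 - (k + 4 / q)) * r * X = (1 - k) * r * x1' - 4 / q * (r * x1') + (1 - (k + 4 / q)) * r"
        by (simp add: X_def algebra_simps add_divide_distrib)
      ultimately show ?thesis using s(2) q3 q1 unfolding loss r_def[symmetric] k_def[symmetric] X_def by linarith
    qed
    moreover have "w \<in> f ` {z. exp x < cmod z \<and> cmod z < exp (x + q ^ 4)}"
      if w: "w \<noteq> 0" "X \<le> ln (cmod w)" "ln (cmod w) \<le> y1' - 1" for w
    proof -
      have "2 * cmod a \<le> ln (cmod w)" using x1 x1'x w by (simp add: X_def)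
      also have "\<dots> \<le> cmod w" using ln_le_minus_one[of "cmod w"] w by simp
      finally have d: "w - a \<noteq> 0" "\<bar>ln (cmod (w - a)) - ln (cmod w)\<bar> \<le> 1" using ln_norm_diff[of a w] w by auto
      have "w - a \<in> (\<lambda>\<zeta>. exp (F \<zeta>)) ` {\<zeta>. x < Re \<zeta> \<and> Re \<zeta> < y}"
        by (rule cov[OF d(1)]) (use d(2) w in \<open>auto simp: X_def\<close>)
      then obtain \<zeta> where \<zeta>: "x < Re \<zeta>" "Re \<zeta> < y" "w - a = exp (F \<zeta>)" by auto
      then have "w = f (exp \<zeta>)" using F[of \<zeta>] by simp
      then show ?thesis using \<zeta> by (intro image_eqI[of _ _ "exp \<zeta>"]) (auto simp: y_def)
    qed
    ultimately show "\<exists>x1 y1. x1 \<ge> Q * x \<and> y1 - x1 \<ge> (1 - step_loss C c / q) * (q ^ 4 / x) * x1 \<and>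
        (\<forall>w. w \<noteq> 0 \<and> x1 \<le> ln (cmod w) \<and> ln (cmod w) \<le> y1 \<longrightarrow> w \<in> f ` {z. exp x < cmod z \<and> cmod z < exp (x + q ^ 4)})"
      by blast
  qed
qed

end

text \<open>Since |f - a| \<ge> 1 on the annulus, Harnack's inequality on discs of radius L/4 makes
  log |f - a| equal to its circular mean up to a factor 1 + O(1/L). The mean is affine in t with
  slope A, and because few poles are enclosed, A t is at least 1 - O(1/L) times the mean at t. Hence
  the mean grows at least almost proportionally to t.\<close>

lemma (in growth_function) annulus_growth_ratio:
  assumes B: "B \<ge> 1"
  obtains M t0 where "M \<ge> 0"
    "\<And>x L z z'. \<lbrakk>x \<ge> t0; L \<ge> M;
        \<And>z. exp x < cmod z \<Longrightarrow> cmod z < exp (x + L) \<Longrightarrow> \<not> is_pole f z \<and> f z \<noteq> a \<and> 2 * cmod a + 2 \<le> cmod (f z);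
        z \<noteq> 0; z' \<noteq> 0; x + L / 4 \<le> ln (cmod z); ln (cmod z) \<le> ln (cmod z'); ln (cmod z') \<le> x + L - L / 4;
        ln (cmod z) \<le> B * L; ln (cmod z) \<le> ln (cmod (f z))\<rbrakk> \<Longrightarrow>
      ln (cmod (f z')) \<ge> ln (cmod z') / ln (cmod z) * (1 - M / L) * ln (cmod (f z))"
proof -
  obtain K where K: "K \<ge> 0"
    "\<And>x y. \<lbrakk>0 \<le> x; x < y; \<And>z. exp x < cmod z \<Longrightarrow> cmod z < exp y \<Longrightarrow> \<not> is_pole f z \<and> f z \<noteq> a\<rbrakk> \<Longrightarrow>
      \<exists>F A n. jensen_data a K x y F A n"
    using jensen_strip[of a] by blast
  define la where "la = ln (1 + cmod a)"
  have la: "la \<ge> 0" by (simp add: la_def)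
  define d where "d = pi + ln C"
  have d: "d > 0" "d \<ge> pi" using lnC pi_gt_zero by (simp_all add: d_def add_pos_nonneg)
  define K3 where "K3 = 2 * la + K"
  have K3: "K3 \<ge> 0" using la K by (simp add: K3_def)
  define M2 where "M2 = 16 * (d + c + K3)"
  have M2: "M2 > 0" using d c K3 by (simp add: M2_def)
  define M3 where "M3 = 16 * K + 4 * M2 * B"
  have M3: "M3 > 0" using M2 B K by (simp add: M3_def add_nonneg_pos)
  define M where "M = M3 + 32 * d + 8 * c + 16"
  have M: "M > 0" using M3 d c by (simp add: M_def)
  show ?thesis
  proof (rule that[of M "\<bar>ln r\<^sub>0\<bar> + 1"])
    show "M \<ge> 0" using M by simp
    fix x L z z'
    assume x: "x \<ge> \<bar>ln r\<^sub>0\<bar> + 1" and L: "L \<ge> M"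
      and reg: "\<And>z. exp x < cmod z \<Longrightarrow> cmod z < exp (x + L) \<Longrightarrow> \<not> is_pole f z \<and> f z \<noteq> a \<and> 2 * cmod a + 2 \<le> cmod (f z)"
      and z0: "z \<noteq> 0" "z' \<noteq> 0" and tz: "x + L / 4 \<le> ln (cmod z)" "ln (cmod z) \<le> ln (cmod z')" "ln (cmod z') \<le> x + L - L / 4"
      and BL: "ln (cmod z) \<le> B * L" and fz: "ln (cmod z) \<le> ln (cmod (f z))"
    define y where "y = x + L"
    define t where "t = ln (cmod z)"
    define t' where "t' = ln (cmod z')"
    have LL: "L \<ge> 32 * d" "L \<ge> 8 * c" "L \<ge> 16" "L \<ge> M3" "L > 0" using L M3 d c by (simp_all add: M_def)
    have x0: "x \<ge> 1" "x > ln r\<^sub>0" using x by linarith+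
    have tt: "x + L / 4 \<le> t" "t \<le> t'" "t' \<le> y - L / 4" using tz by (auto simp: t_def t'_def y_def)
    have lnd: "ln C \<le> d" using pi_gt_zero unfolding d_def by linarith
    have txy: "x < t" "t < y" "x < t'" "t' < y" "t + ln C < y" using tt LL lnd d unfolding y_def by linarith+
    have t4: "t \<ge> L / 4" "t \<ge> 4" "t > 0" using tt x0 LL by linarith+
    obtain F A n where JD: "jensen_data a K x y F A n" using K(2)[of x y] x0 txy reg unfolding y_def by (meson less_trans less_le_trans zero_le_one order_trans)
    then have strip: "log_strip F x y" and F: "\<And>\<zeta>. x < Re \<zeta> \<and> Re \<zeta> < y \<Longrightarrow> exp (F \<zeta>) = f (exp \<zeta>) - a"
      and n: "0 \<le> n" and J: "\<And>t. x < t \<and> t < y \<Longrightarrow> circle_mean F t \<le> (A + n) * t + K \<and>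
          (\<forall>s. x < s \<and> s < y \<longrightarrow> circle_mean F t = circle_mean F s + A * (t - s)) \<and>
          n * (t - x) \<le> nevanlinna_N (exp t) f \<and>
          circle_mean F t + nevanlinna_N (exp t) f - K \<le> nevanlinna_T (exp t) f"
      unfolding jensen_data_def by blast+
    interpret log_strip F x y by (rule strip)
    have J1: "circle_mean F t \<le> (A + n) * t + K" and J3: "n * (t - x) \<le> nevanlinna_N (exp t) f"
      and J4: "circle_mean F t + nevanlinna_N (exp t) f - K \<le> nevanlinna_T (exp t) f"
      using J[of t] txy(1,2) by blast+
    have J2: "circle_mean F t' = circle_mean F t + A * (t' - t)"
      using J[of t'] txy by blast
    have pos: "Re (F \<zeta>) \<ge> 0" if "x < Re \<zeta>" "Re \<zeta> < y" for \<zeta>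
    proof -
      have "exp (Re (F \<zeta>)) = cmod (f (exp \<zeta>) - a)" using F[of \<zeta>] that by (metis norm_exp_eq_Re)
      moreover have "2 * cmod a + 2 \<le> cmod (f (exp \<zeta>))" using reg[of "exp \<zeta>"] that by (simp add: y_def)
      ultimately have "exp (Re (F \<zeta>)) \<ge> 1" using norm_triangle_ineq2[of "f (exp \<zeta>)" a] norm_ge_zero[of a] by linarith
      then show ?thesis by simp
    qed
    \<comment> \<open>The relative Harnack error in a disc of radius L/4 at distance at most d =
      \<pi> + ln C. This distance allows for half a turn of the circle and for the passage from e^t
      to C e^t.\<close>
    define e where "e = 16 * d / L"
    have e: "0 < e" "e \<le> 1" using d LL by (auto simp: e_def divide_le_eq)
    have hk: "Re (F \<zeta>2) \<le> (1 + e) * Re (F \<zeta>1)"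
      if \<zeta>: "x + L / 4 \<le> Re \<zeta>1" "Re \<zeta>1 \<le> y - L / 4" "dist \<zeta>1 \<zeta>2 \<le> d" for \<zeta>1 \<zeta>2
    proof -
      define R where "R = L / 4"
      have R: "R \<ge> 8 * d" "R > 0" using LL by (auto simp: R_def)
      define r where "r = dist \<zeta>1 \<zeta>2"
      have r: "0 \<le> r" "r \<le> d" using that by (auto simp: r_def)
      have sub: "ball \<zeta>1 R \<subseteq> {\<zeta>. x < Re \<zeta> \<and> Re \<zeta> < y}" by (rule ball_subset_strip) (use that in \<open>auto simp: R_def\<close>)
      have "Re (F \<zeta>2) \<le> (R + r) / (R - r) * Re (F \<zeta>1)"
        unfolding r_def by (rule harnack_ball(2)[OF holomorphic_on_subset[OF holo sub]]) (use sub pos r R d in \<open>auto simp: r_def[symmetric]\<close>)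
      also have "\<dots> \<le> (1 + e) * Re (F \<zeta>1)"
      proof (rule mult_right_mono)
        have eR: "e * R = 4 * d" using LL by (simp add: e_def R_def)
        have "e * r \<le> e * R / 2" using e r R d by simp
        then have "R + r \<le> (1 + e) * (R - r)" using eR r by (simp add: algebra_simps)
        then show "(R + r) / (R - r) \<le> 1 + e" using r R d by (simp add: pos_divide_le_eq)
        show "0 \<le> Re (F \<zeta>1)" by (rule pos) (use that LL in auto)
      qed
      finally show ?thesis .
    qed
    have circ: "Re (F (Complex (s + g) \<theta>)) \<le> (1 + e) * Re (F (Complex s \<theta>'))"
      if s: "x + L / 4 \<le> s" "s \<le> y - L / 4" "0 \<le> g" "g \<le> ln C" for s g \<theta> \<theta>'
    proof -
      have sxy: "x < s + g" "s + g < y" using s LL lnd d by linarith+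
      obtain \<theta>2 where \<theta>2: "\<bar>\<theta>2 - \<theta>'\<bar> \<le> pi" "\<And>t. x < t \<Longrightarrow> t < y \<Longrightarrow> Re (F (Complex t \<theta>2)) = Re (F (Complex t \<theta>))"
        using angle_near[OF sxy, of \<theta>' \<theta>] by blast
      have "dist (Complex s \<theta>') (Complex (s + g) \<theta>2) \<le> \<bar>s - (s + g)\<bar> + \<bar>\<theta>' - \<theta>2\<bar>"
        unfolding dist_norm using cmod_le[of "Complex s \<theta>' - Complex (s + g) \<theta>2"] by simp
      also have "\<dots> \<le> d" using \<theta>2(1) s by (simp add: d_def)
      finally have "Re (F (Complex (s + g) \<theta>2)) \<le> (1 + e) * Re (F (Complex s \<theta>'))" using s by (intro hk) auto
      then show ?thesis using \<theta>2(2)[OF sxy] by simp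
    qed
    define I where "I = circle_mean F t"
    define I' where "I' = circle_mean F t'"
    obtain \<theta>z where \<theta>z: "exp (Complex t \<theta>z) = z"
      using z0 by (metis t_def exp_Ln complex_surj Re_Ln)
    obtain \<theta>w where \<theta>w: "exp (Complex t' \<theta>w) = z'"
      using z0 by (metis t'_def exp_Ln complex_surj Re_Ln)
    define uz where "uz = Re (F (Complex t \<theta>z))"
    define uw where "uw = Re (F (Complex t' \<theta>w))"
    have tm: "t \<le> y - L / 4" "x + L / 4 \<le> t'" using tt by auto
    have Iz: "uz \<le> (1 + e) * I"
    proof -
      have "I \<ge> uz / (1 + e)" unfolding I_def
        by (rule circle_mean_ge[OF txy(1,2)]) (use circ[OF tt(1) tm(1), of 0 \<theta>z] lnC e in \<open>simp add: uz_def pos_divide_le_eq mult.commute\<close>)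
      then show ?thesis using e by (simp add: pos_divide_le_eq mult.commute)
    qed
    have Iw: "I' \<le> (1 + e) * uw" unfolding I'_def
      by (rule circle_mean_le[OF txy(3,4)]) (use circ[OF tm(2) tt(3), of 0 _ \<theta>w] lnC in \<open>simp add: uw_def\<close>)
    have lnu: "\<bar>Re (F (Complex s \<theta>)) - ln (cmod (f (exp (Complex s \<theta>))))\<bar> \<le> 1" if "x < s" "s < y" for s \<theta>
    proof -
      let ?w = "f (exp (Complex s \<theta>))"
      have b: "2 * cmod a + 2 \<le> cmod ?w" using reg[of "exp (Complex s \<theta>)"] that by (simp add: y_def)
      have "2 * cmod a \<le> cmod ?w" using b by linarith
      moreover have "?w \<noteq> 0" using b norm_ge_zero[of a] by force
      ultimately have "\<bar>ln (cmod (?w - a)) - ln (cmod ?w)\<bar> \<le> 1" by (rule ln_norm_diff(2))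
      moreover have "cmod (?w - a) = exp (Re (F (Complex s \<theta>)))" using F[of "Complex s \<theta>"] that by (metis norm_exp_eq_Re complex.sel(1))
      ultimately show ?thesis by simp
    qed
    have lz: "\<bar>uz - ln (cmod (f z))\<bar> \<le> 1" using lnu[OF txy(1,2), of \<theta>z] by (simp add: uz_def \<theta>z)
    have lw: "\<bar>uw - ln (cmod (f z'))\<bar> \<le> 1" using lnu[OF txy(3,4), of \<theta>w] by (simp add: uw_def \<theta>w)
    have fzt: "ln (cmod (f z)) \<ge> t" using fz by (simp add: t_def)
    have I16: "I \<ge> L / 16"
    proof -
      have "t / 2 \<le> uz" using lz fzt t4 by linarith
      also have "\<dots> \<le> (1 + e) * I" by (rule Iz)
      finally have a1: "t / 2 \<le> (1 + e) * I" .
      then have "0 < (1 + e) * I" using t4 by linarith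
      then have "0 \<le> I" using e by (simp add: zero_less_mult_iff)
      then have "(1 + e) * I \<le> 2 * I" using e by (intro mult_right_mono) auto
      then show ?thesis using a1 t4 by linarith
    qed
    have I0: "I > 0" using I16 LL by linarith
    have "circle_max F (t + ln C) \<le> (1 + e) * I"
    proof -
      obtain \<theta> where \<theta>: "Re (F (Complex (t + ln C) \<theta>)) = circle_max F (t + ln C)"
        using circle_max_attained[of "t + ln C"] txy lnC by auto
      have "I \<ge> circle_max F (t + ln C) / (1 + e)" unfolding I_def
        by (rule circle_mean_ge[OF txy(1,2)]) (use circ[OF tt(1) tm(1), of "ln C" \<theta>] lnC e \<theta> in \<open>simp add: pos_divide_le_eq mult.commute\<close>)
      then show ?thesis using e by (simp add: pos_divide_le_eq mult.commute)
    qed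
    then have max0: "max (circle_max F (t + ln C)) 0 \<le> (1 + e) * I" using e I0 by simp
    define \<epsilon> where "\<epsilon> = c / t"
    have \<epsilon>: "0 < \<epsilon>" "\<epsilon> \<le> 1 / 2" "\<epsilon> \<le> 4 * c / L"
    proof -
      show "0 < \<epsilon>" using c t4 by (simp add: \<epsilon>_def)
      have "c / t \<le> c / (L / 4)" using c t4 LL by (intro divide_left_mono) auto
      then show le: "\<epsilon> \<le> 4 * c / L" by (simp add: \<epsilon>_def mult.commute)
      have "4 * c / L \<le> 1 / 2" using LL by (simp add: pos_divide_le_eq)
      then show "\<epsilon> \<le> 1 / 2" using le by linarith
    qed
    define N where "N = nevanlinna_N (exp t) f"
    have "(1 - \<epsilon>) * (I + N - K) \<le> (1 + e) * I + la"
    proof -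
      have "(1 - \<epsilon>) * (I + N - K) \<le> (1 - \<epsilon>) * nevanlinna_T (exp t) f"
        using J4 \<epsilon> by (intro mult_left_mono) (auto simp: I_def N_def)
      also have "\<dots> \<le> max (circle_max F (t + ln C)) 0 + ln (1 + cmod a)"
        unfolding \<epsilon>_def
      proof (rule growth_strip[OF strip txy(1,5) F])
        show "\<And>z. exp x < cmod z \<Longrightarrow> cmod z < exp y \<Longrightarrow> \<not> is_pole f z \<and> f z \<noteq> a" using reg by (simp add: y_def)
        have "exp (ln r\<^sub>0) < exp t" using x0 txy by simp
        then show "r\<^sub>0 < exp t" using r0 by simp
      qed (use t4 in auto)
      finally show ?thesis using max0 unfolding la_def by linarith
    qed
    moreover have R0: "(1 + e) * I + la \<ge> 0" using e I0 la by simp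
    have "(1 - \<epsilon>) * (1 + 2 * \<epsilon>) \<ge> 1"
    proof -
      have "\<epsilon> * \<epsilon> \<le> \<epsilon> * (1 / 2)" using \<epsilon> by (intro mult_left_mono) auto
      then show ?thesis by (simp add: algebra_simps)
    qed
    from mult_right_mono[OF this R0] have "(1 + e) * I + la \<le> (1 - \<epsilon>) * ((1 + 2 * \<epsilon>) * ((1 + e) * I + la))"
      by (simp only: mult_1 mult.assoc)
    ultimately have "(1 - \<epsilon>) * (I + N - K) \<le> (1 - \<epsilon>) * ((1 + 2 * \<epsilon>) * ((1 + e) * I + la))" by linarith
    moreover have "0 < 1 - \<epsilon>" using \<epsilon> by linarith
    ultimately have IN: "I + N - K \<le> (1 + 2 * \<epsilon>) * ((1 + e) * I + la)" by (simp only: mult_le_cancel_left_pos)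
    \<comment> \<open>The maximum on |z| = C e^t exceeds the mean on |z| = e^t by a factor 1 + e at
      most, so the growth hypothesis leaves only a fraction O(1/L) of the mean for N. Additive
      constants are such a fraction as well, since I \<ge> L/16.\<close>
    have NI: "N \<le> (M2 / L) * I"
    proof -
      have "(1 + 2 * \<epsilon>) * ((1 + e) * I + la) = I + (e + 2 * \<epsilon> + 2 * \<epsilon> * e) * I + (1 + 2 * \<epsilon>) * la" by (simp add: algebra_simps)
      also have "\<dots> \<le> I + (e + 4 * \<epsilon>) * I + 2 * la"
      proof -
        have "2 * \<epsilon> * e \<le> 2 * \<epsilon> * 1" using e \<epsilon> by (intro mult_left_mono) auto
        then have "e + 2 * \<epsilon> + 2 * \<epsilon> * e \<le> e + 4 * \<epsilon>" by simp
        from mult_right_mono[OF this, of I] I0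
        have "(e + 2 * \<epsilon> + 2 * \<epsilon> * e) * I \<le> (e + 4 * \<epsilon>) * I" by simp
        moreover have "(1 + 2 * \<epsilon>) * la \<le> 2 * la" using \<epsilon> la by (intro mult_right_mono) auto
        ultimately show ?thesis by linarith
      qed
      finally have a1: "N \<le> (e + 4 * \<epsilon>) * I + K3" using IN by (simp add: K3_def)
      have "(e + 4 * \<epsilon>) * I \<le> (16 * d / L + 4 * (4 * c / L)) * I"
        using \<epsilon>(3) I0 by (intro mult_right_mono) (auto simp: e_def)
      moreover have "K3 * 1 \<le> K3 * (16 * I / L)" using K3 I16 LL by (intro mult_left_mono) (auto simp: pos_le_divide_eq)
      ultimately have "N \<le> (16 * d / L + 4 * (4 * c / L)) * I + K3 * (16 * I / L)" using a1 by linarith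
      also have "\<dots> = (M2 / L) * I" using LL by (simp add: M2_def field_simps)
      finally show ?thesis .
    qed
    define m where "m = M3 / L"
    have m: "0 < m" "m \<le> 1" using M3 LL by (auto simp: m_def)
    \<comment> \<open>From n L/4 \<le> N follows n = O(I / L^2). As t \<le> B L, the term n t of
      Jensen's formula is O(I / L).\<close>
    have At: "A * t \<ge> I * (1 - m)"
    proof -
      have "n * (L / 4) \<le> n * (t - x)" using n tt by (intro mult_left_mono) auto
      then have "n * (L / 4) \<le> (M2 / L) * I" using J3 NI unfolding N_def by linarith
      moreover have "n * L = 4 * (n * (L / 4))" by simp
      ultimately have "n * L \<le> 4 * ((M2 / L) * I)" by linarith
      then have "n * L \<le> 4 * (M2 / L) * I" by (simp only: mult.assoc)
      then have "(n * L) * B \<le> (4 * (M2 / L) * I) * B" using B by (intro mult_right_mono) auto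
      moreover have "n * t \<le> n * (B * L)" using n BL by (intro mult_left_mono) (auto simp: t_def)
      ultimately have nt: "n * t \<le> 4 * (M2 / L) * B * I" by (simp add: mult_ac)
      have "K * 1 \<le> K * (16 * I / L)" using K I16 LL by (intro mult_left_mono) (auto simp: pos_le_divide_eq)
      moreover have "A * t \<ge> I - K - n * t" using J1 by (simp add: I_def distrib_right)
      ultimately have "A * t \<ge> I - K * (16 * I / L) - 4 * (M2 / L) * B * I" using nt by linarith
      also have "I - K * (16 * I / L) - 4 * (M2 / L) * B * I = I * (1 - m)" using LL by (simp add: m_def M3_def field_simps)
      finally show ?thesis .
    qed
    define \<rho> where "\<rho> = t' / t"
    have \<rho>: "\<rho> \<ge> 1" using tt t4 by (simp add: \<rho>_def)
    have I'I: "I' \<ge> I * (1 - m) * \<rho>"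
    proof -
      have "I' = I + A * (t' - t)" using J2 by (simp add: I'_def I_def)
      then have "I' * t = (I + A * (t' - t)) * t" by simp
      also have "\<dots> = I * t + (A * t) * (t' - t)" by (simp add: algebra_simps)
      also have "\<dots> \<ge> I * (1 - m) * t + (I * (1 - m)) * (t' - t)"
      proof (intro add_mono mult_right_mono)
        show "I * (1 - m) \<le> I" using I0 m by simp
      qed (use At tt t4 in auto)
      finally have "I * (1 - m) * t' \<le> I' * t" by (simp add: algebra_simps)
      then show ?thesis using t4 by (simp add: \<rho>_def pos_divide_le_eq)
    qed
    define k where "k = 1 - m - 2 * e"
    have k1: "k \<le> 1" using m e by (simp add: k_def)
    have uw: "uw \<ge> uz * k * \<rho>"
    proof (cases "k \<ge> 0")
      case True
      have uz0: "uz \<ge> 0" using lz fzt t4 by linarith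
      have "k * ((1 + e) * (1 + e)) \<le> 1 - m"
      proof -
        have "(1 - 2 * e) * ((1 + e) * (1 + e)) = 1 - 3 * (e * e) - 2 * (e * e * e)" by (simp add: algebra_simps)
        also have "\<dots> \<le> 1"
        proof -
          have "0 \<le> e * e" "0 \<le> e * e * e" using e by simp_all
          then show ?thesis by linarith
        qed
        finally have "(1 - 2 * e) * ((1 + e) * (1 + e)) \<le> 1" .
        moreover have "m * 1 \<le> m * ((1 + e) * (1 + e))" using m e mult_mono[of 1 "1 + e" 1 "1 + e"] by (intro mult_left_mono) auto
        moreover have "k * ((1 + e) * (1 + e)) = (1 - 2 * e) * ((1 + e) * (1 + e)) - m * ((1 + e) * (1 + e))" by (simp add: k_def algebra_simps)
        ultimately show ?thesis by linarith
      qed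
      then have "I * (k * ((1 + e) * (1 + e)) * \<rho>) \<le> I * ((1 - m) * \<rho>)" using I0 \<rho> by (intro mult_left_mono mult_right_mono) auto
      also have "\<dots> \<le> (1 + e) * uw" using I'I Iw by (simp add: mult.assoc)
      finally have "(1 + e) * (k * \<rho> * ((1 + e) * I)) \<le> (1 + e) * uw" by (simp add: mult_ac)
      then have "k * \<rho> * ((1 + e) * I) \<le> uw" using e by (subst (asm) mult_le_cancel_left_pos) auto
      moreover have "k * \<rho> * uz \<le> k * \<rho> * ((1 + e) * I)" using Iz True \<rho> by (intro mult_left_mono) auto
      ultimately show ?thesis by (simp add: mult_ac)
    next
      case False
      have "uz * k * \<rho> \<le> 0" using False lz fzt t4 \<rho> by (intro mult_nonpos_nonneg mult_nonneg_nonpos) auto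
      moreover have "uw \<ge> 0" unfolding uw_def by (rule pos) (use txy in auto)
      ultimately show ?thesis by linarith
    qed
    define l where "l = ln (cmod (f z))"
    have "ln (cmod (f z')) \<ge> \<rho> * (k - 8 / L) * l"
    proof -
      have l: "l \<ge> L / 4" "l - 1 \<le> uz" "uz \<le> l + 1" using fzt t4 lz by (auto simp: l_def)
      have lk: "uz * k \<ge> l * k - 1"
      proof -
        have "\<bar>(uz - l) * k\<bar> \<le> 1 * 1"
        proof -
          have "e \<le> 1 / 2" using LL by (simp add: e_def divide_le_eq)
          then have "\<bar>k\<bar> \<le> 1" using k1 m e unfolding k_def by linarith
          then show ?thesis unfolding abs_mult using lz by (intro mult_mono) (auto simp: l_def)
        qed
        then show ?thesis by (simp add: left_diff_distrib abs_le_iff)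
      qed
      have "1 \<le> (4 / L) * l" using l LL by (simp add: field_simps)
      then have "\<rho> * 2 \<le> \<rho> * ((8 / L) * l)" using \<rho> by (intro mult_left_mono) auto
      moreover have "(l * k - 1) * \<rho> \<le> uz * k * \<rho>" using lk \<rho> by (intro mult_right_mono) auto
      moreover have "(l * k - 1) * \<rho> = \<rho> * (l * k) - \<rho>" by (simp add: algebra_simps)
      ultimately have "uw - 1 \<ge> \<rho> * (l * k) - \<rho> * ((8 / L) * l)" using uw \<rho> by linarith
      then show ?thesis using lw by (simp add: algebra_simps)
    qed
    moreover have "\<rho> * (1 - M / L) * l \<le> \<rho> * (k - 8 / L) * l"
    proof (intro mult_right_mono mult_left_mono)
      have "M / L = m + 2 * e + (8 * c + 16) / L" by (simp add: M_def m_def e_def add_divide_distrib)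
      moreover have "(8 * c + 16) / L \<ge> 8 / L" using c LL by (intro divide_right_mono) auto
      ultimately show "1 - M / L \<le> k - 8 / L" by (simp add: k_def)
    qed (use \<rho> fzt t4 in \<open>auto simp: l_def\<close>)
    ultimately show "ln (cmod (f z')) \<ge> ln (cmod z') / ln (cmod z) * (1 - M / L) * ln (cmod (f z))"
      by (simp add: \<rho>_def t_def t'_def l_def)
  qed
qed

section \<open>Spherical normal families\<close>

text \<open>The convergence arguments below use the chordal metric only through these facts on
  bounded values. The number e is a quarter of 2 / (1 + M'), a lower bound for the chordal distance
  from the disc |a| \<le> M' to infinity.\<close>

lemma chordal_close_bounded:
  obtains e B :: real where "e > 0"
    "\<And>a b. cmod a \<le> M \<Longrightarrow> chordal (Some a) (Some b) < e \<Longrightarrow> cmod b \<le> B"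
    "\<And>a b. cmod b \<le> M \<Longrightarrow> chordal (Some a) (Some b) < e \<Longrightarrow> cmod a \<le> B"
    "\<And>a. cmod a \<le> M \<Longrightarrow> \<not> chordal (Some a) None < e"
proof -
  define M' where "M' = max M 0"
  define e where "e = 1 / (2 * (1 + M'))"
  have M': "M' \<ge> 0" "M \<le> M'" by (auto simp: M'_def)
  have sq: "sqrt (1 + (cmod z)\<^sup>2) \<le> 1 + cmod z" "0 < sqrt (1 + (cmod z)\<^sup>2)" for z :: complex
  proof -
    have "1 + (cmod z)\<^sup>2 \<le> (1 + cmod z)\<^sup>2" by (simp add: power2_sum)
    from real_sqrt_le_mono[OF this] show "sqrt (1 + (cmod z)\<^sup>2) \<le> 1 + cmod z" by simp
    show "0 < sqrt (1 + (cmod z)\<^sup>2)" by (simp add: add_pos_nonneg)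
  qed
  have key: "cmod b \<le> 2 * M' + 2" if a: "cmod a \<le> M" and ch: "chordal (Some a) (Some b) < e" for a b
  proof (rule ccontr)
    assume "\<not> ?thesis"
    then have b: "cmod b > 2 * M' + 2" by simp
    have "cmod b / 2 \<le> cmod (a - b)" using norm_triangle_ineq2[of b a] a b M' by (simp add: norm_minus_commute)
    moreover have "sqrt (1 + (cmod a)\<^sup>2) * sqrt (1 + (cmod b)\<^sup>2) \<le> (1 + M') * (2 * cmod b)"
      using sq(1)[of a] sq(1)[of b] sq(2)[of a] sq(2)[of b] a b M' by (intro mult_mono) auto
    ultimately have "2 * (cmod b / 2) / ((1 + M') * (2 * cmod b)) \<le> 2 * cmod (a - b) / (sqrt (1 + (cmod a)\<^sup>2) * sqrt (1 + (cmod b)\<^sup>2))"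
      using sq(2)[of a] sq(2)[of b] by (intro frac_le) auto
    moreover have "2 * (cmod b / 2) / ((1 + M') * (2 * cmod b)) = e"
    proof -
      have "2 * (cmod b / 2) / ((1 + M') * (2 * cmod b)) = cmod b / (cmod b * (2 * (1 + M')))" by (simp add: mult_ac)
      also have "\<dots> = e" using b M' unfolding e_def by (subst nonzero_divide_mult_cancel_left) auto
      finally show ?thesis .
    qed
    ultimately show False using ch by simp
  qed
  show ?thesis
  proof (rule that[of e "2 * M' + 2"])
    show "e > 0" using M' by (simp add: e_def)
    show "cmod b \<le> 2 * M' + 2" if "cmod a \<le> M" "chordal (Some a) (Some b) < e" for a b using key[OF that] .
    show "cmod a \<le> 2 * M' + 2" if "cmod b \<le> M" "chordal (Some a) (Some b) < e" for a b
      using key[of b a] that by (simp add: norm_minus_commute mult.commute)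
    show "\<not> chordal (Some a) None < e" if "cmod a \<le> M" for a
    proof -
      have "1 / (2 * (1 + M')) \<le> 2 / sqrt (1 + (cmod a)\<^sup>2)"
        using sq[of a] that M' by (intro frac_le) auto
      then show ?thesis by (simp add: e_def)
    qed
  qed
qed

definition chordal_limit :: "complex set \<Rightarrow> (nat \<Rightarrow> complex \<Rightarrow> complex) \<Rightarrow> (complex \<Rightarrow> csphere) \<Rightarrow> bool" where
  "chordal_limit V h g \<longleftrightarrow> (\<forall>K. compact K \<and> K \<subseteq> V \<longrightarrow>
     (\<forall>e>0. \<forall>\<^sub>F n in sequentially. \<forall>z\<in>K. chordal (Some (h n z)) (g z) < e))"

text \<open>The index sequences m are arbitrary and may repeat, as in the definition of a normal
  family of iterates. The condition is local, so that it can be read off near each point of the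
  Fatou set.\<close>

definition sphere_normal :: "complex set \<Rightarrow> (nat \<Rightarrow> complex \<Rightarrow> complex) \<Rightarrow> bool" where
  "sphere_normal W h \<longleftrightarrow> (\<forall>z\<in>W. \<exists>V. open V \<and> z \<in> V \<and> V \<subseteq> W \<and>
     (\<forall>m :: nat \<Rightarrow> nat. \<exists>k g. strict_mono k \<and> chordal_limit V (\<lambda>i. h (m (k i))) g))"

lemma chordal_limit_subset: "chordal_limit V h g \<Longrightarrow> V' \<subseteq> V \<Longrightarrow> chordal_limit V' h g"
  unfolding chordal_limit_def by (meson subset_trans)

text \<open>The limit g is not assumed to be continuous. The bound passes from
  \<open>h (j i) (q i)\<close> to \<open>g (q i)\<close> and from there to \<open>h n (q i)\<close>
  for each fixed large n; only then does \<open>q i\<close> tend to p.\<close>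

lemma chordal_limit_bounded:
  assumes lim: "chordal_limit V h g" and V: "open V" "p \<in> V"
    and hol: "\<And>n. h n holomorphic_on V"
    and q: "q \<longlonglongrightarrow> p" and j: "filterlim j at_top sequentially"
    and bd: "\<forall>\<^sub>F i in sequentially. cmod (h (j i) (q i)) \<le> M"
  obtains B where "\<forall>\<^sub>F n in sequentially. cmod (h n p) \<le> B"
proof -
  obtain r where r: "r > 0" "cball p r \<subseteq> V" using V open_contains_cball by blast
  obtain e B where e: "e > 0" "\<And>a b. cmod a \<le> M \<Longrightarrow> chordal (Some a) (Some b) < e \<Longrightarrow> cmod b \<le> B"
    "\<And>a. cmod a \<le> M \<Longrightarrow> \<not> chordal (Some a) None < e"
    using chordal_close_bounded[of M] by metis
  obtain e' B' where e': "e' > 0" "\<And>a b. cmod b \<le> B \<Longrightarrow> chordal (Some a) (Some b) < e' \<Longrightarrow> cmod a \<le> B'"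
    using chordal_close_bounded[of B] by metis
  have ev: "\<forall>\<^sub>F n in sequentially. \<forall>z\<in>cball p r. chordal (Some (h n z)) (g z) < e0" if "e0 > 0" for e0
    using lim r that unfolding chordal_limit_def by auto
  have "\<forall>\<^sub>F i in sequentially. \<forall>z\<in>cball p r. chordal (Some (h (j i) z)) (g z) < e"
    using filterlim_iff[THEN iffD1, OF j] ev[OF e(1)] by blast
  moreover have qb: "\<forall>\<^sub>F i in sequentially. q i \<in> cball p r"
    using tendstoD[OF q r(1)] by eventually_elim (simp add: dist_commute less_imp_le)
  ultimately have gq: "\<forall>\<^sub>F i in sequentially. \<exists>b. g (q i) = Some b \<and> cmod b \<le> B"
    using bd
  proof eventually_elim
    case (elim i)
    then have ch: "chordal (Some (h (j i) (q i))) (g (q i)) < e" by blast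
    with e(3)[OF elim(3)] have "g (q i) \<noteq> None" by metis
    then show ?case using e(2)[OF elim(3)] ch by force
  qed
  show ?thesis
  proof (rule that[of B'], use ev[OF e'(1)] in eventually_elim)
    case (elim n)
    have "\<forall>\<^sub>F i in sequentially. cmod (h n (q i)) \<le> B'"
      using gq qb by eventually_elim (use elim e'(2) in force)
    moreover have "isCont (h n) p"
      using hol V holomorphic_on_imp_continuous_on continuous_on_eq_continuous_at by blast
    then have "(\<lambda>i. cmod (h n (q i))) \<longlonglongrightarrow> cmod (h n p)"
      using q by (intro tendsto_norm isCont_tendsto_compose[of p "h n"])
    ultimately show ?case using tendsto_upperbound sequentially_bot by blast
  qed
qed

lemma chordal_limit_unbounded:
  assumes lim: "chordal_limit V h g" and V: "open V" "p \<in> V"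
    and hol: "\<And>n. h n holomorphic_on V"
    and q: "q \<longlonglongrightarrow> p" and j: "filterlim j at_top sequentially"
    and ub: "filterlim (\<lambda>i. cmod (h (j i) (q i))) at_top sequentially"
  shows "filterlim (\<lambda>n. cmod (h n p)) at_top sequentially"
  unfolding filterlim_at_top
proof
  fix M :: real
  obtain r where r: "r > 0" "cball p r \<subseteq> V" using V open_contains_cball by blast
  obtain e B where e: "e > 0" "\<And>a b. cmod a \<le> M \<Longrightarrow> chordal (Some a) (Some b) < e \<Longrightarrow> cmod b \<le> B"
    "\<And>a. cmod a \<le> M \<Longrightarrow> \<not> chordal (Some a) None < e"
    using chordal_close_bounded[of M] by metis
  obtain e' B' where e': "e' > 0" "\<And>a b. cmod b \<le> B \<Longrightarrow> chordal (Some a) (Some b) < e' \<Longrightarrow> cmod a \<le> B'"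
    using chordal_close_bounded[of B] by metis
  have ev: "\<forall>\<^sub>F n in sequentially. \<forall>z\<in>cball p r. chordal (Some (h n z)) (g z) < e0" if "e0 > 0" for e0
    using lim r that unfolding chordal_limit_def by auto
  have qb: "\<forall>\<^sub>F i in sequentially. q i \<in> cball p r"
    using tendstoD[OF q r(1)] by eventually_elim (simp add: dist_commute less_imp_le)
  have evj: "\<forall>\<^sub>F i in sequentially. \<forall>z\<in>cball p r. chordal (Some (h (j i) z)) (g z) < e'"
    using filterlim_iff[THEN iffD1, OF j] ev[OF e'(1)] by blast
  show "\<forall>\<^sub>F n in sequentially. M \<le> cmod (h n p)"
    using ev[OF e(1)]
  proof eventually_elim
    case (elim n)
    show ?case
    proof (rule ccontr)
      assume "\<not> ?case"
      then have lt: "cmod (h n p) < M" by simp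
      have "isCont (h n) p"
        using hol V holomorphic_on_imp_continuous_on continuous_on_eq_continuous_at by blast
      then have "(\<lambda>i. cmod (h n (q i))) \<longlonglongrightarrow> cmod (h n p)"
        using q by (intro tendsto_norm isCont_tendsto_compose[of p "h n"])
      from order_tendstoD(2)[OF this lt]
      have "\<forall>\<^sub>F i in sequentially. cmod (h n (q i)) < M" .
      moreover have "\<forall>\<^sub>F i in sequentially. cmod (h (j i) (q i)) \<ge> B' + 1"
        using ub unfolding filterlim_at_top by blast
      ultimately have "\<forall>\<^sub>F i in sequentially. False"
        using qb evj
      proof eventually_elim
        case (elim i)
        have ch: "chordal (Some (h n (q i))) (g (q i)) < e" using \<open>\<forall>z\<in>cball p r. chordal (Some (h n z)) (g z) < e\<close> elim by blast
        have "g (q i) \<noteq> None" using e(3)[of "h n (q i)"] ch elim(1) by (metis less_imp_le)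
        then obtain b where b: "g (q i) = Some b" by blast
        have "cmod b \<le> B" using e(2)[of "h n (q i)" b] ch elim(1) b by simp
        then have "cmod (h (j i) (q i)) \<le> B'" using e'(2)[of b "h (j i) (q i)"] elim b by force
        then show ?case using elim by simp
      qed
      then show False by simp
    qed
  qed
qed

lemma chordal_limit_None:
  assumes "chordal_limit V h g" "z \<in> V"
  shows "filterlim (\<lambda>n. cmod (h n z)) at_top sequentially \<Longrightarrow> g z = None"
    and "g z = None \<Longrightarrow> filterlim (\<lambda>n. cmod (h n z)) at_top sequentially"
proof -
  have ev: "\<forall>\<^sub>F n in sequentially. chordal (Some (h n z)) (g z) < e" if "e > 0" for e
    using assms that unfolding chordal_limit_def by (auto dest!: spec[of _ "{z}"])
  show "g z = None" if ub: "filterlim (\<lambda>n. cmod (h n z)) at_top sequentially"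
  proof (rule ccontr)
    assume "g z \<noteq> None"
    then obtain b where b: "g z = Some b" by blast
    obtain e B where e: "e > 0" "\<And>a. chordal (Some a) (Some b) < e \<Longrightarrow> cmod a \<le> B"
      using chordal_close_bounded[of "cmod b"] by (metis order_refl)
    have "\<forall>\<^sub>F n in sequentially. cmod (h n z) \<ge> B + 1" using ub unfolding filterlim_at_top by blast
    with ev[OF e(1)] have "\<forall>\<^sub>F n in sequentially. False"
      by eventually_elim (use e(2) b in force)
    then show False by simp
  qed
  show "filterlim (\<lambda>n. cmod (h n z)) at_top sequentially" if None: "g z = None"
    unfolding filterlim_at_top
  proof
    fix M :: real
    obtain e where e: "e > 0" "\<And>a. cmod a \<le> M \<Longrightarrow> \<not> chordal (Some a) None < e"
      using chordal_close_bounded[of M] by metis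
    show "\<forall>\<^sub>F n in sequentially. M \<le> cmod (h n z)"
      using ev[OF e(1)] by eventually_elim (use e(2) None in force)
  qed
qed

text \<open>Near a point where the limit is infinite, |h n| \<ge> 1 for all large n, so the
  reciprocals are zero-free and subconverge to a function with a zero, which by Hurwitz's theorem
  vanishes identically. Thus the set where the limit is infinite is open; so is its complement, by
  \<open>chordal_limit_unbounded\<close>.\<close>

lemma chordal_limit_const_None:
  assumes lim: "chordal_limit V h g" and V: "open V" "connected V"
    and hol: "\<And>n. h n holomorphic_on V" and z: "z0 \<in> V" "g z0 = None"
  shows "\<forall>z\<in>V. g z = None"
proof -
  define E where "E = {z\<in>V. g z = None}"
  have openE: "\<exists>r>0. \<forall>y\<in>ball z r. y \<in> V \<and> g y = None" if z: "z \<in> E" for z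
  proof -
    have zV: "z \<in> V" and gz: "g z = None" using z by (auto simp: E_def)
    obtain r where r: "r > 0" "cball z r \<subseteq> V" using V zV open_contains_cball by blast
    have "\<exists>r'>0. r' \<le> r \<and> (\<exists>J. \<forall>n\<ge>J. \<forall>u\<in>ball z r'. cmod (h n u) \<ge> 1)"
    proof (rule ccontr)
      assume neg: "\<not> ?thesis"
      have "\<exists>n u. n \<ge> i \<and> u \<in> ball z (r / Suc i) \<and> cmod (h n u) < 1" for i :: nat
    proof -
      have "r * 1 \<le> r * real (Suc i)" using r by (intro mult_left_mono) auto
      then have "r / real (Suc i) \<le> r" "r / real (Suc i) > 0" using r by (auto simp: pos_divide_le_eq)
      then show ?thesis using neg by (metis not_le)
    qed
      then obtain j q where jq: "\<And>i. j i \<ge> i" "\<And>i. q i \<in> ball z (r / Suc i)" "\<And>i. cmod (h (j i) (q i)) < 1" by metis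
      have "q \<longlonglongrightarrow> z"
      proof (rule tendstoI)
        fix e :: real assume e: "e > 0"
        have "(\<lambda>i. r / real (Suc i)) \<longlonglongrightarrow> 0" by (rule LIMSEQ_Suc) (rule lim_const_over_n)
        then have "\<forall>\<^sub>F i in sequentially. r / real (Suc i) < e" using e by (rule order_tendstoD)
        then show "\<forall>\<^sub>F i in sequentially. dist (q i) z < e"
        proof eventually_elim
          case (elim i) then show ?case using jq(2)[of i] unfolding mem_ball by (metis dist_commute less_trans)
        qed
      qed
      moreover have "filterlim j at_top sequentially"
        using jq(1) filterlim_at_top_mono[OF filterlim_ident] by (metis (mono_tags) always_eventually)
      moreover have "\<forall>\<^sub>F i in sequentially. cmod (h (j i) (q i)) \<le> 1" using jq(3) by (simp add: less_imp_le)
      ultimately obtain B where "\<forall>\<^sub>F n in sequentially. cmod (h n z) \<le> B"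
        using chordal_limit_bounded[OF lim V(1) zV hol] by metis
      moreover have "\<forall>\<^sub>F n in sequentially. cmod (h n z) \<ge> B + 1"
        using chordal_limit_None(2)[OF lim zV gz] unfolding filterlim_at_top by blast
      ultimately have "\<forall>\<^sub>F n in sequentially. False" by eventually_elim simp
      then show False by simp
    qed
    then obtain r' J where r': "r' > 0" "r' \<le> r" and J: "\<And>n u. n \<ge> J \<Longrightarrow> u \<in> ball z r' \<Longrightarrow> cmod (h n u) \<ge> 1" by blast
    have sub: "ball z r' \<subseteq> V" using r r' by (meson ball_subset_cball subset_ball subset_trans)
    define k where "k = (\<lambda>n u. inverse (h (n + J) u))"
    have nz: "h (n + J) u \<noteq> 0" if "u \<in> ball z r'" for n u using J[of "n + J" u] that by force
    have hk: "k n holomorphic_on ball z r'" for n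
      unfolding k_def using nz by (intro holomorphic_intros holomorphic_on_subset[OF hol sub]) auto
    have bk: "cmod (k n u) \<le> 1" if "u \<in> ball z r'" for n u
      using J[of "n + J" u] that by (simp add: k_def norm_inverse inverse_le_1_iff)
    obtain G s where G: "G holomorphic_on ball z r'" "strict_mono (s :: nat \<Rightarrow> nat)"
      "\<And>u. u \<in> ball z r' \<Longrightarrow> (\<lambda>n. k (s n) u) \<longlonglongrightarrow> G u"
      "\<And>K. compact K \<Longrightarrow> K \<subseteq> ball z r' \<Longrightarrow> uniform_limit K (k \<circ> s) G sequentially"
    proof (rule Montel[of "ball z r'" "range k" k])
      show "\<exists>B. \<forall>h\<in>range k. \<forall>z\<in>K. cmod (h z) \<le> B" if "compact K" "K \<subseteq> ball z r'" for K
        using bk that by (intro exI[of _ 1]) blast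
    qed (use hk in auto)
    have sub_lim: "filterlim (\<lambda>n. s n + J) at_top sequentially"
      using filterlim_subseq[OF G(2)] by (rule filterlim_at_top_mono) auto
    have "(\<lambda>n. cmod (k (s n) z)) \<longlonglongrightarrow> 0"
    proof -
      have "filterlim (\<lambda>n. cmod (h (s n + J) z)) at_top sequentially"
        using filterlim_compose[OF chordal_limit_None(2)[OF lim zV gz] sub_lim] by simp
      then show ?thesis unfolding k_def norm_inverse by (rule tendsto_inverse_0_at_top)
    qed
    then have "G z = 0" using G(3)[of z] r' tendsto_norm_zero_iff LIMSEQ_unique by (metis centre_in_ball)
    then have "G constant_on ball z r'"
      using Hurwitz_no_zeros[of "ball z r'" "k \<circ> s" G z] hk G r' nz by (force simp: k_def)
    then have G0: "G u = 0" if "u \<in> ball z r'" for u using that \<open>G z = 0\<close> r' by (metis centre_in_ball constant_on_def)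
    have "g u = None" if u: "u \<in> ball z r'" for u
    proof -
      have uV: "u \<in> V" using sub u by blast
      have "(\<lambda>n. k (s n) u) \<longlonglongrightarrow> 0" using G(3)[OF u] G0[OF u] by simp
      then have "filterlim (\<lambda>n. inverse (k (s n) u)) at_infinity sequentially"
        by (intro filterlim_compose[OF filterlim_inverse_at_infinity]) (use nz[OF u] in \<open>auto simp: filterlim_at k_def\<close>)
      then have fl: "filterlim (\<lambda>n. cmod (h (s n + J) u)) at_top sequentially"
        by (simp add: k_def filterlim_at_infinity_imp_norm_at_top)
      have "filterlim (\<lambda>n. cmod (h n u)) at_top sequentially"
        by (rule chordal_limit_unbounded[OF lim V(1) uV hol _ sub_lim, of "\<lambda>_. u"]) (use fl in auto)
      then show ?thesis using chordal_limit_None(1)[OF lim uV] by blast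
    qed
    then show ?thesis using sub r' by blast
  qed
  have openN: "\<exists>r>0. \<forall>y\<in>ball z r. y \<in> V \<and> g y \<noteq> None" if z: "z \<in> V" "g z \<noteq> None" for z
  proof (rule ccontr)
    assume neg: "\<not> ?thesis"
    obtain r where r: "r > 0" "cball z r \<subseteq> V" using V z open_contains_cball by blast
    have "\<exists>u. u \<in> ball z (r / Suc i) \<and> g u = None" for i :: nat
    proof -
      have "ball z (r / Suc i) \<subseteq> V" using r by (auto simp: divide_le_eq mult_le_cancel_left1 intro!: subset_trans[OF subset_ball subset_trans[OF ball_subset_cball r(2)]])
      then show ?thesis using neg r by (force dest!: spec[of _ "r / Suc i"])
    qed
    then obtain q where q: "\<And>i. q i \<in> ball z (r / Suc i)" "\<And>i. g (q i) = None" by metis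
    have qV: "q i \<in> V" for i
    proof -
      have "ball z (r / Suc i) \<subseteq> V" using r by (auto simp: divide_le_eq mult_le_cancel_left1 intro!: subset_trans[OF subset_ball subset_trans[OF ball_subset_cball r(2)]])
      then show ?thesis using q(1) by blast
    qed
    have "\<exists>n. n \<ge> i \<and> cmod (h n (q i)) \<ge> real i" for i
    proof -
      have "\<forall>\<^sub>F n in sequentially. cmod (h n (q i)) \<ge> real i"
        using chordal_limit_None(2)[OF lim qV q(2)] unfolding filterlim_at_top by blast
      then show ?thesis unfolding eventually_sequentially by (meson nat_le_linear order_refl)
    qed
    then obtain j where j: "\<And>i. j i \<ge> i" "\<And>i. cmod (h (j i) (q i)) \<ge> real i" by metis
    have qz: "q \<longlonglongrightarrow> z"
    proof (rule tendstoI)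
      fix e :: real assume e: "e > 0"
      have "(\<lambda>i. r / real (Suc i)) \<longlonglongrightarrow> 0" by (rule LIMSEQ_Suc) (rule lim_const_over_n)
      then have "\<forall>\<^sub>F i in sequentially. r / real (Suc i) < e" using e by (rule order_tendstoD)
      then show "\<forall>\<^sub>F i in sequentially. dist (q i) z < e"
      proof eventually_elim
        case (elim i) then show ?case using q(1)[of i] unfolding mem_ball by (metis dist_commute less_trans)
      qed
    qed
    have jt: "filterlim j at_top sequentially"
      using j(1) filterlim_at_top_mono[OF filterlim_ident] by (metis (mono_tags) always_eventually)
    have "filterlim (\<lambda>i. cmod (h (j i) (q i))) at_top sequentially"
      by (rule filterlim_at_top_mono[OF filterlim_real_sequentially]) (use j(2) in auto)
    from chordal_limit_unbounded[OF lim V(1) z(1) hol qz jt this] chordal_limit_None(1)[OF lim z(1)] z(2)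
    show False by blast
  qed
  have "open E" unfolding open_contains_ball using openE by (fastforce simp: E_def)
  moreover have "open (V - E)" unfolding open_contains_ball using openN by (fastforce simp: E_def)
  ultimately have "E \<inter> V = {} \<or> (V - E) \<inter> V = {}" by (intro connectedD[OF V(2)]) auto
  moreover have "z0 \<in> E" using z by (simp add: E_def)
  ultimately have "V - E = {}" using z by blast
  then show ?thesis by (auto simp: E_def)
qed

lemma frequently_subseq:
  assumes "\<exists>\<^sub>F i in sequentially. P i"
  obtains s :: "nat \<Rightarrow> nat" where "strict_mono s" "\<And>i. P (s i)"
proof -
  have "infinite {i. P i}" using assms by (simp add: frequently_cofinite flip: cofinite_eq_sequentially)
  from infinite_enumerate[OF this] show ?thesis using that by auto
qed

text \<open>A failure would give, along one subsequence, points u with unbounded values and points v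
  with bounded values. A chordal limit would then be infinite at a limit point of the former and
  finite at one of the latter.\<close>

lemma local_escape:
  fixes h :: "nat \<Rightarrow> complex \<Rightarrow> complex" and m :: "nat \<Rightarrow> nat" and u :: "nat \<Rightarrow> complex"
  assumes V: "open V" "connected V" and hol: "\<And>n. h n holomorphic_on V"
    and norm: "\<And>m :: nat \<Rightarrow> nat. \<exists>k g. strict_mono k \<and> chordal_limit V (\<lambda>i. h (m (k i))) g"
    and Kc: "compact Kc" "Kc \<subseteq> V" and u: "\<forall>\<^sub>F i in sequentially. u i \<in> Kc"
    and ub: "filterlim (\<lambda>i. cmod (h (m i) (u i))) at_top sequentially"
  shows "\<forall>\<^sub>F i in sequentially. \<forall>v\<in>Kc. M \<le> cmod (h (m i) v)"
proof (rule ccontr)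
  assume "\<not> ?thesis"
  then have "\<exists>\<^sub>F i in sequentially. \<exists>v\<in>Kc. cmod (h (m i) v) < M" by (simp add: not_eventually not_le)
  then have fr: "\<exists>\<^sub>F i in sequentially. (\<exists>v\<in>Kc. cmod (h (m i) v) < M) \<and> u i \<in> Kc"
    using u by (rule frequently_eventually_frequently)
  obtain s where s: "strict_mono (s :: nat \<Rightarrow> nat)" "\<And>i. (\<exists>v\<in>Kc. cmod (h (m (s i)) v) < M) \<and> u (s i) \<in> Kc"
    by (rule frequently_subseq[OF fr], rule that)
  then obtain v where v: "\<And>i. v i \<in> Kc" "\<And>i. cmod (h (m (s i)) (v i)) < M" by metis
  obtain k g where k: "strict_mono k" "chordal_limit V (\<lambda>i. h (m (s (k i)))) g" using norm[of "m \<circ> s"] by auto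
  obtain p l where l: "strict_mono (l :: nat \<Rightarrow> nat)" "p \<in> Kc" "((\<lambda>i. u (s (k i))) \<circ> l) \<longlonglongrightarrow> p"
    using Kc(1) s(2) unfolding compact_def by (metis (no_types, lifting))
  obtain p' l' where l': "strict_mono (l' :: nat \<Rightarrow> nat)" "p' \<in> Kc" "((\<lambda>i. v (k i)) \<circ> l') \<longlonglongrightarrow> p'"
    using Kc(1) v(1) unfolding compact_def by (metis (no_types, lifting))
  have pV: "p \<in> V" "p' \<in> V" using l(2) l'(2) Kc by auto
  have "strict_mono (\<lambda>i. s (k (l i)))" using s(1) k(1) l(1) by (simp add: strict_mono_def)
  then have "filterlim (\<lambda>i. cmod (h (m (s (k (l i)))) (u (s (k (l i)))))) at_top sequentially"
    using filterlim_compose[OF ub filterlim_subseq] by simp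
  then have "filterlim (\<lambda>n. cmod (h (m (s (k n))) p)) at_top sequentially"
    using l(3) by (intro chordal_limit_unbounded[where h = "\<lambda>i. h (m (s (k i)))" and q = "\<lambda>i. u (s (k (l i)))" and j = l,
          OF k(2) V(1) pV(1) hol _ filterlim_subseq[OF l(1)]]) (simp_all add: o_def)
  then have "g p = None" by (rule chordal_limit_None(1)[OF k(2) pV(1)])
  then have "g p' = None" using chordal_limit_const_None[OF k(2) V hol pV(1)] pV(2) by blast
  then have unb: "filterlim (\<lambda>n. cmod (h (m (s (k n))) p')) at_top sequentially"
    by (rule chordal_limit_None(2)[OF k(2) pV(2)])
  have bd: "\<forall>\<^sub>F i in sequentially. cmod (h (m (s (k (l' i)))) (v (k (l' i)))) \<le> M"
    using v(2) by (intro always_eventually) (simp add: less_imp_le)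
  have vl: "(\<lambda>i. v (k (l' i))) \<longlonglongrightarrow> p'" using l'(3) by (simp add: o_def)
  obtain B where "\<forall>\<^sub>F n in sequentially. cmod (h (m (s (k n))) p') \<le> B"
    by (rule chordal_limit_bounded[where h = "\<lambda>i. h (m (s (k i)))" and q = "\<lambda>i. v (k (l' i))" and j = l',
          OF k(2) V(1) pV(2) hol vl filterlim_subseq[OF l'(1)] bd], rule that)
  moreover have "\<forall>\<^sub>F n in sequentially. cmod (h (m (s (k n))) p') \<ge> B + 1" using unb unfolding filterlim_at_top by blast
  ultimately have "\<forall>\<^sub>F n in sequentially. False" by eventually_elim simp
  then show False by simp
qed

text \<open>The subsequence on which the conclusion would fail is fixed first, so that
  \<open>good\<close> refers to a single sequence; by \<open>local_escape\<close> the good points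
  then form an open and closed subset of W. In this way escape at moving points spreads over a whole
  component.\<close>

lemma normal_escape:
  fixes h :: "nat \<Rightarrow> complex \<Rightarrow> complex" and m :: "nat \<Rightarrow> nat" and u :: "nat \<Rightarrow> complex"
  assumes W: "open W" "connected W" and hol: "\<And>n. h n holomorphic_on W" and norm: "sphere_normal W h"
    and K0: "compact K0" "K0 \<subseteq> W" "\<And>i. u i \<in> K0"
    and ub: "filterlim (\<lambda>i. cmod (h (m i) (u i))) at_top sequentially"
    and K: "compact K" "K \<subseteq> W"
  shows "\<forall>\<^sub>F i in sequentially. \<forall>v\<in>K. M \<le> cmod (h (m i) v)"
proof (rule ccontr)
  assume "\<not> ?thesis"
  then have fr: "\<exists>\<^sub>F i in sequentially. \<exists>v\<in>K. cmod (h (m i) v) < M" by (simp add: not_eventually not_le)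
  obtain s where s: "strict_mono (s :: nat \<Rightarrow> nat)" "\<And>i. \<exists>v\<in>K. cmod (h (m (s i)) v) < M"
    by (rule frequently_subseq[OF fr], rule that)
  then obtain v where v: "\<And>i. v i \<in> K" "\<And>i. cmod (h (m (s i)) (v i)) < M" by metis
  obtain p l1 where l1: "strict_mono (l1 :: nat \<Rightarrow> nat)" "p \<in> K0" "((\<lambda>i. u (s i)) \<circ> l1) \<longlonglongrightarrow> p"
    using K0(1,3) unfolding compact_def by (metis (no_types, lifting))
  obtain p' l2 where l2: "strict_mono (l2 :: nat \<Rightarrow> nat)" "p' \<in> K" "((\<lambda>i. v (l1 i)) \<circ> l2) \<longlonglongrightarrow> p'"
    using K(1) v(1) unfolding compact_def by (metis (no_types, lifting))
  define l where "l = (\<lambda>i. l1 (l2 i))"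
  have sl: "strict_mono (\<lambda>i. s (l i))" using s(1) l1(1) l2(1) by (simp add: strict_mono_def l_def)
  have up: "(\<lambda>i. u (s (l i))) \<longlonglongrightarrow> p" using LIMSEQ_subseq_LIMSEQ[OF l1(3) l2(1)] by (simp add: o_def l_def)
  have vp: "(\<lambda>i. v (l i)) \<longlonglongrightarrow> p'" using l2(3) by (simp add: o_def l_def)
  define m' where "m' = (\<lambda>i. m (s (l i)))"
  define good where "good = (\<lambda>x. \<exists>r>0. \<forall>M. \<forall>\<^sub>F i in sequentially. \<forall>y\<in>ball x r. M \<le> cmod (h (m' i) y))"
  have loc: "\<exists>r>0. cball x r \<subseteq> W \<and> (\<forall>w. (\<forall>\<^sub>F i in sequentially. w i \<in> cball x r) \<longrightarrow>
      filterlim (\<lambda>i. cmod (h (m' i) (w i))) at_top sequentially \<longrightarrow> good x)" if x: "x \<in> W" for x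
  proof -
    obtain V where V: "open V" "x \<in> V" "V \<subseteq> W" "\<And>m :: nat \<Rightarrow> nat. \<exists>k g. strict_mono k \<and> chordal_limit V (\<lambda>i. h (m (k i))) g"
      using norm x unfolding sphere_normal_def by metis
    obtain r where r: "r > 0" "ball x r \<subseteq> V" using V open_contains_ball by blast
    have cb: "cball x (r / 2) \<subseteq> ball x r" using r by auto
    have *: "good x" if w: "\<forall>\<^sub>F i in sequentially. w i \<in> cball x (r / 2)"
      "filterlim (\<lambda>i. cmod (h (m' i) (w i))) at_top sequentially" for w
    proof -
      have ev: "\<forall>\<^sub>F i in sequentially. \<forall>v\<in>cball x (r / 2). M \<le> cmod (h (m' i) v)" for M
      proof (rule local_escape[where h = h and m = m' and u = w and V = "ball x r", OF open_ball connected_ball _ _ compact_cball cb w])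
        show "h n holomorphic_on ball x r" for n using hol V r by (meson holomorphic_on_subset order_trans)
        show "\<exists>k g. strict_mono k \<and> chordal_limit (ball x r) (\<lambda>i. h (m (k i))) g" for m :: "nat \<Rightarrow> nat"
          using V(4)[of m] chordal_limit_subset r(2) by blast
      qed
      have "\<forall>\<^sub>F i in sequentially. \<forall>v\<in>ball x (r / 2). M \<le> cmod (h (m' i) v)" for M
        using ev[of M] by eventually_elim auto
      then show ?thesis unfolding good_def using r by (intro exI[of _ "r / 2"]) auto
    qed
    have "cball x (r / 2) \<subseteq> W" using cb r V by (meson order_trans)
    then show ?thesis using * r by (intro exI[of _ "r / 2"]) auto
  qed
  define X where "X = {x\<in>W. good x}"
  have pX: "p \<in> X"
  proof -
    have pW: "p \<in> W" using l1 K0 by auto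
    from loc[OF pW] obtain r where r: "r > 0" "\<And>w. (\<forall>\<^sub>F i in sequentially. w i \<in> cball p r) \<Longrightarrow>
      filterlim (\<lambda>i. cmod (h (m' i) (w i))) at_top sequentially \<Longrightarrow> good p" by blast
    have "\<forall>\<^sub>F i in sequentially. u (s (l i)) \<in> cball p r"
      using tendstoD[OF up r(1)] by eventually_elim (simp add: dist_commute)
    moreover have "filterlim (\<lambda>i. cmod (h (m' i) (u (s (l i))))) at_top sequentially"
      using filterlim_compose[OF ub filterlim_subseq[OF sl]] by (simp add: m'_def)
    ultimately show ?thesis using r(2)[of "\<lambda>i. u (s (l i))"] pW by (simp add: X_def)
  qed
  have goodO: "\<exists>r>0. ball x r \<subseteq> {y. good y}" if gx: "good x" for x
  proof -
    obtain r where r: "r > 0" "\<And>M. \<forall>\<^sub>F i in sequentially. \<forall>y\<in>ball x r. M \<le> cmod (h (m' i) y)"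
      using gx unfolding good_def by metis
    have "good y" if y: "y \<in> ball x r" for y
    proof -
      have sub: "ball y (r - dist x y) \<subseteq> ball x r"
      proof
        fix z assume "z \<in> ball y (r - dist x y)"
        then show "z \<in> ball x r" using dist_triangle[of x z y] by simp
      qed
      have "\<forall>\<^sub>F i in sequentially. \<forall>z\<in>ball y (r - dist x y). M \<le> cmod (h (m' i) z)" for M
        using r(2)[of M] by eventually_elim (use sub in blast)
      moreover have "r - dist x y > 0" using y by simp
      ultimately show ?thesis unfolding good_def by blast
    qed
    then show ?thesis using r by blast
  qed
  have "open X"
    unfolding open_contains_ball
  proof
    fix x assume "x \<in> X"
    then have "x \<in> W" "good x" by (auto simp: X_def)
    then obtain r1 r2 where r: "r1 > 0" "ball x r1 \<subseteq> W" "r2 > 0" "ball x r2 \<subseteq> {y. good y}"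
      using goodO W(1) open_contains_ball by metis
    then have "ball x (min r1 r2) \<subseteq> X" by (auto simp: X_def)
    then show "\<exists>e>0. ball x e \<subseteq> X" using r by (metis min_less_iff_conj)
  qed
  moreover have "open (W - X)"
    unfolding open_contains_ball
  proof
    fix x assume x: "x \<in> W - X"
    then have xW: "x \<in> W" and ng: "\<not> good x" by (auto simp: X_def)
    obtain r where r: "r > 0" "cball x r \<subseteq> W" "\<And>w. (\<forall>\<^sub>F i in sequentially. w i \<in> cball x r) \<Longrightarrow>
      filterlim (\<lambda>i. cmod (h (m' i) (w i))) at_top sequentially \<Longrightarrow> good x" using loc[OF xW] by blast
    have "y \<notin> X" if y: "y \<in> ball x r" for y
    proof
      assume "y \<in> X"
      then obtain r' where r': "r' > 0" "\<And>M. \<forall>\<^sub>F i in sequentially. \<forall>z\<in>ball y r'. M \<le> cmod (h (m' i) z)"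
        by (auto simp: X_def good_def)
      have "filterlim (\<lambda>i. cmod (h (m' i) y)) at_top sequentially"
        unfolding filterlim_at_top
      proof
        fix Z
        show "\<forall>\<^sub>F i in sequentially. Z \<le> cmod (h (m' i) y)"
          using r'(2)[of Z] by eventually_elim (use r'(1) in auto)
      qed
      then have "good x" using r(3)[of "\<lambda>_. y"] y by auto
      then show False using ng by simp
    qed
    then show "\<exists>e>0. ball x e \<subseteq> W - X" using r by (intro exI[of _ r]) (auto simp: subset_iff)
  qed
  ultimately have "X \<inter> W = {} \<or> (W - X) \<inter> W = {}" by (intro connectedD[OF W(2)]) auto
  then have "W = X" using pX by (auto simp: X_def)
  then have "good p'" using l2(2) K by (auto simp: X_def)
  then obtain r where r: "r > 0" "\<And>M. \<forall>\<^sub>F i in sequentially. \<forall>y\<in>ball p' r. M \<le> cmod (h (m' i) y)"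
    unfolding good_def by metis
  have "\<forall>\<^sub>F i in sequentially. v (l i) \<in> ball p' r" using tendstoD[OF vp r(1)] by eventually_elim (simp add: dist_commute)
  with r(2)[of M] have "\<forall>\<^sub>F i in sequentially. False"
  proof eventually_elim
    case (elim i)
    then have "M \<le> cmod (h (m (s (l i))) (v (l i)))" by (auto simp: m'_def)
    then show ?case using v(2)[of "l i"] by simp
  qed
  then show False by simp
qed

lemma norm_inverse_gt:
  fixes w :: complex
  assumes "w \<noteq> 0" "R > 0" "cmod w < 1 / R" shows "cmod (inverse w) > R"
proof -
  have "R * cmod w < 1" using assms by (simp add: pos_less_divide_eq mult.commute)
  then show ?thesis using assms by (simp add: inverse_eq_divide norm_divide pos_less_divide_eq)
qed

lemma norm_inverse_less:
  fixes z :: complex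
  assumes "d > 0" "cmod z > 1 / d" shows "cmod (inverse z) < d"
proof -
  have "0 < 1 / d" using assms by simp
  then have "cmod z > 0" using assms by linarith
  moreover have "1 < cmod z * d" using assms by (simp add: pos_divide_less_eq)
  ultimately show ?thesis by (simp add: inverse_eq_divide norm_divide pos_divide_less_eq mult.commute)
qed

section \<open>Infinity is not in the domain of f\<close>

context growth_function
begin

text \<open>Only finitely many poles remain, so N(r, f) = O(log r), and the power bound is then
  excluded by \<open>transcendental\<close>.\<close>

lemma not_power_bounded:
  assumes "\<And>z. cmod z \<ge> R \<Longrightarrow> \<not> is_pole f z \<and> cmod (f z) \<le> cmod z ^ m"
  shows False
proof -
  define P where "P = {p. cmod p \<le> \<bar>R\<bar> \<and> is_pole f p}"
  have finP: "finite P" unfolding P_def by (rule finite_poles)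
  define S where "S = (\<Sum>p\<in>P. real (pole_mult f p) * (1 + \<bar>ln (cmod p)\<bar>))"
  have S0: "S \<ge> 0" unfolding S_def by (intro sum_nonneg) auto
  define Q where "Q = S + real (pole_mult f 0) + real m"
  obtain t0 where t0: "\<And>t. t \<ge> t0 \<Longrightarrow> (\<And>z. cmod z = exp t \<Longrightarrow> \<not> is_pole f z) \<Longrightarrow>
     nevanlinna_N (exp t) f \<le> Q * t \<Longrightarrow> \<exists>z. cmod z = exp t \<and> cmod (f z) > exp (Q * t)"
    using transcendental[of Q] by blast
  define t where "t = max t0 (max 1 \<bar>R\<bar>)"
  have t: "t \<ge> t0" "t \<ge> 1" "t \<ge> \<bar>R\<bar>" by (auto simp: t_def)
  have tR: "exp t \<ge> R" using t(3) exp_ge_add_one_self[of t] by linarith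
  have "nevanlinna_N (exp t) f \<le> Q * t"
  proof -
    let ?P = "{p. cmod p < exp t \<and> p \<noteq> 0 \<and> is_pole f p}"
    have PP: "?P \<subseteq> P"
    proof
      fix p assume "p \<in> ?P"
      then have "is_pole f p" by simp
      then have "cmod p < R" using assms[of p] by force
      then show "p \<in> P" using \<open>is_pole f p\<close> by (simp add: P_def)
    qed
    have "(\<Sum>p\<in>?P. real (pole_mult f p) * ln (exp t / cmod p)) \<le> (\<Sum>p\<in>?P. real (pole_mult f p) * (1 + \<bar>ln (cmod p)\<bar>) * t)"
    proof (rule sum_mono)
      fix p assume "p \<in> ?P"
      then have p: "cmod p > 0" by simp
      have "ln (exp t / cmod p) = t - ln (cmod p)" using p by (simp add: ln_div)
      also have "\<dots> \<le> t + \<bar>ln (cmod p)\<bar> * 1" by simp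
      also have "\<dots> \<le> t + \<bar>ln (cmod p)\<bar> * t" using t by (intro add_left_mono mult_left_mono) auto
      finally have "ln (exp t / cmod p) \<le> (1 + \<bar>ln (cmod p)\<bar>) * t" by (simp add: distrib_right)
      then show "real (pole_mult f p) * ln (exp t / cmod p) \<le> real (pole_mult f p) * (1 + \<bar>ln (cmod p)\<bar>) * t"
        unfolding mult.assoc by (intro mult_left_mono) auto
    qed
    also have "\<dots> \<le> (\<Sum>p\<in>P. real (pole_mult f p) * (1 + \<bar>ln (cmod p)\<bar>) * t)"
      using PP finP t by (intro sum_mono2) auto
    also have "\<dots> = S * t" by (simp add: S_def sum_distrib_right)
    finally have "nevanlinna_N (exp t) f \<le> S * t + real (pole_mult f 0) * t"
      using nevanlinna_N_eq[of "exp t"] by simp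
    also have "\<dots> \<le> Q * t" using t by (simp add: Q_def distrib_right)
    finally show ?thesis .
  qed
  then obtain z where z: "cmod z = exp t" "cmod (f z) > exp (Q * t)" using t0[OF t(1)] assms tR by force
  have "cmod (f z) \<le> exp t ^ m" using assms[of z] z(1) tR by simp
  also have "\<dots> = exp (real m * t)" by (simp add: exp_of_nat_mult)
  also have "\<dots> \<le> exp (Q * t)" using t S0 by (simp add: Q_def mult_right_mono)
  finally show False using z by simp
qed

lemma not_defined_at_infinity: "\<not> defined_at_infinity f"
proof
  assume "defined_at_infinity f"
  then obtain l where l: "limitin riemann_sphere (meromorphic_value f) l at_infinity"
    by (auto simp: defined_at_infinity_def)
  have ev: "\<exists>R. \<forall>z. cmod z \<ge> R \<longrightarrow> meromorphic_value f z \<in> U" if "openin riemann_sphere U" "l \<in> U" for U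
    using l that unfolding limitin_def eventually_at_infinity by blast
  show False
  proof (cases l)
    case (Some b)
    have "openin riemann_sphere (Some ` ball b 1)" by (simp add: riemann_sphere_def)
    then obtain R where R: "\<And>z. cmod z \<ge> R \<Longrightarrow> meromorphic_value f z \<in> Some ` ball b 1" using ev Some by force
    show False
    proof (rule not_power_bounded[of "max R (cmod b + 1)" 1])
      fix z assume z: "max R (cmod b + 1) \<le> cmod z"
      then have "meromorphic_value f z \<in> Some ` ball b 1" using R by simp
      then have "\<not> is_pole f z" "f z \<in> ball b 1" by (auto simp: meromorphic_value_def split: if_splits)
      then show "\<not> is_pole f z \<and> cmod (f z) \<le> cmod z ^ 1"
        using z norm_triangle_ineq2[of "f z" b] by (auto simp: dist_norm norm_minus_commute)
    qed
  next
    case None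
    have big: "\<exists>R. \<forall>z. cmod z \<ge> R \<longrightarrow> is_pole f z \<or> cmod (f z) > B" for B
    proof -
      have "openin riemann_sphere (insert None (Some ` (topspace euclidean - cball 0 B)))"
        unfolding riemann_sphere_def openin_Alexandroff_compactification by (intro disjI2 exI[of _ "cball 0 B"]) auto
      from ev[OF this] None obtain R where R: "\<And>z. cmod z \<ge> R \<Longrightarrow> meromorphic_value f z \<in> insert None (Some ` (topspace euclidean - cball 0 B))" by auto
      have "is_pole f z \<or> cmod (f z) > B" if "cmod z \<ge> R" for z
        using R[OF that] by (auto simp: meromorphic_value_def split: if_splits)
      then show ?thesis by blast
    qed
    define q where "q = (\<lambda>z. inverse (f z))"
    have qnice: "q nicely_meromorphic_on UNIV" unfolding q_def by (intro nicely_meromorphic_on_inverse nice)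
    have small: "\<exists>R. R > 0 \<and> (\<forall>z. cmod z \<ge> R \<longrightarrow> cmod (q z) \<le> e)" if e: "e > 0" for e
    proof -
      obtain R where R: "\<And>z. cmod z \<ge> R \<Longrightarrow> is_pole f z \<or> cmod (f z) > 1 / e" using big by blast
      have "cmod (q z) \<le> e" if z: "cmod z \<ge> R" for z
      proof (cases "is_pole f z")
        \<comment> \<open>The conventional value of f at a pole is 0, and so is its inverse, which
          is the correct value of 1/f there.\<close>
        case True
        then show ?thesis using is_pole_zero_at_nicely_mero[OF nice] e by (simp add: q_def)
      next
        case False
        then have "cmod (f z) > 1 / e" using R[OF z] by simp
        then have "inverse (cmod (f z)) \<le> inverse (1 / e)" using e by (intro le_imp_inverse_le) auto
        then show ?thesis by (simp add: q_def norm_inverse)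
      qed
      then show ?thesis by (intro exI[of _ "max R 1"]) auto
    qed
    obtain R where R: "R > 0" "\<And>z. cmod z \<ge> R \<Longrightarrow> cmod (q z) \<le> 1" using small[of 1] by auto
    have qana: "q analytic_on {z}" if z: "cmod z > R" for z
    proof (rule nicely_meromorphic_on_imp_analytic_at[OF qnice])
      show "\<not> is_pole q z"
      proof
        assume "is_pole q z"
        then have "filterlim q at_infinity (at z)" by (simp add: is_pole_def)
        then have "\<forall>\<^sub>F w in at z. cmod (q w) \<ge> 2" by (simp add: filterlim_at_infinity[of 0])
        moreover have "\<forall>\<^sub>F w in at z. w \<in> - cball 0 R"
          using z by (intro eventually_at_in_open') auto
        ultimately have "\<forall>\<^sub>F w in at z. False" 
        proof eventually_elim
          case (elim w) then show ?case using R(2)[of w] by auto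
        qed
        then show False by simp
      qed
    qed simp
    \<comment> \<open>In the coordinate w = 1/z the function 1/f tends to 0 at w = 0 without
      vanishing identically, so it has a finite order n there. This bounds |f| by a power of |z|
      near infinity.\<close>
    define k where "k = (\<lambda>w. q (inverse w))"
    have kana: "k analytic_on ball 0 (1 / R) - {0}"
    proof (subst analytic_on_analytic_at, intro ballI)
      fix w :: complex assume w: "w \<in> ball 0 (1 / R) - {0}"
      then have "cmod (inverse w) > R" using R by (intro norm_inverse_gt) auto
      then have "q analytic_on {inverse w}" by (rule qana)
      moreover have "(\<lambda>x. inverse x) analytic_on {w}" using w by (intro analytic_intros) auto
      ultimately have "q \<circ> (\<lambda>x. inverse x) analytic_on {w}" by (intro analytic_on_compose_gen[of _ _ q "{inverse w}"]) auto
      then show "k analytic_on {w}" by (simp add: k_def o_def)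
    qed
    have kiso: "isolated_singularity_at k 0" unfolding isolated_singularity_at_def using kana R by (intro exI[of _ "1 / R"]) auto
    have klim: "k \<midarrow>0\<rightarrow> 0"
    proof (rule tendstoI)
      fix e :: real assume e: "e > 0"
      obtain R' where R': "R' > 0" "\<And>z. cmod z \<ge> R' \<Longrightarrow> cmod (q z) \<le> e / 2" using small[of "e / 2"] e by auto
      show "\<forall>\<^sub>F w in at 0. dist (k w) 0 < e"
        unfolding eventually_at
      proof (intro exI[of _ "1 / R'"] conjI ballI impI)
        fix w :: complex assume w: "w \<noteq> 0 \<and> dist w 0 < 1 / R'"
        then have "cmod (inverse w) \<ge> R'" using R' norm_inverse_gt[of w R'] by auto
        then show "dist (k w) 0 < e" using R'(2)[of "inverse w"] e by (simp add: k_def)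
      qed (use R' in auto)
    qed
    have kess: "not_essential k 0" using klim by (auto simp: not_essential_def)
    have kfreq: "\<exists>\<^sub>F w in at 0. k w \<noteq> 0"
    proof (rule ccontr)
      assume "\<not> ?thesis"
      then have "\<forall>\<^sub>F w in at 0. k w = 0" by (simp add: not_frequently)
      then obtain \<delta> where \<delta>: "\<delta> > 0" "\<And>w :: complex. w \<noteq> 0 \<Longrightarrow> cmod w < \<delta> \<Longrightarrow> k w = 0" by (auto simp: eventually_at)
      have f0: "f z = 0" if "cmod z > 1 / \<delta>" for z
      proof -
        have z0: "z \<noteq> 0" using that \<delta>(1) by (auto simp: not_less)
        then have "cmod (inverse z) < \<delta>" using that \<delta>(1) by (intro norm_inverse_less)
        then show ?thesis using \<delta>(2)[of "inverse z"] z0 by (simp add: k_def q_def)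
      qed
      define z1 where "z1 = complex_of_real (1 / \<delta> + 1)"
      have "cmod z1 = 1 / \<delta> + 1" unfolding z1_def norm_of_real using \<delta>(1) by simp
      then have "\<forall>\<^sub>F w in at z1. w \<in> - cball 0 (1 / \<delta>)"
        by (intro eventually_at_in_open') auto
      with frequently_ne have "\<exists>\<^sub>F w in at z1. f w \<noteq> 0 \<and> w \<in> - cball 0 (1 / \<delta>)"
        by (rule frequently_eventually_frequently)
      then have "\<exists>\<^sub>F w in at z1. False" by (rule frequently_elim1) (use f0 in auto)
      then show False by simp
    qed
    define n where "n = zorder k 0"
    define g where "g = zor_poly k 0"
    obtain r where r: "r > 0" "g holomorphic_on cball 0 r" "g 0 \<noteq> 0"
      and kg: "\<And>w. w \<in> cball 0 r - {0} \<Longrightarrow> k w = g w * w powi n"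
      using zorder_exist[OF kiso kess kfreq] unfolding n_def g_def by auto
    have "isCont g 0"
      using r holomorphic_on_imp_continuous_on[OF holomorphic_on_subset[OF r(2) ball_subset_cball]]
      by (simp add: continuous_on_eq_continuous_at)
    then have "\<forall>\<^sub>F w in nhds 0. dist (g w) (g 0) < cmod (g 0) / 2"
      using r(3) by (intro tendstoD) (auto simp: isCont_def continuous_within tendsto_at_iff_tendsto_nhds)
    then obtain \<delta> where \<delta>: "\<delta> > 0" "\<And>w :: complex. cmod w < \<delta> \<Longrightarrow> dist (g w) (g 0) < cmod (g 0) / 2"
      by (auto simp: eventually_nhds_metric)
    define m where "m = nat \<bar>n\<bar>"
    define R1 where "R1 = max (max R 1) (max (1 / r) (1 / \<delta> + 2 / cmod (g 0))) + 1"
    show False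
    proof (rule not_power_bounded[of R1 "Suc m"])
      fix z assume z: "R1 \<le> cmod z"
      have "1 / \<delta> > 0" "2 / cmod (g 0) > 0" using \<delta> r by auto
      then have zz: "cmod z > R" "cmod z > 1" "cmod z > 1 / r" "cmod z > 1 / \<delta>" "cmod z > 2 / cmod (g 0)" "z \<noteq> 0"
        using z R(1) unfolding R1_def by (linarith, linarith, linarith, linarith, linarith, force)
      define w where "w = inverse z"
      have w: "w \<noteq> 0" "cmod w < r" "cmod w < \<delta>" "cmod w < 1" "cmod w > 0"
        using zz r \<delta> norm_inverse_less[of r z] norm_inverse_less[of \<delta> z] norm_inverse_less[of 1 z] by (auto simp: w_def)
      have gw: "cmod (g w) \<ge> cmod (g 0) / 2"
        using \<delta>(2)[OF w(3)] norm_triangle_ineq3[of "g w" "g 0"] by (simp add: dist_norm abs_le_iff) 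
      have "cmod w powi n \<ge> cmod w ^ m"
      proof (cases "n \<ge> 0")
        case True then show ?thesis by (simp add: m_def power_int_def)
      next
        case False
        have "cmod w ^ m \<le> 1" using w by (intro power_le_one) auto
        also have "1 \<le> inverse (cmod w ^ nat (- n))" using w by (intro one_le_inverse power_le_one zero_less_power) auto
        finally show ?thesis using False by (simp add: power_int_def power_inverse)
      qed
      then have "cmod (g 0) / 2 * cmod w ^ m \<le> cmod (g w) * cmod w powi n" using gw by (intro mult_mono) auto
      then have kw: "cmod (k w) \<ge> cmod (g 0) / 2 * cmod w ^ m"
        using kg[of w] w by (simp add: norm_mult norm_power_int)
      have pos: "cmod (g 0) / 2 * cmod w ^ m > 0" using r w by simp
      have fz: "f z \<noteq> 0" using kw pos by (auto simp: k_def w_def q_def)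
      have "cmod (f z) = inverse (cmod (k w))" by (simp add: k_def w_def q_def norm_inverse)
      also have "\<dots> \<le> inverse (cmod (g 0) / 2 * cmod w ^ m)" using kw pos by (intro le_imp_inverse_le) auto
      also have "cmod w = inverse (cmod z)" by (simp only: w_def norm_inverse)
      also have "inverse (cmod (g 0) / 2 * inverse (cmod z) ^ m) = 2 / cmod (g 0) * cmod z ^ m"
        by (simp add: power_inverse divide_simps)
      also have "\<dots> \<le> cmod z * cmod z ^ m" using zz by (intro mult_right_mono) auto
      finally show "\<not> is_pole f z \<and> cmod (f z) \<le> cmod z ^ Suc m"
        using fz is_pole_zero_at_nicely_mero[OF nice] by auto
    qed
  qed
qed

end

section \<open>The Fatou set in the plane\<close>

context growth_function
begin

text \<open>Infinity is not in the Fatou set, since the first iterate is undefined there. Hence the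
  finite points are all of it, as \<open>fatou_set_eq\<close> states.\<close>

definition plane_fatou :: "complex set" where
  "plane_fatou = {z. Some z \<in> fatou_set f}"

lemma sphere_map_Some: "sphere_map f (Some z) = meromorphic_value f z"
  by (simp add: sphere_map_def)

lemma iterate_Some:
  assumes "\<And>k. k < n \<Longrightarrow> \<not> is_pole f ((f ^^ k) z)"
  shows "iterate f n (Some z) = Some ((f ^^ n) z)"
  using assms
proof (induction n)
  case (Suc n)
  then have "iterate f n (Some z) = Some ((f ^^ n) z)" by simp
  then show ?case using Suc.prems[of n] by (simp add: sphere_map_Some meromorphic_value_def)
qed simp

lemma orbit_regular:
  assumes "\<forall>n. iterate_defined f n (Some z)"
  shows "\<not> is_pole f ((f ^^ n) z)"
proof (induction n rule: less_induct)
  case (less n)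
  have "iterate f n (Some z) = Some ((f ^^ n) z)" using less by (intro iterate_Some) auto
  moreover have "iterate f (Suc n) (Some z) \<noteq> None"
    using assms not_defined_at_infinity unfolding iterate_defined_def by (metis lessI)
  ultimately show ?case by (auto simp: sphere_map_Some meromorphic_value_def)
qed

lemma fatou_nhd:
  assumes "w \<in> fatou_set f"
  obtains z V where "w = Some z" "open V" "z \<in> V" "\<And>v n. v \<in> V \<Longrightarrow> \<not> is_pole f ((f ^^ n) v)"
    "normal_family (Some ` V) (range (iterate f))"
proof -
  obtain U where U: "openin riemann_sphere U" "w \<in> U" "\<And>n v. v \<in> U \<Longrightarrow> iterate_defined f n v"
    "normal_family U (range (iterate f))" using assms by (auto simp: fatou_set_def)
  have "None \<notin> U"
  proof
    assume "None \<in> U"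
    then have "iterate_defined f 1 None" using U(3) by blast
    then show False using not_defined_at_infinity by (auto simp: iterate_defined_def)
  qed
  then obtain V where V: "open V" "U = Some ` V"
    using U(1) unfolding riemann_sphere_def openin_Alexandroff_compactification by auto
  obtain z where z: "w = Some z" "z \<in> V" using U(2) V(2) by auto
  show ?thesis
  proof (rule that[OF z(1) V(1) z(2)])
    show "\<not> is_pole f ((f ^^ n) v)" if "v \<in> V" for v n
      using orbit_regular[of v n] U(3) V(2) that by blast
    show "normal_family (Some ` V) (range (iterate f))" using U(4) V(2) by simp
  qed
qed

lemma fatouI:
  assumes "open V" "z \<in> V" "\<And>v n. v \<in> V \<Longrightarrow> \<not> is_pole f ((f ^^ n) v)"
    "normal_family (Some ` V) (range (iterate f))"
  shows "z \<in> plane_fatou"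
  unfolding plane_fatou_def fatou_set_def mem_Collect_eq
proof (intro exI[of _ "Some ` V"] conjI allI ballI)
  show "openin riemann_sphere (Some ` V)" using assms(1) by (simp add: riemann_sphere_def)
  fix n v assume "v \<in> Some ` V"
  then obtain u where u: "u \<in> V" "v = Some u" by auto
  have "iterate f k v = Some ((f ^^ k) u)" for k unfolding u(2) using assms(3)[OF u(1)] by (intro iterate_Some) auto
  then show "iterate_defined f n v" by (simp add: iterate_defined_def)
qed (use assms in auto)

lemma fatou_set_eq: "fatou_set f = Some ` plane_fatou"
proof -
  have "w \<in> Some ` plane_fatou" if "w \<in> fatou_set f" for w
    using fatou_nhd[OF that] that by (metis imageI mem_Collect_eq plane_fatou_def)
  then show ?thesis by (auto simp: plane_fatou_def)
qed

lemma plane_fatou_nhd: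
  assumes "z \<in> plane_fatou"
  obtains V where "open V" "z \<in> V" "V \<subseteq> plane_fatou" "\<And>v n. v \<in> V \<Longrightarrow> \<not> is_pole f ((f ^^ n) v)"
    "normal_family (Some ` V) (range (iterate f))"
proof -
  have "Some z \<in> fatou_set f" using assms by (simp add: plane_fatou_def)
  from fatou_nhd[OF this] obtain V where V: "open V" "z \<in> V" "\<And>v n. v \<in> V \<Longrightarrow> \<not> is_pole f ((f ^^ n) v)"
    "normal_family (Some ` V) (range (iterate f))" by (metis option.inject)
  moreover have "V \<subseteq> plane_fatou" using fatouI[OF V(1) _ V(3,4)] by blast
  ultimately show ?thesis using that by blast
qed

lemma open_plane_fatou: "open plane_fatou"
  unfolding open_subopen[of plane_fatou] using plane_fatou_nhd by metis

lemma fatou_regular: "z \<in> plane_fatou \<Longrightarrow> \<not> is_pole f ((f ^^ n) z)"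
  using plane_fatou_nhd by metis

lemma fatou_iterate: "z \<in> plane_fatou \<Longrightarrow> iterate f n (Some z) = Some ((f ^^ n) z)"
  using fatou_regular by (intro iterate_Some)

lemma iterate_analytic:
  assumes "\<And>k. k < n \<Longrightarrow> \<not> is_pole f ((f ^^ k) z)"
  shows "(f ^^ n) analytic_on {z}"
  using assms
proof (induction n)
  case 0
  then show ?case by (simp add: id_def analytic_on_ident flip: eq_id_iff)
next
  case (Suc n)
  have "(f ^^ n) analytic_on {z}" using Suc by simp
  moreover have "f analytic_on {(f ^^ n) z}" using Suc.prems[of n] by (intro analytic_at_nonpole) simp
  ultimately have "f \<circ> (f ^^ n) analytic_on {z}" by (intro analytic_on_compose_gen[of _ _ f "{(f ^^ n) z}"]) auto
  then show ?case by (simp add: o_def)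
qed

lemma iterate_holomorphic: "(f ^^ n) holomorphic_on plane_fatou"
proof -
  have "(f ^^ n) analytic_on plane_fatou"
    unfolding analytic_on_analytic_at[of "f ^^ n" plane_fatou] using fatou_regular by (auto intro: iterate_analytic)
  then show ?thesis by (rule analytic_imp_holomorphic)
qed

lemma compactin_sphere: "compact K \<Longrightarrow> compactin riemann_sphere (Some ` K)"
  unfolding riemann_sphere_def by (rule image_compactin[OF _ continuous_map_Some]) simp

lemma sphere_normal_iterates:
  assumes W: "open W" "W \<subseteq> plane_fatou"
  shows "sphere_normal W (\<lambda>n. f ^^ n)"
  unfolding sphere_normal_def
proof
  fix z assume z: "z \<in> W"
  then obtain V where V: "open V" "z \<in> V" "V \<subseteq> plane_fatou" "\<And>v n. v \<in> V \<Longrightarrow> \<not> is_pole f ((f ^^ n) v)"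
    "normal_family (Some ` V) (range (iterate f))" using plane_fatou_nhd W by blast
  have "\<exists>k g. strict_mono k \<and> chordal_limit (V \<inter> W) (\<lambda>i. f ^^ (m (k i))) g" for m :: "nat \<Rightarrow> nat"
  proof -
    have "range (\<lambda>i. iterate f (m i)) \<subseteq> range (iterate f)" by auto
    then obtain k g where k: "strict_mono k" "locally_uniformly_convergent (Some ` V) ((\<lambda>i. iterate f (m i)) \<circ> k) g"
      using V(5) unfolding normal_family_def by blast
    have "chordal_limit (V \<inter> W) (\<lambda>i. f ^^ (m (k i))) (g \<circ> Some)"
      unfolding chordal_limit_def
    proof (intro allI impI)
      fix K and e :: real assume K: "compact K \<and> K \<subseteq> V \<inter> W" and e: "e > 0"
      then have "compactin riemann_sphere (Some ` K) \<and> Some ` K \<subseteq> Some ` V" using compactin_sphere by auto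
      then have "\<forall>\<^sub>F n in sequentially. \<forall>w\<in>Some ` K. chordal (((\<lambda>i. iterate f (m i)) \<circ> k) n w) (g w) < e"
        using k(2) e unfolding locally_uniformly_convergent_def by blast
      then show "\<forall>\<^sub>F n in sequentially. \<forall>z\<in>K. chordal (Some ((f ^^ m (k n)) z)) ((g \<circ> Some) z) < e"
      proof eventually_elim
        case (elim n)
        show ?case
        proof
          fix z assume z: "z \<in> K"
          then have "z \<in> plane_fatou" using K W by auto
          from fatou_iterate[OF this, of "m (k n)"] elim z
          show "chordal (Some ((f ^^ m (k n)) z)) ((g \<circ> Some) z) < e" by force
        qed
      qed
    qed
    then show ?thesis using k(1) by blast
  qed
  then show "\<exists>V. open V \<and> z \<in> V \<and> V \<subseteq> W \<and> (\<forall>m :: nat \<Rightarrow> nat. \<exists>k g. strict_mono k \<and> chordal_limit V (\<lambda>i. f ^^ (m (k i))) g)"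
    using V(1,2) W z by (intro exI[of _ "V \<inter> W"]) auto
qed

lemma not_constant_on_open:
  assumes "open S" "S \<noteq> {}" shows "\<not> f constant_on S"
proof
  assume "f constant_on S"
  then obtain c' where c': "\<And>z. z \<in> S \<Longrightarrow> f z = c'" by (auto simp: constant_on_def)
  obtain z where z: "z \<in> S" using assms by blast
  have "\<forall>\<^sub>F w in at z. w \<in> S" using assms z by (intro eventually_at_in_open')
  with frequently_ne[of c' z] have "\<exists>\<^sub>F w in at z. f w \<noteq> c' \<and> w \<in> S" by (rule frequently_eventually_frequently)
  then have "\<exists>\<^sub>F w in at z. False" by (rule frequently_elim1) (use c' in auto)
  then show False by simp
qed

lemma f_holomorphic: "(\<And>z. z \<in> S \<Longrightarrow> \<not> is_pole f z) \<Longrightarrow> f holomorphic_on S"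
  using analytic_at_nonpole analytic_on_analytic_at[of f S] analytic_imp_holomorphic by blast

lemma open_image:
  assumes "open S" "\<And>z. z \<in> S \<Longrightarrow> \<not> is_pole f z" shows "open (f ` S)"
proof -
  have "\<exists>T. open T \<and> y \<in> T \<and> T \<subseteq> f ` S" if y: "y \<in> f ` S" for y
  proof -
    obtain z where z: "z \<in> S" "y = f z" using y by blast
    obtain r where r: "r > 0" "ball z r \<subseteq> S" using assms(1) z open_contains_ball by blast
    have "open (f ` ball z r)"
    proof (rule open_mapping_thm[of f "ball z r"])
      show "f holomorphic_on ball z r" using r assms(2) by (intro f_holomorphic) auto
      show "\<not> f constant_on ball z r" using r by (intro not_constant_on_open) auto
    qed auto
    then show ?thesis using z r by (intro exI[of _ "f ` ball z r"]) auto
  qed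
  then show ?thesis by (subst open_subopen) auto
qed

text \<open>A sequence of iterates on the image of a ball is pulled back to the shifted sequence on
  the closed ball around z. The limit on the image is obtained from an arbitrary choice of
  preimages; uniformity survives because it holds on the whole closed ball.\<close>

lemma fatou_invariant: assumes "z \<in> plane_fatou" shows "f z \<in> plane_fatou"
proof -
  obtain V where V: "open V" "z \<in> V" "V \<subseteq> plane_fatou" "\<And>v n. v \<in> V \<Longrightarrow> \<not> is_pole f ((f ^^ n) v)"
    "normal_family (Some ` V) (range (iterate f))" using plane_fatou_nhd[OF assms] by metis
  obtain r where r: "r > 0" "cball z r \<subseteq> V" using V open_contains_cball by blast
  have br: "ball z r \<subseteq> cball z r" by auto
  have bV: "ball z r \<subseteq> V" using br r(2) by (rule subset_trans)
  show ?thesis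
  proof (rule fatouI[of "f ` ball z r"])
    show "open (f ` ball z r)" 
    proof (intro open_image open_ball)
      show "\<not> is_pole f v" if "v \<in> ball z r" for v using V(4)[OF subsetD[OF bV that], of 0] by simp
    qed
    show "f z \<in> f ` ball z r" using r by auto
    show "\<not> is_pole f ((f ^^ n) v)" if v: "v \<in> f ` ball z r" for v n
    proof -
      obtain u where u: "u \<in> ball z r" "v = f u" using v by blast
      have "\<not> is_pole f ((f ^^ Suc n) u)" using V(4) u r br by blast
      then show ?thesis by (simp add: u(2) funpow_swap1)
    qed
    show "normal_family (Some ` (f ` ball z r)) (range (iterate f))"
      unfolding normal_family_def
    proof (intro allI impI)
      fix F :: "nat \<Rightarrow> csphere \<Rightarrow> csphere" assume F: "range F \<subseteq> range (iterate f)"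
      then have "\<exists>n. F i = iterate f n" for i by blast
      then obtain m where m: "\<And>i. F i = iterate f (m i)" by metis
      have "range (\<lambda>i. iterate f (Suc (m i))) \<subseteq> range (iterate f)" by blast
      then obtain k g where k: "strict_mono k" "locally_uniformly_convergent (Some ` V) ((\<lambda>i. iterate f (Suc (m i))) \<circ> k) g"
        using V(5) unfolding normal_family_def by blast
      define pre where "pre = (\<lambda>w. SOME u. u \<in> ball z r \<and> w = Some (f u))"
      have pre: "pre w \<in> ball z r \<and> w = Some (f (pre w))" if "w \<in> Some ` (f ` ball z r)" for w
        unfolding pre_def by (rule someI_ex) (use that in auto)
      have "locally_uniformly_convergent (Some ` (f ` ball z r)) (F \<circ> k) (\<lambda>w. g (Some (pre w)))"
        unfolding locally_uniformly_convergent_def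
      proof (intro allI impI)
        fix K and e :: real assume K: "compactin riemann_sphere K \<and> K \<subseteq> Some ` (f ` ball z r)" and e: "e > 0"
        have "compactin riemann_sphere (Some ` cball z r) \<and> Some ` cball z r \<subseteq> Some ` V" using compactin_sphere r by auto
        then have "\<forall>\<^sub>F n in sequentially. \<forall>w\<in>Some ` cball z r. chordal (((\<lambda>i. iterate f (Suc (m i))) \<circ> k) n w) (g w) < e"
          using k(2) e unfolding locally_uniformly_convergent_def by blast
        then show "\<forall>\<^sub>F n in sequentially. \<forall>w\<in>K. chordal ((F \<circ> k) n w) (g (Some (pre w))) < e"
        proof eventually_elim
          case (elim n)
          show ?case
          proof
            fix w assume "w \<in> K"
            then have p: "pre w \<in> ball z r" "w = Some (f (pre w))" using pre K by blast+
            have "sphere_map f (Some (pre w)) = w"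
              using V(4)[OF subsetD[OF bV p(1)], of 0] p(2) by (simp add: sphere_map_Some meromorphic_value_def)
            then have "iterate f (Suc (m (k n))) (Some (pre w)) = iterate f (m (k n)) w" by (simp add: funpow_swap1)
            moreover have "chordal (iterate f (Suc (m (k n))) (Some (pre w))) (g (Some (pre w))) < e"
              using elim p(1) br by (auto simp del: funpow.simps)
            ultimately show "chordal ((F \<circ> k) n w) (g (Some (pre w))) < e" by (simp add: m del: funpow.simps)
          qed
        qed
      qed
      then show "\<exists>k g. strict_mono k \<and> locally_uniformly_convergent (Some ` (f ` ball z r)) (F \<circ> k) g"
        using k(1) by blast
    qed
  qed
qed

lemma fatou_iterate_invariant: "z \<in> plane_fatou \<Longrightarrow> (f ^^ n) z \<in> plane_fatou"
  by (induction n) (auto intro: fatou_invariant)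

lemma connectedin_sphere: "connected S \<Longrightarrow> connectedin riemann_sphere (Some ` S)"
  unfolding riemann_sphere_def
  by (rule connectedin_continuous_map_image[OF continuous_map_Some]) (simp add: connectedin_iff_connected)

lemma connected_of_sphere:
  assumes "connectedin riemann_sphere (Some ` S)" shows "connected S"
proof (rule connectedI)
  fix A B assume AB: "open A" "open B" "A \<inter> S \<noteq> {}" "B \<inter> S \<noteq> {}" "A \<inter> B \<inter> S = {}" "S \<subseteq> A \<union> B"
  have "openin riemann_sphere (Some ` A)" "openin riemann_sphere (Some ` B)"
    using AB by (auto simp: riemann_sphere_def)
  moreover have "Some ` S \<subseteq> Some ` A \<union> Some ` B" using AB by auto
  moreover have "Some ` A \<inter> Some ` B \<inter> Some ` S = {}" using AB by auto
  moreover have "Some ` A \<inter> Some ` S \<noteq> {}" "Some ` B \<inter> Some ` S \<noteq> {}" using AB by auto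
  ultimately show False using assms unfolding connectedin by blast
qed

lemma component_max:
  assumes U: "U \<in> fatou_components f" and S: "connected S" "S \<subseteq> plane_fatou" "Some ` S \<inter> U \<noteq> {}"
  shows "Some ` S \<subseteq> U"
proof -
  have "connectedin (subtopology riemann_sphere (fatou_set f)) (Some ` S)"
    unfolding connectedin_subtopology fatou_set_eq using connectedin_sphere[OF S(1)] S(2) by auto
  then show ?thesis
    using connected_components_of_maximal[of U "subtopology riemann_sphere (fatou_set f)" "Some ` S"] U S(3)
    by (auto simp: fatou_components_def disjnt_def)
qed

lemma component_plane:
  assumes U: "U \<in> fatou_components f"
  obtains W where "U = Some ` W" "open W" "connected W" "W \<noteq> {}" "W \<subseteq> plane_fatou"
proof -
  define W where "W = {z. Some z \<in> U}"
  have cU: "connectedin (subtopology riemann_sphere (fatou_set f)) U"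
    using U connectedin_connected_components_of by (auto simp: fatou_components_def)
  have sub: "U \<subseteq> Some ` plane_fatou" using cU unfolding connectedin_subtopology fatou_set_eq by auto
  then have UW: "U = Some ` W" by (auto simp: W_def)
  have ne: "W \<noteq> {}" using nonempty_connected_components_of[of U] U UW by (auto simp: fatou_components_def)
  have WP: "W \<subseteq> plane_fatou" using sub by (auto simp: W_def)
  have "connected W" using cU unfolding connectedin_subtopology UW by (intro connected_of_sphere) auto
  moreover have "open W"
    unfolding open_contains_ball
  proof
    fix z assume z: "z \<in> W"
    then obtain r where r: "r > 0" "ball z r \<subseteq> plane_fatou" using open_plane_fatou WP open_contains_ball by blast
    have "Some z \<in> Some ` ball z r \<inter> U" using z r(1) by (auto simp: W_def)
    then have "Some ` ball z r \<subseteq> U" by (intro component_max[OF U connected_ball r(2)]) blast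
    then show "\<exists>r>0. ball z r \<subseteq> W" using r by (auto simp: W_def)
  qed
  ultimately show ?thesis using that UW ne WP by blast
qed

lemma iterate_component:
  assumes "W \<subseteq> plane_fatou" shows "iterate f n ` (Some ` W) = Some ` ((f ^^ n) ` W)"
proof -
  have "iterate f n (Some z) = Some ((f ^^ n) z)" if "z \<in> W" for z using that assms fatou_iterate by blast
  then show ?thesis by (auto simp: image_iff)
qed

lemma component_at_props:
  assumes U: "U \<in> fatou_components f"
  shows "component_at f U n \<in> fatou_components f" "iterate f n ` U \<subseteq> component_at f U n"
proof -
  obtain W where W: "U = Some ` W" "open W" "connected W" "W \<noteq> {}" "W \<subseteq> plane_fatou" using component_plane[OF U] by metis
  have im: "iterate f n ` U = Some ` ((f ^^ n) ` W)" unfolding W(1) by (rule iterate_component[OF W(5)])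
  have con: "connected ((f ^^ n) ` W)"
    by (rule connected_continuous_image[OF holomorphic_on_imp_continuous_on[OF holomorphic_on_subset[OF iterate_holomorphic W(5)]] W(3)])
  have PF: "(f ^^ n) ` W \<subseteq> plane_fatou" using W(5) fatou_iterate_invariant by auto
  obtain z where z: "z \<in> (f ^^ n) ` W" using W(4) by auto
  have "Some z \<in> topspace (subtopology riemann_sphere (fatou_set f))"
    using z PF by (auto simp: fatou_set_eq riemann_sphere_def)
  then obtain X where X: "X \<in> fatou_components f" "Some z \<in> X"
    unfolding Union_connected_components_of[symmetric] fatou_components_def by blast
  have sub: "iterate f n ` U \<subseteq> X" unfolding im by (rule component_max[OF X(1) con PF]) (use X(2) z in auto)
  have uniq: "Y = X" if Y: "Y \<in> fatou_components f" "iterate f n ` U \<subseteq> Y" for Y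
  proof (rule ccontr)
    assume "Y \<noteq> X"
    then have "disjnt Y X"
      using Y(1) X(1) pairwise_disjoint_connected_components_of[of "subtopology riemann_sphere (fatou_set f)"]
      by (auto simp: fatou_components_def pairwise_def)
    moreover have "Some z \<in> Y" using Y(2) z im by blast
    ultimately show False using X(2) by (auto simp: disjnt_def)
  qed
  have "component_at f U n \<in> fatou_components f \<and> iterate f n ` U \<subseteq> component_at f U n"
    unfolding component_at_def by (rule theI[of _ X]) (use X sub uniq in \<open>blast+\<close>)
  then show "component_at f U n \<in> fatou_components f" "iterate f n ` U \<subseteq> component_at f U n" by auto
qed

end

section \<open>The Fatou set is not the whole plane\<close>

lemma entire_double_fixpoint:
  assumes hol: "f holomorphic_on UNIV" and np: "\<And>p. f \<noteq> poly p"
  shows "\<exists>z. f (f z) = z"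
proof (rule ccontr)
  assume neg: "\<not> ?thesis"
  then have nf2: "f (f z) \<noteq> z" for z by blast
  then have nf: "f z \<noteq> z" for z by metis
  have hff: "(\<lambda>z. f (f z)) holomorphic_on UNIV"
    using holomorphic_on_compose[of f UNIV f] hol holomorphic_on_subset by (auto simp: o_def)
  \<comment> \<open>If f o f has no fixed point, neither has f. A zero of Q would be a fixed point
    of f o f, and where Q is 1 the value f z would be a fixed point of f. By Picard's theorem Q is a
    constant c.\<close>
  define Q where "Q = (\<lambda>z. (f (f z) - z) / (f z - z))"
  have hQ: "Q holomorphic_on UNIV" unfolding Q_def using nf by (intro holomorphic_intros hff hol) auto
  have "range Q \<inter> {0, 1} = {}"
    using nf nf2 nf[of "f _"] by (auto simp: Q_def) 
  then obtain c where c: "Q = (\<lambda>z. c)" using little_Picard[OF hQ, of 0 1] by auto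
  have c01: "c \<noteq> 0" "c \<noteq> 1" using \<open>range Q \<inter> {0, 1} = {}\<close> c by auto
  have eq: "f (f z) - z = c * (f z - z)" for z
  proof -
    have "(f (f z) - z) / (f z - z) = c" using c by (auto simp: Q_def fun_eq_iff)
    then show ?thesis using nf[of z] by (simp add: divide_eq_eq)
  qed
  have D: "(f has_field_derivative deriv f z) (at z)" for z
    using hol holomorphic_derivI by blast
  \<comment> \<open>This equation shows that f'(f z) omits 0 and c, so it is constant by Picard's
    theorem; then f' is constant and f is a polynomial of degree at most 1.\<close>
  have der: "deriv f z * (deriv f (f z) - c) = 1 - c" for z
  proof -
    have "((\<lambda>z. f (f z) - z) has_field_derivative deriv f (f z) * deriv f z - 1) (at z)"
      by (rule DERIV_diff[OF DERIV_chain2[OF D D] DERIV_ident])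
    moreover have "((\<lambda>z. c * (f z - z)) has_field_derivative c * (deriv f z - 1)) (at z)"
      by (rule DERIV_cmult[OF DERIV_diff[OF D DERIV_ident]])
    moreover have "(\<lambda>z. f (f z) - z) = (\<lambda>z. c * (f z - z))" using eq by auto
    ultimately have "deriv f (f z) * deriv f z - 1 = c * (deriv f z - 1)" using DERIV_unique by metis
    then show ?thesis by (simp add: algebra_simps)
  qed
  have d0: "deriv f z \<noteq> 0" for z using der[of z] c01 by auto
  have dc: "deriv f (f z) \<noteq> c" for z using der[of z] c01 by auto
  have hd: "deriv f holomorphic_on UNIV" by (rule holomorphic_deriv[OF hol open_UNIV])
  have hdf: "(\<lambda>z. deriv f (f z)) holomorphic_on UNIV"
    using holomorphic_on_compose[of f UNIV "deriv f"] hol hd holomorphic_on_subset by (auto simp: o_def)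
  obtain k where k: "\<And>z. deriv f (f z) = k"
    using little_Picard[OF hdf, of 0 c] c01 d0 dc by (metis (no_types, lifting) disjoint_insert(1) image_iff inf_bot_right)
  have nc: "\<not> f constant_on UNIV"
  proof
    assume "f constant_on UNIV"
    then obtain b where "\<And>z. f z = b" by (auto simp: constant_on_def)
    then show False using nf[of b] by simp
  qed
  have "open (f ` UNIV)" using open_mapping_thm[OF hol open_UNIV connected_UNIV open_UNIV _ nc] by simp
  then have "deriv f z = k" for z
    using analytic_continuation_open[of "range f" UNIV "deriv f" "\<lambda>_. k" z] hd k by auto
  then have "((\<lambda>z. f z - k * z) has_field_derivative 0) (at z)" for z
    using D[of z] by (auto intro!: derivative_eq_intros)
  then obtain b where "\<And>z. f z - k * z = b"
    using has_field_derivative_zero_constant[of UNIV "\<lambda>z. f z - k * z"] by (auto intro: has_field_derivative_at_within)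
  then have "f = poly [:b, k:]" by (auto simp: fun_eq_iff algebra_simps)
  then show False using np by blast
qed

context growth_function
begin

text \<open>Suppose that f on the disc of radius \<rho> omitted a point of modulus 2 \<rho> and one
  of modulus 8 \<rho>. These are at least 6 \<rho> apart, and Schottky's theorem would give |f| =
  O(\<rho>) on |z| = \<rho>/4, where \<open>transcendental\<close> provides a value larger than
  |z|^2.\<close>

lemma entire_covers_circle:
  assumes np: "\<And>z. \<not> is_pole f z"
  obtains \<rho>0 where "\<rho>0 > 0" "\<And>\<rho>. \<rho> \<ge> \<rho>0 \<Longrightarrow> \<exists>s\<ge>2 * \<rho>. sphere 0 s \<subseteq> f ` ball 0 \<rho>"
proof -
  have hol: "f holomorphic_on S" for S using np by (intro f_holomorphic)
  define K where "K = exp (pi * exp (pi * (2 + 2 * 1 + 12 * (1/2) / (1 - 1/2))))"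
  have K: "K > 0" by (simp add: K_def)
  obtain t0 where t0: "\<And>t. t \<ge> t0 \<Longrightarrow> nevanlinna_N (exp t) f \<le> 2 * t \<Longrightarrow> \<exists>z. cmod z = exp t \<and> cmod (f z) > exp (2 * t)"
    using transcendental[of 2] np by metis
  define \<rho>0 where "\<rho>0 = max (4 * exp (max t0 0)) (max (cmod (f 0)) (16 * (2 + 10 * K)))"
  show ?thesis
  proof (rule that[of \<rho>0])
    show "\<rho>0 > 0" by (simp add: \<rho>0_def less_max_iff_disj)
    fix \<rho> assume \<rho>: "\<rho> \<ge> \<rho>0"
    have r1: "\<rho> \<ge> 4 * exp (max t0 0)" "\<rho> \<ge> cmod (f 0)" "\<rho> \<ge> 16 * (2 + 10 * K)" using \<rho> by (auto simp: \<rho>0_def)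
    have r0: "\<rho> > 0" using r1(1) exp_gt_zero[of "max t0 0"] by linarith
    show "\<exists>s\<ge>2 * \<rho>. sphere 0 s \<subseteq> f ` ball 0 \<rho>"
    proof (rule ccontr)
      assume "\<not> ?thesis"
      then have ns: "\<not> sphere 0 (2 * \<rho>) \<subseteq> f ` ball 0 \<rho>" "\<not> sphere 0 (8 * \<rho>) \<subseteq> f ` ball 0 \<rho>" using r0 by auto
      obtain w1 where w1: "cmod w1 = 2 * \<rho>" "w1 \<notin> f ` ball 0 \<rho>" using ns(1) by (auto simp: subset_iff)
      obtain w2 where w2: "cmod w2 = 8 * \<rho>" "w2 \<notin> f ` ball 0 \<rho>" using ns(2) by (auto simp: subset_iff)
      note w = w1 w2
      have w12: "cmod (w2 - w1) \<ge> 6 * \<rho>" "cmod (w2 - w1) \<le> 10 * \<rho>"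
        using norm_triangle_ineq2[of w2 w1] norm_triangle_ineq4[of w2 w1] w by auto
      then have wne: "w2 - w1 \<noteq> 0" using r0 by auto
      define g where "g = (\<lambda>\<zeta>. (f (of_real (\<rho> / 2) * \<zeta>) - w1) / (w2 - w1))"
      have "f \<circ> (\<lambda>\<zeta>. of_real (\<rho> / 2) * \<zeta>) holomorphic_on cball 0 1"
        by (intro holomorphic_on_compose hol holomorphic_intros)
      then have hg: "g holomorphic_on cball 0 1" unfolding g_def using wne by (intro holomorphic_intros) (auto simp: o_def)
      have g01: "\<not> (g \<zeta> = 0 \<or> g \<zeta> = 1)" if "\<zeta> \<in> cball 0 1" for \<zeta>
      proof -
        have "cmod (of_real (\<rho> / 2) * \<zeta>) \<le> \<rho> / 2 * 1" using that r0 unfolding norm_mult by (intro mult_mono) auto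
        then have "of_real (\<rho> / 2) * \<zeta> \<in> ball 0 \<rho>" using r0 by simp
        then have "f (of_real (\<rho> / 2) * \<zeta>) \<noteq> w1" "f (of_real (\<rho> / 2) * \<zeta>) \<noteq> w2" using w by blast+
        then show ?thesis using wne by (auto simp: g_def)
      qed
      have "cmod (f 0 - w1) \<le> 3 * \<rho>" using norm_triangle_ineq4[of "f 0" w1] w r1 by linarith
      then have g0: "cmod (g 0) \<le> 1" using w12 r0 wne by (simp add: g_def norm_divide divide_le_eq)
      define t where "t = ln (\<rho> / 4)"
      have et: "exp t = \<rho> / 4" using r0 by (simp add: t_def)
      have "exp (max t0 0) \<le> exp t" using r1(1) et by linarith
      then have "max t0 0 \<le> t" by (simp only: exp_le_cancel_iff)
      then have tt: "t \<ge> t0" "t \<ge> 0" by auto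
      have "nevanlinna_N (exp t) f = 0" using nevanlinna_N_eq[of "exp t"] np by (simp add: pole_mult_def)
      then obtain z where z: "cmod z = exp t" "cmod (f z) > exp (2 * t)" using t0[OF tt(1)] tt by auto
      define \<zeta> where "\<zeta> = z / of_real (\<rho> / 2)"
      have "cmod \<zeta> = (\<rho> / 4) / (\<rho> / 2)" unfolding \<zeta>_def norm_divide using z et r0 by simp
      then have "cmod \<zeta> \<le> 1 / 2" using r0 by simp
      then have "cmod (g \<zeta>) \<le> K" unfolding K_def by (intro Schottky[OF hg g0 g01]) auto
      moreover have "of_real (\<rho> / 2) * \<zeta> = z" using r0 by (simp add: \<zeta>_def)
      ultimately have "cmod (f z - w1) \<le> K * cmod (w2 - w1)" using wne by (simp add: g_def norm_divide divide_le_eq)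
      also have "\<dots> \<le> K * (10 * \<rho>)" using w12 K by (intro mult_left_mono) auto
      finally have "cmod (f z) \<le> 2 * \<rho> + K * (10 * \<rho>)" using norm_triangle_ineq2[of "f z" w1] w by linarith
      also have "\<dots> = (2 + 10 * K) * \<rho>" by (simp add: algebra_simps)
      also have "\<dots> \<le> (\<rho> / 16) * \<rho>" using r1 r0 by (intro mult_right_mono) auto
      also have "\<dots> = exp t * exp t" by (simp add: et)
      also have "\<dots> = exp (2 * t)" by (simp flip: exp_add)
      finally show False using z by simp
    qed
  qed
qed

text \<open>The circle covered by f bounds a disc to which the induction hypothesis applies, and the
  maximum principle moves the large value from this disc to the circle.\<close>

lemma entire_iterates_large:
  assumes np: "\<And>z. \<not> is_pole f z"
    and cov: "\<And>\<rho>. \<rho> \<ge> \<rho>0 \<Longrightarrow> \<exists>s\<ge>2 * \<rho>. sphere 0 s \<subseteq> f ` ball 0 \<rho>" and "\<rho>0 > 0" "\<rho> \<ge> \<rho>0"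
  shows "\<exists>z\<in>cball 0 \<rho>. cmod ((f ^^ n) z) \<ge> 2 ^ n * \<rho>"
  using assms(4)
proof (induction n arbitrary: \<rho>)
  case 0
  then show ?case using assms(3) by (intro bexI[of _ "of_real \<rho>"]) auto
next
  case (Suc n)
  obtain s where s: "s \<ge> 2 * \<rho>" "sphere 0 s \<subseteq> f ` ball 0 \<rho>" using cov[OF Suc.prems] by blast
  have s0: "s \<ge> \<rho>0" "s > 0" using s Suc.prems assms(3) by auto
  obtain z where z: "z \<in> cball 0 s" "cmod ((f ^^ n) z) \<ge> 2 ^ n * s" using Suc.IH[OF s0(1)] by blast
  have hol: "(f ^^ n) holomorphic_on UNIV"
    using np iterate_analytic analytic_on_analytic_at[of "f ^^ n" UNIV] analytic_imp_holomorphic by blast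
  have "\<exists>w\<in>sphere 0 s. cmod ((f ^^ n) w) \<ge> 2 ^ n * s"
  proof (rule ccontr)
    assume neg: "\<not> ?thesis"
    have cpt: "compact (sphere (0::complex) s)" "sphere (0::complex) s \<noteq> {}" using s0 by auto
    have "continuous_on (sphere 0 s) (\<lambda>w. cmod ((f ^^ n) w))"
      by (intro continuous_intros holomorphic_on_imp_continuous_on holomorphic_on_subset[OF hol]) auto
    from continuous_attains_sup[OF cpt this] obtain w where w: "w \<in> sphere 0 s"
      "\<And>v. v \<in> sphere 0 s \<Longrightarrow> cmod ((f ^^ n) v) \<le> cmod ((f ^^ n) w)" by auto
    have "cmod ((f ^^ n) z) \<le> cmod ((f ^^ n) w)"
    proof (rule maximum_modulus_frontier[of "f ^^ n" "cball 0 s"])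
      show "continuous_on (closure (cball 0 s)) (f ^^ n)"
        by (rule holomorphic_on_imp_continuous_on[OF holomorphic_on_subset[OF hol]]) auto
    qed (use z w s0 hol in \<open>auto intro: holomorphic_on_subset\<close>)
    then have "2 ^ n * s \<le> cmod ((f ^^ n) w)" using z(2) by linarith
    then show False using neg w(1) by blast
  qed
  then obtain w where w: "w \<in> sphere 0 s" "cmod ((f ^^ n) w) \<ge> 2 ^ n * s" by blast
  then obtain v where v: "v \<in> ball 0 \<rho>" "w = f v" using s(2) by blast
  have "2 ^ Suc n * \<rho> = 2 ^ n * (2 * \<rho>)" by simp
  also have "\<dots> \<le> 2 ^ n * s" using s(1) by (intro mult_left_mono) auto
  also have "\<dots> \<le> cmod ((f ^^ Suc n) v)" using w(2) v(2) by (simp add: funpow_swap1)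
  finally show ?case using v(1) by (intro bexI[of _ v]) auto
qed

text \<open>If every point were normal, f would be entire. The even iterates fix a point p, but they
  are unbounded at points of a fixed disc, and \<open>normal_escape\<close> would make p escape
  too.\<close>

lemma plane_fatou_ne_UNIV: "plane_fatou \<noteq> UNIV"
proof
  assume UN: "plane_fatou = UNIV"
  have np: "\<not> is_pole f z" for z using fatou_regular[of z 0] UN by simp
  have hol: "f holomorphic_on UNIV" using np by (intro f_holomorphic)
  obtain p where p: "f (f p) = p" using entire_double_fixpoint[OF hol not_poly] by blast
  obtain \<rho>0 where \<rho>0: "\<rho>0 > 0" "\<And>\<rho>. \<rho> \<ge> \<rho>0 \<Longrightarrow> \<exists>s\<ge>2 * \<rho>. sphere 0 s \<subseteq> f ` ball 0 \<rho>"
    using entire_covers_circle[OF np] by metis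
  have "\<exists>z\<in>cball 0 \<rho>0. cmod ((f ^^ (2 * i)) z) \<ge> 2 ^ (2 * i) * \<rho>0" for i
    by (rule entire_iterates_large[OF np \<rho>0(2,1)]) auto
  then obtain u where u: "\<And>i. u i \<in> cball 0 \<rho>0" "\<And>i. cmod ((f ^^ (2 * i)) (u i)) \<ge> 2 ^ (2 * i) * \<rho>0" by metis
  have "filterlim (\<lambda>i. \<rho>0 * real i) at_top sequentially"
    using \<rho>0(1) by (intro filterlim_tendsto_pos_mult_at_top[OF tendsto_const _ filterlim_real_sequentially])
  then have "filterlim (\<lambda>i. cmod ((f ^^ (2 * i)) (u i))) at_top sequentially"
  proof (rule filterlim_at_top_mono, intro always_eventually allI)
    fix i
    have "real i \<le> 2 ^ i" by (metis less_imp_le of_nat_less_two_power)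
    also have "(2::real) ^ i \<le> 2 ^ (2 * i)" by (intro power_increasing) auto
    finally have "\<rho>0 * real i \<le> 2 ^ (2 * i) * \<rho>0" using \<rho>0(1) by (simp add: mult.commute)
    then show "\<rho>0 * real i \<le> cmod ((f ^^ (2 * i)) (u i))" using u(2)[of i] by linarith
  qed
  then have "\<forall>\<^sub>F i in sequentially. \<forall>v\<in>{p}. cmod p + 1 \<le> cmod ((f ^^ (2 * i)) v)"
    using normal_escape[where W = UNIV and h = "\<lambda>n. f ^^ n" and m = "\<lambda>i. 2 * i" and ?K0.0 = "cball 0 \<rho>0" and u = u and K = "{p}"]
      UN connected_UNIV iterate_holomorphic sphere_normal_iterates u(1) by simp
  then obtain i where i: "cmod p + 1 \<le> cmod ((f ^^ (2 * i)) p)" by (auto simp: eventually_sequentially)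
  have "(f ^^ (2 * i)) p = p" using p by (induction i) auto
  then show False using i by simp
qed

lemma fatou_omits:
  obtains a where "\<And>z. z \<in> plane_fatou \<Longrightarrow> f z \<noteq> a"
  using plane_fatou_ne_UNIV fatou_invariant by (metis UNIV_eq_I)

end

section \<open>Chains of annuli\<close>

definition log_annulus :: "real \<Rightarrow> real \<Rightarrow> complex set" where
  "log_annulus x y = {z. exp x < cmod z \<and> cmod z < exp y}"

definition closed_log_annulus :: "real \<Rightarrow> real \<Rightarrow> complex set" where
  "closed_log_annulus x y = {z. exp x \<le> cmod z \<and> cmod z \<le> exp y}"

text \<open>The fourth root of such a width is at least \<open>step_min\<close>, so that the
  covering step applies, and at least twice \<open>step_loss\<close>, so that at most half of the
  relative width is lost in one step.\<close>

definition start_width :: "real \<Rightarrow> real \<Rightarrow> real" where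
  "start_width C c = (max 1 (max (step_min C c) (2 * step_loss C c))) ^ 4"

lemma log_annulus_subset_closed: "log_annulus x y \<subseteq> closed_log_annulus x y"
  by (auto simp: log_annulus_def closed_log_annulus_def)

lemma compact_closed_log_annulus: "compact (closed_log_annulus x y)"
proof -
  have "closed_log_annulus x y = cball 0 (exp y) - ball 0 (exp x)" by (auto simp: closed_log_annulus_def)
  then show ?thesis by (simp add: compact_diff)
qed

lemma closed_log_annulus_ln: "w \<in> closed_log_annulus x y \<longleftrightarrow> w \<noteq> 0 \<and> x \<le> ln (cmod w) \<and> ln (cmod w) \<le> y"
proof (cases "w = 0")
  case False
  then have "cmod w = exp (ln (cmod w))" by simp
  then show ?thesis using False unfolding closed_log_annulus_def by (metis (mono_tags, lifting) exp_le_cancel_iff mem_Collect_eq)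
qed (auto simp: closed_log_annulus_def not_le)

lemma log_annulus_ln: "w \<in> log_annulus x y \<longleftrightarrow> w \<noteq> 0 \<and> x < ln (cmod w) \<and> ln (cmod w) < y"
proof (cases "w = 0")
  case False
  then have "cmod w = exp (ln (cmod w))" by simp
  then show ?thesis using False unfolding log_annulus_def by (metis (mono_tags, lifting) exp_less_cancel_iff mem_Collect_eq)
qed (auto simp: log_annulus_def not_less)

lemma exp_minus_two_le:
  fixes d :: real assumes "0 \<le> d" "d \<le> 1 / 2" shows "exp (- 2 * d) \<le> 1 - d"
proof -
  have "exp (2 * d) * (1 - d) \<ge> (1 + 2 * d) * (1 - d)"
    using assms exp_ge_add_one_self[of "2 * d"] by (intro mult_right_mono) auto
  moreover have "(1 + 2 * d) * (1 - d) = 1 + d * (1 - 2 * d)" by (simp add: algebra_simps)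
  moreover have "d * (1 - 2 * d) \<ge> 0" using assms by (intro mult_nonneg_nonneg) auto
  ultimately have "1 \<le> (1 - d) * exp (2 * d)" by (simp add: mult.commute)
  then show ?thesis by (simp add: exp_minus field_simps)
qed

context growth_function
begin

text \<open>The condition y1 \<le> 2 x1 keeps the image admissible for the next step, where the
  width must not exceed x1. An image that is too wide is cut off; this is harmless because the
  relative width demanded is at most 1.\<close>

definition step_ok :: "real \<Rightarrow> real \<Rightarrow> real \<Rightarrow> real \<Rightarrow> real \<Rightarrow> bool" where
  "step_ok Q x y x1 y1 \<longleftrightarrow> Q * x \<le> x1 \<and> y1 \<le> 2 * x1 \<and>
     (1 - step_loss C c / root 4 (y - x)) * ((y - x) / x) * x1 \<le> y1 - x1 \<and>
     closed_log_annulus x1 y1 \<subseteq> f ` log_annulus x y"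

lemma step_ok_exists:
  obtains t0 where "t0 \<ge> 1"
    "\<And>x y. \<lbrakk>x \<ge> t0; y - x \<ge> start_width C c; y \<le> 2 * x; \<And>z. z \<in> log_annulus x y \<Longrightarrow> \<not> is_pole f z \<and> f z \<noteq> a\<rbrakk> \<Longrightarrow>
       \<exists>x1 y1. step_ok Q x y x1 y1"
proof -
  obtain t0 where t0: "\<And>x q. \<lbrakk>x \<ge> t0; q \<ge> step_min C c; q ^ 4 \<le> x;
        \<And>z. exp x < cmod z \<Longrightarrow> cmod z < exp (x + q ^ 4) \<Longrightarrow> \<not> is_pole f z \<and> f z \<noteq> a\<rbrakk> \<Longrightarrow>
      \<exists>x1 y1. x1 \<ge> max Q 1 * x \<and> y1 - x1 \<ge> (1 - step_loss C c / q) * (q ^ 4 / x) * x1 \<and>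
        (\<forall>w. w \<noteq> 0 \<and> x1 \<le> ln (cmod w) \<and> ln (cmod w) \<le> y1 \<longrightarrow> w \<in> f ` {z. exp x < cmod z \<and> cmod z < exp (x + q ^ 4)})"
    using step_annulus[of a "max Q 1"] by blast
  show ?thesis
  proof (rule that[of "max t0 1"])
    fix x y assume x: "x \<ge> max t0 1" and y: "y - x \<ge> start_width C c" "y \<le> 2 * x"
      and reg: "\<And>z. z \<in> log_annulus x y \<Longrightarrow> \<not> is_pole f z \<and> f z \<noteq> a"
    define m where "m = max 1 (max (step_min C c) (2 * step_loss C c))"
    have m: "m \<ge> 1" "m \<ge> step_min C c" "m \<ge> 2 * step_loss C c" by (auto simp: m_def)
    define q where "q = root 4 (y - x)"
    have L: "y - x \<ge> m ^ 4" using y by (simp add: start_width_def m_def)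
    then have "root 4 (y - x) \<ge> root 4 (m ^ 4)" by (intro real_root_le_mono) auto
    then have qm: "q \<ge> m" using m by (simp add: q_def real_root_power_cancel)
    have "y - x \<ge> 0" using L m zero_le_power[of m 4] by linarith
    then have q4: "q ^ 4 = y - x" by (simp add: q_def real_root_pow_pos2)
    have xq: "x + q ^ 4 = y" using q4 by simp
    have "\<exists>x1 y1. x1 \<ge> max Q 1 * x \<and> y1 - x1 \<ge> (1 - step_loss C c / q) * (q ^ 4 / x) * x1 \<and>
        (\<forall>w. w \<noteq> 0 \<and> x1 \<le> ln (cmod w) \<and> ln (cmod w) \<le> y1 \<longrightarrow> w \<in> f ` {z. exp x < cmod z \<and> cmod z < exp (x + q ^ 4)})"
      by (rule t0) (use x y m qm q4 reg in \<open>auto simp: log_annulus_def\<close>)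
    then obtain x1 y1 where x1: "x1 \<ge> max Q 1 * x" and y1: "y1 - x1 \<ge> (1 - step_loss C c / q) * (q ^ 4 / x) * x1"
      and cov: "\<And>w. w \<noteq> 0 \<and> x1 \<le> ln (cmod w) \<and> ln (cmod w) \<le> y1 \<Longrightarrow> w \<in> f ` log_annulus x y"
      unfolding xq log_annulus_def by blast
    have "Q * x \<le> max Q 1 * x" "1 * x \<le> max Q 1 * x" using x by (intro mult_right_mono; simp)+
    then have x1Q: "Q * x \<le> x1" "x \<le> x1" using x1 by auto
    have sl: "step_loss C c > 0"
    proof -
      have "step_radius C > 0" "step_pole_const C c > 0" using lnC c pi_gt_zero
        by (auto simp: step_radius_def step_pole_const_def add_nonneg_pos intro!: add_pos_pos add_pos_nonneg)
      then show ?thesis using pi_gt_zero by (simp add: step_loss_def add_pos_pos)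
    qed
    have r: "0 \<le> q ^ 4 / x" "q ^ 4 / x \<le> 1" using q4 y x \<open>y - x \<ge> 0\<close> by (auto simp: divide_le_eq)
    have "(1 - step_loss C c / q) * (q ^ 4 / x) \<le> 1 * 1"
      using sl r qm m by (intro mult_mono) auto
    then have "(1 - step_loss C c / q) * (q ^ 4 / x) * x1 \<le> 1 * x1"
      using x1Q x by (intro mult_right_mono) auto
    then have "step_ok Q x y x1 (min y1 (2 * x1))"
      unfolding step_ok_def using x1Q y1 cov q4
      by (auto simp: q_def[symmetric] closed_log_annulus_ln)
    then show "\<exists>x1 y1. step_ok Q x y x1 y1" by blast
  qed simp
qed

text \<open>The number 32 is 2 times 2^4: at most half of the relative width is lost in a step, so
  the width still grows 16-fold and its fourth root at least doubles. The relative losses are then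
  at most 2^(-n) / 2, and the relative width never falls below e^(-2) times its initial
  value.\<close>

lemma annulus_chain:
  assumes Q: "Q \<ge> 32"
  obtains t0 where "t0 \<ge> 1"
    "\<And>S x0 y0. \<lbrakk>x0 \<ge> t0; y0 - x0 \<ge> start_width C c; y0 \<le> 2 * x0; log_annulus x0 y0 \<subseteq> S;
        f ` S \<subseteq> S; \<And>z. z \<in> S \<Longrightarrow> \<not> is_pole f z \<and> f z \<noteq> a\<rbrakk> \<Longrightarrow>
       \<exists>X Y \<rho>. X 0 = x0 \<and> Y 0 = y0 \<and> \<rho> > 0 \<and>
         (\<forall>n::nat. Q * X n \<le> X (Suc n) \<and> (1 + \<rho>) * X n \<le> Y n \<and> Y n \<le> 2 * X n \<and> start_width C c \<le> Y n - X n \<and> log_annulus (X n) (Y n) \<subseteq> S \<and>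
            closed_log_annulus (X (Suc n)) (Y (Suc n)) \<subseteq> f ` log_annulus (X n) (Y n))"
proof -
  obtain t0 where t0: "t0 \<ge> 1"
    "\<And>x y. \<lbrakk>x \<ge> t0; y - x \<ge> start_width C c; y \<le> 2 * x; \<And>z. z \<in> log_annulus x y \<Longrightarrow> \<not> is_pole f z \<and> f z \<noteq> a\<rbrakk> \<Longrightarrow>
       \<exists>x1 y1. step_ok Q x y x1 y1"
    using step_ok_exists[of a Q] by blast
  show ?thesis
  proof (rule that[OF t0(1)])
    fix S x0 y0
    assume x0: "x0 \<ge> t0" "y0 - x0 \<ge> start_width C c" "y0 \<le> 2 * x0" "log_annulus x0 y0 \<subseteq> S"
      and S: "f ` S \<subseteq> S" "\<And>z. z \<in> S \<Longrightarrow> \<not> is_pole f z \<and> f z \<noteq> a"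
    define good where "good = (\<lambda>p :: real \<times> real. fst p \<ge> t0 \<and> snd p - fst p \<ge> start_width C c \<and> snd p \<le> 2 * fst p \<and> log_annulus (fst p) (snd p) \<subseteq> S)"
    define m where "m = max 1 (max (step_min C c) (2 * step_loss C c))"
    have m: "m \<ge> 1" "m \<ge> 2 * step_loss C c" by (auto simp: m_def)
    have sw: "start_width C c = m ^ 4" "m ^ 4 \<ge> 1" using m by (simp_all add: start_width_def m_def one_le_power)
    have rootm: "root 4 (y - x) \<ge> m" if "y - x \<ge> start_width C c" for x y
      using that m real_root_le_mono[of 4 "m ^ 4" "y - x"] by (simp add: sw real_root_power_cancel)
    have half: "step_loss C c / root 4 (y - x) \<le> 1 / 2" if "y - x \<ge> start_width C c" for x y
    proof -
      have "step_loss C c \<le> (1 / 2) * root 4 (y - x)" "root 4 (y - x) > 0" using rootm[OF that] m by linarith+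
      then show ?thesis by (simp only: pos_divide_le_eq)
    qed
    have next_good: "good (x1, y1) \<and> y1 - x1 \<ge> 16 * (y - x)" if g: "good (x, y)" and s: "step_ok Q x y x1 y1" for x y x1 y1
    proof -
      have gx: "x \<ge> t0" "y - x \<ge> start_width C c" "y \<le> 2 * x" "log_annulus x y \<subseteq> S" using g by (auto simp: good_def)
      have sx: "Q * x \<le> x1" "y1 \<le> 2 * x1" "(1 - step_loss C c / root 4 (y - x)) * ((y - x) / x) * x1 \<le> y1 - x1"
        "closed_log_annulus x1 y1 \<subseteq> f ` log_annulus x y" using s by (auto simp: step_ok_def)
      have x: "x \<ge> 1" using gx t0 by linarith
      have L: "y - x \<ge> 1" using gx(2) sw by linarith
      have Qx: "1 * x \<le> Q * x" using Q x by (intro mult_right_mono) auto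
      have p: "0 \<le> (y - x) / x" using x L by simp
      have h: "1 / 2 \<le> 1 - step_loss C c / root 4 (y - x)" using half[OF gx(2)] by linarith
      have a1: "(1 / 2) * ((y - x) / x) \<le> (1 - step_loss C c / root 4 (y - x)) * ((y - x) / x)" by (rule mult_right_mono[OF h p])
      have a2: "0 \<le> (1 / 2) * ((y - x) / x)" using p by simp
      have "(1 / 2) * ((y - x) / x) * (Q * x) \<le> (1 - step_loss C c / root 4 (y - x)) * ((y - x) / x) * x1"
        by (rule mult_mono[OF a1 sx(1)]) (use a1 a2 x Q in \<open>linarith | simp\<close>)+
      moreover have "(1 / 2) * ((y - x) / x) * (Q * x) = Q / 2 * (y - x)" using x by simp
      ultimately have "Q / 2 * (y - x) \<le> y1 - x1" using sx(3) by linarith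
      moreover have "16 * (y - x) \<le> Q / 2 * (y - x)" using Q L by (intro mult_right_mono) auto
      ultimately have w: "y1 - x1 \<ge> 16 * (y - x)" by linarith
      have "log_annulus x1 y1 \<subseteq> S"
        using log_annulus_subset_closed[of x1 y1] sx(4) gx(4) S(1) by blast
      moreover have "start_width C c \<le> y1 - x1" using w gx(2) L by argo
      moreover have "t0 \<le> x1" using gx(1) sx(1) Qx by argo
      ultimately show ?thesis using w sx unfolding good_def fst_conv snd_conv by (intro conjI) (linarith | assumption)+
    qed
    have "\<exists>f'. f' 0 = (x0, y0) \<and> (\<forall>n. good (f' n) \<and> step_ok Q (fst (f' n)) (snd (f' n)) (fst (f' (Suc n))) (snd (f' (Suc n))))"
    proof -
      define R where "R = (\<lambda>p p'. step_ok Q (fst p) (snd p) (fst p') (snd p'))"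
      have ex: "\<exists>p'. good p' \<and> R p p'" if "good p" for p
      proof -
        obtain x1 y1 where "step_ok Q (fst p) (snd p) x1 y1"
          using t0(2)[of "fst p" "snd p"] \<open>good p\<close> S(2) unfolding good_def by blast
        then show ?thesis using next_good[of "fst p" "snd p" x1 y1] \<open>good p\<close> unfolding R_def by (intro exI[of _ "(x1, y1)"]) auto
      qed
      define nx where "nx = (\<lambda>p. SOME p'. good p' \<and> R p p')"
      have nx: "good (nx p) \<and> R p (nx p)" if "good p" for p unfolding nx_def by (rule someI_ex[OF ex[OF that]])
      define f' where "f' = (\<lambda>n. (nx ^^ n) (x0, y0))"
      have "good (f' n)" for n by (induction n) (use x0 nx in \<open>auto simp: f'_def good_def\<close>)
      then have "good (f' n) \<and> R (f' n) (f' (Suc n))" for n using nx[of "f' n"] by (simp add: f'_def)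
      then show ?thesis unfolding R_def by (intro exI[of _ f']) (auto simp: f'_def)
    qed
    then obtain f' where f'0: "f' 0 = (x0, y0)" and f': "\<And>n. good (f' n)"
      "\<And>n. step_ok Q (fst (f' n)) (snd (f' n)) (fst (f' (Suc n))) (snd (f' (Suc n)))" by blast
    define X where "X = (\<lambda>n. fst (f' n))"
    define Y where "Y = (\<lambda>n. snd (f' n))"
    have XY: "X n \<ge> t0" "Y n - X n \<ge> start_width C c" "Y n \<le> 2 * X n" "log_annulus (X n) (Y n) \<subseteq> S" for n
      using f'(1)[of n] by (auto simp: good_def X_def Y_def)
    have st: "Q * X n \<le> X (Suc n)" "(1 - step_loss C c / root 4 (Y n - X n)) * ((Y n - X n) / X n) * X (Suc n) \<le> Y (Suc n) - X (Suc n)"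
      "closed_log_annulus (X (Suc n)) (Y (Suc n)) \<subseteq> f ` log_annulus (X n) (Y n)" for n
      using f'(2)[of n] by (auto simp: step_ok_def X_def Y_def)
    have Xpos: "X n \<ge> 1" for n using XY(1)[of n] t0(1) by linarith
    have w16: "Y (Suc n) - X (Suc n) \<ge> 16 * (Y n - X n)" for n
      using next_good[of "X n" "Y n" "X (Suc n)" "Y (Suc n)"] f' by (simp add: X_def Y_def)
    have sl: "step_loss C c > 0"
    proof -
      have "step_radius C > 0" "step_pole_const C c > 0" using lnC c pi_gt_zero
        by (auto simp: step_radius_def step_pole_const_def add_nonneg_pos intro!: add_pos_pos add_pos_nonneg)
      then show ?thesis using pi_gt_zero by (simp add: step_loss_def add_pos_pos)
    qed
    have root_growth: "root 4 (Y n - X n) \<ge> m * 2 ^ n" for n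
    proof -
      have "Y n - X n \<ge> 16 ^ n * m ^ 4"
      proof (induction n)
        case 0 then show ?case using XY(2)[of 0] by (simp add: sw)
      next
        case (Suc n)
        have "16 ^ Suc n * m ^ 4 = 16 * (16 ^ n * m ^ 4)" by simp
        also have "\<dots> \<le> 16 * (Y n - X n)" using Suc by (intro mult_left_mono) auto
        also have "\<dots> \<le> Y (Suc n) - X (Suc n)" by (rule w16)
        finally show ?case .
      qed
      moreover have "16 ^ n * m ^ 4 = (m * 2 ^ n) ^ 4"
        by (simp add: power_mult_distrib power_mult[symmetric] mult.commute[of n] power_mult[of 2 4, simplified])
      ultimately have "root 4 ((m * 2 ^ n) ^ 4) \<le> root 4 (Y n - X n)" by (intro real_root_le_mono) auto
      moreover have "root 4 ((m * 2 ^ n) ^ 4) = m * 2 ^ n" using m by (intro real_root_power_cancel) auto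
      ultimately show ?thesis by simp
    qed
    define rw where "rw = (\<lambda>n. (Y n - X n) / X n)"
    have rw0: "rw n > 0" for n using XY(2)[of n] sw Xpos[of n] by (auto simp: rw_def intro!: divide_pos_pos)
    have rwSuc: "rw (Suc n) \<ge> exp (- (1 / 2 ^ n)) * rw n" for n
    proof -
      define d where "d = step_loss C c / root 4 (Y n - X n)"
      have mp: "m * 2 ^ n > 0" using m by simp
      then have rp: "root 4 (Y n - X n) > 0" using root_growth[of n] by linarith
      have "d \<le> step_loss C c / (m * 2 ^ n)"
        unfolding d_def using sl by (intro divide_left_mono root_growth mult_pos_pos rp mp) auto
      also have "\<dots> \<le> (m / 2) / (m * 2 ^ n)" using m by (intro divide_right_mono) auto
      also have "\<dots> = (1 / 2 ^ n) / 2" using m by simp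
      finally have d1: "d \<le> (1 / 2 ^ n) / 2" .
      have d0: "d \<ge> 0" using sl rp by (simp add: d_def)
      have "exp (- (1 / 2 ^ n)) \<le> exp (- 2 * d)" using d1 by simp
      also have "\<dots> \<le> 1 - d" by (rule exp_minus_two_le[OF d0]) (use half[OF XY(2)] in \<open>simp add: d_def\<close>)
      finally have "exp (- (1 / 2 ^ n)) * rw n \<le> (1 - d) * rw n" using rw0[of n] by (intro mult_right_mono) auto
      also have "\<dots> \<le> rw (Suc n)"
        using st(2)[of n] Xpos[of "Suc n"] unfolding rw_def d_def by (simp add: pos_le_divide_eq)
      finally show ?thesis .
    qed
    have rwn: "rw n \<ge> exp (- 2) * rw 0" for n
    proof -
      \<comment> \<open>The exponents 2^(-k) with k < n add up to 2 - 2 / 2^n.\<close>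
      have "rw n \<ge> exp (- 2 + 2 / 2 ^ n) * rw 0"
      proof (induction n)
        case (Suc n)
        have "- 2 + 2 / 2 ^ Suc n = - (1 / 2 ^ n) + (- 2 + 2 / 2 ^ n :: real)" by (simp add: field_simps)
        then have "exp (- 2 + 2 / 2 ^ Suc n) * rw 0 = exp (- (1 / 2 ^ n)) * (exp (- 2 + 2 / 2 ^ n) * rw 0)"
          by (simp only: exp_add mult.assoc)
        also have "\<dots> \<le> exp (- (1 / 2 ^ n)) * rw n" using Suc by (intro mult_left_mono) auto
        also have "\<dots> \<le> rw (Suc n)" by (rule rwSuc)
        finally show ?case .
      qed simp
      moreover have "exp (- 2) * rw 0 \<le> exp (- 2 + 2 / 2 ^ n) * rw 0" using rw0[of 0] by (intro mult_right_mono) auto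
      ultimately show ?thesis by linarith
    qed
    define \<rho> where "\<rho> = exp (- 2) * rw 0"
    have "(1 + \<rho>) * X n \<le> Y n" for n
    proof -
      have "\<rho> * X n \<le> rw n * X n" using rwn[of n] Xpos[of n] by (intro mult_right_mono) (auto simp: \<rho>_def)
      also have "\<dots> = Y n - X n" using Xpos[of n] by (simp add: rw_def)
      finally show ?thesis by (simp add: distrib_right)
    qed
    moreover have "\<rho> > 0" using rw0[of 0] by (simp add: \<rho>_def)
    ultimately show "\<exists>X Y \<rho>. X 0 = x0 \<and> Y 0 = y0 \<and> \<rho> > 0 \<and>
         (\<forall>n::nat. Q * X n \<le> X (Suc n) \<and> (1 + \<rho>) * X n \<le> Y n \<and> Y n \<le> 2 * X n \<and> start_width C c \<le> Y n - X n \<and> log_annulus (X n) (Y n) \<subseteq> S \<and>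
            closed_log_annulus (X (Suc n)) (Y (Suc n)) \<subseteq> f ` log_annulus (X n) (Y n))"
      using f'0 XY st by (intro exI[of _ X] exI[of _ Y] exI[of _ \<rho>]) (auto simp: X_def Y_def)
  qed
qed

end

section \<open>Limits of positive harmonic functions\<close>

lemma holomorphic_Re_constant:
  assumes g: "g holomorphic_on S" and S: "open S" "connected S"
    and T: "open T" "T \<noteq> {}" "T \<subseteq> S" "\<And>u. u \<in> T \<Longrightarrow> Re (g u) = c" and u: "u \<in> S"
  shows "Re (g u) = c"
proof (cases "g constant_on S")
  case True
  then show ?thesis using T u unfolding constant_on_def by (metis ex_in_conv subsetD)
next
  case False
  have op: "open (g ` T)" by (rule open_mapping_thm[OF g S T(1,3) False])
  obtain t where t: "t \<in> T" using T(2) by blast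
  then obtain e where e: "e > 0" "ball (g t) e \<subseteq> g ` T" using op open_contains_ball by blast
  have "g t + of_real (e / 2) \<in> ball (g t) e" using e(1) by (simp add: dist_norm)
  then obtain t' where "t' \<in> T" "g t + of_real (e / 2) = g t'" using e(2) by blast
  then have "Re (g t) + e / 2 = Re (g t')" by (metis Re_complex_of_real plus_complex.sel(1))
  then show ?thesis using T(4) t \<open>t' \<in> T\<close> e(1) by simp
qed

lemma positive_montel:
  fixes G :: "nat \<Rightarrow> complex \<Rightarrow> complex"
  assumes G: "\<And>k. G k holomorphic_on ball z R" and pos: "\<And>k v. v \<in> ball z R \<Longrightarrow> Re (G k v) > 0"
    and im: "\<And>k. Im (G k z) = 0" and B: "\<And>k. Re (G k z) \<le> B"
  obtains s g where "strict_mono (s :: nat \<Rightarrow> nat)" "g holomorphic_on ball z R"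
    "\<And>K. compact K \<Longrightarrow> K \<subseteq> ball z R \<Longrightarrow> uniform_limit K (\<lambda>k. G (s k)) g sequentially"
proof -
  have bd: "\<exists>M. \<forall>h\<in>range G. \<forall>v\<in>K. norm (h v) \<le> M" if K: "compact K" "K \<subseteq> ball z R" for K
  proof (cases "K = {}")
    case False
    have "continuous_on K (dist z)" by (intro continuous_intros)
    from continuous_attains_sup[OF K(1) False this] obtain q where q: "q \<in> K" "\<And>v. v \<in> K \<Longrightarrow> dist z v \<le> dist z q" by auto
    have d: "dist z q < R" using q(1) K(2) by auto
    have R0: "R > 0" using d zero_le_dist[of z q] by linarith
    then have z: "z \<in> ball z R" by simp
    have "norm (G k v) \<le> (R + R) / (R - dist z q) * B" if v: "v \<in> K" for k v
    proof -
      have "norm (G k v) \<le> (R + dist z v) / (R - dist z v) * Re (G k z)"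
        by (rule positive_real_norm_le[OF G pos _ im]) (use v K in auto)
      also have "\<dots> \<le> (R + R) / (R - dist z q) * B"
        using q(2)[OF v] d pos[OF z, of k] B[of k]
        R0 by (intro mult_mono frac_le divide_nonneg_nonneg) auto
      finally show ?thesis .
    qed
    then show ?thesis by blast
  qed auto
  obtain g s where "g holomorphic_on ball z R" "strict_mono (s :: nat \<Rightarrow> nat)"
    "\<And>K. compact K \<Longrightarrow> K \<subseteq> ball z R \<Longrightarrow> uniform_limit K (G \<circ> s) g sequentially"
    by (rule Montel[of "ball z R" "range G" G]) (use G bd in \<open>auto\<close>)
  then show ?thesis by (intro that[of s g]) (auto simp: o_def)
qed

text \<open>On a circle around \<open>z\<close> on which \<open>g'\<close> has no zero, \<open>Re g\<close> takes values on both sides of \<open>Re (g z)\<close>.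
  Hence so does \<open>Re (L k) / v k\<close>, which attains \<open>y k / v k\<close> at a point of the circle where \<open>(L k)'\<close> is large.\<close>

lemma covering_sequence:
  fixes L :: "nat \<Rightarrow> complex \<Rightarrow> complex" and v y :: "nat \<Rightarrow> real"
  assumes R: "R > 0" and L: "\<And>k. L k holomorphic_on ball z R" and g: "g holomorphic_on ball z R"
    and lim: "\<And>K. compact K \<Longrightarrow> K \<subseteq> ball z R \<Longrightarrow>
      uniform_limit K (\<lambda>k u. (L k u - \<i> * of_real (Im (L k z))) / of_real (v k)) g sequentially"
    and v: "filterlim v at_top sequentially" and nc: "\<not> g constant_on ball z R"
    and y: "(\<lambda>k. y k / v k) \<longlonglongrightarrow> Re (g z)"
  shows "\<forall>\<^sub>F k in sequentially. \<forall>w. cmod w = exp (y k) \<longrightarrow> w \<in> (\<lambda>u. exp (L k u)) ` ball z R"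
proof -
  define G where "G = (\<lambda>k u. (L k u - \<i> * of_real (Im (L k z))) / of_real (v k))"
  have zin: "z \<in> ball z R" using R by simp
  have dg: "deriv g holomorphic_on ball z R" by (rule holomorphic_deriv[OF g open_ball])
  have "\<exists>\<beta>\<in>ball z R. deriv g \<beta> \<noteq> 0"
  proof (rule ccontr)
    assume "\<not> ?thesis"
    then have "\<exists>c. \<forall>u\<in>ball z R. g u = c"
      using g holomorphic_derivI[OF g open_ball]
      by (intro has_field_derivative_zero_constant[OF convex_ball]) (metis has_field_derivative_at_within)
    then show False using nc by (auto simp: constant_on_def)
  qed
  then obtain \<beta> where \<beta>: "\<beta> \<in> ball z R" "deriv g \<beta> \<noteq> 0" by blast
  \<comment> \<open>The zeros of g' are isolated, so some circle about z carries none of them, even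
    if z itself is a critical point.\<close>
  have "\<exists>r>0. ball z r \<subseteq> ball z R \<and> (\<forall>w\<in>ball z r - {z}. deriv g w \<noteq> 0)"
  proof (cases "deriv g z = 0")
    case True
    show ?thesis
      by (rule isolated_zeros[OF dg open_ball connected_ball zin True \<beta>]) blast
  next
    case False
    have "continuous_on (ball z R) (deriv g)" using dg by (rule holomorphic_on_imp_continuous_on)
    then have "isCont (deriv g) z" using zin by (simp add: continuous_on_eq_continuous_at)
    then obtain e where e: "e > 0" "\<And>w. dist z w < e \<Longrightarrow> deriv g w \<noteq> 0" using continuous_at_avoid[of z "deriv g" 0] False by auto
    then show ?thesis using R by (intro exI[of _ "min e R"]) auto
  qed
  then obtain r where r: "r > 0" "ball z r \<subseteq> ball z R" "\<And>w. w \<in> ball z r - {z} \<Longrightarrow> deriv g w \<noteq> 0" by blast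
  have rR: "r \<le> R" using r(1,2) R by (simp add: ball_subset_ball_iff)
  define s where "s = r / 2"
  define l where "l = (R - s) / 2"
  have s: "0 < s" "s < R" "s < r" using r(1) rR by (auto simp: s_def)
  have l: "l > 0" "s + l < R" using s by (auto simp: l_def field_simps)
  let ?C = "sphere z s" and ?K = "cball z (s + l)"
  have K: "compact ?K" "?K \<subseteq> ball z R" using l by auto
  have CK: "cball \<zeta> l \<subseteq> ?K" if "\<zeta> \<in> ?C" for \<zeta>
  proof
    fix u assume "u \<in> cball \<zeta> l"
    then show "u \<in> ?K" using that dist_triangle[of z u \<zeta>] by simp
  qed
  have CR: "?C \<subseteq> ball z R" using s by auto
  have C: "compact ?C" "?C \<noteq> {}" "connected ?C" using s by (auto intro: connected_sphere)
  have "continuous_on ?C (\<lambda>w. cmod (deriv g w))"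
    by (intro continuous_intros holomorphic_on_imp_continuous_on holomorphic_on_subset[OF dg CR])
  from continuous_attains_inf[OF C(1,2) this] obtain q0 where q0: "q0 \<in> ?C" "\<And>w. w \<in> ?C \<Longrightarrow> cmod (deriv g q0) \<le> cmod (deriv g w)" by auto
  define \<delta> where "\<delta> = cmod (deriv g q0) / 2"
  have "q0 \<in> ball z r - {z}" using q0(1) s by auto
  then have \<delta>: "\<delta> > 0" using r(3) by (simp add: \<delta>_def)
  have gi: "g holomorphic_on ball z s" "continuous_on (cball z s) g"
    using s by (auto intro!: holomorphic_on_subset[OF g] holomorphic_on_imp_continuous_on)
  have opg: "open (g ` ball z s)" by (rule open_mapping_thm[OF g open_ball connected_ball open_ball _ nc]) (use s in auto)
  then obtain e where e: "e > 0" "ball (g z) e \<subseteq> g ` ball z s" using s open_contains_ball by (metis centre_in_ball image_eqI)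
  have mem: "g z + of_real (e / 2) \<in> g ` ball z s" "g z - of_real (e / 2) \<in> g ` ball z s"
    using e by (auto simp: dist_norm intro!: subsetD[OF e(2)])
  have "\<exists>p\<in>?C. Re (g p) > Re (g z)"
  proof (rule ccontr)
    assume "\<not> ?thesis"
    then have "Re (g u) \<le> Re (g z)" if "u \<in> cball z s" for u
      using maximum_real_frontier[of g "cball z s" "Re (g z)" u] gi s that by (simp add: not_less)
    moreover obtain u where "u \<in> ball z s" "g u = g z + of_real (e / 2)" using mem(1) by (metis imageE)
    ultimately have "Re (g z + of_real (e / 2)) \<le> Re (g z)" by (metis mem_ball_imp_mem_cball)
    then show False using e(1) by simp
  qed
  then obtain p where p: "p \<in> ?C" "Re (g p) > Re (g z)" by blast
  have "\<exists>q\<in>?C. Re (g q) < Re (g z)"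
  proof (rule ccontr)
    assume neg: "\<not> ?thesis"
    have "Re (- g u) \<le> - Re (g z)" if "u \<in> cball z s" for u
      by (rule maximum_real_frontier[of "\<lambda>u. - g u" "cball z s"]) (use gi s that neg in \<open>auto intro!: holomorphic_intros continuous_intros simp: not_less\<close>)
    moreover obtain u where "u \<in> ball z s" "g u = g z - of_real (e / 2)" using mem(2) by (metis imageE)
    ultimately have "Re (- (g z - of_real (e / 2))) \<le> - Re (g z)" by (metis mem_ball_imp_mem_cball)
    then show False using e(1) by simp
  qed
  then obtain q where q: "q \<in> ?C" "Re (g q) < Re (g z)" by blast
  obtain \<Lambda> where \<Lambda>: "covering_const \<Lambda>" using covering_const_exists by blast
  have vpos: "\<forall>\<^sub>F k in sequentially. v k \<ge> max 1 (\<Lambda> / (\<delta> * l))" using v unfolding filterlim_at_top by blast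
  have unif: "\<forall>\<^sub>F k in sequentially. \<forall>u\<in>?K. dist (G k u) (g u) < \<delta> * l"
    using lim[OF K] \<delta> l(1) unfolding uniform_limit_iff G_def by simp
  have pt: "(\<lambda>k. Re (G k u)) \<longlonglongrightarrow> Re (g u)" if "u \<in> ?C" for u
  proof -
    have "(\<lambda>k. G k u) \<longlonglongrightarrow> g u" using lim[of "{u}"] subsetD[OF CR that] by (simp add: G_def)
    then show ?thesis by (rule tendsto_Re)
  qed
  have "\<forall>\<^sub>F k in sequentially. y k / v k < Re (G k p)"
    using order_tendstoD(2)[OF tendsto_diff[OF y pt[OF p(1)]], of 0] p(2) by simp
  moreover have "\<forall>\<^sub>F k in sequentially. Re (G k q) < y k / v k"
    using order_tendstoD(1)[OF tendsto_diff[OF y pt[OF q(1)]], of 0] q(2) by simp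
  ultimately show ?thesis using vpos unif
  proof eventually_elim
    case (elim k)
    have vk: "v k > 0" "v k \<ge> \<Lambda> / (\<delta> * l)" using elim(3) by auto
    have ReG: "Re (G k u) = Re (L k u) / v k" for u by (simp add: G_def Re_divide_of_real)
    have contL: "continuous_on ?C (\<lambda>u. Re (L k u))"
      by (intro continuous_intros holomorphic_on_imp_continuous_on holomorphic_on_subset[OF L CR])
    have "connected ((\<lambda>u. Re (L k u)) ` ?C)" by (rule connected_continuous_image[OF contL C(3)])
    then have Icc: "{Re (L k q)..Re (L k p)} \<subseteq> (\<lambda>u. Re (L k u)) ` ?C" by (rule connected_contains_Icc) (use p q in auto)
    have "y k \<in> {Re (L k q)..Re (L k p)}"
      using elim(1,2) vk(1) unfolding ReG by (simp add: divide_less_cancel)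
    from subsetD[OF Icc this] obtain \<zeta> where \<zeta>: "\<zeta> \<in> ?C" "Re (L k \<zeta>) = y k" by (metis imageE)
    have LG: "L k u = of_real (v k) * G k u + \<i> * of_real (Im (L k z))" for u using vk(1) by (simp add: G_def)
    have hG: "G k holomorphic_on ball z R" unfolding G_def
      by (rule holomorphic_on_divide[OF holomorphic_on_diff[OF L holomorphic_on_const] holomorphic_on_const]) (use vk(1) in simp)
    \<comment> \<open>Cauchy's inequality makes the derivative of G k close to g' on the circle. So
      |(L k)'| is at least v k \<delta> there, and the covering constant is reached because v tends
      to infinity.\<close>
    have "norm ((deriv ^^ 1) (\<lambda>u. G k u - g u) \<zeta>) \<le> fact 1 * (\<delta> * l) / l ^ 1"
    proof (rule Cauchy_inequality)
      have sub: "cball \<zeta> l \<subseteq> ball z R" using CK[OF \<zeta>(1)] K(2) by blast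
      show "(\<lambda>u. G k u - g u) holomorphic_on ball \<zeta> l" "continuous_on (cball \<zeta> l) (\<lambda>u. G k u - g u)"
        using sub by (auto intro!: holomorphic_intros holomorphic_on_imp_continuous_on holomorphic_on_subset[OF hG] holomorphic_on_subset[OF g])
      show "norm (G k u - g u) \<le> \<delta> * l" if "norm (\<zeta> - u) = l" for u
      proof -
        have "u \<in> ?K" using CK[OF \<zeta>(1)] that by (auto simp: dist_norm)
        then show ?thesis using elim(4) by (force simp: dist_norm)
      qed
    qed (use l in auto)
    moreover have D: "(g has_field_derivative deriv g \<zeta>) (at \<zeta>)" "(G k has_field_derivative deriv (G k) \<zeta>) (at \<zeta>)"
      using holomorphic_derivI[OF g open_ball] holomorphic_derivI[OF hG open_ball] \<zeta>(1) CR by auto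
    have "deriv (\<lambda>u. G k u - g u) \<zeta> = deriv (G k) \<zeta> - deriv g \<zeta>" by (rule DERIV_imp_deriv[OF DERIV_diff[OF D(2,1)]])
    ultimately have "cmod (deriv (G k) \<zeta> - deriv g \<zeta>) \<le> \<delta>" using l by simp
    moreover have "cmod (deriv g \<zeta>) \<ge> 2 * \<delta>" using q0(2)[OF \<zeta>(1)] by (simp add: \<delta>_def)
    ultimately have dG: "cmod (deriv (G k) \<zeta>) \<ge> \<delta>"
      using norm_triangle_ineq2[of "deriv g \<zeta>" "deriv (G k) \<zeta>"] by (simp add: norm_minus_commute)
    have "((\<lambda>u. of_real (v k) * G k u + \<i> * of_real (Im (L k z))) has_field_derivative of_real (v k) * deriv (G k) \<zeta> + 0) (at \<zeta>)"
      by (rule DERIV_add[OF DERIV_cmult[OF D(2)] DERIV_const])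
    moreover have "(\<lambda>u. of_real (v k) * G k u + \<i> * of_real (Im (L k z))) = L k" by (rule ext) (rule LG[symmetric])
    ultimately have "(L k has_field_derivative of_real (v k) * deriv (G k) \<zeta> + 0) (at \<zeta>)" by simp
    then have "deriv (L k) \<zeta> = of_real (v k) * deriv (G k) \<zeta> + 0" by (rule DERIV_imp_deriv)
    then have "cmod (deriv (L k) \<zeta>) = v k * cmod (deriv (G k) \<zeta>)" using vk(1) by (simp add: norm_mult)
    also have "\<dots> \<ge> v k * \<delta>" using dG vk(1) by (intro mult_left_mono) auto
    finally have "cmod (deriv (L k) \<zeta>) * l \<ge> v k * \<delta> * l" using l by (simp add: mult_right_mono)
    moreover have "v k * \<delta> * l \<ge> \<Lambda>" using vk(2) \<delta> l by (simp add: pos_divide_le_eq mult.assoc)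
    ultimately have der: "cmod (deriv (L k) \<zeta>) * l \<ge> \<Lambda>" by linarith
    have bl: "ball \<zeta> l \<subseteq> ball z R" using CK[OF \<zeta>(1)] K(2) ball_subset_cball by blast
    show ?case
    proof (intro allI impI)
      fix w assume "cmod w = exp (y k)"
      then have "w \<in> (\<lambda>u. exp (L k u)) ` ball \<zeta> l"
        using \<Lambda>[unfolded covering_const_def, THEN conjunct2, rule_format, OF holomorphic_on_subset[OF L bl] l(1) der] \<zeta>(2) by simp
      then show "w \<in> (\<lambda>u. exp (L k u)) ` ball z R" using bl by blast
    qed
  qed
qed

text \<open>Let T n be the sum of the errors still to come. Once |s n| exceeds T n, the sign of s is
  fixed and |s n| - T n increases from then on; if this never happens for n \<ge> N, then s tends to
  0.\<close>

lemma convergent_if_almost_expanding: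
  fixes s e :: "nat \<Rightarrow> real"
  assumes e: "\<And>n. e n \<ge> 0" "summable e" and B: "\<And>n. \<bar>s n\<bar> \<le> B"
    and up: "\<And>n. n \<ge> N \<Longrightarrow> s n \<ge> 0 \<Longrightarrow> s n - e n \<le> s (Suc n)"
    and dn: "\<And>n. n \<ge> N \<Longrightarrow> s n \<le> 0 \<Longrightarrow> s (Suc n) \<le> s n + e n"
  shows "convergent s"
proof -
  define T where "T = (\<lambda>n. suminf e - sum e {..<n})"
  have T0: "T n \<ge> 0" for n using sum_le_suminf[OF e(2), of "{..<n}"] e(1) by (simp add: T_def)
  have TS: "T (Suc n) = T n - e n" for n by (simp add: T_def)
  have Tl: "T \<longlonglongrightarrow> 0" unfolding T_def using tendsto_diff[OF tendsto_const summable_LIMSEQ[OF e(2)], of "suminf e"] by simp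
  have one_sided: "convergent s'" if B': "\<And>n. \<bar>s' n\<bar> \<le> B" and n: "n \<ge> N" "s' n > T n"
    and up': "\<And>n. n \<ge> N \<Longrightarrow> s' n \<ge> 0 \<Longrightarrow> s' n - e n \<le> s' (Suc n)" for s' :: "nat \<Rightarrow> real" and n
  proof -
    have pos: "s' (n + k) - T (n + k) > 0" for k
    proof (induction k)
      case (Suc k)
      then show ?case using up'[of "n + k"] n(1) T0[of "n + k"] TS[of "n + k"] by simp
    qed (use n in simp)
    have inc: "incseq (\<lambda>k. s' (k + n) - T (k + n))"
    proof (rule incseq_SucI)
      fix k
      show "s' (k + n) - T (k + n) \<le> s' (Suc k + n) - T (Suc k + n)"
        using up'[of "k + n"] n(1) T0[of "k + n"] TS[of "k + n"] pos[of k] by (simp add: add.commute)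
    qed
    have "Bseq (\<lambda>k. s' (k + n) - T (k + n))"
    proof (rule BseqI'[of _ B])
      fix k show "norm (s' (k + n) - T (k + n)) \<le> B"
        using pos[of k] T0[of "k + n"] B'[of "k + n"] by (simp add: add.commute)
    qed
    then have "convergent (\<lambda>k. s' (k + n) - T (k + n))" using inc by (intro Bseq_monoseq_convergent) (auto simp: monoseq_def incseq_def)
    moreover have "convergent (\<lambda>k. T (k + n))" using Tl LIMSEQ_ignore_initial_segment convergentI by blast
    ultimately have "convergent (\<lambda>k. (s' (k + n) - T (k + n)) + T (k + n))" by (rule convergent_add)
    then show ?thesis by (simp add: convergent_ignore_initial_segment)
  qed
  consider n where "n \<ge> N" "s n > T n" | n where "n \<ge> N" "- s n > T n" | "\<And>n. n \<ge> N \<Longrightarrow> \<bar>s n\<bar> \<le> T n" by force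
  then show ?thesis
  proof cases
    case 1 then show ?thesis using one_sided[of s] B up by blast
  next
    case 2
    have "convergent (\<lambda>n. - s n)"
    proof (rule one_sided[where s' = "\<lambda>n. - s n", OF _ 2])
      fix n assume "n \<ge> N" "- s n \<ge> 0"
      then show "- s n - e n \<le> - s (Suc n)" using dn[of n] by simp
    qed (use B in auto)
    then show ?thesis by (simp add: convergent_minus_iff[symmetric])
  next
    case 3
    have "s \<longlonglongrightarrow> 0"
      by (rule Lim_null_comparison[OF _ Tl]) (use 3 in \<open>auto simp: eventually_sequentially\<close>)
    then show ?thesis by (rule convergentI)
  qed
qed

text \<open>The local functions G need not fit together. Therefore the partial derivatives required
  by \<open>harmonic_on\<close> are defined globally through \<open>frechet_derivative\<close> and
  only computed from G.\<close>

lemma harmonic_on_locally_Re: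
  assumes S: "open S"
    and loc: "\<And>z. z \<in> S \<Longrightarrow> \<exists>e>0. \<exists>G. ball z e \<subseteq> S \<and> G holomorphic_on ball z e \<and> (\<forall>v\<in>ball z e. h v = Re (G v))"
  shows "harmonic_on h S"
proof -
  have Re_deriv: "((\<lambda>v. Re (G v)) has_derivative (\<lambda>v. Re (deriv G u) * Re v + (- Im (deriv G u)) * Im v)) (at u)"
    if "G holomorphic_on ball z e" "u \<in> ball z e" for G z e u
  proof -
    have "(G has_derivative (*) (deriv G u)) (at u)"
      using holomorphic_derivI[OF that(1) open_ball that(2)] by (simp add: has_field_derivative_def)
    then have "((\<lambda>v. Re (G v)) has_derivative (\<lambda>v. Re (deriv G u * v))) (at u)" by (rule has_derivative_Re)
    moreover have "(\<lambda>v. Re (deriv G u * v)) = (\<lambda>v. Re (deriv G u) * Re v + (- Im (deriv G u)) * Im v)" by (auto simp: fun_eq_iff)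
    ultimately show ?thesis by simp
  qed
  have Dat: "frechet_derivative k (at u) 1 = a \<and> frechet_derivative k (at u) \<i> = b"
    if "(k has_derivative (\<lambda>v. a * Re v + b * Im v)) (at u)" for k :: "complex \<Rightarrow> real" and a b u
    using frechet_derivative_at[OF that] by (simp add: fun_eq_iff flip: frechet_derivative_at[OF that])
  define ux where "ux = (\<lambda>u. frechet_derivative h (at u) 1)"
  define uy where "uy = (\<lambda>u. frechet_derivative h (at u) \<i>)"
  define uxx where "uxx = (\<lambda>u. frechet_derivative ux (at u) 1)"
  define uxy where "uxy = (\<lambda>u. frechet_derivative ux (at u) \<i>)"
  define uyx where "uyx = (\<lambda>u. frechet_derivative uy (at u) 1)"
  define uyy where "uyy = (\<lambda>u. frechet_derivative uy (at u) \<i>)"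
  have main: "\<exists>e>0. \<exists>p. ball z e \<subseteq> S \<and> p holomorphic_on ball z e \<and> (\<forall>u\<in>ball z e.
      (h has_derivative (\<lambda>v. ux u * Re v + uy u * Im v)) (at u) \<and>
      (ux has_derivative (\<lambda>v. uxx u * Re v + uxy u * Im v)) (at u) \<and>
      (uy has_derivative (\<lambda>v. uyx u * Re v + uyy u * Im v)) (at u) \<and>
      uxx u = Re (p u) \<and> uxy u = - Im (p u) \<and> uyx u = - Im (p u) \<and> uyy u = - Re (p u))" if z: "z \<in> S" for z
  proof -
    obtain e G where e: "e > 0" "ball z e \<subseteq> S" and G: "G holomorphic_on ball z e" "\<And>v. v \<in> ball z e \<Longrightarrow> h v = Re (G v)"
      using loc[OF z] by blast
    have hG': "deriv G holomorphic_on ball z e" "(\<lambda>v. \<i> * deriv G v) holomorphic_on ball z e" 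
      by (auto intro!: holomorphic_intros holomorphic_deriv[OF G(1) open_ball])
    have di: "deriv (\<lambda>v. \<i> * deriv G v) u = \<i> * deriv (deriv G) u" if "u \<in> ball z e" for u
      by (rule DERIV_imp_deriv[OF DERIV_cmult[OF holomorphic_derivI[OF hG'(1) open_ball that]]])
    have hd: "(h has_derivative (\<lambda>v. Re (deriv G u) * Re v + (- Im (deriv G u)) * Im v)) (at u)" if u: "u \<in> ball z e" for u
      by (rule has_derivative_transform_within_open[OF Re_deriv[OF G(1) u] open_ball u]) (simp add: G(2))
    have uxG: "ux u = Re (deriv G u)" "uy u = Re (\<i> * deriv G u)" if "u \<in> ball z e" for u
      using Dat[OF hd[OF that]] by (simp_all add: ux_def uy_def)
    have uxd: "(ux has_derivative (\<lambda>v. Re (deriv (deriv G) u) * Re v + (- Im (deriv (deriv G) u)) * Im v)) (at u)" if u: "u \<in> ball z e" for u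
      by (rule has_derivative_transform_within_open[OF Re_deriv[OF hG'(1) u] open_ball u]) (simp add: uxG)
    have uyd: "(uy has_derivative (\<lambda>v. (- Im (deriv (deriv G) u)) * Re v + (- Re (deriv (deriv G) u)) * Im v)) (at u)" if u: "u \<in> ball z e" for u
    proof -
      have "(uy has_derivative (\<lambda>v. Re (deriv (\<lambda>v. \<i> * deriv G v) u) * Re v + (- Im (deriv (\<lambda>v. \<i> * deriv G v) u)) * Im v)) (at u)"
        by (rule has_derivative_transform_within_open[OF Re_deriv[OF hG'(2) u] open_ball u]) (simp only: uxG)
      then show ?thesis by (simp add: di[OF u])
    qed
    show ?thesis
    proof (intro exI[of _ e] conjI exI[of _ "deriv (deriv G)"] ballI)
      fix u assume u: "u \<in> ball z e"
      show xx: "uxx u = Re (deriv (deriv G) u)" "uxy u = - Im (deriv (deriv G) u)"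
        using Dat[OF uxd[OF u]] unfolding uxx_def uxy_def by blast+
      show yy: "uyx u = - Im (deriv (deriv G) u)" "uyy u = - Re (deriv (deriv G) u)"
        using Dat[OF uyd[OF u]] unfolding uyx_def uyy_def by blast+
      show "(ux has_derivative (\<lambda>v. uxx u * Re v + uxy u * Im v)) (at u)" unfolding xx by (rule uxd[OF u])
      show "(uy has_derivative (\<lambda>v. uyx u * Re v + uyy u * Im v)) (at u)" unfolding yy by (rule uyd[OF u])
      have "uy u = - Im (deriv G u)" using uxG(2)[OF u] by simp
      then show "(h has_derivative (\<lambda>v. ux u * Re v + uy u * Im v)) (at u)" using hd[OF u] uxG(1)[OF u] by simp
    qed (use e holomorphic_deriv[OF hG'(1) open_ball] in auto)
  qed
  have cont: "continuous_on S k"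
    if k: "\<And>z. z \<in> S \<Longrightarrow> \<exists>e>0. \<exists>p. p holomorphic_on ball z e \<and> (\<forall>u\<in>ball z e. k u = Re (c * p u))" for k :: "complex \<Rightarrow> real" and c
    unfolding continuous_on_eq_continuous_at[OF S]
  proof
    fix z assume "z \<in> S"
    then obtain e p where e: "e > 0" "p holomorphic_on ball z e" "\<And>u. u \<in> ball z e \<Longrightarrow> k u = Re (c * p u)" using k by blast
    have "continuous_on (ball z e) (\<lambda>u. Re (c * p u))" by (intro continuous_intros holomorphic_on_imp_continuous_on[OF e(2)])
    then have "continuous_on (ball z e) k" using e(3) by (simp cong: continuous_on_cong_simp)
    then show "isCont k z" using e(1) by (simp add: continuous_on_eq_continuous_at)
  qed
  have c: "continuous_on S uxx" "continuous_on S uxy" "continuous_on S uyx" "continuous_on S uyy"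
  proof -
    show "continuous_on S uxx" by (rule cont[of _ 1], drule main) (simp, blast)
    show "continuous_on S uxy" by (rule cont[of _ \<i>], drule main) (simp, blast)
    show "continuous_on S uyx" by (rule cont[of _ \<i>], drule main) (simp, blast)
    show "continuous_on S uyy" by (rule cont[of _ "- 1"], drule main) (simp, blast)
  qed
  show ?thesis
    unfolding harmonic_on_def
  proof (intro conjI exI ballI)
    fix z assume z: "z \<in> S"
    show "(h has_derivative (\<lambda>v. ux z * Re v + uy z * Im v)) (at z)" 
      "(ux has_derivative (\<lambda>v. uxx z * Re v + uxy z * Im v)) (at z)"
      "(uy has_derivative (\<lambda>v. uyx z * Re v + uyy z * Im v)) (at z)" "uxx z + uyy z = 0"
      using main[OF z] by (auto dest!: bspec[of _ _ z])
  qed (use S c in auto)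
qed

section \<open>Components containing wide annuli\<close>

text \<open>The omitted value of \<open>fatou_omits\<close> serves as the number a of the chain. The
  annuli are recorded as subsets of images of T, so that they can be attributed to a compact set or
  to a small ball.\<close>

lemma (in growth_function) chain_from:
  assumes Q: "Q \<ge> 32"
  obtains t0 where "t0 \<ge> 1"
    "\<And>T x y N. \<lbrakk>x \<ge> t0; y - x \<ge> start_width C c; y \<le> 2 * x; T \<subseteq> plane_fatou; log_annulus x y \<subseteq> (f ^^ N) ` T\<rbrakk> \<Longrightarrow>
      \<exists>X Y \<rho>. X 0 = x \<and> Y 0 = y \<and> \<rho> > 0 \<and> (\<forall>n::nat. 1 \<le> X n \<and> Q * X n \<le> X (Suc n) \<and> (1 + \<rho>) * X n \<le> Y n \<and> Y n \<le> 2 * X n \<and>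
        start_width C c \<le> Y n - X n \<and> log_annulus (X n) (Y n) \<subseteq> (f ^^ (N + n)) ` T \<and>
        closed_log_annulus (X (Suc n)) (Y (Suc n)) \<subseteq> f ` log_annulus (X n) (Y n))"
proof -
  obtain a where a: "\<And>z. z \<in> plane_fatou \<Longrightarrow> f z \<noteq> a" using fatou_omits by blast
  obtain t0 where t0: "t0 \<ge> 1"
    "\<And>S x0 y0. \<lbrakk>x0 \<ge> t0; y0 - x0 \<ge> start_width C c; y0 \<le> 2 * x0; log_annulus x0 y0 \<subseteq> S;
        f ` S \<subseteq> S; \<And>z. z \<in> S \<Longrightarrow> \<not> is_pole f z \<and> f z \<noteq> a\<rbrakk> \<Longrightarrow>
       \<exists>X Y \<rho>. X 0 = x0 \<and> Y 0 = y0 \<and> \<rho> > 0 \<and>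
         (\<forall>n::nat. Q * X n \<le> X (Suc n) \<and> (1 + \<rho>) * X n \<le> Y n \<and> Y n \<le> 2 * X n \<and> start_width C c \<le> Y n - X n \<and> log_annulus (X n) (Y n) \<subseteq> S \<and>
            closed_log_annulus (X (Suc n)) (Y (Suc n)) \<subseteq> f ` log_annulus (X n) (Y n))"
    using annulus_chain[OF Q, of a] by blast
  show ?thesis
  proof (rule that[OF t0(1)])
    fix T x y N
    assume x: "x \<ge> t0" "y - x \<ge> start_width C c" "y \<le> 2 * x" and T: "T \<subseteq> plane_fatou" "log_annulus x y \<subseteq> (f ^^ N) ` T"
    have s1: "log_annulus x y \<subseteq> plane_fatou" using T fatou_iterate_invariant by blast
    have s2: "f ` plane_fatou \<subseteq> plane_fatou" using fatou_invariant by blast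
    have s3: "\<not> is_pole f z \<and> f z \<noteq> a" if "z \<in> plane_fatou" for z using fatou_regular[OF that, of 0] a[OF that] by simp
    have "\<exists>X Y \<rho>. X 0 = x \<and> Y 0 = y \<and> \<rho> > 0 \<and>
         (\<forall>n::nat. Q * X n \<le> X (Suc n) \<and> (1 + \<rho>) * X n \<le> Y n \<and> Y n \<le> 2 * X n \<and> start_width C c \<le> Y n - X n \<and> log_annulus (X n) (Y n) \<subseteq> plane_fatou \<and>
            closed_log_annulus (X (Suc n)) (Y (Suc n)) \<subseteq> f ` log_annulus (X n) (Y n))" by (rule t0(2)[OF x s1 s2]) (rule s3)
    then obtain X Y \<rho> where J: "X 0 = x \<and> Y 0 = y \<and> \<rho> > 0 \<and>
         (\<forall>n::nat. Q * X n \<le> X (Suc n) \<and> (1 + \<rho>) * X n \<le> Y n \<and> Y n \<le> 2 * X n \<and> start_width C c \<le> Y n - X n \<and> log_annulus (X n) (Y n) \<subseteq> plane_fatou \<and>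
            closed_log_annulus (X (Suc n)) (Y (Suc n)) \<subseteq> f ` log_annulus (X n) (Y n))" by (elim exE) (rule that)
    then have 0: "X 0 = x" "Y 0 = y" "\<rho> > 0" by blast+
    have n: "Q * X n \<le> X (Suc n) \<and> (1 + \<rho>) * X n \<le> Y n \<and> Y n \<le> 2 * X n \<and> start_width C c \<le> Y n - X n \<and>
            closed_log_annulus (X (Suc n)) (Y (Suc n)) \<subseteq> f ` log_annulus (X n) (Y n)" for n using J by blast
    have X1: "1 \<le> X n" for n
    proof (induction n)
      case (Suc k)
      have "1 * X k \<le> Q * X k" using Q Suc by (intro mult_right_mono) auto
      then show ?case using n[of k] Suc by linarith
    qed (use 0 x t0(1) in simp)
    have im: "log_annulus (X n) (Y n) \<subseteq> (f ^^ (N + n)) ` T" for n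
    proof (induction n)
      case (Suc k)
      have "log_annulus (X (Suc k)) (Y (Suc k)) \<subseteq> f ` log_annulus (X k) (Y k)" using n[of k] log_annulus_subset_closed by blast
      also have "\<dots> \<subseteq> f ` ((f ^^ (N + k)) ` T)" using Suc by (rule image_mono)
      finally show ?case by (simp add: image_image)
    qed (use 0 T in simp)
    show "\<exists>X Y \<rho>. X 0 = x \<and> Y 0 = y \<and> \<rho> > 0 \<and> (\<forall>n::nat. 1 \<le> X n \<and> Q * X n \<le> X (Suc n) \<and> (1 + \<rho>) * X n \<le> Y n \<and> Y n \<le> 2 * X n \<and>
        start_width C c \<le> Y n - X n \<and> log_annulus (X n) (Y n) \<subseteq> (f ^^ (N + n)) ` T \<and>
        closed_log_annulus (X (Suc n)) (Y (Suc n)) \<subseteq> f ` log_annulus (X n) (Y n))"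
      by (intro exI[of _ X] exI[of _ Y] exI[of _ \<rho>] conjI allI) (use 0 n X1 im in blast)+
  qed
qed

text \<open>The annuli are covered by images of one compact subset Kw of the component W. Points at
  which the logarithmic sizes X n and Y n are attained therefore have limit points inside W, where
  Harnack's inequality is available.\<close>

locale annulus_component = growth_function f C c r\<^sub>0 for f C c r\<^sub>0 +
  fixes W Kw :: "complex set" and m :: nat and X Y :: "nat \<Rightarrow> real" and \<rho> :: real
  assumes W: "open W" "connected W" "W \<subseteq> plane_fatou"
    and Kw: "compact Kw" "Kw \<subseteq> W"
    and \<rho>: "\<rho> > 0" and X1: "\<And>n. 1 \<le> X n" and grow: "\<And>n. 32 * X n \<le> X (Suc n)"
    and ratio: "\<And>n. (1 + \<rho>) * X n \<le> Y n" and Y2: "\<And>n. Y n \<le> 2 * X n"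
    and width: "\<And>n. start_width C c \<le> Y n - X n"
    and cover: "\<And>n. closed_log_annulus (X n) (Y n) \<subseteq> (f ^^ (m + n)) ` Kw"
begin

definition log_size :: "nat \<Rightarrow> complex \<Rightarrow> real" where
  "log_size n z = ln (cmod ((f ^^ n) z))"

lemma X_power: "32 ^ n \<le> X n"
proof (induction n)
  case (Suc n) then show ?case using grow[of n] by simp
qed (use X1[of 0] in simp)

lemma X_ge: "real n \<le> X n"
proof -
  have "real n \<le> 2 ^ n" by (simp add: less_imp_le)
  also have "(2::real) ^ n \<le> 32 ^ n" by (intro power_mono) auto
  finally show ?thesis using X_power[of n] by linarith
qed

lemma X_le_Y: "X n \<le> Y n"
proof -
  have "1 * X n \<le> (1 + \<rho>) * X n" using \<rho> X1[of n] by (intro mult_right_mono) auto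
  then show ?thesis using ratio[of n] by linarith
qed

lemma chain_point:
  assumes "X n \<le> t" "t \<le> Y n" obtains u where "u \<in> Kw" "log_size (m + n) u = t"
proof -
  have "complex_of_real (exp t) \<in> closed_log_annulus (X n) (Y n)" using assms by (simp add: closed_log_annulus_def)
  then obtain u where "u \<in> Kw" "(f ^^ (m + n)) u = complex_of_real (exp t)" using cover by (metis imageE subsetD)
  then show ?thesis using that[of u] by (simp add: log_size_def)
qed

lemma Kw_nonempty: "Kw \<noteq> {}"
  using chain_point[of 0 "X 0"] X_le_Y[of 0] by auto

lemma holo_W: "(f ^^ n) holomorphic_on W"
  by (rule holomorphic_on_subset[OF iterate_holomorphic W(3)])

text \<open>Points of Kw that are mapped to the inner circles of the annuli escape, and
  \<open>normal_escape\<close> extends this to all of W.\<close>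

lemma tends_infinity:
  assumes K: "compact K" "K \<subseteq> W"
  shows "\<forall>\<^sub>F n in sequentially. \<forall>z\<in>K. M \<le> cmod ((f ^^ n) z)"
proof -
  have "\<exists>u\<in>Kw. log_size (m + i) u = X i" for i using chain_point[of i "X i"] X_le_Y[of i] by auto
  then obtain u :: "nat \<Rightarrow> complex" where u: "\<And>i. u i \<in> Kw" "\<And>i. log_size (m + i) (u i) = X i" by metis
  have "filterlim (\<lambda>i. cmod ((f ^^ (m + i)) (u i))) at_top sequentially"
  proof (rule filterlim_at_top_mono[OF filterlim_real_sequentially], intro always_eventually allI)
    fix i
    have "real i \<le> exp (X i)" using X_ge[of i] exp_ge_add_one_self[of "X i"] by linarith
    also have "\<dots> = cmod ((f ^^ (m + i)) (u i))"
    proof -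
      have "cmod ((f ^^ (m + i)) (u i)) \<noteq> 0" using u(2)[of i] X1[of i] by (auto simp: log_size_def)
      then show ?thesis unfolding u(2)[symmetric] log_size_def by simp
    qed
    finally show "real i \<le> cmod ((f ^^ (m + i)) (u i))" .
  qed
  then have "\<forall>\<^sub>F i in sequentially. \<forall>v\<in>K. M \<le> cmod ((f ^^ (m + i)) v)"
    by (rule normal_escape[OF W(1,2) holo_W sphere_normal_iterates[OF W(1,3)] Kw u(1) _ K])
  then have "\<forall>\<^sub>F i in sequentially. \<forall>v\<in>K. M \<le> cmod ((f ^^ (i + m)) v)" by (simp only: add.commute)
  then show ?thesis using eventually_sequentially_seg[of "\<lambda>n. \<forall>z\<in>K. M \<le> cmod ((f ^^ n) z)" m] by blast
qed

lemma log_size_large: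
  assumes K: "compact K" "K \<subseteq> W"
  shows "\<forall>\<^sub>F n in sequentially. \<forall>z\<in>K. M \<le> log_size n z"
  using tends_infinity[OF K, of "exp M"]
proof eventually_elim
  case (elim n)
  show ?case
  proof
    fix z assume "z \<in> K"
    then have "exp M \<le> cmod ((f ^^ n) z)" using elim by blast
    then have "ln (exp M) \<le> ln (cmod ((f ^^ n) z))" by (subst ln_le_cancel_iff) (auto intro: less_le_trans[OF exp_gt_zero])
    then show "M \<le> log_size n z" by (simp add: log_size_def)
  qed
qed

lemma log_size_at_top: "z \<in> W \<Longrightarrow> filterlim (\<lambda>n. log_size n z) at_top sequentially"
  using log_size_large[of "{z}"] by (simp add: filterlim_at_top)

lemma log_branch:
  assumes z: "cball z r \<subseteq> W" "r > 0"
  shows "\<forall>\<^sub>F n in sequentially. \<exists>L. L holomorphic_on ball z r \<and>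
    (\<forall>u\<in>ball z r. (f ^^ n) u = exp (L u) \<and> Re (L u) = log_size n u \<and> 1 \<le> log_size n u)"
  using log_size_large[OF compact_cball z(1), of 1]
proof eventually_elim
  case (elim n)
  have big: "1 \<le> log_size n u" if "u \<in> ball z r" for u using elim that by auto
  have nz: "(f ^^ n) u \<noteq> 0" if "u \<in> ball z r" for u using big[OF that] by (auto simp: log_size_def)
  have hol: "(f ^^ n) holomorphic_on ball z r" using holo_W by (rule holomorphic_on_subset) (use z in auto)
  obtain L where L: "L holomorphic_on ball z r" "\<And>u. u \<in> ball z r \<Longrightarrow> exp (L u) = (f ^^ n) u"
    by (rule holomorphic_logarithm_exists[OF convex_ball open_ball hol nz, of z]) (use z in auto)
  have "Re (L u) = log_size n u" if "u \<in> ball z r" for u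
    using L(2)[OF that, symmetric] by (simp add: log_size_def)
  then show ?case using L big by (intro exI[of _ L]) auto
qed

lemma harnack_small:
  assumes z: "z \<in> W" and \<eta>: "\<eta> > 0"
  obtains \<delta> where "\<delta> > 0" "ball z \<delta> \<subseteq> W"
    "\<forall>\<^sub>F n in sequentially. \<forall>u\<in>ball z \<delta>. 1 \<le> log_size n u \<and> log_size n u \<le> (1 + \<eta>) * log_size n z \<and> log_size n z \<le> (1 + \<eta>) * log_size n u"
proof -
  obtain r where r: "r > 0" "cball z r \<subseteq> W" using z W(1) open_contains_cball by blast
  \<comment> \<open>This solves (r + \<delta>) / (r - \<delta>) = 1 + \<eta>.\<close>
  define \<delta> where "\<delta> = r * \<eta> / (2 + \<eta>)"
  have \<delta>: "\<delta> > 0" "\<delta> < r" using r \<eta> by (auto simp: \<delta>_def pos_divide_less_eq)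
  have \<delta>e: "\<delta> * (2 + \<eta>) = r * \<eta>" using \<eta> by (simp add: \<delta>_def)
  have "ball z \<delta> \<subseteq> cball z r" using \<delta> by auto
  then have sub: "ball z \<delta> \<subseteq> W" using r(2) by blast
  show ?thesis
  proof (rule that[OF \<delta>(1) sub])
    show "\<forall>\<^sub>F n in sequentially. \<forall>u\<in>ball z \<delta>. 1 \<le> log_size n u \<and> log_size n u \<le> (1 + \<eta>) * log_size n z \<and> log_size n z \<le> (1 + \<eta>) * log_size n u"
      using log_branch[OF r(2,1)]
    proof eventually_elim
      case (elim n)
      then obtain L where L: "L holomorphic_on ball z r"
        "\<And>u. u \<in> ball z r \<Longrightarrow> (f ^^ n) u = exp (L u) \<and> Re (L u) = log_size n u \<and> 1 \<le> log_size n u" by blast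
      show ?case
      proof
        fix u assume u: "u \<in> ball z \<delta>"
        define d where "d = dist z u"
        have d: "0 \<le> d" "d < \<delta>" using u by (auto simp: d_def)
        have ur: "u \<in> ball z r" "z \<in> ball z r" using u \<delta> r by auto
        have pos: "0 \<le> Re (L v)" if "v \<in> ball z r" for v using L(2)[OF that] by linarith
        have H: "(r - d) / (r + d) * log_size n z \<le> log_size n u" "log_size n u \<le> (r + d) / (r - d) * log_size n z"
          using harnack_ball[OF L(1) pos ur(1)] L(2)[OF ur(1)] L(2)[OF ur(2)] by (simp_all add: d_def)
        have "d * (2 + \<eta>) \<le> \<delta> * (2 + \<eta>)" using d \<eta> by (intro mult_right_mono) auto
        then have k: "r + d \<le> (1 + \<eta>) * (r - d)" using \<delta>e by (simp add: algebra_simps)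
        have rd: "r - d > 0" "r + d > 0" using d \<delta> r by auto
        have "(r + d) / (r - d) \<le> 1 + \<eta>" using k rd by (simp add: pos_divide_le_eq)
        then have "(r + d) / (r - d) * log_size n z \<le> (1 + \<eta>) * log_size n z" using L(2)[OF ur(2)] by (intro mult_right_mono) auto
        moreover have "log_size n z \<le> (1 + \<eta>) * log_size n u"
        proof -
          have "(r - d) * log_size n z \<le> (r + d) * log_size n u"
            using H(1) rd by (simp add: pos_divide_le_eq mult.commute)
          also have "\<dots> \<le> ((1 + \<eta>) * (r - d)) * log_size n u" using k L(2)[OF ur(1)] by (intro mult_right_mono) auto
          finally have "(r - d) * log_size n z \<le> (r - d) * ((1 + \<eta>) * log_size n u)" by (simp add: mult_ac)
          then show ?thesis using rd(1) by (simp only: mult_le_cancel_left_pos)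
        qed
        ultimately show "1 \<le> log_size n u \<and> log_size n u \<le> (1 + \<eta>) * log_size n z \<and> log_size n z \<le> (1 + \<eta>) * log_size n u"
          using H(2) L(2)[OF ur(1)] by linarith
      qed
    qed
  qed
qed

text \<open>Being comparable up to some constant is an equivalence relation whose classes are open
  by Harnack's inequality, and W is connected.\<close>

lemma comparable_points:
  assumes "z \<in> W" "v \<in> W"
  shows "\<exists>\<kappa>\<ge>1. \<forall>\<^sub>F n in sequentially. 1 \<le> log_size n z \<and> 1 \<le> log_size n v \<and> log_size n v \<le> \<kappa> * log_size n z \<and> log_size n z \<le> \<kappa> * log_size n v"
proof (rule connected_equivalence_relation[OF W(2) assms])
  fix x y assume "\<exists>\<kappa>\<ge>1. \<forall>\<^sub>F n in sequentially. 1 \<le> log_size n x \<and> 1 \<le> log_size n y \<and> log_size n y \<le> \<kappa> * log_size n x \<and> log_size n x \<le> \<kappa> * log_size n y"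
  then show "\<exists>\<kappa>\<ge>1. \<forall>\<^sub>F n in sequentially. 1 \<le> log_size n y \<and> 1 \<le> log_size n x \<and> log_size n x \<le> \<kappa> * log_size n y \<and> log_size n y \<le> \<kappa> * log_size n x"
    by (elim exE) (rule exI, elim conjE, intro conjI, assumption, erule eventually_mono, blast)
next
  fix x y w
  assume "\<exists>\<kappa>\<ge>1. \<forall>\<^sub>F n in sequentially. 1 \<le> log_size n x \<and> 1 \<le> log_size n y \<and> log_size n y \<le> \<kappa> * log_size n x \<and> log_size n x \<le> \<kappa> * log_size n y"
    "\<exists>\<kappa>\<ge>1. \<forall>\<^sub>F n in sequentially. 1 \<le> log_size n y \<and> 1 \<le> log_size n w \<and> log_size n w \<le> \<kappa> * log_size n y \<and> log_size n y \<le> \<kappa> * log_size n w"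
  then obtain k l where k: "k \<ge> 1" "\<forall>\<^sub>F n in sequentially. 1 \<le> log_size n x \<and> 1 \<le> log_size n y \<and> log_size n y \<le> k * log_size n x \<and> log_size n x \<le> k * log_size n y"
    and l: "l \<ge> 1" "\<forall>\<^sub>F n in sequentially. 1 \<le> log_size n y \<and> 1 \<le> log_size n w \<and> log_size n w \<le> l * log_size n y \<and> log_size n y \<le> l * log_size n w" by blast
  have kl: "1 \<le> k * l" using mult_mono[of 1 k 1 l] k(1) l(1) by simp
  have "\<forall>\<^sub>F n in sequentially. 1 \<le> log_size n x \<and> 1 \<le> log_size n w \<and> log_size n w \<le> (k * l) * log_size n x \<and> log_size n x \<le> (k * l) * log_size n w"
    using k(2) l(2)
  proof eventually_elim
    case (elim n)
    have "l * log_size n y \<le> l * (k * log_size n x)" "k * log_size n y \<le> k * (l * log_size n w)"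
      using elim k(1) l(1) by (auto intro!: mult_left_mono)
    then have "log_size n w \<le> (k * l) * log_size n x" "log_size n x \<le> (k * l) * log_size n w"
      using elim by (simp_all add: mult_ac)
    then show ?case using elim by blast
  qed
  then show "\<exists>\<kappa>\<ge>1. \<forall>\<^sub>F n in sequentially. 1 \<le> log_size n x \<and> 1 \<le> log_size n w \<and> log_size n w \<le> \<kappa> * log_size n x \<and> log_size n x \<le> \<kappa> * log_size n w"
    using kl by (intro exI[of _ "k * l"] conjI)
next
  fix x assume x: "x \<in> W"
  obtain \<delta> where d: "\<delta> > 0" "ball x \<delta> \<subseteq> W"
    "\<forall>\<^sub>F n in sequentially. \<forall>u\<in>ball x \<delta>. 1 \<le> log_size n u \<and> log_size n u \<le> (1 + 2) * log_size n x \<and> log_size n x \<le> (1 + 2) * log_size n u"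
    using harnack_small[OF x, of 2] by auto
  have "\<exists>\<kappa>\<ge>1. \<forall>\<^sub>F n in sequentially. 1 \<le> log_size n x \<and> 1 \<le> log_size n y \<and> log_size n y \<le> \<kappa> * log_size n x \<and> log_size n x \<le> \<kappa> * log_size n y"
    if y: "y \<in> ball x \<delta>" for y
    using d(3) d(1) y by (intro exI[of _ 3] conjI) (auto elim!: eventually_mono)
  then show "\<exists>T. openin (top_of_set W) T \<and> x \<in> T \<and> (\<forall>y\<in>T. \<exists>\<kappa>\<ge>1. \<forall>\<^sub>F n in sequentially. 1 \<le> log_size n x \<and> 1 \<le> log_size n y \<and> log_size n y \<le> \<kappa> * log_size n x \<and> log_size n x \<le> \<kappa> * log_size n y)"
    using d(1,2) W(1) by (intro exI[of _ "ball x \<delta>"] conjI ballI) (auto simp: openin_open_eq)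
qed

lemma comparable:
  assumes K: "compact K" "K \<subseteq> W"
  obtains \<kappa> where "\<kappa> \<ge> 1" "\<forall>\<^sub>F n in sequentially. \<forall>u\<in>K. \<forall>v\<in>K. 1 \<le> log_size n u \<and> log_size n u \<le> \<kappa> * log_size n v"
proof -
  obtain z where z: "z \<in> W" using Kw Kw_nonempty by blast
  have loc: "\<exists>\<delta>>0. \<forall>\<^sub>F n in sequentially. \<forall>u\<in>ball x \<delta>. 1 \<le> log_size n u \<and> log_size n u \<le> 3 * log_size n x \<and> log_size n x \<le> 3 * log_size n u"
    if "x \<in> W" for x 
  proof -
    have "(0::real) < 2" "(1::real) + 2 = 3" by auto
    from harnack_small[OF that this(1), unfolded this(2)] show ?thesis by blast
  qed
  then obtain \<delta> where d: "\<And>x. x \<in> W \<Longrightarrow> \<delta> x > 0" "\<And>x. x \<in> W \<Longrightarrow>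
      \<forall>\<^sub>F n in sequentially. \<forall>u\<in>ball x (\<delta> x). 1 \<le> log_size n u \<and> log_size n u \<le> 3 * log_size n x \<and> log_size n x \<le> 3 * log_size n u"
  proof -
    have "\<forall>x. \<exists>\<delta>. x \<in> W \<longrightarrow> \<delta> > 0 \<and> (\<forall>\<^sub>F n in sequentially. \<forall>u\<in>ball x \<delta>. 1 \<le> log_size n u \<and> log_size n u \<le> 3 * log_size n x \<and> log_size n x \<le> 3 * log_size n u)"
      using loc by blast
    from choice[OF this] show ?thesis using that by blast
  qed
  obtain k where k: "\<And>x. x \<in> W \<Longrightarrow> k x \<ge> 1" "\<And>x. x \<in> W \<Longrightarrow>
      \<forall>\<^sub>F n in sequentially. 1 \<le> log_size n z \<and> 1 \<le> log_size n x \<and> log_size n x \<le> k x * log_size n z \<and> log_size n z \<le> k x * log_size n x"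
  proof -
    have "\<forall>x. \<exists>\<kappa>. x \<in> W \<longrightarrow> \<kappa> \<ge> 1 \<and> (\<forall>\<^sub>F n in sequentially. 1 \<le> log_size n z \<and> 1 \<le> log_size n x \<and> log_size n x \<le> \<kappa> * log_size n z \<and> log_size n z \<le> \<kappa> * log_size n x)"
      using comparable_points[OF z] by blast
    from choice[OF this] show ?thesis using that by blast
  qed
  have cov: "K \<subseteq> (\<Union>x\<in>K. ball x (\<delta> x))"
  proof
    fix x assume "x \<in> K"
    then show "x \<in> (\<Union>x\<in>K. ball x (\<delta> x))" using d(1)[of x] K(2) by (intro UN_I[of x]) auto
  qed
  obtain D where D: "D \<subseteq> K" "finite D" "K \<subseteq> (\<Union>x\<in>D. ball x (\<delta> x))"
    using compactE_image[OF K(1) _ cov] by (metis open_ball)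
  have DW: "x \<in> W" if "x \<in> D" for x using D(1) K(2) that by blast
  define \<kappa> where "\<kappa> = 1 + (\<Sum>x\<in>D. k x)"
  have kk: "k x \<le> \<kappa>" if "x \<in> D" for x
    using member_le_sum[OF that, of k] k(1) DW D(2) by (force simp: \<kappa>_def)
  have k0: "\<kappa> \<ge> 1" using sum_nonneg[of D k] k(1) DW by (force simp: \<kappa>_def)
  have "\<forall>\<^sub>F n in sequentially. \<forall>x\<in>D. \<forall>u\<in>ball x (\<delta> x). 1 \<le> log_size n u \<and> log_size n u \<le> 3 * log_size n x \<and> log_size n x \<le> 3 * log_size n u"
    by (rule eventually_ball_finite[OF D(2)]) (use d(2) DW in blast)
  moreover have "\<forall>\<^sub>F n in sequentially. \<forall>x\<in>D. 1 \<le> log_size n z \<and> 1 \<le> log_size n x \<and> log_size n x \<le> k x * log_size n z \<and> log_size n z \<le> k x * log_size n x"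
    by (rule eventually_ball_finite[OF D(2)]) (use k(2) DW in blast)
  ultimately have ev: "\<forall>\<^sub>F n in sequentially. \<forall>u\<in>K. \<forall>v\<in>K. 1 \<le> log_size n u \<and> log_size n u \<le> (9 * \<kappa> * \<kappa>) * log_size n v"
  proof eventually_elim
    case (elim n)
    have *: "1 \<le> log_size n u \<and> log_size n u \<le> 3 * \<kappa> * log_size n z \<and> log_size n z \<le> 3 * \<kappa> * log_size n u" if u: "u \<in> K" for u
    proof -
      obtain x where x: "x \<in> D" "u \<in> ball x (\<delta> x)" using u D(3) by blast
      have a: "1 \<le> log_size n u" "log_size n u \<le> 3 * log_size n x" "log_size n x \<le> 3 * log_size n u" using elim(1) x by blast+
      have b: "1 \<le> log_size n z" "1 \<le> log_size n x" "log_size n x \<le> k x * log_size n z" "log_size n z \<le> k x * log_size n x" using elim(2) x(1) by blast+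
      have "k x * log_size n z \<le> \<kappa> * log_size n z" "k x * log_size n x \<le> \<kappa> * log_size n x"
        using kk[OF x(1)] b by (auto intro!: mult_right_mono)
      moreover have "\<kappa> * log_size n x \<le> \<kappa> * (3 * log_size n u)" using a k0 by (intro mult_left_mono) auto
      ultimately have "log_size n u \<le> 3 * (\<kappa> * log_size n z)" "log_size n z \<le> \<kappa> * (3 * log_size n u)" using a b by linarith+
      then show ?thesis using a by (simp add: mult_ac)
    qed
    show ?case
    proof (intro ballI conjI)
      fix u v assume uv: "u \<in> K" "v \<in> K"
      show "1 \<le> log_size n u" using *[OF uv(1)] by blast
      have "log_size n u \<le> 3 * \<kappa> * log_size n z" using *[OF uv(1)] by blast
      also have "\<dots> \<le> 3 * \<kappa> * (3 * \<kappa> * log_size n v)" using *[OF uv(2)] k0 by (intro mult_left_mono) auto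
      finally show "log_size n u \<le> (9 * \<kappa> * \<kappa>) * log_size n v" by (simp add: mult_ac)
    qed
  qed
  have "1 \<le> 9 * \<kappa> * \<kappa>" using mult_mono[OF k0 k0] k0 by simp
  then show ?thesis using ev by (rule that)
qed

text \<open>The chain of the locale is only known to grow by the factor 32. As X n tends to
  infinity, a later annulus lies beyond the threshold belonging to any prescribed Q, and a new chain
  is started there.\<close>

lemma restart:
  assumes Q: "Q \<ge> 32"
  obtains N :: nat and Z :: "nat \<Rightarrow> real" where "\<And>n. 1 \<le> Z n" "\<And>n. Q * Z n \<le> Z (Suc n)" "\<And>n. \<exists>u\<in>Kw. log_size (N + n) u = Z n"
proof -
  obtain t0 where t0: "t0 \<ge> 1"
    "\<And>T x y N. \<lbrakk>x \<ge> t0; y - x \<ge> start_width C c; y \<le> 2 * x; T \<subseteq> plane_fatou; log_annulus x y \<subseteq> (f ^^ N) ` T\<rbrakk> \<Longrightarrow>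
      \<exists>X Y \<rho>. X 0 = x \<and> Y 0 = y \<and> \<rho> > 0 \<and> (\<forall>n::nat. 1 \<le> X n \<and> Q * X n \<le> X (Suc n) \<and> (1 + \<rho>) * X n \<le> Y n \<and> Y n \<le> 2 * X n \<and>
        start_width C c \<le> Y n - X n \<and> log_annulus (X n) (Y n) \<subseteq> (f ^^ (N + n)) ` T \<and>
        closed_log_annulus (X (Suc n)) (Y (Suc n)) \<subseteq> f ` log_annulus (X n) (Y n))"
    using chain_from[OF Q] by blast
  obtain N0 :: nat where N0: "t0 \<le> real N0" using real_arch_simple by blast
  have x: "X N0 \<ge> t0" using N0 X_ge[of N0] by linarith
  have KF: "Kw \<subseteq> plane_fatou" using Kw W by blast
  have "log_annulus (X N0) (Y N0) \<subseteq> (f ^^ (m + N0)) ` Kw" using cover log_annulus_subset_closed by blast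
  from t0(2)[OF x width Y2 KF this] obtain X' Y' \<rho>' where
    J: "X' 0 = X N0 \<and> Y' 0 = Y N0 \<and> \<rho>' > 0 \<and> (\<forall>n::nat. 1 \<le> X' n \<and> Q * X' n \<le> X' (Suc n) \<and> (1 + \<rho>') * X' n \<le> Y' n \<and> Y' n \<le> 2 * X' n \<and>
        start_width C c \<le> Y' n - X' n \<and> log_annulus (X' n) (Y' n) \<subseteq> (f ^^ (m + N0 + n)) ` Kw \<and>
        closed_log_annulus (X' (Suc n)) (Y' (Suc n)) \<subseteq> f ` log_annulus (X' n) (Y' n))" by (elim exE) (rule that)
  then have X': "\<rho>' > 0" "\<And>n::nat. 1 \<le> X' n \<and> Q * X' n \<le> X' (Suc n) \<and> (1 + \<rho>') * X' n \<le> Y' n \<and> Y' n \<le> 2 * X' n \<and>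
        start_width C c \<le> Y' n - X' n \<and> log_annulus (X' n) (Y' n) \<subseteq> (f ^^ (m + N0 + n)) ` Kw \<and>
        closed_log_annulus (X' (Suc n)) (Y' (Suc n)) \<subseteq> f ` log_annulus (X' n) (Y' n)" by blast+
  show ?thesis
  proof (rule that[of "\<lambda>n. X' (Suc n)" "m + N0 + 1"])
    fix n
    show "1 \<le> X' (Suc n)" "Q * X' (Suc n) \<le> X' (Suc (Suc n))" using X'(2) by blast+
    have "1 \<le> X' (Suc n)" "(1 + \<rho>') * X' (Suc n) \<le> Y' (Suc n)" using X'(2) by blast+
    moreover have "1 * X' (Suc n) \<le> (1 + \<rho>') * X' (Suc n)" using X'(1) \<open>1 \<le> X' (Suc n)\<close> by (intro mult_right_mono) auto
    ultimately have "X' (Suc n) \<le> Y' (Suc n)" by linarith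
    then have "complex_of_real (exp (X' (Suc n))) \<in> closed_log_annulus (X' (Suc n)) (Y' (Suc n))" by (simp add: closed_log_annulus_def)
    then have "complex_of_real (exp (X' (Suc n))) \<in> f ` (f ^^ (m + N0 + n)) ` Kw" using X'(2)[of n] by blast
    then obtain u where "u \<in> Kw" "(f ^^ (m + N0 + 1 + n)) u = complex_of_real (exp (X' (Suc n)))" by auto
    then show "\<exists>u\<in>Kw. log_size (m + N0 + 1 + n) u = X' (Suc n)" by (intro bexI[of _ u]) (simp_all add: log_size_def)
  qed
qed

text \<open>The growth factor of a chain can be prescribed by \<open>restart\<close>. Comparison
  with points of Kw costs a factor \<kappa> at time n and again at time n + 1, hence the choice of Q
  \<kappa>^2.\<close>

lemma fast:
  assumes K: "compact K" "K \<subseteq> W"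
  shows "\<forall>\<^sub>F n in sequentially. \<forall>u\<in>K. \<forall>v\<in>K. Q * log_size n v \<le> log_size (Suc n) u"
proof -
  have KK: "compact (K \<union> Kw)" "K \<union> Kw \<subseteq> W" using K Kw by auto
  obtain \<kappa> where k: "\<kappa> \<ge> 1" "\<forall>\<^sub>F n in sequentially. \<forall>u\<in>K \<union> Kw. \<forall>v\<in>K \<union> Kw. 1 \<le> log_size n u \<and> log_size n u \<le> \<kappa> * log_size n v"
    using comparable[OF KK] by blast
  define Q' where "Q' = max 32 (Q * \<kappa> * \<kappa>)"
  have q32: "Q' \<ge> 32" by (simp add: Q'_def)
  obtain N :: nat and Z :: "nat \<Rightarrow> real" where Z: "\<And>n. 1 \<le> Z n" "\<And>n. Q' * Z n \<le> Z (Suc n)" "\<And>n. \<exists>u\<in>Kw. log_size (N + n) u = Z n"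
    by (rule restart[OF q32], rule that)
  obtain N1 where N1: "\<And>n u v. n \<ge> N1 \<Longrightarrow> u \<in> K \<union> Kw \<Longrightarrow> v \<in> K \<union> Kw \<Longrightarrow> 1 \<le> log_size n u \<and> log_size n u \<le> \<kappa> * log_size n v"
    using k(2) unfolding eventually_sequentially by blast
  show ?thesis
    unfolding eventually_sequentially
  proof (intro exI[of _ "N + N1"] allI impI ballI)
    fix n u v assume n: "N + N1 \<le> n" and uv: "u \<in> K" "v \<in> K"
    define i where "i = n - N"
    have i: "n = N + i" "Suc n = N + Suc i" using n by (auto simp: i_def)
    obtain p where p: "p \<in> Kw" "log_size n p = Z i" using Z(3)[of i] i by auto
    obtain q where q: "q \<in> Kw" "log_size (Suc n) q = Z (Suc i)" using Z(3)[of "Suc i"] i by auto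
    have a: "log_size n v \<le> \<kappa> * Z i" using N1[of n v p] n uv p by auto
    have b: "Z (Suc i) \<le> \<kappa> * log_size (Suc n) u" using N1[of "Suc n" q u] n uv q by auto
    have v1: "1 \<le> log_size n v" using N1[of n v v] n uv by auto
    have "\<kappa> * (Q * log_size n v) \<le> \<kappa> * log_size (Suc n) u"
    proof (cases "Q \<ge> 0")
      case True
      have "\<kappa> * (Q * log_size n v) \<le> \<kappa> * (Q * (\<kappa> * Z i))" using a True k(1) by (intro mult_left_mono) auto
      also have "\<dots> = (Q * \<kappa> * \<kappa>) * Z i" by (simp add: mult_ac)
      also have "\<dots> \<le> Q' * Z i" using Z(1)[of i] by (intro mult_right_mono) (auto simp: Q'_def)
      also have "\<dots> \<le> \<kappa> * log_size (Suc n) u" using Z(2)[of i] b by linarith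
      finally show ?thesis .
    next
      case False
      then have "Q * log_size n v \<le> 0" using v1 by (simp add: mult_nonpos_nonneg)
      moreover have "1 \<le> log_size (Suc n) u" using N1[of "Suc n" u u] n uv by auto
      ultimately show ?thesis using k(1) by (intro mult_left_mono) linarith+
    qed
    then show "Q * log_size n v \<le> log_size (Suc n) u" using k(1) by simp
  qed
qed

text \<open>If two images lay in one component, some \<zeta> and its iterate f^p(\<zeta>) would both
  belong to it. Comparability would bound log |f^(n+p)(\<zeta>)| by \<kappa> log |f^n(\<zeta>)|,
  which by \<open>fast\<close> is exceeded after a single step.\<close>

lemma wandering_component:
  assumes U: "U \<in> fatou_components f" "U = Some ` W"
  shows "wandering f U"
proof -
  have main: False if ij: "0 < i" "i < j" and eq: "component_at f U i = component_at f U j" for i j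
  proof -
    obtain W' where W': "component_at f U i = Some ` W'" "open W'" "connected W'" "W' \<noteq> {}" "W' \<subseteq> plane_fatou"
      using component_plane[OF component_at_props(1)[OF U(1)]] by metis
    have "Some ` (f ^^ i) ` W \<subseteq> Some ` W'" "Some ` (f ^^ j) ` W \<subseteq> Some ` W'"
      using component_at_props(2)[OF U(1), of i] component_at_props(2)[OF U(1), of j] W'(1) eq
        iterate_component[OF W(3)] unfolding U(2) by auto
    then have sub: "(f ^^ i) ` W \<subseteq> W'" "(f ^^ j) ` W \<subseteq> W'" by auto
    interpret W': annulus_component f C c r\<^sub>0 W' "(f ^^ i) ` Kw" m "\<lambda>n. X (n + i)" "\<lambda>n. Y (n + i)" \<rho>
    proof unfold_locales
      show "compact ((f ^^ i) ` Kw)"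
        by (rule compact_continuous_image[OF holomorphic_on_imp_continuous_on[OF holomorphic_on_subset[OF holo_W Kw(2)]] Kw(1)])
      show "closed_log_annulus (X (n + i)) (Y (n + i)) \<subseteq> (f ^^ (m + n)) ` (f ^^ i) ` Kw" for n
        using cover[of "n + i"] by (simp add: image_image funpow_add add.assoc[symmetric])
      show "32 * X (n + i) \<le> X (Suc n + i)" for n using grow[of "n + i"] by simp
      show "(f ^^ i) ` Kw \<subseteq> W'" using sub(1) Kw(2) by blast
    qed (use W' sub Kw \<rho> X1 ratio Y2 width in auto)
    obtain w where w: "w \<in> W" using Kw Kw_nonempty by blast
    define \<zeta> where "\<zeta> = (f ^^ i) w"
    define p where "p = j - i"
    have p: "p \<ge> 1" "j = p + i" using ij by (auto simp: p_def)
    have fp: "(f ^^ p) \<zeta> = (f ^^ j) w" by (simp add: p \<zeta>_def funpow_add)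
    have K: "compact {\<zeta>, (f ^^ p) \<zeta>}" "{\<zeta>, (f ^^ p) \<zeta>} \<subseteq> W'" using sub w fp by (auto simp: \<zeta>_def)
    obtain \<kappa> where k: "\<kappa> \<ge> 1" "\<forall>\<^sub>F n in sequentially. \<forall>u\<in>{\<zeta>, (f ^^ p) \<zeta>}. \<forall>v\<in>{\<zeta>, (f ^^ p) \<zeta>}. 1 \<le> W'.log_size n u \<and> W'.log_size n u \<le> \<kappa> * W'.log_size n v"
      using W'.comparable[OF K] by blast
    have "\<forall>\<^sub>F n in sequentially. (\<kappa> + 1) * W'.log_size n \<zeta> \<le> W'.log_size (Suc n) \<zeta>"
      using W'.fast[OF K, of "\<kappa> + 1"] by (rule eventually_mono) blast
    moreover have "\<forall>\<^sub>F n in sequentially. 1 \<le> W'.log_size n \<zeta> \<and> W'.log_size n ((f ^^ p) \<zeta>) \<le> \<kappa> * W'.log_size n \<zeta>"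
      using k(2) by (rule eventually_mono) blast
    ultimately obtain N where N: "\<And>n. n \<ge> N \<Longrightarrow> (\<kappa> + 1) * W'.log_size n \<zeta> \<le> W'.log_size (Suc n) \<zeta>"
      "\<And>n. n \<ge> N \<Longrightarrow> 1 \<le> W'.log_size n \<zeta> \<and> W'.log_size n ((f ^^ p) \<zeta>) \<le> \<kappa> * W'.log_size n \<zeta>"
      using eventually_conj unfolding eventually_sequentially by (metis (no_types, lifting) max.boundedE max.cobounded1 max.cobounded2 order_trans)
    have mono: "W'.log_size (N + 1) \<zeta> \<le> W'.log_size (N + 1 + q) \<zeta>" for q
    proof (induction q)
      case (Suc q)
      have "1 * W'.log_size (N + 1 + q) \<zeta> \<le> (\<kappa> + 1) * W'.log_size (N + 1 + q) \<zeta>"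
        using N(2)[of "N + 1 + q"] k(1) by (intro mult_right_mono) auto
      then show ?case using N(1)[of "N + 1 + q"] Suc by simp
    qed simp
    have "(\<kappa> + 1) * W'.log_size N \<zeta> \<le> W'.log_size (N + 1) \<zeta>" using N(1)[of N] by simp
    also have "\<dots> \<le> W'.log_size (N + p) \<zeta>" using mono[of "p - 1"] p by simp
    also have "\<dots> = W'.log_size N ((f ^^ p) \<zeta>)" by (simp add: W'.log_size_def funpow_add)
    also have "\<dots> \<le> \<kappa> * W'.log_size N \<zeta>" using N(2)[of N] by simp
    finally show False using N(2)[of N] by (simp add: distrib_right)
  qed
  show ?thesis unfolding wandering_def using main by (metis linorder_neqE_nat)
qed

text \<open>The branches L are returned together with the limit G because
  \<open>covering_sequence\<close> needs them before normalisation. The scale v is left free, since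
  it may be the logarithmic size at a point other than z.\<close>

lemma log_limit:
  fixes \<sigma> :: "nat \<Rightarrow> nat" and v :: "nat \<Rightarrow> real"
  assumes z: "cball z r \<subseteq> W" "r > 0" and \<sigma>: "strict_mono \<sigma>"
    and v: "\<forall>\<^sub>F k in sequentially. 0 < v k \<and> log_size (\<sigma> k) z \<le> B * v k"
  shows "\<exists>s L G. strict_mono (s :: nat \<Rightarrow> nat) \<and> (\<forall>k::nat. L k holomorphic_on ball z r) \<and>
    (\<forall>k. \<forall>u\<in>ball z r. (f ^^ \<sigma> (s k)) u = exp (L k u)) \<and> G holomorphic_on ball z r \<and>
    (\<forall>K. compact K \<and> K \<subseteq> ball z r \<longrightarrow>
      uniform_limit K (\<lambda>k u. (L k u - \<i> * of_real (Im (L k z))) / of_real (v (s k))) G sequentially) \<and>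
    (\<forall>u\<in>ball z r. (\<lambda>k. log_size (\<sigma> (s k)) u / v (s k)) \<longlonglongrightarrow> Re (G u))"
proof -
  have "\<forall>\<^sub>F k in sequentially. \<exists>L. L holomorphic_on ball z r \<and>
    (\<forall>u\<in>ball z r. (f ^^ \<sigma> k) u = exp (L u) \<and> Re (L u) = log_size (\<sigma> k) u \<and> 1 \<le> log_size (\<sigma> k) u)"
    using eventually_compose_filterlim[OF log_branch[OF z] filterlim_subseq[OF \<sigma>]] .
  from eventually_conj[OF this v] obtain N where N: "\<And>k. k \<ge> N \<Longrightarrow> \<exists>L. L holomorphic_on ball z r \<and>
    (\<forall>u\<in>ball z r. (f ^^ \<sigma> k) u = exp (L u) \<and> Re (L u) = log_size (\<sigma> k) u \<and> 1 \<le> log_size (\<sigma> k) u)"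
    "\<And>k. k \<ge> N \<Longrightarrow> 0 < v k \<and> log_size (\<sigma> k) z \<le> B * v k" unfolding eventually_sequentially by blast
  have "\<forall>k. \<exists>L. L holomorphic_on ball z r \<and>
    (\<forall>u\<in>ball z r. (f ^^ \<sigma> (k + N)) u = exp (L u) \<and> Re (L u) = log_size (\<sigma> (k + N)) u \<and> 1 \<le> log_size (\<sigma> (k + N)) u)"
    using N(1) by simp
  then obtain L where L: "\<And>k. L k holomorphic_on ball z r" "\<And>k u. u \<in> ball z r \<Longrightarrow>
     (f ^^ \<sigma> (k + N)) u = exp (L k u) \<and> Re (L k u) = log_size (\<sigma> (k + N)) u \<and> 1 \<le> log_size (\<sigma> (k + N)) u" by metis
  have vp: "v (k + N) > 0" "log_size (\<sigma> (k + N)) z \<le> B * v (k + N)" for k using N(2)[of "k + N"] by auto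
  define G where "G = (\<lambda>k u. (L k u - \<i> * of_real (Im (L k z))) / of_real (v (k + N)))"
  have ReG: "Re (G k u) = log_size (\<sigma> (k + N)) u / v (k + N)" if "u \<in> ball z r" for k u
    using L(2)[OF that, of k] by (simp add: G_def Re_divide_of_real)
  have zr: "z \<in> ball z r" using z by simp
  have hG: "G k holomorphic_on ball z r" for k
    unfolding G_def by (rule holomorphic_on_divide[OF holomorphic_on_diff[OF L(1) holomorphic_on_const] holomorphic_on_const]) (use vp(1)[of k] in simp)
  have pos: "Re (G k u) > 0" if "u \<in> ball z r" for k u using L(2)[OF that, of k] vp(1)[of k] ReG[OF that] by simp
  have im: "Im (G k z) = 0" for k by (simp add: G_def Im_divide_of_real)
  have bd: "Re (G k z) \<le> B" for k using vp[of k] ReG[OF zr] by (simp add: pos_divide_le_eq)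
  obtain s g where s: "strict_mono (s :: nat \<Rightarrow> nat)" "g holomorphic_on ball z r"
    "\<And>K. compact K \<Longrightarrow> K \<subseteq> ball z r \<Longrightarrow> uniform_limit K (\<lambda>k. G (s k)) g sequentially"
    by (rule positive_montel[of G z r B, OF hG pos im bd], assumption, rule that) blast+
  show ?thesis
  proof (intro exI[of _ "\<lambda>k. s k + N"] exI[of _ "\<lambda>k. L (s k)"] exI[of _ g] conjI allI ballI impI)
    show "strict_mono (\<lambda>k. s k + N)" using s(1) by (simp add: strict_mono_def)
    show "L (s k) holomorphic_on ball z r" for k by (rule L(1))
    show "(f ^^ \<sigma> (s k + N)) u = exp (L (s k) u)" if "u \<in> ball z r" for k u using L(2)[OF that] by blast
    show "g holomorphic_on ball z r" by (rule s(2))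
    show "uniform_limit K (\<lambda>k u. (L (s k) u - \<i> * of_real (Im (L (s k) z))) / of_real (v (s k + N))) g sequentially"
      if "compact K \<and> K \<subseteq> ball z r" for K using s(3)[of K] that by (simp add: G_def)
    show "(\<lambda>k. log_size (\<sigma> (s k + N)) u / v (s k + N)) \<longlonglongrightarrow> Re (g u)" if u: "u \<in> ball z r" for u
    proof -
      have "(\<lambda>k. G (s k) u) \<longlonglongrightarrow> g u" by (rule tendsto_uniform_limitI[OF s(3)[of "{u}"]]) (use u in auto)
      from tendsto_Re[OF this] show ?thesis by (simp add: ReG[OF u])
    qed
  qed
qed

end

lemma ln_ratio_step:
  fixes p q p' q' x :: real
  assumes pos: "0 < p" "0 < q" "0 < p'" "0 < q'" and x: "0 \<le> x" "x \<le> 1 / 2" and step: "q / p * (1 - x) * p' \<le> q'"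
  shows "ln (q / p) - 2 * x \<le> ln (q' / p')"
proof -
  have e: "exp (- 2 * x) \<le> 1 - x" by (rule exp_minus_two_le[OF x])
  have "q / p * exp (- 2 * x) \<le> q / p * (1 - x)" using e pos by (intro mult_left_mono) auto
  also have "\<dots> \<le> q' / p'" using step pos by (simp add: pos_le_divide_eq)
  finally have "ln (q / p * exp (- 2 * x)) \<le> ln (q' / p')" using pos by (subst ln_le_cancel_iff) auto
  moreover have "ln (q / p * exp (- 2 * x)) = ln (q / p) + ln (exp (- 2 * x))" by (rule ln_mult_pos) (use pos in auto)
  ultimately show ?thesis by simp
qed

section \<open>Nonconstant limits and convergence of h_n\<close>

context annulus_component
begin

lemma log_limit_Re:
  fixes \<sigma> :: "nat \<Rightarrow> nat" and v :: "nat \<Rightarrow> real"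
  assumes "cball z r \<subseteq> W" "r > 0" "strict_mono \<sigma>" "\<forall>\<^sub>F k in sequentially. 0 < v k \<and> log_size (\<sigma> k) z \<le> B * v k"
  shows "\<exists>s G. strict_mono (s :: nat \<Rightarrow> nat) \<and> G holomorphic_on ball z r \<and>
    (\<forall>u\<in>ball z r. (\<lambda>k. log_size (\<sigma> (s k)) u / v (s k)) \<longlonglongrightarrow> Re (G u))"
  using log_limit[OF assms] by (elim exE conjE) (intro exI conjI, assumption+)

text \<open>Convergence of the ratio to 1 on a ball would spread to all of W, by the identity
  theorem for limits of subsequences. But at each late time Kw contains points of logarithmic sizes
  X n and Y n \<ge> (1 + \<rho>) X n, and Harnack's inequality near limit points p and q of these
  makes the ratio at p and q contradict the bound.\<close>

lemma not_degenerate: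
  fixes \<sigma> :: "nat \<Rightarrow> nat"
  assumes \<sigma>: "strict_mono \<sigma>" and z0: "z0 \<in> W" "r > 0" "ball z0 r \<subseteq> W"
    and lim: "\<And>u. u \<in> ball z0 r \<Longrightarrow> (\<lambda>k. log_size (\<sigma> k) u / log_size (\<sigma> k) z0) \<longlonglongrightarrow> 1"
  shows False
proof -
  define P where "P = (\<lambda>u. (\<lambda>k. log_size (\<sigma> k) u / log_size (\<sigma> k) z0) \<longlonglongrightarrow> 1)"
  define D where "D = {z\<in>W. \<exists>e>0. ball z e \<subseteq> W \<and> (\<forall>u\<in>ball z e. P u)}"
  have spread: "P u" if b: "cball b R \<subseteq> W" "R > 0" and x: "x \<in> D" "x \<in> ball b R" and u: "u \<in> ball b R" for b R x u
  proof (rule ccontr)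
    assume "\<not> P u"
    then obtain \<epsilon> where \<epsilon>: "\<epsilon> > 0" "\<not> (\<forall>\<^sub>F k in sequentially. dist (log_size (\<sigma> k) u / log_size (\<sigma> k) z0) 1 < \<epsilon>)"
      unfolding P_def tendsto_iff by blast
    then have fr: "\<exists>\<^sub>F k in sequentially. \<epsilon> \<le> dist (log_size (\<sigma> k) u / log_size (\<sigma> k) z0) 1" by (simp add: not_eventually not_less)
    obtain \<tau> :: "nat \<Rightarrow> nat" where \<tau>: "strict_mono \<tau>" "\<And>i. \<epsilon> \<le> dist (log_size (\<sigma> (\<tau> i)) u / log_size (\<sigma> (\<tau> i)) z0) 1"
      by (rule frequently_subseq[OF fr], rule that)
    have b0: "compact {b, z0}" "{b, z0} \<subseteq> W" using b z0 by auto
    obtain \<kappa> where k: "\<kappa> \<ge> 1" "\<forall>\<^sub>F n in sequentially. \<forall>u\<in>{b, z0}. \<forall>v\<in>{b, z0}. 1 \<le> log_size n u \<and> log_size n u \<le> \<kappa> * log_size n v"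
      by (rule comparable[OF b0], rule that)
    have st: "strict_mono (\<lambda>k. \<sigma> (\<tau> k))" using \<sigma> \<tau>(1) by (simp add: strict_mono_def)
    have ev: "\<forall>\<^sub>F k in sequentially. 0 < log_size (\<sigma> (\<tau> k)) z0 \<and> log_size (\<sigma> (\<tau> k)) b \<le> \<kappa> * log_size (\<sigma> (\<tau> k)) z0"
      using eventually_compose_filterlim[OF k(2) filterlim_subseq[OF st]] by (rule eventually_mono) force
    from log_limit_Re[OF b st ev] obtain s G where J: "strict_mono (s :: nat \<Rightarrow> nat) \<and> G holomorphic_on ball b R \<and>
      (\<forall>u\<in>ball b R. (\<lambda>k. log_size (\<sigma> (\<tau> (s k))) u / log_size (\<sigma> (\<tau> (s k))) z0) \<longlonglongrightarrow> Re (G u))" by (elim exE) (rule that)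
    note s = J[THEN conjunct1] and G = J[THEN conjunct2, THEN conjunct1] J[THEN conjunct2, THEN conjunct2, rule_format]
    obtain e where e: "e > 0" "\<And>u. u \<in> ball x e \<Longrightarrow> P u" using x(1) unfolding D_def by blast
    have ts: "strict_mono (\<tau> \<circ> s)" using \<tau>(1) s by (simp add: strict_mono_def)
    have one: "Re (G w) = 1" if w: "w \<in> ball x e \<inter> ball b R" for w
    proof (rule LIMSEQ_unique[OF G(2)])
      show "(\<lambda>k. log_size (\<sigma> (\<tau> (s k))) w / log_size (\<sigma> (\<tau> (s k))) z0) \<longlonglongrightarrow> 1"
        using LIMSEQ_subseq_LIMSEQ[OF e(2)[unfolded P_def] ts] w by (simp add: o_def)
    qed (use w in auto)
    have "Re (G u) = 1"
      by (rule holomorphic_Re_constant[where T = "ball x e \<inter> ball b R", OF G(1) open_ball connected_ball open_Int[OF open_ball open_ball] _ _ one u]) (use centre_in_ball[of x e] e(1) x(2) in blast)+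
    then have "(\<lambda>k. log_size (\<sigma> (\<tau> (s k))) u / log_size (\<sigma> (\<tau> (s k))) z0) \<longlonglongrightarrow> 1" using G(2)[OF u] by simp
    from tendstoD[OF this \<epsilon>(1)] obtain k where "dist (log_size (\<sigma> (\<tau> (s k))) u / log_size (\<sigma> (\<tau> (s k))) z0) 1 < \<epsilon>"
      unfolding eventually_sequentially by blast
    then show False using \<tau>(2)[of "s k"] by linarith
  qed
  have z0D: "z0 \<in> D" using z0 lim by (auto simp: D_def P_def)
  have "z0 \<in> D \<longleftrightarrow> z \<in> D" if z: "z \<in> W" for z
  proof (rule connected_equivalence_relation[OF W(2) z0(1) z])
    fix x assume x: "x \<in> W"
    obtain R where R: "R > 0" "cball x R \<subseteq> W" using x W(1) open_contains_cball by blast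
    have sub: "ball x R \<subseteq> W" using R(2) ball_subset_cball by blast
    have D: "y \<in> D" if q: "q \<in> D" "q \<in> ball x R" and y: "y \<in> ball x R" for q y
    proof -
      obtain e where e: "e > 0" "ball y e \<subseteq> ball x R" using y open_ball open_contains_ball by blast
      have "P u" if "u \<in> ball y e" for u by (rule spread[OF R(2,1) q]) (use that e in blast)
      then show ?thesis using e sub y unfolding D_def by blast
    qed
    have xx: "x \<in> ball x R" using R(1) by simp
    show "\<exists>T. openin (top_of_set W) T \<and> x \<in> T \<and> (\<forall>y\<in>T. (x \<in> D) = (y \<in> D))"
    proof (intro exI[of _ "ball x R"] conjI ballI)
      show "openin (top_of_set W) (ball x R)" using sub W(1) by (simp add: openin_open_eq)
      show "(x \<in> D) = (y \<in> D)" if "y \<in> ball x R" for y using D that xx by blast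
    qed (rule xx)
  qed auto
  then have inD: "z \<in> D" if "z \<in> W" for z using z0D that by blast
  have all: "P z" if zW: "z \<in> W" for z
  proof -
    obtain e where "e > 0" "\<forall>u\<in>ball z e. P u" using inD[OF zW] unfolding D_def by blast
    then show ?thesis using centre_in_ball[of z e] by blast
  qed
  have "\<forall>k. \<exists>a b. a \<in> Kw \<and> b \<in> Kw \<and> (m \<le> \<sigma> k \<longrightarrow> log_size (\<sigma> k) a = X (\<sigma> k - m) \<and> log_size (\<sigma> k) b = Y (\<sigma> k - m))"
  proof
    fix k
    obtain a where a: "a \<in> Kw" "log_size (m + (\<sigma> k - m)) a = X (\<sigma> k - m)"
      by (rule chain_point[OF order_refl X_le_Y], rule that)
    obtain b where b: "b \<in> Kw" "log_size (m + (\<sigma> k - m)) b = Y (\<sigma> k - m)"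
      by (rule chain_point[OF X_le_Y order_refl], rule that)
    show "\<exists>a b. a \<in> Kw \<and> b \<in> Kw \<and> (m \<le> \<sigma> k \<longrightarrow> log_size (\<sigma> k) a = X (\<sigma> k - m) \<and> log_size (\<sigma> k) b = Y (\<sigma> k - m))"
      using a b by (intro exI[of _ a] exI[of _ b]) auto
  qed
  then obtain A B where AB: "\<And>k. A k \<in> Kw" "\<And>k. B k \<in> Kw"
    "\<And>k. m \<le> \<sigma> k \<Longrightarrow> log_size (\<sigma> k) (A k) = X (\<sigma> k - m) \<and> log_size (\<sigma> k) (B k) = Y (\<sigma> k - m)" by metis
  have "seq_compact (Kw \<times> Kw)" using Kw(1) by (intro compact_imp_seq_compact compact_Times)
  then obtain l s where l: "l \<in> Kw \<times> Kw" "strict_mono (s :: nat \<Rightarrow> nat)" "((\<lambda>k. (A k, B k)) \<circ> s) \<longlonglongrightarrow> l"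
    by (rule seq_compactE[of _ "\<lambda>k. (A k, B k)"]) (use AB in auto)
  obtain p q where pq: "l = (p, q)" by (cases l)
  have pW: "p \<in> W" "q \<in> W" using l(1) pq Kw(2) by auto
  have Al: "(\<lambda>k. A (s k)) \<longlonglongrightarrow> p" using tendsto_fst[OF l(3)] by (simp add: pq o_def)
  have Bl: "(\<lambda>k. B (s k)) \<longlonglongrightarrow> q" using tendsto_snd[OF l(3)] by (simp add: pq o_def)
  \<comment> \<open>Three factors 1 + \<eta> will occur: two from Harnack's inequality near p and
    near q, one from the ratio at p and q. As \<eta> \<le> 1, their product is at most 1 + 7 \<eta>
    < 1 + \<rho>.\<close>
  define \<eta> where "\<eta> = min 1 (\<rho> / 8)"
  have \<eta>: "0 < \<eta>" "\<eta> \<le> 1" "8 * \<eta> \<le> \<rho>" using \<rho> by (auto simp: \<eta>_def)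
  obtain dp where dp: "dp > 0" "\<forall>\<^sub>F n in sequentially. \<forall>u\<in>ball p dp. 1 \<le> log_size n u \<and> log_size n u \<le> (1 + \<eta>) * log_size n p \<and> log_size n p \<le> (1 + \<eta>) * log_size n u"
    by (rule harnack_small[OF pW(1) \<eta>(1)], rule that)
  obtain dq where dq: "dq > 0" "\<forall>\<^sub>F n in sequentially. \<forall>u\<in>ball q dq. 1 \<le> log_size n u \<and> log_size n u \<le> (1 + \<eta>) * log_size n q \<and> log_size n q \<le> (1 + \<eta>) * log_size n u"
    by (rule harnack_small[OF pW(2) \<eta>(1)], rule that)
  have ss: "strict_mono (\<lambda>k. \<sigma> (s k))" using \<sigma> l(2) by (simp add: strict_mono_def)
  note sub = eventually_compose_filterlim[OF _ filterlim_subseq[OF ss]]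
  have "(\<lambda>k. (log_size (\<sigma> k) q / log_size (\<sigma> k) z0) / (log_size (\<sigma> k) p / log_size (\<sigma> k) z0)) \<longlonglongrightarrow> 1 / 1"
    using all[OF pW(1)] all[OF pW(2)] unfolding P_def by (intro tendsto_divide) auto
  from LIMSEQ_subseq_LIMSEQ[OF this l(2)]
  have "(\<lambda>k. (log_size (\<sigma> (s k)) q / log_size (\<sigma> (s k)) z0) / (log_size (\<sigma> (s k)) p / log_size (\<sigma> (s k)) z0)) \<longlonglongrightarrow> 1" by (simp add: o_def)
  from order_tendstoD(2)[OF this, of "1 + \<eta>"] \<eta>(1)
  have e1: "\<forall>\<^sub>F k in sequentially. (log_size (\<sigma> (s k)) q / log_size (\<sigma> (s k)) z0) / (log_size (\<sigma> (s k)) p / log_size (\<sigma> (s k)) z0) < 1 + \<eta>" by simp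
  have e2: "\<forall>\<^sub>F k in sequentially. \<forall>z\<in>{z0}. 1 \<le> log_size (\<sigma> (s k)) z"
    by (rule sub[OF log_size_large]) (use z0 in auto)
  have e3: "\<forall>\<^sub>F k in sequentially. A (s k) \<in> ball p dp" using tendstoD[OF Al dp(1)] by (simp add: dist_commute)
  have e4: "\<forall>\<^sub>F k in sequentially. B (s k) \<in> ball q dq" using tendstoD[OF Bl dq(1)] by (simp add: dist_commute)
  have e5: "\<forall>\<^sub>F k in sequentially. m \<le> \<sigma> (s k)" by (rule sub[OF eventually_ge_at_top])
  have "\<forall>\<^sub>F k in sequentially. False"
    using e1 e2 e3 e4 e5 sub[OF dp(2)] sub[OF dq(2)]
  proof eventually_elim
    case (elim k)
    define n where "n = \<sigma> (s k)"
    have l0: "log_size n z0 \<ge> 1" using elim(2) by (simp add: n_def)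
    have pp: "p \<in> ball p dp" using dp(1) by simp
    have lp: "log_size n p \<ge> 1" using elim(6) pp unfolding n_def by blast
    have a: "log_size n p \<le> (1 + \<eta>) * log_size n (A (s k))" using elim(6) elim(3) unfolding n_def by blast
    have b: "log_size n (B (s k)) \<le> (1 + \<eta>) * log_size n q" using elim(7) elim(4) unfolding n_def by blast
    have XY: "log_size n (A (s k)) = X (n - m)" "log_size n (B (s k)) = Y (n - m)" using AB(3)[of "s k"] elim(5) by (auto simp: n_def)
    have "(log_size n q / log_size n z0) / (log_size n p / log_size n z0) = log_size n q / log_size n p" using l0 by simp
    then have "log_size n q / log_size n p < 1 + \<eta>" using elim(1) unfolding n_def[symmetric] by argo
    then have q: "log_size n q \<le> (1 + \<eta>) * log_size n p" using lp by (simp add: pos_divide_less_eq)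
    have "Y (n - m) \<le> (1 + \<eta>) * log_size n q" using b XY by simp
    also have "\<dots> \<le> (1 + \<eta>) * ((1 + \<eta>) * log_size n p)" using q \<eta> by (intro mult_left_mono) auto
    also have "\<dots> \<le> (1 + \<eta>) * ((1 + \<eta>) * ((1 + \<eta>) * X (n - m)))" using a XY \<eta> by (intro mult_left_mono) auto
    also have "\<dots> = (1 + \<eta> * (3 + \<eta> * (3 + \<eta>))) * X (n - m)" by (simp add: algebra_simps)
    also have "\<dots> < (1 + \<rho>) * X (n - m)"
    proof (intro mult_strict_right_mono)
      have "\<eta> * (3 + \<eta>) \<le> 1 * 4" using \<eta> by (intro mult_mono) auto
      then have "\<eta> * (3 + \<eta> * (3 + \<eta>)) \<le> \<eta> * 7" using \<eta> by (intro mult_left_mono) auto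
      then show "1 + \<eta> * (3 + \<eta> * (3 + \<eta>)) < 1 + \<rho>" using \<eta> by linarith
    qed (use X1[of "n - m"] in simp)
    finally show ?case using ratio[of "n - m"] by simp
  qed
  then show False by simp
qed

text \<open>If the images missed points of annuli of relative width tending to \<open>0\<close> infinitely often, a limit of the
  normalised logarithms would be constant.\<close>

lemma covers_annulus:
  assumes z: "cball z r \<subseteq> W" "r > 0"
  shows "\<exists>\<alpha>. 0 < \<alpha> \<and> \<alpha> < 1 \<and> (\<forall>\<^sub>F n in sequentially.
    closed_log_annulus ((1 - \<alpha>) * log_size n z) ((1 + \<alpha>) * log_size n z) \<subseteq> (f ^^ n) ` ball z r)"
proof (rule ccontr)
  assume neg: "\<not> ?thesis"
  define \<alpha> where "\<alpha> = (\<lambda>k::nat. 1 / (real k + 2))"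
  have \<alpha>: "0 < \<alpha> k" "\<alpha> k < 1" for k by (auto simp: \<alpha>_def)
  define bad where "bad = (\<lambda>k n. \<not> closed_log_annulus ((1 - \<alpha> k) * log_size n z) ((1 + \<alpha> k) * log_size n z) \<subseteq> (f ^^ n) ` ball z r)"
  have ex: "\<exists>n>N. bad k n" for k N
  proof (rule ccontr)
    assume "\<not> ?thesis"
    then have "\<forall>n\<ge>Suc N. \<not> bad k n" by auto
    then have "\<forall>\<^sub>F n in sequentially. \<not> bad k n" unfolding eventually_sequentially by blast
    then show False using neg \<alpha>[of k] unfolding bad_def by auto
  qed
  \<comment> \<open>The relative width \<alpha> k shrinks along the sequence of bad times, so that y
    k divided by the logarithmic size at z tends to 1, which is also the value of Re G at z.\<close>
  have "\<exists>\<sigma>. \<forall>k. bad k (\<sigma> k) \<and> \<sigma> k < \<sigma> (Suc k)"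
    by (rule dependent_nat_choice) (use ex in blast)+
  then obtain \<sigma> where \<sigma>0: "\<And>k. bad k (\<sigma> k)" "\<And>k. \<sigma> k < \<sigma> (Suc k)" by blast
  have \<sigma>: "strict_mono \<sigma>" using \<sigma>0(2) by (simp add: strict_mono_Suc_iff)
  have "\<forall>k. \<exists>w. w \<in> closed_log_annulus ((1 - \<alpha> k) * log_size (\<sigma> k) z) ((1 + \<alpha> k) * log_size (\<sigma> k) z) \<and> w \<notin> (f ^^ \<sigma> k) ` ball z r"
    using \<sigma>0(1) unfolding bad_def by blast
  then obtain w where w: "\<And>k. w k \<in> closed_log_annulus ((1 - \<alpha> k) * log_size (\<sigma> k) z) ((1 + \<alpha> k) * log_size (\<sigma> k) z)"
    "\<And>k. w k \<notin> (f ^^ \<sigma> k) ` ball z r" by metis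
  define y where "y = (\<lambda>k. ln (cmod (w k)))"
  have wy: "w k \<noteq> 0" "(1 - \<alpha> k) * log_size (\<sigma> k) z \<le> y k" "y k \<le> (1 + \<alpha> k) * log_size (\<sigma> k) z" for k
    using w(1)[of k] unfolding closed_log_annulus_ln y_def by auto
  have ey: "cmod (w k) = exp (y k)" for k using wy(1)[of k] by (simp add: y_def)
  have zW: "z \<in> W" and zr: "z \<in> ball z r" using z by auto
  have large: "\<forall>\<^sub>F n in sequentially. 1 \<le> log_size n z" using log_size_large[of "{z}" 1] zW by simp
  have ev1: "\<forall>\<^sub>F k in sequentially. 1 \<le> log_size (\<sigma> k) z" by (rule eventually_compose_filterlim[OF large filterlim_subseq[OF \<sigma>]])
  then have ev: "\<forall>\<^sub>F k in sequentially. 0 < log_size (\<sigma> k) z \<and> log_size (\<sigma> k) z \<le> 1 * log_size (\<sigma> k) z"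
    by (rule eventually_mono) simp
  from log_limit[OF z \<sigma> ev] obtain s and L :: "nat \<Rightarrow> complex \<Rightarrow> complex" and G where J: "strict_mono (s :: nat \<Rightarrow> nat) \<and> (\<forall>k::nat. L k holomorphic_on ball z r) \<and>
    (\<forall>k. \<forall>u\<in>ball z r. (f ^^ \<sigma> (s k)) u = exp (L k u)) \<and> G holomorphic_on ball z r \<and>
    (\<forall>K. compact K \<and> K \<subseteq> ball z r \<longrightarrow>
      uniform_limit K (\<lambda>k u. (L k u - \<i> * of_real (Im (L k z))) / of_real (log_size (\<sigma> (s k)) z)) G sequentially) \<and>
    (\<forall>u\<in>ball z r. (\<lambda>k. log_size (\<sigma> (s k)) u / log_size (\<sigma> (s k)) z) \<longlonglongrightarrow> Re (G u))" by (elim exE) (rule that)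
  note s = J[THEN conjunct1] and J2 = J[THEN conjunct2]
  note L1 = J2[THEN conjunct1, rule_format] and J3 = J2[THEN conjunct2]
  note L2 = J3[THEN conjunct1, rule_format] and J4 = J3[THEN conjunct2]
  note G1 = J4[THEN conjunct1] and J5 = J4[THEN conjunct2]
  note G2 = J5[THEN conjunct1, rule_format, OF conjI] and G3 = J5[THEN conjunct2, rule_format]
  have ss: "strict_mono (\<lambda>k. \<sigma> (s k))" using \<sigma> s by (simp add: strict_mono_def)
  have ev2: "\<forall>\<^sub>F k in sequentially. 1 \<le> log_size (\<sigma> (s k)) z" by (rule eventually_compose_filterlim[OF large filterlim_subseq[OF ss]])
  have Gz: "Re (G z) = 1"
  proof (rule LIMSEQ_unique[OF G3[OF zr]])
    have "\<forall>\<^sub>F k in sequentially. log_size (\<sigma> (s k)) z / log_size (\<sigma> (s k)) z = 1" using ev2 by (rule eventually_mono) simp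
    then show "(\<lambda>k. log_size (\<sigma> (s k)) z / log_size (\<sigma> (s k)) z) \<longlonglongrightarrow> 1" by (rule tendsto_eventually)
  qed
  have nc: "\<not> G constant_on ball z r"
  proof
    assume "G constant_on ball z r"
    then have "G u = G z" if "u \<in> ball z r" for u using that zr unfolding constant_on_def by metis
    then have "(\<lambda>k. log_size (\<sigma> (s k)) u / log_size (\<sigma> (s k)) z) \<longlonglongrightarrow> 1" if "u \<in> ball z r" for u
      using G3[OF that] Gz that by simp
    then show False using not_degenerate[OF ss zW z(2)] z(1) ball_subset_cball by blast
  qed
  have vtop: "filterlim (\<lambda>k. log_size (\<sigma> (s k)) z) at_top sequentially"
    by (rule filterlim_compose[OF log_size_at_top[OF zW] filterlim_subseq[OF ss]])
  have ylim: "(\<lambda>k. y (s k) / log_size (\<sigma> (s k)) z) \<longlonglongrightarrow> Re (G z)"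
  proof -
    have "\<alpha> \<longlonglongrightarrow> 0" unfolding \<alpha>_def by real_asymp
    then have a0: "(\<lambda>k. \<alpha> (s k)) \<longlonglongrightarrow> 0" using LIMSEQ_subseq_LIMSEQ[OF _ s] by (simp add: o_def)
    have "\<forall>\<^sub>F k in sequentially. norm (y (s k) / log_size (\<sigma> (s k)) z - 1) \<le> \<alpha> (s k)"
      using ev2
    proof eventually_elim
      case (elim k)
      have "1 - \<alpha> (s k) \<le> y (s k) / log_size (\<sigma> (s k)) z" "y (s k) / log_size (\<sigma> (s k)) z \<le> 1 + \<alpha> (s k)"
        using wy(2,3)[of "s k"] elim by (simp_all add: pos_le_divide_eq pos_divide_le_eq)
      then show ?case unfolding real_norm_def by linarith
    qed
    then have "(\<lambda>k. y (s k) / log_size (\<sigma> (s k)) z - 1) \<longlonglongrightarrow> 0" using a0 by (rule Lim_null_comparison)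
    then show ?thesis using Gz by (simp add: LIM_zero_iff)
  qed
  have "\<forall>\<^sub>F k in sequentially. \<forall>w. cmod w = exp (y (s k)) \<longrightarrow> w \<in> (\<lambda>u. exp (L k u)) ` ball z r"
    by (rule covering_sequence[OF z(2) L1 G1 G2 vtop nc ylim])
  then obtain k where "w (s k) \<in> (\<lambda>u. exp (L k u)) ` ball z r" using ey unfolding eventually_sequentially by blast
  then have "w (s k) \<in> (f ^^ \<sigma> (s k)) ` ball z r" using L2 by auto
  then show False using w(2) by blast
qed

text \<open>An annulus of fixed relative width about |f^N(z)| exceeds \<open>start_width\<close> on
  the logarithmic scale as soon as log |f^N(z)| is large, so a new chain can start in the image of
  the ball. The bound \<beta> \<le> 1/2 ensures y \<le> 2 x.\<close>

lemma image_annuli: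
  assumes z: "cball z r \<subseteq> W" "r > 0"
  shows "\<exists>N X' Y' \<rho>'. 0 < \<rho>' \<and> (\<forall>n::nat. 1 \<le> X' n \<and> 32 * X' n \<le> X' (Suc n) \<and> (1 + \<rho>') * X' n \<le> Y' n \<and>
    log_annulus (X' n) (Y' n) \<subseteq> (f ^^ (N + n)) ` ball z r \<and>
    closed_log_annulus (X' (Suc n)) (Y' (Suc n)) \<subseteq> f ` log_annulus (X' n) (Y' n))"
proof -
  obtain \<alpha> where \<alpha>: "0 < \<alpha>" "\<alpha> < 1" "\<forall>\<^sub>F n in sequentially.
    closed_log_annulus ((1 - \<alpha>) * log_size n z) ((1 + \<alpha>) * log_size n z) \<subseteq> (f ^^ n) ` ball z r"
    using covers_annulus[OF z] by blast
  define \<beta> where "\<beta> = min \<alpha> (1 / 2)"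
  have \<beta>: "0 < \<beta>" "\<beta> \<le> 1 / 2" "\<beta> \<le> \<alpha>" using \<alpha> by (auto simp: \<beta>_def)
  obtain t0 where t0: "t0 \<ge> 1"
    "\<And>T x y N. \<lbrakk>x \<ge> t0; y - x \<ge> start_width C c; y \<le> 2 * x; T \<subseteq> plane_fatou; log_annulus x y \<subseteq> (f ^^ N) ` T\<rbrakk> \<Longrightarrow>
      \<exists>X Y \<rho>. X 0 = x \<and> Y 0 = y \<and> \<rho> > 0 \<and> (\<forall>n::nat. 1 \<le> X n \<and> 32 * X n \<le> X (Suc n) \<and> (1 + \<rho>) * X n \<le> Y n \<and> Y n \<le> 2 * X n \<and>
        start_width C c \<le> Y n - X n \<and> log_annulus (X n) (Y n) \<subseteq> (f ^^ (N + n)) ` T \<and>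
        closed_log_annulus (X (Suc n)) (Y (Suc n)) \<subseteq> f ` log_annulus (X n) (Y n))"
    using chain_from[OF order_refl] by blast
  have zW: "z \<in> W" using z by auto
  have "\<forall>\<^sub>F n in sequentially. max (2 * t0) (start_width C c / \<beta>) \<le> log_size n z"
    using log_size_at_top[OF zW] unfolding filterlim_at_top by blast
  from eventually_conj[OF this \<alpha>(3)] obtain N where N: "max (2 * t0) (start_width C c / \<beta>) \<le> log_size N z"
    "closed_log_annulus ((1 - \<alpha>) * log_size N z) ((1 + \<alpha>) * log_size N z) \<subseteq> (f ^^ N) ` ball z r"
    unfolding eventually_sequentially by blast
  define t where "t = log_size N z"
  have t: "2 * t0 \<le> t" "start_width C c / \<beta> \<le> t" using N(1) by (auto simp: t_def)
  have tp: "t > 0" using t t0(1) by linarith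
  have bt: "\<beta> * t \<le> (1 / 2) * t" "\<beta> * t \<le> \<alpha> * t" "0 < \<beta> * t" using \<beta> tp by (auto intro!: mult_right_mono)
  define x where "x = (1 - \<beta> / 2) * t"
  define y where "y = (1 + \<beta> / 2) * t"
  have xe: "x = t - \<beta> * t / 2" "y = t + \<beta> * t / 2" by (simp_all add: x_def y_def algebra_simps)
  have x1: "x \<ge> t0" "y \<le> 2 * x" using xe bt t tp by linarith+
  have "start_width C c \<le> \<beta> * t" using t(2) \<beta>(1) by (simp add: pos_divide_le_eq mult.commute)
  then have x2: "start_width C c \<le> y - x" using xe by simp
  have "(1 - \<alpha>) * t \<le> x" "y \<le> (1 + \<alpha>) * t"
    unfolding x_def y_def using \<beta> tp by (auto intro!: mult_right_mono)
  then have "log_annulus x y \<subseteq> closed_log_annulus ((1 - \<alpha>) * t) ((1 + \<alpha>) * t)"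
    unfolding subset_iff log_annulus_ln closed_log_annulus_ln by auto
  then have x3: "log_annulus x y \<subseteq> (f ^^ N) ` ball z r" using N(2) unfolding t_def[symmetric] by (rule subset_trans)
  have x4: "ball z r \<subseteq> plane_fatou" using z(1) W(3) ball_subset_cball by blast
  from t0(2)[OF x1(1) x2 x1(2) x4 x3] obtain X' Y' \<rho>' where
    "X' 0 = x \<and> Y' 0 = y \<and> \<rho>' > 0 \<and> (\<forall>n::nat. 1 \<le> X' n \<and> 32 * X' n \<le> X' (Suc n) \<and> (1 + \<rho>') * X' n \<le> Y' n \<and> Y' n \<le> 2 * X' n \<and>
        start_width C c \<le> Y' n - X' n \<and> log_annulus (X' n) (Y' n) \<subseteq> (f ^^ (N + n)) ` ball z r \<and>
        closed_log_annulus (X' (Suc n)) (Y' (Suc n)) \<subseteq> f ` log_annulus (X' n) (Y' n))" by (elim exE) (rule that)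
  then show ?thesis by (intro exI[of _ N] exI[of _ X'] exI[of _ Y'] exI[of _ \<rho>']) blast
qed

text \<open>Let s n be the logarithm of the ratio of log |f^n(u)| to log |f^n(z0)|. By
  \<open>annulus_growth_ratio\<close>, applied to the two points in order of modulus, s n eventually
  moves away from 0 up to an error M / (\<alpha> log |f^n(z0)|). The errors are summable because log
  |f^n(z0)| at least doubles in each late step.\<close>

lemma ratio_convergent_near:
  assumes z0: "z0 \<in> W"
  shows "\<exists>\<delta>>0. ball z0 \<delta> \<subseteq> W \<and> (\<forall>u\<in>ball z0 \<delta>. convergent (\<lambda>n. ln (log_size n u / log_size n z0)))"
proof -
  obtain r where r: "r > 0" "cball z0 r \<subseteq> W" using z0 W(1) open_contains_cball by blast
  obtain \<alpha> where \<alpha>: "0 < \<alpha>" "\<alpha> < 1" "\<forall>\<^sub>F n in sequentially.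
    closed_log_annulus ((1 - \<alpha>) * log_size n z0) ((1 + \<alpha>) * log_size n z0) \<subseteq> (f ^^ n) ` ball z0 r"
    using covers_annulus[OF r(2,1)] by blast
  obtain a where a: "\<And>z. z \<in> plane_fatou \<Longrightarrow> f z \<noteq> a" using fatou_omits by blast
  have B: "1 / \<alpha> \<ge> 1" using \<alpha> by simp
  obtain M t0 where M: "M \<ge> 0"
    "\<And>x L z z'. \<lbrakk>x \<ge> t0; L \<ge> M;
        \<And>z. exp x < cmod z \<Longrightarrow> cmod z < exp (x + L) \<Longrightarrow> \<not> is_pole f z \<and> f z \<noteq> a \<and> 2 * cmod a + 2 \<le> cmod (f z);
        z \<noteq> 0; z' \<noteq> 0; x + L / 4 \<le> ln (cmod z); ln (cmod z) \<le> ln (cmod z'); ln (cmod z') \<le> x + L - L / 4;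
        ln (cmod z) \<le> 1 / \<alpha> * L; ln (cmod z) \<le> ln (cmod (f z))\<rbrakk> \<Longrightarrow>
      ln (cmod (f z')) \<ge> ln (cmod z') / ln (cmod z) * (1 - M / L) * ln (cmod (f z))"
    using annulus_growth_ratio[OF B, of a] by blast
  \<comment> \<open>With this Harnack factor both points stay in the middle half of the annulus of
    logarithmic width L = 2 \<alpha> t n.\<close>
  have \<eta>: "\<alpha> / 4 > 0" using \<alpha> by simp
  obtain \<delta> where d: "\<delta> > 0" "ball z0 \<delta> \<subseteq> W"
    "\<forall>\<^sub>F n in sequentially. \<forall>u\<in>ball z0 \<delta>. 1 \<le> log_size n u \<and> log_size n u \<le> (1 + \<alpha> / 4) * log_size n z0 \<and> log_size n z0 \<le> (1 + \<alpha> / 4) * log_size n u"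
    by (rule harnack_small[OF z0 \<eta>], rule that)
  define t where "t = (\<lambda>n. log_size n z0)"
  define e where "e = (\<lambda>n. M / (\<alpha> * \<bar>t n\<bar>))"
  have e0: "e n \<ge> 0" for n using M(1) \<alpha>(1) by (simp add: e_def)
  have z0c: "compact {z0}" "{z0} \<subseteq> W" using z0 by auto
  have sum: "summable e"
  proof -
    have "\<forall>\<^sub>F n in sequentially. norm (e (Suc n)) \<le> 1 / 2 * norm (e n)"
      using fast[OF z0c, of 2] log_size_large[OF z0c, of 1]
    proof eventually_elim
      case (elim n)
      have tt: "2 * t n \<le> t (Suc n)" "1 \<le> t n" using elim by (auto simp: t_def)
      have "M / (\<alpha> * t (Suc n)) \<le> M / (\<alpha> * (2 * t n))"
        using tt \<alpha>(1) M(1) by (intro divide_left_mono mult_left_mono mult_pos_pos) auto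
      moreover have "e (Suc n) = M / (\<alpha> * t (Suc n))" "e n = M / (\<alpha> * t n)" using tt by (simp_all add: e_def)
      moreover have "M / (\<alpha> * (2 * t n)) = 1 / 2 * (M / (\<alpha> * t n))" by simp
      ultimately have "e (Suc n) \<le> 1 / 2 * e n" by argo
      then show ?case using e0[of n] e0[of "Suc n"] by simp
    qed
    then obtain N where "\<And>n. n \<ge> N \<Longrightarrow> norm (e (Suc n)) \<le> 1 / 2 * norm (e n)" unfolding eventually_sequentially by blast
    then show ?thesis by (intro summable_ratio_test[of "1 / 2" N]) auto
  qed
  have conv: "convergent (\<lambda>n. ln (log_size n u / t n))" if u: "u \<in> ball z0 \<delta>" for u
  proof -
    define s where "s = (\<lambda>n. ln (log_size n u / t n))"
    have K: "compact {z0, u}" "{z0, u} \<subseteq> W" using z0 u d(2) by auto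
    have E1: "\<forall>\<^sub>F n in sequentially. max 1 (max (t0 / (1 - \<alpha>)) (M / \<alpha>)) \<le> t n"
      using log_size_at_top[OF z0] unfolding filterlim_at_top t_def by blast
    have E2: "\<forall>\<^sub>F n in sequentially. \<forall>z\<in>cball z0 r. 2 * cmod a + 2 \<le> cmod ((f ^^ Suc n) z)"
      using tends_infinity[OF compact_cball r(2), of "2 * cmod a + 2"] by (subst eventually_sequentially_Suc)
    have main: "\<forall>\<^sub>F n in sequentially. (s n \<ge> 0 \<longrightarrow> s n - e n \<le> s (Suc n)) \<and> (s n \<le> 0 \<longrightarrow> s (Suc n) \<le> s n + e n) \<and> \<bar>s n\<bar> \<le> ln (1 + \<alpha> / 4)"
      using E1 E2 d(3) \<alpha>(3) fast[OF K, of 1] log_size_large[OF K, of 1]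
        eventually_sequentially_Suc[THEN iffD2, OF log_size_large[OF K, of 1]]
    proof eventually_elim
      case (elim n)
      have t1: "1 \<le> t n" "t0 / (1 - \<alpha>) \<le> t n" "M / \<alpha> \<le> t n" using elim(1) by auto
      have tx: "t0 \<le> (1 - \<alpha>) * t n" using t1(2) \<alpha>(2) by (simp add: pos_divide_le_eq mult.commute)
      have tM: "M \<le> \<alpha> * t n" using t1(3) \<alpha>(1) by (simp add: pos_divide_le_eq mult.commute)
      define L where "L = 2 * \<alpha> * t n"
      define x where "x = (1 - \<alpha>) * t n"
      have xL: "x + L = (1 + \<alpha>) * t n" by (simp add: x_def L_def algebra_simps)
      have aL: "\<alpha> * t n = L / 2" "0 < L" using \<alpha>(1) t1(1) by (auto simp: L_def)
      have xe: "x = t n - L / 2" using aL by (simp add: x_def left_diff_distrib)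
      have LM: "M \<le> L" using tM aL by linarith
      \<comment> \<open>The annulus consists of values f^n(q) with q in the ball, so f is regular
        and omits a there, and it is large there because f^(n+1) is large on the ball. This is the
        use made of the covering property.\<close>
      have reg: "\<not> is_pole f z \<and> f z \<noteq> a \<and> 2 * cmod a + 2 \<le> cmod (f z)" if z: "exp x < cmod z" "cmod z < exp (x + L)" for z
      proof -
        have "z \<in> closed_log_annulus ((1 - \<alpha>) * t n) ((1 + \<alpha>) * t n)" using z unfolding xL by (simp add: closed_log_annulus_def x_def)
        then obtain q where q: "q \<in> ball z0 r" "z = (f ^^ n) q" using elim(4) unfolding t_def by blast
        have qF: "q \<in> plane_fatou" "q \<in> cball z0 r" using q(1) r(2) W(3) ball_subset_cball by blast+
        have "2 * cmod a + 2 \<le> cmod (f z)" using elim(2) qF(2) q(2) by simp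
        then show ?thesis using fatou_regular[OF qF(1), of n] a[OF fatou_iterate_invariant[OF qF(1), of n]] q(2) by simp
      qed
      have u1: "1 \<le> log_size n u" "log_size n u \<le> (1 + \<alpha> / 4) * t n" "t n \<le> (1 + \<alpha> / 4) * log_size n u"
        using elim(3) u unfolding t_def by blast+
      have ub: "log_size n u \<le> t n + L / 8" using u1(2) aL by (simp add: algebra_simps)
      have "(\<alpha> / 4) * log_size n u \<le> (\<alpha> / 4) * (2 * t n)" using u1(2) \<alpha> t1(1) by (intro mult_left_mono) (auto intro: order_trans[OF _ mult_right_mono[of _ 2]])
      then have lb: "t n - L / 4 \<le> log_size n u" using u1(3) aL by (simp add: algebra_simps)
      have range: "x + L / 4 \<le> log_size n p \<and> log_size n p \<le> x + L - L / 4 \<and> log_size n p \<le> 1 / \<alpha> * L \<and> 1 \<le> log_size n p \<and> 1 \<le> log_size (Suc n) p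
          \<and> log_size n p \<le> log_size (Suc n) p" if p: "p \<in> {z0, u}" for p
      proof -
        have "1 / \<alpha> * L = 2 * t n" using \<alpha>(1) by (simp add: L_def)
        moreover have "L / 2 \<le> t n" using aL(1) \<alpha> t1(1) by (simp add: L_def)
        moreover have "t n - L / 4 \<le> log_size n p" "log_size n p \<le> t n + L / 8" using p lb ub aL(2) by (auto simp: t_def)
        moreover have "1 \<le> log_size n p" using elim(6) p by blast
        moreover have "1 \<le> log_size (Suc n) p" using elim(7) p by blast
        moreover have "1 * log_size n p \<le> log_size (Suc n) p" using elim(5) p by blast
        ultimately show ?thesis using aL(2) unfolding xe by linarith
      qed
      have step: "ln (log_size n q / log_size n p) - e n \<le> ln (log_size (Suc n) q / log_size (Suc n) p)"
        if pq: "p \<in> {z0, u}" "q \<in> {z0, u}" "log_size n p \<le> log_size n q" for p q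
      proof -
        note rp = range[OF pq(1)] and rq = range[OF pq(2)]
        have nz: "(f ^^ n) p \<noteq> 0" "(f ^^ n) q \<noteq> 0" using rp rq unfolding log_size_def by (metis ln_0 norm_zero not_one_le_zero)+
        have 1: "x + L / 4 \<le> ln (cmod ((f ^^ n) p))" "ln (cmod ((f ^^ n) p)) \<le> ln (cmod ((f ^^ n) q))" "ln (cmod ((f ^^ n) q)) \<le> x + L - L / 4"
          "ln (cmod ((f ^^ n) p)) \<le> 1 / \<alpha> * L" "ln (cmod ((f ^^ n) p)) \<le> ln (cmod (f ((f ^^ n) p)))"
          using rp rq pq(3) by (simp_all add: log_size_def)
        have x0: "t0 \<le> x" using tx by (simp add: x_def)
        have "ln (cmod ((f ^^ n) q)) / ln (cmod ((f ^^ n) p)) * (1 - M / L) * ln (cmod (f ((f ^^ n) p))) \<le> ln (cmod (f ((f ^^ n) q)))"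
          by (rule M(2)[OF x0 LM reg nz 1])
        then have st: "log_size n q / log_size n p * (1 - M / L) * log_size (Suc n) p \<le> log_size (Suc n) q" by (simp add: log_size_def)
        have Mh: "0 \<le> M / L" "M / L \<le> 1 / 2" using M(1) aL(2) tM aL(1) by (auto simp: pos_divide_le_eq)
        have "ln (log_size n q / log_size n p) - 2 * (M / L) \<le> ln (log_size (Suc n) q / log_size (Suc n) p)"
          by (rule ln_ratio_step[OF _ _ _ _ Mh st]) (use rp rq in linarith)+
        moreover have "2 * (M / L) = e n" using t1(1) by (simp add: e_def L_def)
        ultimately show ?thesis by simp
      qed
      have pos: "0 < t n" "0 < log_size n u" "0 < t (Suc n)" "0 < log_size (Suc n) u"
        using range[of z0] range[of u] by (auto simp: t_def)
      have A: "s n - e n \<le> s (Suc n)" if "s n \<ge> 0"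
      proof -
        have "1 \<le> log_size n u / t n" using that pos by (simp add: s_def)
        then have "t n \<le> log_size n u" using pos by (simp add: pos_le_divide_eq)
        then show ?thesis using step[of z0 u] by (simp add: s_def t_def)
      qed
      have inv: "ln (t k / log_size k u) = - s k" if "0 < t k" "0 < log_size k u" for k using that by (simp add: s_def ln_div)
      have B': "s (Suc n) \<le> s n + e n" if "s n \<le> 0"
      proof -
        have "log_size n u / t n \<le> 1" using that pos by (simp add: s_def)
        then have "log_size n u \<le> t n" using pos by (simp add: pos_divide_le_eq)
        then have "ln (t n / log_size n u) - e n \<le> ln (t (Suc n) / log_size (Suc n) u)" using step[of u z0] by (simp add: t_def)
        then show ?thesis using inv[of n] inv[of "Suc n"] pos by simp
      qed
      have "log_size n u / t n \<le> 1 + \<alpha> / 4" "t n / log_size n u \<le> 1 + \<alpha> / 4" using u1 pos by (simp_all add: pos_divide_le_eq)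
      then have "ln (log_size n u / t n) \<le> ln (1 + \<alpha> / 4)" "ln (t n / log_size n u) \<le> ln (1 + \<alpha> / 4)"
        using pos by (auto intro!: ln_mono)
      then have "\<bar>s n\<bar> \<le> ln (1 + \<alpha> / 4)" using inv[of n] pos by (simp add: s_def abs_le_iff)
      then show ?case using A B' by blast
    qed
    then obtain N where N: "\<And>n. n \<ge> N \<Longrightarrow> (s n \<ge> 0 \<longrightarrow> s n - e n \<le> s (Suc n)) \<and> (s n \<le> 0 \<longrightarrow> s (Suc n) \<le> s n + e n) \<and> \<bar>s n\<bar> \<le> ln (1 + \<alpha> / 4)"
      unfolding eventually_sequentially by blast
    have "convergent (\<lambda>n. s (n + N))"
    proof (rule convergent_if_almost_expanding[where e = "\<lambda>n. e (n + N)" and N = 0 and B = "ln (1 + \<alpha> / 4)"])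
      show "summable (\<lambda>n. e (n + N))" using sum by (simp add: summable_iff_shift)
    qed (use e0 N in auto)
    then show ?thesis using convergent_ignore_initial_segment[of s N] by (simp add: s_def)
  qed
  show ?thesis using d(1,2) conv unfolding t_def by blast
qed

text \<open>The existence of a positive limit is an equivalence relation between the two points,
  with open classes by \<open>ratio_convergent_near\<close>.\<close>

lemma ratio_limit:
  assumes "z \<in> W" "v \<in> W"
  shows "\<exists>l>0. (\<lambda>n. log_size n v / log_size n z) \<longlonglongrightarrow> l"
proof (rule connected_equivalence_relation[OF W(2) assms])
  have pos: "\<forall>\<^sub>F n in sequentially. 0 < log_size n x" if "x \<in> W" for x
    using log_size_at_top[OF that] by (simp add: filterlim_at_top_dense)
  fix x y assume xy: "\<exists>l>0. (\<lambda>n. log_size n y / log_size n x) \<longlonglongrightarrow> l" "x \<in> W" "y \<in> W"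
  then obtain l where l: "l > 0" "(\<lambda>n. log_size n y / log_size n x) \<longlonglongrightarrow> l" by blast
  then show "\<exists>l>0. (\<lambda>n. log_size n x / log_size n y) \<longlonglongrightarrow> l"
    using tendsto_inverse[OF l(2)] by (intro exI[of _ "inverse l"]) auto
next
  fix x y w assume xyw: "\<exists>l>0. (\<lambda>n. log_size n y / log_size n x) \<longlonglongrightarrow> l" "\<exists>l>0. (\<lambda>n. log_size n w / log_size n y) \<longlonglongrightarrow> l"
    "x \<in> W" "y \<in> W" "w \<in> W"
  then obtain l k where l: "l > 0" "(\<lambda>n. log_size n y / log_size n x) \<longlonglongrightarrow> l" and k: "k > 0" "(\<lambda>n. log_size n w / log_size n y) \<longlonglongrightarrow> k" by blast
  have "\<forall>\<^sub>F n in sequentially. (log_size n y / log_size n x) * (log_size n w / log_size n y) = log_size n w / log_size n x"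
    using log_size_large[of "{y}" 1] xyw(4) by (auto elim!: eventually_mono)
  from tendsto_cong[THEN iffD1, OF this tendsto_mult[OF l(2) k(2)]]
  show "\<exists>l>0. (\<lambda>n. log_size n w / log_size n x) \<longlonglongrightarrow> l" using l(1) k(1) by (intro exI[of _ "l * k"]) auto
next
  fix x assume x: "x \<in> W"
  obtain \<delta> where d: "\<delta> > 0" "ball x \<delta> \<subseteq> W" "\<And>u. u \<in> ball x \<delta> \<Longrightarrow> convergent (\<lambda>n. ln (log_size n u / log_size n x))"
    using ratio_convergent_near[OF x] by blast
  have "\<exists>l>0. (\<lambda>n. log_size n y / log_size n x) \<longlonglongrightarrow> l" if y: "y \<in> ball x \<delta>" for y
  proof -
    obtain k where k: "(\<lambda>n. ln (log_size n y / log_size n x)) \<longlonglongrightarrow> k" using d(3)[OF y] convergentD by blast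
    have "y \<in> W" using y d(2) by blast
    then have "\<forall>\<^sub>F n in sequentially. \<forall>z\<in>{x, y}. 1 \<le> log_size n z" using x by (intro log_size_large) auto
    then have "\<forall>\<^sub>F n in sequentially. exp (ln (log_size n y / log_size n x)) = log_size n y / log_size n x"
      by (rule eventually_mono) (auto intro!: divide_pos_pos)
    from tendsto_cong[THEN iffD1, OF this tendsto_exp[OF k]] show ?thesis by (intro exI[of _ "exp k"]) auto
  qed
  then show "\<exists>T. openin (top_of_set W) T \<and> x \<in> T \<and> (\<forall>y\<in>T. \<exists>l>0. (\<lambda>n. log_size n y / log_size n x) \<longlonglongrightarrow> l)"
    using d(1,2) W(1) by (intro exI[of _ "ball x \<delta>"] conjI ballI) (auto simp: openin_open_eq)
qed

definition limit_ratio :: "complex \<Rightarrow> complex \<Rightarrow> real" where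
  "limit_ratio zs z = lim (\<lambda>n. log_size n z / log_size n zs)"

lemma limit_ratio:
  assumes "zs \<in> W" "z \<in> W"
  shows "(\<lambda>n. log_size n z / log_size n zs) \<longlonglongrightarrow> limit_ratio zs z" "limit_ratio zs z > 0"
  using ratio_limit[OF assms] by (auto simp: limit_ratio_def limI)

lemma limit_ratio_nonconstant:
  assumes zs: "zs \<in> W" and z: "z \<in> W" "r > 0" "ball z r \<subseteq> W"
  shows "\<exists>a\<in>ball z r. \<exists>b\<in>ball z r. limit_ratio zs a < limit_ratio zs b"
proof (rule ccontr)
  assume neg: "\<not> ?thesis"
  have zr: "z \<in> ball z r" using z by simp
  have eq: "limit_ratio zs u = limit_ratio zs z" if "u \<in> ball z r" for u using neg that zr by (meson less_linear)
  have "(\<lambda>k. log_size (id k) u / log_size (id k) z) \<longlonglongrightarrow> 1" if u: "u \<in> ball z r" for u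
  proof -
    have uW: "u \<in> W" using u z(3) by blast
    have A: "\<forall>\<^sub>F n in sequentially. (log_size n u / log_size n zs) / (log_size n z / log_size n zs) = log_size n u / log_size n z"
      using log_size_large[of "{zs}" 1] zs by (auto elim!: eventually_mono)
    have B: "(\<lambda>n. (log_size n u / log_size n zs) / (log_size n z / log_size n zs)) \<longlonglongrightarrow> limit_ratio zs u / limit_ratio zs z"
      using limit_ratio[OF zs uW] limit_ratio[OF zs z(1)] by (intro tendsto_divide) auto
    have "(\<lambda>n. log_size n u / log_size n z) \<longlonglongrightarrow> limit_ratio zs u / limit_ratio zs z" by (rule Lim_transform_eventually[OF B A])
    then show ?thesis using eq[OF u] limit_ratio(2)[OF zs z(1)] by simp
  qed
  then show False using not_degenerate[OF strict_mono_id z] by (simp add: id_def)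
qed

text \<open>A harmonic limit Re G exists at first along a subsequence only; as the full sequence
  converges by \<open>limit_ratio\<close>, the two limits agree.\<close>

lemma limit_ratio_harmonic:
  assumes zs: "zs \<in> W"
  shows "harmonic_on (limit_ratio zs) W"
proof (rule harmonic_on_locally_Re[OF W(1)])
  fix z assume z: "z \<in> W"
  obtain r where r: "r > 0" "cball z r \<subseteq> W" using z W(1) open_contains_cball by blast
  have K: "compact {z, zs}" "{z, zs} \<subseteq> W" using z zs by auto
  obtain \<kappa> where k: "\<kappa> \<ge> 1" "\<forall>\<^sub>F n in sequentially. \<forall>u\<in>{z, zs}. \<forall>v\<in>{z, zs}. 1 \<le> log_size n u \<and> log_size n u \<le> \<kappa> * log_size n v"
    by (rule comparable[OF K], rule that)
  have ev: "\<forall>\<^sub>F k in sequentially. 0 < log_size k zs \<and> log_size k z \<le> \<kappa> * log_size k zs"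
    using k(2) by (rule eventually_mono) force
  have sid: "strict_mono (\<lambda>k::nat. k)" by (simp add: strict_mono_def)
  from log_limit_Re[OF r(2,1) sid ev] obtain s G where J: "strict_mono (s :: nat \<Rightarrow> nat) \<and> G holomorphic_on ball z r \<and>
    (\<forall>u\<in>ball z r. (\<lambda>k. log_size (s k) u / log_size (s k) zs) \<longlonglongrightarrow> Re (G u))" by (elim exE) (rule that)
  note s = J[THEN conjunct1] and G = J[THEN conjunct2, THEN conjunct1] J[THEN conjunct2, THEN conjunct2, rule_format]
  have sub: "ball z r \<subseteq> W" using r(2) ball_subset_cball by blast
  have "limit_ratio zs u = Re (G u)" if u: "u \<in> ball z r" for u
  proof -
    have "(\<lambda>k. log_size (s k) u / log_size (s k) zs) \<longlonglongrightarrow> limit_ratio zs u"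
      using LIMSEQ_subseq_LIMSEQ[OF limit_ratio(1)[OF zs, of u] s] u sub by (auto simp: o_def)
    then show ?thesis using G(2)[OF u] LIMSEQ_unique by blast
  qed
  then show "\<exists>e>0. \<exists>G. ball z e \<subseteq> W \<and> G holomorphic_on ball z e \<and> (\<forall>v\<in>ball z e. limit_ratio zs v = Re (G v))"
    using r(1) sub G(1) by blast
qed

end

section \<open>Transfer to the Riemann sphere\<close>

lemma compact_of_sphere:
  assumes "compactin riemann_sphere (Some ` K)" shows "compact K"
proof (rule compactI)
  fix \<C> assume C: "\<forall>t\<in>\<C>. open t" "K \<subseteq> \<Union>\<C>"
  have "openin riemann_sphere T" if "T \<in> (\<lambda>t. Some ` t) ` \<C>" for T using that C(1) by (auto simp: riemann_sphere_def)
  moreover have "Some ` K \<subseteq> \<Union>((\<lambda>t. Some ` t) ` \<C>)" using C(2) by blast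
  ultimately obtain \<F> where F: "finite \<F>" "\<F> \<subseteq> (\<lambda>t. Some ` t) ` \<C>" "Some ` K \<subseteq> \<Union>\<F>"
    using compactinD[OF assms] by metis
  then obtain \<C>' where C': "\<C>' \<subseteq> \<C>" "finite \<C>'" "\<F> = (\<lambda>t. Some ` t) ` \<C>'" using finite_subset_image by metis
  have "K \<subseteq> \<Union>\<C>'" using F(3) C'(3) by auto
  then show "\<exists>\<C>'\<subseteq>\<C>. finite \<C>' \<and> K \<subseteq> \<Union>\<C>'" using C' by blast
qed

lemma annulus_eq_log_annulus: "annulus (exp x) (exp y) = Some ` log_annulus x y"
  by (simp add: annulus_def log_annulus_def)

lemma infinite_annulus: assumes "0 \<le> x" "x < y" shows "infinite (annulus x y)"
proof -
  have "(\<lambda>t. Some (complex_of_real t)) ` {x<..<y} \<subseteq> annulus x y" using assms by (auto simp: annulus_def)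
  moreover have "infinite ((\<lambda>t. Some (complex_of_real t)) ` {x<..<y})"
    using assms by (subst finite_image_iff) (auto simp: inj_on_def)
  ultimately show ?thesis using finite_subset by blast
qed

context annulus_component
begin

lemma iterate_W: "w \<in> W \<Longrightarrow> iterate f n (Some w) = Some ((f ^^ n) w)"
  using fatou_iterate W(3) by blast

lemma escaping_component: "escaping f (Some ` W)"
  unfolding escaping_def locally_uniformly_convergent_def
proof (intro allI impI)
  fix K e assume K: "compactin riemann_sphere K \<and> K \<subseteq> Some ` W" and e: "0 < (e::real)"
  then obtain K' where K': "K = Some ` K'" "K' \<subseteq> W" by (meson subset_image_iff)
  have "compact K'" using K K' compact_of_sphere by blast
  from tends_infinity[OF this K'(2), of "2 / e"]
  show "\<forall>\<^sub>F n in sequentially. \<forall>w\<in>K. chordal (iterate f n w) None < e"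
  proof eventually_elim
    case (elim n)
    show ?case
    proof
      fix w assume "w \<in> K"
      then obtain z where z: "w = Some z" "z \<in> K'" using K' by blast
      define a where "a = cmod ((f ^^ n) z)"
      have "2 / e \<le> a" using elim z by (auto simp: a_def)
      also have "a < sqrt (1 + a\<^sup>2)" by (rule real_less_rsqrt) simp
      finally have "2 < e * sqrt (1 + a\<^sup>2)" using e by (simp add: pos_divide_less_eq mult.commute)
      moreover have "sqrt (1 + a\<^sup>2) > 0" by (simp add: add_pos_nonneg)
      ultimately have "2 / sqrt (1 + a\<^sup>2) < e" by (simp add: pos_divide_less_eq)
      then show "chordal (iterate f n w) None < e" using z K' iterate_W[of z n] by (auto simp: a_def)
    qed
  qed
qed

text \<open>For large n both logarithmic sizes are at least 1, so the infinite values of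
  \<open>elog\<close> and a vanishing denominator do not occur.\<close>

lemma h_seq_eq:
  assumes "zs \<in> W" "z \<in> W"
  shows "\<forall>\<^sub>F n in sequentially. h_seq f (Some zs) n (Some z) = ereal (log_size n z / log_size n zs)"
proof -
  have "\<forall>\<^sub>F n in sequentially. \<forall>u\<in>{zs, z}. 1 \<le> log_size n u" using assms by (intro log_size_large) auto
  then show ?thesis
  proof eventually_elim
    case (elim n)
    have e: "elog (sphere_norm (iterate f n (Some u))) = ereal (log_size n u)" if "u \<in> {zs, z}" for u
    proof -
      have "1 \<le> log_size n u" using elim that by blast
      then have "(f ^^ n) u \<noteq> 0" by (auto simp: log_size_def)
      moreover have "iterate f n (Some u) = Some ((f ^^ n) u)" using that assms by (intro iterate_W) auto
      ultimately show ?thesis by (simp add: elog_def log_size_def)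
    qed
    have "log_size n zs \<noteq> 0" using elim by auto
    then show ?case unfolding h_seq_def using e[of z] e[of zs] by simp
  qed
qed

lemma limit_function:
  assumes zs: "zs \<in> Some ` W"
  shows "\<exists>h :: csphere \<Rightarrow> real.
    (\<forall>z\<in>Some ` W. h_upper f zs z = ereal (h z) \<and> h_lower f zs z = ereal (h z)) \<and>
    harmonic_on (\<lambda>z. h (Some z)) {z. Some z \<in> Some ` W} \<and> (\<forall>z\<in>Some ` W. h z > 0) \<and> \<not> h constant_on Some ` W"
proof -
  obtain ws where ws: "zs = Some ws" "ws \<in> W" using zs by blast
  define h where "h = (\<lambda>z. limit_ratio ws (the z))"
  have lims: "h_upper f zs z = ereal (h z) \<and> h_lower f zs z = ereal (h z)" if zU: "z \<in> Some ` W" for z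
  proof -
    obtain w where w: "z = Some w" "w \<in> W" using zU by blast
    have "(\<lambda>n. ereal (log_size n w / log_size n ws)) \<longlonglongrightarrow> ereal (h z)"
      using limit_ratio(1)[OF ws(2) w(2)] w(1) by (simp add: h_def)
    then have "(\<lambda>n. h_seq f zs n z) \<longlonglongrightarrow> ereal (h z)"
      using tendsto_cong[OF h_seq_eq[OF ws(2) w(2)]] ws(1) w(1) by simp
    then show ?thesis using lim_imp_Limsup lim_imp_Liminf sequentially_bot unfolding h_upper_def h_lower_def by blast
  qed
  have W': "{z. Some z \<in> Some ` W} = W" by auto
  have "harmonic_on (\<lambda>z. h (Some z)) {z. Some z \<in> Some ` W}"
    unfolding W' h_def using limit_ratio_harmonic[OF ws(2)] by simp
  moreover have "\<forall>z\<in>Some ` W. h z > 0" using limit_ratio(2)[OF ws(2)] by (auto simp: h_def)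
  moreover have "\<not> h constant_on Some ` W"
  proof
    assume "h constant_on Some ` W"
    then obtain k where k: "\<And>w. w \<in> W \<Longrightarrow> limit_ratio ws w = k" unfolding constant_on_def h_def by auto
    obtain r where r: "r > 0" "ball ws r \<subseteq> W" using ws(2) W(1) open_contains_ball by blast
    then obtain a b where "a \<in> ball ws r" "b \<in> ball ws r" "limit_ratio ws a < limit_ratio ws b"
      using limit_ratio_nonconstant[OF ws(2) ws(2) r] by blast
    then show False using k r(2) by (metis less_irrefl subsetD)
  qed
  ultimately show ?thesis using lims by (intro exI[of _ h]) blast
qed

lemma interior_ball:
  assumes V: "V \<subseteq> Some ` W" "z \<in> riemann_sphere interior_of V"
  obtains w r where "z = Some w" "0 < r" "cball w r \<subseteq> W" "Some ` cball w r \<subseteq> V"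
proof -
  obtain T where T: "openin riemann_sphere T" "z \<in> T" "T \<subseteq> V" using V(2) unfolding interior_of_def by blast
  obtain w where w: "z = Some w" using T V(1) by blast
  have "openin euclidean {x \<in> topspace euclidean. Some x \<in> T}"
    by (rule openin_continuous_map_preimage[OF _ T(1)]) (simp add: riemann_sphere_def continuous_map_Some)
  then have "open {x. Some x \<in> T}" by simp
  then obtain r where r: "r > 0" "cball w r \<subseteq> {x. Some x \<in> T}" using T(2) w open_contains_cball by blast
  have "Some ` cball w r \<subseteq> V" using r(2) T(3) by blast
  moreover from this have "cball w r \<subseteq> W" using V(1) by blast
  ultimately show ?thesis using that w r(1) by blast
qed

lemma image_contains_annulus:
  assumes V: "V \<subseteq> Some ` W" "z \<in> riemann_sphere interior_of V"
  shows "\<exists>\<alpha>. 0 < \<alpha> \<and> \<alpha> < 1 \<and> (\<forall>\<^sub>F n in sequentially. \<exists>w. iterate f n z = Some w \<and>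
    annulus (cmod w powr (1 - \<alpha>)) (cmod w powr (1 + \<alpha>)) \<subseteq> iterate f n ` V)"
proof -
  obtain w r where w: "z = Some w" "0 < r" "cball w r \<subseteq> W" "Some ` cball w r \<subseteq> V" by (rule interior_ball[OF V])
  obtain \<alpha> where \<alpha>: "0 < \<alpha>" "\<alpha> < 1" "\<forall>\<^sub>F n in sequentially.
      closed_log_annulus ((1 - \<alpha>) * log_size n w) ((1 + \<alpha>) * log_size n w) \<subseteq> (f ^^ n) ` ball w r"
    using covers_annulus[OF w(3,2)] by blast
  have wW: "w \<in> W" using w by auto
  have large: "\<forall>\<^sub>F n in sequentially. \<forall>u\<in>{w}. 1 \<le> log_size n u" using wW by (intro log_size_large) auto
  have "\<forall>\<^sub>F n in sequentially. \<exists>w'. iterate f n z = Some w' \<and>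
      annulus (cmod w' powr (1 - \<alpha>)) (cmod w' powr (1 + \<alpha>)) \<subseteq> iterate f n ` V"
    using \<alpha>(3) large
  proof eventually_elim
    case (elim n)
    have nz: "(f ^^ n) w \<noteq> 0" using elim(2) by (auto simp: log_size_def)
    have p: "cmod ((f ^^ n) w) powr k = exp (k * log_size n w)" for k using nz by (simp add: powr_def log_size_def)
    have "annulus (cmod ((f ^^ n) w) powr (1 - \<alpha>)) (cmod ((f ^^ n) w) powr (1 + \<alpha>)) \<subseteq> Some ` (f ^^ n) ` ball w r"
      unfolding p annulus_eq_log_annulus using elim(1) log_annulus_subset_closed by (intro image_mono) blast
    also have "\<dots> = iterate f n ` Some ` ball w r"
      by (rule iterate_component[symmetric]) (use w(3) W(3) ball_subset_cball in blast)
    also have "\<dots> \<subseteq> iterate f n ` V" using w(4) ball_subset_cball by blast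
    finally show ?case using iterate_W[OF wW] w(1) by blast
  qed
  then show ?thesis using \<alpha> by blast
qed

lemma annuli_sequence:
  assumes V: "V \<subseteq> Some ` W" "z \<in> riemann_sphere interior_of V"
  shows "\<exists>a\<in>V. \<exists>b\<in>V. \<exists>\<tau>>1. \<exists>r R :: nat \<Rightarrow> real.
    (\<forall>\<^sub>F n in sequentially.
       (\<exists>u v. iterate f n a = Some u \<and> iterate f n b = Some v \<and> cmod u powr \<tau> \<le> cmod v) \<and>
       0 < r n \<and> r n < R n \<and> annulus (r n) (R n) \<subseteq> iterate f n ` V \<and> R n \<ge> r n powr \<tau> \<and>
       annulus (r (Suc n)) (R (Suc n)) \<subseteq> sphere_map f ` annulus (r n) (R n)) \<and>
    filterlim (\<lambda>n. r n powr \<tau>) at_top sequentially"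
proof -
  obtain w r where w: "z = Some w" "0 < r" "cball w r \<subseteq> W" "Some ` cball w r \<subseteq> V" by (rule interior_ball[OF V])
  have wW: "w \<in> W" and bW: "ball w r \<subseteq> W" using w ball_subset_cball by auto
  have bV: "Some ` ball w r \<subseteq> V" using w(4) ball_subset_cball by blast
  obtain a b where ab: "a \<in> ball w r" "b \<in> ball w r" "limit_ratio w a < limit_ratio w b"
    using limit_ratio_nonconstant[OF wW wW w(2) bW] by blast
  obtain N X' Y' \<rho>' where J: "0 < \<rho>' \<and> (\<forall>n::nat. 1 \<le> X' n \<and> 32 * X' n \<le> X' (Suc n) \<and> (1 + \<rho>') * X' n \<le> Y' n \<and>
    log_annulus (X' n) (Y' n) \<subseteq> (f ^^ (N + n)) ` ball w r \<and>
    closed_log_annulus (X' (Suc n)) (Y' (Suc n)) \<subseteq> f ` log_annulus (X' n) (Y' n))"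
    using image_annuli[OF w(3,2)] by (elim exE) (rule that)
  have XY: "1 \<le> X' n" "32 * X' n \<le> X' (Suc n)" "(1 + \<rho>') * X' n \<le> Y' n"
    "log_annulus (X' n) (Y' n) \<subseteq> (f ^^ (N + n)) ` ball w r"
    "closed_log_annulus (X' (Suc n)) (Y' (Suc n)) \<subseteq> f ` log_annulus (X' n) (Y' n)" for n using J by blast+
  have \<rho>': "0 < \<rho>'" using J by blast
  have aW: "a \<in> W" "b \<in> W" using ab bW by auto
  define q where "q = limit_ratio w b / limit_ratio w a"
  have q: "q > 1" using ab(3) limit_ratio(2)[OF wW aW(1)] by (simp add: q_def pos_less_divide_eq)
  \<comment> \<open>Less than q, the limiting ratio of the logarithmic sizes at b and a, and at most
    1 + \<rho>', the guaranteed ratio of the logarithmic radii of the annuli.\<close>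
  define \<tau> where "\<tau> = min (1 + \<rho>') ((1 + q) / 2)"
  have \<tau>: "\<tau> > 1" "\<tau> \<le> 1 + \<rho>'" "\<tau> < q" using q \<rho>' by (auto simp: \<tau>_def min_def)
  \<comment> \<open>The chain starts at time N. For n < N the truncated difference is 0; these
    indices are disposed of by \<open>eventually\<close>.\<close>
  define rr where "rr = (\<lambda>n. exp (X' (n - N)))"
  define RR where "RR = (\<lambda>n. exp (Y' (n - N)))"
  have lim: "(\<lambda>n. (log_size n b / log_size n w) / (log_size n a / log_size n w)) \<longlonglongrightarrow> q"
    unfolding q_def using limit_ratio[OF wW aW(1)] limit_ratio[OF wW aW(2)] by (intro tendsto_divide) auto
  have large: "\<forall>\<^sub>F n in sequentially. \<forall>u\<in>{a, b, w}. 1 \<le> log_size n u" using aW wW by (intro log_size_large) auto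
  have eN: "\<forall>\<^sub>F n in sequentially. N \<le> n" by (rule eventually_ge_at_top)
  have ev: "\<forall>\<^sub>F n in sequentially.
       (\<exists>u v. iterate f n (Some a) = Some u \<and> iterate f n (Some b) = Some v \<and> cmod u powr \<tau> \<le> cmod v) \<and>
       0 < rr n \<and> rr n < RR n \<and> annulus (rr n) (RR n) \<subseteq> iterate f n ` V \<and> RR n \<ge> rr n powr \<tau> \<and>
       annulus (rr (Suc n)) (RR (Suc n)) \<subseteq> sphere_map f ` annulus (rr n) (RR n)"
    using order_tendstoD(1)[OF lim \<tau>(3)] large eN
  proof eventually_elim
    case (elim n)
    define i where "i = n - N"
    have ni: "n = N + i" "Suc n - N = Suc i" using elim(3) by (auto simp: i_def)
    have l: "1 \<le> log_size n a" "1 \<le> log_size n b" "1 \<le> log_size n w" using elim(2) by auto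
    have "\<tau> < log_size n b / log_size n a" using elim(1) l by simp
    then have t: "\<tau> * log_size n a \<le> log_size n b" using l by (simp add: pos_less_divide_eq)
    have nz: "(f ^^ n) a \<noteq> 0" "(f ^^ n) b \<noteq> 0" using l by (auto simp: log_size_def)
    have "cmod ((f ^^ n) a) powr \<tau> = exp (\<tau> * log_size n a)" using nz by (simp add: powr_def log_size_def)
    also have "\<dots> \<le> exp (log_size n b)" using t by simp
    also have "\<dots> = cmod ((f ^^ n) b)" using nz by (simp add: log_size_def)
    finally have uv: "\<exists>u v. iterate f n (Some a) = Some u \<and> iterate f n (Some b) = Some v \<and> cmod u powr \<tau> \<le> cmod v"
      using iterate_W aW by blast
    have XYi: "\<tau> * X' i \<le> Y' i"
    proof -
      have "\<tau> * X' i \<le> (1 + \<rho>') * X' i" using \<tau>(2) XY(1)[of i] by (intro mult_right_mono) auto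
      then show ?thesis using XY(3)[of i] by linarith
    qed
    have "1 * X' i < \<tau> * X' i" using \<tau>(1) XY(1)[of i] by (intro mult_strict_right_mono) auto
    then have lt: "X' i < Y' i" using XYi by linarith
    have An: "annulus (rr n) (RR n) = Some ` log_annulus (X' i) (Y' i)"
      unfolding rr_def RR_def annulus_eq_log_annulus i_def ..
    have im: "annulus (rr n) (RR n) \<subseteq> iterate f n ` V"
    proof -
      have "annulus (rr n) (RR n) \<subseteq> Some ` (f ^^ n) ` ball w r" 
      proof -
        have "log_annulus (X' i) (Y' i) \<subseteq> (f ^^ n) ` ball w r" using XY(4)[of i] by (simp only: ni(1))
        then show ?thesis unfolding An by (rule image_mono)
      qed
      also have "\<dots> = iterate f n ` Some ` ball w r" by (rule iterate_component[symmetric]) (use bW W(3) in blast)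
      also have "\<dots> \<subseteq> iterate f n ` V" using bV by blast
      finally show ?thesis .
    qed
    have reg: "sphere_map f (Some y) = Some (f y)" if y: "y \<in> log_annulus (X' i) (Y' i)" for y
    proof -
      obtain x where "x \<in> ball w r" "y = (f ^^ (N + i)) x" using y XY(4)[of i] by blast
      then have "\<not> is_pole f y" using fatou_regular[of x "N + i"] bW W(3) by blast
      then show ?thesis by (simp add: sphere_map_Some meromorphic_value_def)
    qed
    have next_sub: "annulus (rr (Suc n)) (RR (Suc n)) \<subseteq> sphere_map f ` annulus (rr n) (RR n)"
    proof -
      have "annulus (rr (Suc n)) (RR (Suc n)) = Some ` log_annulus (X' (Suc i)) (Y' (Suc i))"
        unfolding rr_def RR_def annulus_eq_log_annulus ni(2) ..
      also have "\<dots> \<subseteq> Some ` f ` log_annulus (X' i) (Y' i)"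
        using XY(5)[of i] log_annulus_subset_closed by (intro image_mono) blast
      also have "\<dots> = sphere_map f ` annulus (rr n) (RR n)" unfolding An using reg by (auto simp: image_iff)
      finally show ?thesis .
    qed
    have "rr n powr \<tau> = exp (\<tau> * X' i)" by (simp add: rr_def powr_def i_def)
    then have "rr n powr \<tau> \<le> RR n" using XYi by (simp add: RR_def i_def)
    moreover have "0 < rr n" "rr n < RR n" using lt by (simp_all add: rr_def RR_def i_def)
    ultimately show ?case using uv im next_sub by blast
  qed
  have Xn: "real n \<le> X' n" for n
  proof (induction n)
    case (Suc n) then show ?case using XY(1,2)[of n] by simp
  qed (use XY(1)[of 0] in simp)
  have "filterlim (\<lambda>n. rr n powr \<tau>) at_top sequentially"
  proof (rule filterlim_at_top_mono)
    show "filterlim (\<lambda>n. real (n - N)) at_top sequentially" by real_asymp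
    show "\<forall>\<^sub>F n in sequentially. real (n - N) \<le> rr n powr \<tau>"
    proof (intro always_eventually allI)
      fix n
      have "1 * X' (n - N) \<le> \<tau> * X' (n - N)" using \<tau>(1) XY(1)[of "n - N"] by (intro mult_right_mono) auto
      then have "real (n - N) \<le> \<tau> * X' (n - N)" using Xn[of "n - N"] by linarith
      also have "\<dots> \<le> exp (\<tau> * X' (n - N))" using exp_ge_add_one_self[of "\<tau> * X' (n - N)"] by linarith
      finally show "real (n - N) \<le> rr n powr \<tau>" by (simp add: rr_def powr_def)
    qed
  qed
  moreover have "Some a \<in> V" "Some b \<in> V" using ab(1,2) bV by auto
  ultimately show ?thesis using ev \<tau>(1)
    by (intro bexI[of _ "Some a"] bexI[of _ "Some b"] exI[of _ \<tau>] conjI exI[of _ rr] exI[of _ RR])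
qed

end

section \<open>From one wide annulus to the chain\<close>

context growth_function
begin

lemma open_iterate_image:
  assumes "open S" "S \<subseteq> plane_fatou" shows "open ((f ^^ n) ` S)"
proof (induction n)
  case (Suc n)
  have "open (f ` ((f ^^ n) ` S))" by (rule open_image[OF Suc]) (use assms(2) fatou_regular in blast)
  then show ?case by (simp add: image_image)
qed (use assms in simp)

text \<open>Images of small open balls of W are open and cover T; the closed balls belonging to a
  finite subcover make up K.\<close>

lemma compact_lift:
  assumes W: "open W" "W \<subseteq> plane_fatou" and T: "compact T" "T \<subseteq> (f ^^ n) ` W"
  obtains K where "compact K" "K \<subseteq> W" "T \<subseteq> (f ^^ n) ` K"
proof -
  have "\<forall>w. \<exists>e. w \<in> W \<longrightarrow> e > 0 \<and> cball w e \<subseteq> W" using W(1) open_contains_cball by blast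
  then obtain e where e: "\<And>w. w \<in> W \<Longrightarrow> e w > 0 \<and> cball w (e w) \<subseteq> W" by metis
  have op: "open ((f ^^ n) ` ball w (e w))" if "w \<in> W" for w
    by (rule open_iterate_image[OF open_ball]) (use e[OF that] W(2) ball_subset_cball in blast)
  have "T \<subseteq> (\<Union>w\<in>W. (f ^^ n) ` ball w (e w))" using T(2) e by (force simp: image_iff)
  then obtain D where D: "D \<subseteq> W" "finite D" "T \<subseteq> (\<Union>w\<in>D. (f ^^ n) ` ball w (e w))"
    using compactE_image[OF T(1), of W "\<lambda>w. (f ^^ n) ` ball w (e w)"] op by metis
  show ?thesis
  proof (rule that[of "\<Union>w\<in>D. cball w (e w)"])
    show "compact (\<Union>w\<in>D. cball w (e w))" using D(2) by (intro compact_UN) auto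
    show "(\<Union>w\<in>D. cball w (e w)) \<subseteq> W" using e D(1) by blast
    show "T \<subseteq> (f ^^ n) ` (\<Union>w\<in>D. cball w (e w))" using D(3) ball_subset_cball by blast
  qed
qed

text \<open>The given open annulus is shortened by 1 at both ends of the logarithmic scale, so that
  a closed annulus can be lifted to a compact set. The remaining width 2 d - 2 is at least
  \<open>start_width\<close>, and the term 3 d in the exponent of the radius ensures y \<le> 2
  x.\<close>

lemma annulus_component_exists:
  assumes d: "d = start_width C c + 2"
  shows "\<exists>R>0. \<forall>U\<in>fatou_components f.
    (\<exists>m>0. \<exists>r\<ge>R. annulus (exp 1 powr (- d) * r) (exp 1 powr d * r) \<subseteq> iterate f m ` U) \<longrightarrow>
    (\<exists>W Kw m X Y \<rho>. U = Some ` W \<and> annulus_component f C c r\<^sub>0 W Kw m X Y \<rho>)"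
proof -
  obtain t0 where t0: "t0 \<ge> 1"
    "\<And>T x y N. \<lbrakk>x \<ge> t0; y - x \<ge> start_width C c; y \<le> 2 * x; T \<subseteq> plane_fatou; log_annulus x y \<subseteq> (f ^^ N) ` T\<rbrakk> \<Longrightarrow>
      \<exists>X Y \<rho>. X 0 = x \<and> Y 0 = y \<and> \<rho> > 0 \<and> (\<forall>n::nat. 1 \<le> X n \<and> 32 * X n \<le> X (Suc n) \<and> (1 + \<rho>) * X n \<le> Y n \<and> Y n \<le> 2 * X n \<and>
        start_width C c \<le> Y n - X n \<and> log_annulus (X n) (Y n) \<subseteq> (f ^^ (N + n)) ` T \<and>
        closed_log_annulus (X (Suc n)) (Y (Suc n)) \<subseteq> f ` log_annulus (X n) (Y n))"
    using chain_from[OF order_refl] by blast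
  have sw: "start_width C c \<ge> 1" by (simp add: start_width_def one_le_power)
  show ?thesis
  proof (intro exI[of _ "exp (t0 + 3 * d)"] conjI ballI impI)
    fix U assume U: "U \<in> fatou_components f"
      and "\<exists>m>0. \<exists>r\<ge>exp (t0 + 3 * d). annulus (exp 1 powr (- d) * r) (exp 1 powr d * r) \<subseteq> iterate f m ` U"
    then obtain m r where r: "r \<ge> exp (t0 + 3 * d)" "annulus (exp 1 powr (- d) * r) (exp 1 powr d * r) \<subseteq> iterate f m ` U" by blast
    obtain W where W: "U = Some ` W" "open W" "connected W" "W \<noteq> {}" "W \<subseteq> plane_fatou" by (rule component_plane[OF U])
    define t where "t = ln r"
    have "r > 0" using r(1) exp_gt_zero[of "t0 + 3 * d"] by linarith
    then have rt: "r = exp t" by (simp add: t_def)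
    have t: "t \<ge> t0 + 3 * d" using r(1) unfolding rt by simp
    define x where "x = t - d + 1"
    define y where "y = t + d - 1"
    have "exp 1 powr (- d) * r = exp (t - d)" "exp 1 powr d * r = exp (t + d)" by (simp_all add: rt powr_def exp_add exp_diff exp_minus divide_inverse)
    then have "Some ` log_annulus (t - d) (t + d) \<subseteq> Some ` (f ^^ m) ` W"
      using r(2) iterate_component[OF W(5)] unfolding W(1) by (simp add: annulus_eq_log_annulus)
    then have "log_annulus (t - d) (t + d) \<subseteq> (f ^^ m) ` W" by auto
    moreover have "closed_log_annulus x y \<subseteq> log_annulus (t - d) (t + d)"
      unfolding subset_iff log_annulus_ln closed_log_annulus_ln x_def y_def by auto
    ultimately have "closed_log_annulus x y \<subseteq> (f ^^ m) ` W" by blast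
    from compact_lift[OF W(2,5) compact_closed_log_annulus this]
    obtain K where K: "compact K" "K \<subseteq> W" "closed_log_annulus x y \<subseteq> (f ^^ m) ` K" by metis
    have x1: "x \<ge> t0" "y - x \<ge> start_width C c" "y \<le> 2 * x" using t d sw t0(1) by (auto simp: x_def y_def)
    have x2: "K \<subseteq> plane_fatou" "log_annulus x y \<subseteq> (f ^^ m) ` K" using K W(5) log_annulus_subset_closed by blast+
    from t0(2)[OF x1 x2] obtain X Y \<rho> where J: "X 0 = x \<and> Y 0 = y \<and> \<rho> > 0 \<and> (\<forall>n::nat. 1 \<le> X n \<and> 32 * X n \<le> X (Suc n) \<and> (1 + \<rho>) * X n \<le> Y n \<and> Y n \<le> 2 * X n \<and>
        start_width C c \<le> Y n - X n \<and> log_annulus (X n) (Y n) \<subseteq> (f ^^ (m + n)) ` K \<and>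
        closed_log_annulus (X (Suc n)) (Y (Suc n)) \<subseteq> f ` log_annulus (X n) (Y n))" by (elim exE) (rule that)
    have cov: "closed_log_annulus (X n) (Y n) \<subseteq> (f ^^ (m + n)) ` K" for n
    proof (cases n)
      case 0 then show ?thesis using J K(3) by simp
    next
      case (Suc k)
      have "closed_log_annulus (X (Suc k)) (Y (Suc k)) \<subseteq> f ` log_annulus (X k) (Y k)" using J by blast
      also have "\<dots> \<subseteq> f ` (f ^^ (m + k)) ` K" using J by (intro image_mono) blast
      finally show ?thesis by (simp add: Suc image_image)
    qed
    have "annulus_component f C c r\<^sub>0 W K m X Y \<rho>"
      by unfold_locales (use W K J cov in blast)+
    then show "\<exists>W Kw m X Y \<rho>. U = Some ` W \<and> annulus_component f C c r\<^sub>0 W Kw m X Y \<rho>" using W(1) by blast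
  qed simp
qed

end

text \<open>Under a constant function any set has an image of at most two points, the second one
  being assigned to infinity. So the annulus condition of the theorem cannot hold.\<close>

lemma constant_no_annulus:
  assumes f: "\<And>z. f z = k" and m: "m > 0" and r: "r > 0" and D: "D > 1" and d: "d > 0"
  shows "\<not> annulus (D powr (- d) * r) (D powr d * r) \<subseteq> iterate f m ` U"
proof -
  have fk: "f = (\<lambda>_. k)" using f by auto
  have np: "\<not> is_pole f z" for z unfolding fk by (rule analytic_at_imp_no_pole) simp
  have fin: "finite (sphere_map f ` S)" for S
  proof -
    have "sphere_map f w \<in> {Some k, sphere_map f None}" for w
      by (cases w) (auto simp: sphere_map_def meromorphic_value_def np f)
    then have "sphere_map f ` S \<subseteq> {Some k, sphere_map f None}" by blast
    then show ?thesis using finite_subset by blast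
  qed
  obtain n where "m = Suc n" using m by (cases m) auto
  then have "finite (iterate f m ` U)" using fin[of "iterate f n ` U"] by (simp add: image_image)
  moreover have "infinite (annulus (D powr (- d) * r) (D powr d * r))"
    using D d r by (intro infinite_annulus mult_strict_right_mono powr_less_mono) auto
  ultimately show ?thesis using finite_subset by blast
qed

theorem theorem2:
  fixes C c r\<^sub>0 :: real
  assumes "C \<ge> 1" and "c > 0" and "r\<^sub>0 > 0"
  shows "\<exists>D>1. \<exists>d>1. \<forall>f :: complex \<Rightarrow> complex.
    f nicely_meromorphic_on UNIV \<and> \<not> moebius_transformation f \<and>
    \<not> (\<exists>p. degree p \<ge> 2 \<and> f = poly p) \<and>
    (\<forall>r>r\<^sub>0. r \<noteq> 1 \<longrightarrow>
       elog (max_modulus (C * r) f) \<ge> ereal ((1 - c / ln r) * nevanlinna_T r f))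
    \<longrightarrow>
    (\<exists>R\<^sub>0>0. \<forall>U\<in>fatou_components f.
      (\<exists>m>0. \<exists>r\<ge>R\<^sub>0. annulus (D powr (- d) * r) (D powr d * r) \<subseteq> iterate f m ` U)
      \<longrightarrow>
      escaping f U \<and> wandering f U \<and>
      (\<forall>zs\<in>U. \<exists>h :: csphere \<Rightarrow> real.
         (\<forall>z\<in>U. h_upper f zs z = ereal (h z) \<and> h_lower f zs z = ereal (h z)) \<and>
         harmonic_on (\<lambda>z. h (Some z)) {z. Some z \<in> U} \<and>
         (\<forall>z\<in>U. h z > 0) \<and> \<not> h constant_on U) \<and>
      (\<forall>z\<^sub>0\<in>U. \<forall>V. V \<subseteq> U \<and> z\<^sub>0 \<in> riemann_sphere interior_of V \<longrightarrow>
         (\<exists>\<alpha>. 0 < \<alpha> \<and> \<alpha> < 1 \<and>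
            (\<forall>\<^sub>F n in sequentially. \<exists>w. iterate f n z\<^sub>0 = Some w \<and>
               annulus (cmod w powr (1 - \<alpha>)) (cmod w powr (1 + \<alpha>)) \<subseteq> iterate f n ` V)) \<and>
         (\<exists>a\<in>V. \<exists>b\<in>V. \<exists>\<tau>>1. \<exists>r R :: nat \<Rightarrow> real.
            (\<forall>\<^sub>F n in sequentially.
               (\<exists>u v. iterate f n a = Some u \<and> iterate f n b = Some v \<and>
                      cmod u powr \<tau> \<le> cmod v) \<and>
               0 < r n \<and> r n < R n \<and>
               annulus (r n) (R n) \<subseteq> iterate f n ` V \<and>
               R n \<ge> r n powr \<tau> \<and>
               annulus (r (Suc n)) (R (Suc n)) \<subseteq> sphere_map f ` annulus (r n) (R n)) \<and>
            filterlim (\<lambda>n. r n powr \<tau>) at_top sequentially)))"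
proof -
  \<comment> \<open>With D = e the annulus of the theorem is the interval of half-width d about log
    r on the logarithmic scale. Both D and d are fixed before f; R_0 is chosen afterwards.\<close>
  define d where "d = start_width C c + 2"
  have d: "d > 1" by (simp add: d_def start_width_def add_nonneg_pos)
  show ?thesis
  proof (rule exI[of _ "exp 1"], rule conjI, simp, rule exI[of _ d], rule conjI, rule d, intro allI impI)
    fix f :: "complex \<Rightarrow> complex"
    assume f: "f nicely_meromorphic_on UNIV \<and> \<not> moebius_transformation f \<and>
      \<not> (\<exists>p. degree p \<ge> 2 \<and> f = poly p) \<and>
      (\<forall>r>r\<^sub>0. r \<noteq> 1 \<longrightarrow> elog (max_modulus (C * r) f) \<ge> ereal ((1 - c / ln r) * nevanlinna_T r f))"
    show "\<exists>R\<^sub>0>0. \<forall>U\<in>fatou_components f.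
      (\<exists>m>0. \<exists>r\<ge>R\<^sub>0. annulus (exp 1 powr (- d) * r) (exp 1 powr d * r) \<subseteq> iterate f m ` U)
      \<longrightarrow>
      escaping f U \<and> wandering f U \<and>
      (\<forall>zs\<in>U. \<exists>h :: csphere \<Rightarrow> real.
         (\<forall>z\<in>U. h_upper f zs z = ereal (h z) \<and> h_lower f zs z = ereal (h z)) \<and>
         harmonic_on (\<lambda>z. h (Some z)) {z. Some z \<in> U} \<and>
         (\<forall>z\<in>U. h z > 0) \<and> \<not> h constant_on U) \<and>
      (\<forall>z\<^sub>0\<in>U. \<forall>V. V \<subseteq> U \<and> z\<^sub>0 \<in> riemann_sphere interior_of V \<longrightarrow>
         (\<exists>\<alpha>. 0 < \<alpha> \<and> \<alpha> < 1 \<and>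
            (\<forall>\<^sub>F n in sequentially. \<exists>w. iterate f n z\<^sub>0 = Some w \<and>
               annulus (cmod w powr (1 - \<alpha>)) (cmod w powr (1 + \<alpha>)) \<subseteq> iterate f n ` V)) \<and>
         (\<exists>a\<in>V. \<exists>b\<in>V. \<exists>\<tau>>1. \<exists>r R :: nat \<Rightarrow> real.
            (\<forall>\<^sub>F n in sequentially.
               (\<exists>u v. iterate f n a = Some u \<and> iterate f n b = Some v \<and>
                      cmod u powr \<tau> \<le> cmod v) \<and>
               0 < r n \<and> r n < R n \<and>
               annulus (r n) (R n) \<subseteq> iterate f n ` V \<and>
               R n \<ge> r n powr \<tau> \<and>
               annulus (r (Suc n)) (R (Suc n)) \<subseteq> sphere_map f ` annulus (r n) (R n)) \<and>
            filterlim (\<lambda>n. r n powr \<tau>) at_top sequentially))" (is "\<exists>R\<^sub>0>0. \<forall>U\<in>_. ?A R\<^sub>0 U \<longrightarrow> ?B U")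
    proof (cases "f constant_on UNIV")
      case True
      then obtain k where k: "\<And>z. f z = k" by (auto simp: constant_on_def)
      have nA: "\<not> ?A 1 U" for U
      proof
        assume "?A 1 U"
        then obtain m r where "m > 0" "r \<ge> 1" "annulus (exp 1 powr (- d) * r) (exp 1 powr d * r) \<subseteq> iterate f m ` U" by blast
        then show False using constant_no_annulus[of f k m r "exp 1" d U] k d by simp
      qed
      show ?thesis
      proof (rule exI[of _ 1], rule conjI, simp, intro ballI, rule impI)
        fix U assume "?A 1 U"
        from nA[of U] this show "?B U" by (rule notE)
      qed
    next
      case False
      have np: "f \<noteq> poly p" for p
      proof
        assume p: "f = poly p"
        then have "degree p < 2" using f by force
        then consider "degree p = 0" | "degree p = 1" by linarith
        then show False
        proof cases
          case 1
          then obtain k where "p = [:k:]" by (rule degree_eq_zeroE)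
          then show False using False p by (simp add: constant_on_def)
        next
          case 2
          obtain b q where pq: "p = pCons b q" by (cases p)
          have q: "q \<noteq> 0" "degree q = 0" using 2 pq by (auto simp: degree_pCons_eq_if split: if_splits)
          obtain a where a: "q = [:a:]" using q(2) by (rule degree_eq_zeroE)
          have ab: "p = [:b, a:]" "a \<noteq> 0" using pq a q(1) by auto
          have "moebius_transformation f" unfolding moebius_transformation_def
            by (intro exI[of _ a] exI[of _ b] exI[of _ 0] exI[of _ 1]) (simp add: p ab algebra_simps)
          then show False using f by blast
        qed
      qed
      interpret growth_function f C c r\<^sub>0
        by unfold_locales (use assms f False np in blast)+
      from annulus_component_exists[OF d_def] obtain R where R: "R > 0 \<and> (\<forall>U\<in>fatou_components f. ?A R U \<longrightarrow>
          (\<exists>W Kw m X Y \<rho>. U = Some ` W \<and> annulus_component f C c r\<^sub>0 W Kw m X Y \<rho>))"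
        by (elim exE) (rule that)
      have B: "?B U" if U: "U \<in> fatou_components f" and A: "?A R U" for U
      proof -
        from R[THEN conjunct2, THEN bspec, THEN mp, OF U A] obtain W Kw m X Y \<rho> where UW: "U = Some ` W" and ac: "annulus_component f C c r\<^sub>0 W Kw m X Y \<rho>"
          by (elim exE conjE) (rule that)
        interpret annulus_component f C c r\<^sub>0 W Kw m X Y \<rho> by (rule ac)
        show ?thesis
          unfolding UW
        proof (intro conjI ballI allI impI)
          show "escaping f (Some ` W)" by (rule escaping_component)
          show "wandering f (Some ` W)" using wandering_component[OF U UW] unfolding UW .
        qed ((rule limit_function, assumption), (erule conjE, rule image_contains_annulus, assumption, assumption),
          (erule conjE, rule annuli_sequence, assumption, assumption))
      qed
      show ?thesis
      proof (rule exI[of _ R], rule conjI, rule R[THEN conjunct1], intro ballI, rule impI)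
        fix U assume "U \<in> fatou_components f" "?A R U"
        then show "?B U" by (rule B)
      qed
    qed
  qed
qed

end
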